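(* Let $K$ be an algebraically closed field of prime characteristic $p$ with $p\neq 2$. Let $G$ be a simple algebraic group over $K$ and $(a,b,c)$ a hyperbolic triple of integers such that the pair $(G,(a,b,c))$ is one of the following (letters $b,c$ stand for arbitrary integers making the triple hyperbolic): $\mathrm{SL}_2(K)$: $(2,b,c)$; $\mathrm{Sp}_4(K)$: $(2,3,c)$, $(2,4,c)$, $(3,3,4)$, $(3,4,4)$, $(4,4,4)$; $\mathrm{Sp}_6(K)$: $(2,3,c)$, $(2,4,c)$, $(2,5,5)$, $(2,5,6)$, $(2,6,6)$; $\mathrm{Sp}_8(K)$: $(2,3,7)$, $(2,3,8)$, $(2,4,5)$, $(2,4,6)$; $\mathrm{Sp}_{10}(K)$: $(2,3,7)$, $(2,3,8)$, $(2,3,9)$, $(2,3,10)$, $(2,4,5)$, $(2,4,6)$; $\mathrm{Sp}_{12}(K)$: $(2,3,7)$, $(2,3,8)$, $(2,4,5)$; $\mathrm{Sp}_{14}(K)$: $(2,3,7)$, $(2,3,8)$, $(2,4,5)$; $\mathrm{Sp}_{16}(K)$: $(2,3,7)$; $\mathrm{Sp}_{18}(K)$: $(2,3,7)$; $\mathrm{Sp}_{22}(K)$: $(2,3,7)$. Then a quasisimple group $(G^F)'=G(p^r)$, where $F$ is a Steinberg endomorphism of $G$, is never an $(a,b,c)$-group.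
   Context: A hyperbolic triple of integers is a triple $(a,b,c)$ of positive integers with $a\leq b\leq c$ and $1/a+1/b+1/c<1$. For a Steinberg endomorphism $F$ of $G$, $G^F$ is the (finite) fixed point group and $(G^F)'$ its derived subgroup; when $(G^F)'$ is quasisimple (perfect with simple quotient by its centre) it is denoted $G(p^r)$ for a suitable positive integer $r$. An $(a,b,c)$-group is a finite group generated by two elements of orders dividing $a$ and $b$ respectively whose product has order dividing $c$. *)

theory Defs
  imports
    "Jordan_Normal_Form.Determinant"
    "HOL-Computational_Algebra.Computational_Algebra"
    "HOL-Algebra.Generated_Groups"
    "HOL-Algebra.Multiplicative_Group"
    "HOL-Algebra.SimpleGroups"
begin

definition matrix_group :: "nat \<Rightarrow> 'k::comm_ring_1 mat set \<Rightarrow> 'k mat monoid" where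
  "matrix_group n S = \<lparr>carrier = S, monoid.mult = (*), one = 1\<^sub>m n\<rparr>"

definition special_linear_group :: "nat \<Rightarrow> 'k::comm_ring_1 mat monoid" where
  "special_linear_group n = matrix_group n {A \<in> carrier_mat n n. det A = 1}"

definition symplectic_form :: "nat \<Rightarrow> 'k::comm_ring_1 mat" where
  "symplectic_form m = four_block_mat (0\<^sub>m m m) (1\<^sub>m m) (- 1\<^sub>m m) (0\<^sub>m m m)"

text \<open>The parameter is the rank: this is the group usually written $Sp_{2m}$, consisting of
  matrices of size $2m$.\<close>

definition symplectic_group :: "nat \<Rightarrow> 'k::comm_ring_1 mat monoid" where
  "symplectic_group m = matrix_group (2 * m)
     {A \<in> carrier_mat (2 * m) (2 * m).
        transpose_mat A * symplectic_form m * A = symplectic_form m}"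

text \<open>Polynomial functions in the entries of a matrix of size $n$. The groups considered here
  are Zariski closed in the space of all matrices, so that their regular functions are exactly
  the restrictions of these (no inverse of the determinant is needed).\<close>

inductive_set entry_polynomials :: "nat \<Rightarrow> ('k::comm_ring_1 mat \<Rightarrow> 'k) set"
  for n :: nat where
  const: "(\<lambda>A. x) \<in> entry_polynomials n"
| entry: "i < n \<Longrightarrow> j < n \<Longrightarrow> (\<lambda>A. A $$ (i, j)) \<in> entry_polynomials n"
| add: "f \<in> entry_polynomials n \<Longrightarrow> g \<in> entry_polynomials n
    \<Longrightarrow> (\<lambda>A. f A + g A) \<in> entry_polynomials n"
| mult: "f \<in> entry_polynomials n \<Longrightarrow> g \<in> entry_polynomials n
    \<Longrightarrow> (\<lambda>A. f A * g A) \<in> entry_polynomials n"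

text \<open>The size of the matrices in a matrix group is read off from its identity element.\<close>

definition algebraic_endomorphism ::
  "'k::comm_ring_1 mat monoid \<Rightarrow> ('k mat \<Rightarrow> 'k mat) \<Rightarrow> bool" where
  "algebraic_endomorphism G F \<longleftrightarrow>
     F \<in> hom G G \<and>
     (let n = dim_row \<one>\<^bsub>G\<^esub> in
        \<forall>i<n. \<forall>j<n. \<exists>f\<in>entry_polynomials n. \<forall>A\<in>carrier G. F A $$ (i, j) = f A)"

definition fixed_point_group :: "('a, 'b) monoid_scheme \<Rightarrow> ('a \<Rightarrow> 'a) \<Rightarrow> ('a, 'b) monoid_scheme" where
  "fixed_point_group G F = G\<lparr>carrier := {g \<in> carrier G. F g = g}\<rparr>"

text \<open>A Steinberg endomorphism is a surjective endomorphism of algebraic groups with finite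
  fixed point group. For simple algebraic groups these are, by a theorem of Steinberg, the
  endomorphisms some power of which is a Frobenius endomorphism.\<close>

definition steinberg_endomorphism ::
  "'k::comm_ring_1 mat monoid \<Rightarrow> ('k mat \<Rightarrow> 'k mat) \<Rightarrow> bool" where
  "steinberg_endomorphism G F \<longleftrightarrow>
     algebraic_endomorphism G F \<and>
     F ` carrier G = carrier G \<and>
     finite (carrier (fixed_point_group G F))"

definition derived_group :: "('a, 'b) monoid_scheme \<Rightarrow> ('a, 'b) monoid_scheme" where
  "derived_group G = G\<lparr>carrier := derived G (carrier G)\<rparr>"

definition group_centre :: "('a, 'b) monoid_scheme \<Rightarrow> 'a set" where
  "group_centre G = {z \<in> carrier G. \<forall>g\<in>carrier G. z \<otimes>\<^bsub>G\<^esub> g = g \<otimes>\<^bsub>G\<^esub> z}"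

definition quasisimple_group :: "('a, 'b) monoid_scheme \<Rightarrow> bool" where
  "quasisimple_group G \<longleftrightarrow>
     group G \<and> derived G (carrier G) = carrier G \<and> simple_group (G Mod group_centre G)"

definition hyperbolic_triple :: "nat \<Rightarrow> nat \<Rightarrow> nat \<Rightarrow> bool" where
  "hyperbolic_triple a b c \<longleftrightarrow>
     0 < a \<and> a \<le> b \<and> b \<le> c \<and> 1 / real a + 1 / real b + 1 / real c < 1"

definition abc_group :: "nat \<Rightarrow> nat \<Rightarrow> nat \<Rightarrow> ('a, 'b) monoid_scheme \<Rightarrow> bool" where
  "abc_group a b c G \<longleftrightarrow>
     group G \<and> finite (carrier G) \<and>
     (\<exists>x\<in>carrier G. \<exists>y\<in>carrier G.
        generate G {x, y} = carrier G \<and>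
        group.ord G x dvd a \<and> group.ord G y dvd b \<and> group.ord G (x \<otimes>\<^bsub>G\<^esub> y) dvd c)"

text \<open>Here \<open>UNIV\<close> stands for an arbitrary entry of the triple; hyperbolicity is imposed
  separately.\<close>

definition listed_pairs :: "('k::comm_ring_1 mat monoid \<times> nat \<times> nat \<times> nat) set" where
  "listed_pairs =
     {special_linear_group 2} \<times> ({2} \<times> UNIV \<times> UNIV) \<union>
     {symplectic_group 2} \<times>
       ({2} \<times> {3} \<times> UNIV \<union> {2} \<times> {4} \<times> UNIV \<union> {(3,3,4), (3,4,4), (4,4,4)}) \<union>
     {symplectic_group 3} \<times>
       ({2} \<times> {3} \<times> UNIV \<union> {2} \<times> {4} \<times> UNIV \<union> {(2,5,5), (2,5,6), (2,6,6)}) \<union>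
     {symplectic_group 4} \<times> {(2,3,7), (2,3,8), (2,4,5), (2,4,6)} \<union>
     {symplectic_group 5} \<times>
       {(2,3,7), (2,3,8), (2,3,9), (2,3,10), (2,4,5), (2,4,6)} \<union>
     {symplectic_group 6} \<times> {(2,3,7), (2,3,8), (2,4,5)} \<union>
     {symplectic_group 7} \<times> {(2,3,7), (2,3,8), (2,4,5)} \<union>
     {symplectic_group 8} \<times> {(2,3,7)} \<union>
     {symplectic_group 9} \<times> {(2,3,7)} \<union>
     {symplectic_group 11} \<times> {(2,3,7)}"

end

theory Submission
  imports Defs "HOL-Library.Function_Algebras" "Jordan_Normal_Form.Char_Poly"
begin

text \<open>
For \<open>SL\<^sub>2\<close> and \<open>a = 2\<close>, the only solutions of \<open>x\<^sup>2 = 1\<close> are \<open>1\<close> and \<open>- 1\<close>, because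
the characteristic is not 2. Hence the first generator is central, the group is abelian, and an abelian
group is not quasisimple.

For \<open>Sp\<^sub>2\<^sub>m\<close> with \<open>m \<ge> 2\<close> the proof applies Scott's inequality to the space \<open>L\<close> of symmetric
bilinear forms on \<open>V = K\<^sup>2\<^sup>m\<close>, which is the dual of the adjoint representation and has dimension
\<open>m (2 m + 1)\<close>. If a group generated by \<open>x\<close> and \<open>y\<close> fixes no nonzero vector of \<open>L\<close> (and none of its
dual, which the symplectic form identifies with symmetric forms again), then the dimensions of the fixed
spaces of \<open>x\<close>, \<open>y\<close> and \<open>x y\<close> on \<open>L\<close> have sum at most \<open>dim L\<close> (\<open>scott_symmetric_forms\<close>).
On the other hand, an isometry whose order divides \<open>a\<close> has a large fixed space on \<open>L\<close>. If \<open>r\<^sub>i\<close> are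
the successive rank drops along the linear factors of \<open>X\<^sup>a - 1\<close>, then the invariant forms contain
one block of size \<open>r\<^sub>i\<^sup>2\<close> for each factor, half of their dimension is symmetric, and the factors
\<open>X - 1\<close> and \<open>X + 1\<close> contribute a little more (\<open>tw_forms_bound\<close>). As the \<open>r\<^sub>i\<close> are integers with sum \<open>2 m\<close>,
this gives explicit lower bounds, and for every listed triple the three bounds
add up to more than \<open>m (2 m + 1)\<close>.

It remains to see that the derived group of \<open>G\<^sup>F\<close> fixes no nonzero symmetric form, and here the
classification of Steinberg endomorphisms is replaced by a direct argument. The map \<open>F\<close> turns \<open>V\<close> into
a second representation of the algebraic group \<open>Sp\<^sub>2\<^sub>m\<close>. A highest weight argument with the tori of the coordinate
planes, by descent through the subgroups \<open>Sp\<^sub>2\<^sub>(\<^sub>m\<^sub>-\<^sub>i\<^sub>)\<close>, produces a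
vector \<open>f\<close> that is fixed by the stabilizer of the first basis vector and has some weight \<open>k > 0\<close>
(\<open>highest_weight_exists\<close>). Then \<open>g e\<^sub>0 \<mapsto> F(g) f\<close> is a well-defined map \<open>\<phi>\<close> with \<open>\<phi>(c v) = c\<^sup>k \<phi>(v)\<close>. Comparing
weights shows that \<open>\<phi>\<close> is additive (\<open>phi_additive\<close>), and that it multiplies the symplectic form, raised to the power \<open>k\<close>, by a
constant (\<open>om_phi\<close>). If \<open>k\<close> were 1, then \<open>\<phi>\<close> would be a linear similitude, whose
centralizer is infinite, but \<open>F\<close> has only finitely many fixed points; so \<open>k \<ge> 2\<close> (\<open>k_ge_2\<close>). By the linear form of
Lang's theorem the fixed vectors of \<open>\<phi>\<close> span \<open>V\<close> (\<open>fixed_vectors_span\<close>). Each of them is the centre of a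
transvection in \<open>G\<^sup>F\<close>, and for \<open>m \<ge> 2\<close> a commutator computation places such a transvection in the derived
group (\<open>derived_transvection\<close>). A symmetric form invariant under
all these transvections vanishes on a spanning set that is closed under addition, hence is zero
(\<open>transvections_no_invariant_form\<close>).
\<close>

section \<open>Finite-dimensional spaces of functions\<close>

text \<open>Vectors are functions on an arbitrary index type. Thus spaces of all dimensions, and also the spaces of
bilinear forms on them, are instances of one vector space structure, and the dimension can vary within an induction.\<close>

definition fscale :: "'k::field \<Rightarrow> ('a \<Rightarrow> 'k) \<Rightarrow> 'a \<Rightarrow> 'k" where
  "fscale c f = (\<lambda>x. c * f x)"

lemma fscale_apply [simp]: "fscale c f x = c * f x"
  by (simp add: fscale_def)

interpretation fv: vector_space fscale
  by standard (simp_all add: fscale_def fun_eq_iff algebra_simps)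

interpretation fp: vector_space_pair fscale fscale ..

abbreviation flin :: "(('a \<Rightarrow> 'k::field) \<Rightarrow> 'b \<Rightarrow> 'k) \<Rightarrow> bool" where
  "flin \<equiv> Vector_Spaces.linear fscale fscale"

lemma flinI:
  assumes "\<And>x y. f (x + y) = f x + f y" "\<And>c x. f (fscale c x) = fscale c (f x)"
  shows "flin f"
  using assms by unfold_locales auto

lemma flin_add: "flin f \<Longrightarrow> f (x + y) = f x + f y"
  by (rule fp.linear_add)
lemma flin_scale: "flin f \<Longrightarrow> f (fscale c x) = fscale c (f x)"
  by (rule fp.linear_scale)
lemma flin_diff: "flin f \<Longrightarrow> f (x - y) = f x - f y"
  by (rule fp.linear_diff)
lemma flin_0: "flin f \<Longrightarrow> f 0 = 0"
  by (rule fp.linear_0)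
lemma flin_sum: "flin f \<Longrightarrow> f (\<Sum>i\<in>I. g i) = (\<Sum>i\<in>I. f (g i))"
  by (rule fp.linear_sum)
lemmas flin_simps = flin_add flin_scale flin_diff flin_0 flin_sum

lemma sum_fun_apply [simp]: "(\<Sum>i\<in>I. f i) x = (\<Sum>i\<in>I. f i x)"
  by (induction I rule: infinite_finite_induct) auto

text \<open>The ambient function space may be infinite-dimensional, so finite dimension is a property of subsets.\<close>

definition fd :: "('a \<Rightarrow> 'k::field) set \<Rightarrow> bool" where
  "fd U \<longleftrightarrow> (\<exists>B. finite B \<and> U \<subseteq> fv.span B)"

lemma fd_subset: "fd T \<Longrightarrow> S \<subseteq> T \<Longrightarrow> fd S"
  unfolding fd_def by blast

lemma fd_basis:
  assumes "fd U"
  obtains B where "B \<subseteq> U" "fv.independent B" "U \<subseteq> fv.span B" "card B = fv.dim U" "finite B"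
proof -
  obtain B where B: "B \<subseteq> U" "fv.independent B" "U \<subseteq> fv.span B" "card B = fv.dim U"
    using fv.basis_exists by blast
  obtain C where C: "finite C" "U \<subseteq> fv.span C" using assms fd_def by blast
  have "finite B" using fv.independent_span_bound[OF C(1) B(2)] B(1) C(2) by blast
  then show thesis using that B by blast
qed

lemma fd_independent:
  assumes "fd U" "fv.independent S" "S \<subseteq> U"
  shows "finite S \<and> card S \<le> fv.dim U"
proof -
  obtain B where B: "B \<subseteq> U" "U \<subseteq> fv.span B" "card B = fv.dim U" "finite B"
    using fd_basis[OF assms(1)] by metis
  show ?thesis using fv.independent_span_bound[OF B(4) assms(2)] B assms(3) by auto
qed

lemma fd_dim_mono:
  assumes "fd T" "S \<subseteq> T"
  shows "fv.dim S \<le> fv.dim T"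
proof -
  obtain B where B: "B \<subseteq> T" "fv.independent B" "T \<subseteq> fv.span B" "card B = fv.dim T" "finite B"
    using fd_basis[OF assms(1)] by metis
  show ?thesis using fv.dim_le_card[of S B] B assms(2) by auto
qed

lemma fd_dim_equal:
  assumes "fv.subspace S" "fd T" "S \<subseteq> T" "fv.dim T \<le> fv.dim S"
  shows "S = T"
proof (rule ccontr)
  assume "S \<noteq> T"
  then obtain t where t: "t \<in> T" "t \<notin> S" using assms(3) by blast
  obtain B where B: "B \<subseteq> S" "fv.independent B" "S \<subseteq> fv.span B" "card B = fv.dim S" "finite B"
    using fd_basis[OF fd_subset[OF assms(2,3)]] by metis
  have "fv.span B \<subseteq> S" using B(1) assms(1) by (rule fv.span_minimal)
  then have t': "t \<notin> fv.span B" using t by blast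
  then have "fv.independent (insert t B)" using B(2) fv.independent_insertI by blast
  then have "card (insert t B) \<le> fv.dim T"
    using fd_independent[OF assms(2)] B(1) assms(3) t(1) by blast
  moreover have "t \<notin> B" using t' fv.span_base by blast
  ultimately show False using B(4,5) assms(4) by simp
qed

lemma fd_image:
  assumes "flin f" "fd U"
  shows "fd (f ` U)"
proof -
  obtain B where B: "finite B" "U \<subseteq> fv.span B" using assms(2) fd_def by blast
  have "f ` U \<subseteq> fv.span (f ` B)" using B(2) fp.linear_span_image[OF assms(1)] by blast
  then show ?thesis unfolding fd_def using B(1) by blast
qed

lemma rank_nullity:
  assumes "flin f" "fv.subspace U" "fd U"
  shows "fv.dim U = fv.dim {x \<in> U. f x = 0} + fv.dim (f ` U)"
proof -
  let ?K = "{x \<in> U. f x = 0}"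
  obtain A where A: "A \<subseteq> ?K" "fv.independent A" "?K \<subseteq> fv.span A" "card A = fv.dim ?K" "finite A"
    using fd_basis[OF fd_subset[OF assms(3), of ?K]] by (metis (no_types, lifting) mem_Collect_eq subsetI)
  obtain B where B: "A \<subseteq> B" "B \<subseteq> U" "fv.independent B" "U \<subseteq> fv.span B"
    using fv.maximal_independent_subset_extend[of A U] A by blast
  have fB: "finite B" using fd_independent[OF assms(3) B(3,2)] by blast
  have dU: "fv.dim U = card B" using B fv.basis_card_eq_dim by metis
  let ?C = "B - A"
  have spU: "fv.span B \<subseteq> U" using B(2) assms(2) by (rule fv.span_minimal)
  have span0: "fv.span A \<subseteq> ?K"
    using A(1) by (rule fv.span_minimal)
      (use assms(2) in \<open>auto simp: fv.subspace_def flin_simps[OF assms(1)]\<close>)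
  have inj: "inj_on f (fv.span ?C)"
  proof -
    have "x = 0" if x: "x \<in> fv.span ?C" "f x = 0" for x
    proof -
      have "x \<in> U" using x(1) fv.span_mono[of ?C B] spU by blast
      then have "x \<in> fv.span A" using x A(3) by blast
      then obtain u where u: "x = (\<Sum>v\<in>A. fscale (u v) v)"
        using fv.span_finite[OF A(5)] by blast
      obtain w where w: "x = (\<Sum>v\<in>?C. fscale (w v) v)"
        using x(1) fv.span_finite[of ?C] fB by blast
      let ?z = "\<lambda>v. if v \<in> A then u v else - w v"
      have "(\<Sum>v\<in>B. fscale (?z v) v) = (\<Sum>v\<in>A. fscale (?z v) v) + (\<Sum>v\<in>?C. fscale (?z v) v)"
        using fB B(1) by (metis (no_types, lifting) add.commute sum.subset_diff)
      also have "(\<Sum>v\<in>A. fscale (?z v) v) = x" unfolding u by (rule sum.cong) auto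
      also have "(\<Sum>v\<in>?C. fscale (?z v) v) = (\<Sum>v\<in>?C. - fscale (w v) v)"
        by (rule sum.cong) (auto simp: fv.scale_minus_left)
      also have "\<dots> = - x" unfolding w by (simp add: sum_negf)
      also have "x + - x = 0" by (simp only: add.right_inverse)
      finally have "(\<Sum>v\<in>B. fscale (?z v) v) = 0" .
      then have "\<forall>v\<in>B. ?z v = 0"
        using fv.independentD[OF B(3) fB order_refl] by (intro ballI)
      then have "\<forall>v\<in>?C. w v = 0" by force
      then show "x = 0" unfolding w by simp
    qed
    moreover have "fv.subspace (fv.span ?C)" by simp
    ultimately show ?thesis using fp.linear_inj_on_iff_eq_0[OF assms(1)] by blast
  qed
  have iC: "fv.independent ?C" using B(3) fv.independent_mono by blast
  have ifC: "fv.independent (f ` ?C)"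
    using fp.linear_independent_injective_image[OF assms(1) iC inj] .
  have cfC: "card (f ` ?C) = card ?C"
    using inj fv.span_superset by (metis card_image inj_on_subset)
  have "f ` U \<subseteq> fv.span (f ` ?C)"
  proof
    fix y assume "y \<in> f ` U"
    then obtain x where x: "x \<in> U" "y = f x" by blast
    then have "y \<in> fv.span (f ` B)" using B(4) fp.linear_span_image[OF assms(1)] by blast
    moreover have "f ` B \<subseteq> insert 0 (f ` ?C)" using A(1) by blast
    ultimately have "y \<in> fv.span (insert 0 (f ` ?C))" using fv.span_mono by blast
    then show "y \<in> fv.span (f ` ?C)" by simp
  qed
  then have "fv.dim (f ` U) = card (f ` ?C)"
    using fv.basis_card_eq_dim[of "f ` ?C" "f ` U"] ifC image_mono[of ?C U f] B(2) by (metis Diff_subset subset_trans)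
  then show ?thesis using dU A(4,5) cfC fB B(1)
    by (metis card_Diff_subset card_mono le_add_diff_inverse)
qed

lemma family_card_le_dim:
  assumes "fd U" "finite I" "\<And>i. i \<in> I \<Longrightarrow> f i \<in> U"
    and indep: "\<And>a. (\<Sum>i\<in>I. fscale (a i) (f i)) = 0 \<Longrightarrow> \<forall>i\<in>I. a i = (0::'k::field)"
  shows "card I \<le> fv.dim U"
proof -
  have inj: "inj_on f I"
  proof (rule inj_onI, rule ccontr)
    fix i j assume ij: "i \<in> I" "j \<in> I" "f i = f j" "i \<noteq> j"
    let ?a = "\<lambda>l. if l = i then 1 else if l = j then - 1 else (0::'k)"
    have "(\<Sum>l\<in>I. fscale (?a l) (f l)) = (\<Sum>l\<in>{i,j}. fscale (?a l) (f l))"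
      by (rule sum.mono_neutral_right) (use ij assms(2) in \<open>auto simp: fun_eq_iff\<close>)
    also have "\<dots> = 0" using ij by (simp add: fun_eq_iff)
    finally show False using indep[of ?a] ij by auto
  qed
  have "fv.independent (f ` I)"
    unfolding fv.independent_explicit_finite_subsets
  proof (intro allI impI ballI)
    fix S u v assume S: "S \<subseteq> f ` I" "finite S" "(\<Sum>v\<in>S. fscale (u v) v) = 0" "v \<in> S"
    let ?a = "\<lambda>i. if f i \<in> S then u (f i) else 0"
    have "(\<Sum>i\<in>I. fscale (?a i) (f i)) = (\<Sum>v\<in>f ` I. fscale (if v \<in> S then u v else 0) v)"
      by (simp add: sum.reindex[OF inj])
    also have "\<dots> = (\<Sum>v\<in>S. fscale (u v) v)"
      by (rule sum.mono_neutral_cong_right) (use S assms(2) in auto)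
    finally have "(\<Sum>i\<in>I. fscale (?a i) (f i)) = 0" using S(3) by simp
    then have "\<forall>i\<in>I. ?a i = 0" by (rule indep)
    then show "u v = 0" using S(1,4) by fastforce
  qed
  then have "card (f ` I) \<le> fv.dim U" using fd_independent[OF assms(1)] assms(3) by blast
  then show ?thesis using card_image[OF inj] by simp
qed

lemma dim_le_of_inj:
  assumes "flin f" "fv.subspace U" "\<And>x. x \<in> U \<Longrightarrow> f x = 0 \<Longrightarrow> x = 0"
    and "fd T" "f ` U \<subseteq> T"
  shows "fd U" "fv.dim U \<le> fv.dim T"
proof -
  have "inj_on f U" using fp.linear_inj_on_iff_eq_0[OF assms(1,2)] assms(3) by blast
  then obtain g where g: "flin g" "\<forall>v\<in>U. g (f v) = v"
    using fp.linear_exists_left_inverse_on[OF assms(1,2)] by blast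
  then have "U \<subseteq> g ` (f ` U)" by force
  moreover have "fd (g ` (f ` U))" using g(1) fd_image fd_subset assms(4,5) by blast
  ultimately show fU: "fd U" using fd_subset by blast
  have "{x \<in> U. f x = 0} \<subseteq> fv.span {}" using assms(3) by auto
  then have "fv.dim {x \<in> U. f x = 0} = 0"
    using fv.dim_le_card[of "{x \<in> U. f x = 0}" "{}"] by simp
  then have "fv.dim U = fv.dim (f ` U)" using rank_nullity[OF assms(1,2) fU] by simp
  then show "fv.dim U \<le> fv.dim T" using fd_dim_mono assms(4,5) by metis
qed

definition supported :: "'a set \<Rightarrow> ('a \<Rightarrow> 'k::field) set" where
  "supported I = {f. \<forall>x. x \<notin> I \<longrightarrow> f x = 0}"

definition delta :: "'a \<Rightarrow> 'a \<Rightarrow> 'k::field" where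
  "delta i = (\<lambda>x. if x = i then 1 else 0)"

lemma delta_apply: "delta i x = (if x = i then 1 else 0)"
  by (simp add: delta_def)

lemma subspace_supported [simp]: "fv.subspace (supported I)"
  by (auto simp: fv.subspace_def supported_def)

lemma delta_in_supported [simp]: "i \<in> I \<Longrightarrow> delta i \<in> supported I"
  by (auto simp: supported_def delta_def)

lemma supported_expand:
  assumes "finite I" "f \<in> supported I"
  shows "f = (\<Sum>i\<in>I. fscale (f i) (delta i))"
proof
  fix x show "f x = (\<Sum>i\<in>I. fscale (f i) (delta i)) x"
    using assms by (simp add: delta_def supported_def if_distrib cong: if_cong)
qed

lemma supported_dim:
  assumes "finite I"
  shows "fd (supported I :: ('a \<Rightarrow> 'k::field) set)" "fv.dim (supported I :: ('a \<Rightarrow> 'k) set) = card I"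
proof -
  have sp: "supported I \<subseteq> fv.span (delta ` I :: ('a \<Rightarrow> 'k) set)"
  proof
    fix f :: "'a \<Rightarrow> 'k" assume "f \<in> supported I"
    then have "f = (\<Sum>i\<in>I. fscale (f i) (delta i))" using supported_expand assms by blast
    also have "\<dots> \<in> fv.span (delta ` I)"
      by (intro fv.span_sum fv.span_scale fv.span_base) auto
    finally show "f \<in> fv.span (delta ` I)" .
  qed
  then show 1: "fd (supported I :: ('a \<Rightarrow> 'k) set)" unfolding fd_def using assms by blast
  have "fv.dim (supported I :: ('a \<Rightarrow> 'k) set) \<le> card (delta ` I :: ('a \<Rightarrow> 'k) set)"
    using fv.dim_le_card[OF sp] assms by blast
  also have "\<dots> \<le> card I" using assms card_image_le by blast
  moreover have "card I \<le> fv.dim (supported I :: ('a \<Rightarrow> 'k) set)"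
  proof (rule family_card_le_dim[OF 1 assms, of delta])
    fix a :: "'a \<Rightarrow> 'k" assume a: "(\<Sum>i\<in>I. fscale (a i) (delta i)) = 0"
    show "\<forall>i\<in>I. a i = 0"
    proof
      fix i assume "i \<in> I"
      have "(\<Sum>j\<in>I. fscale (a j) (delta j)) i = 0" using a by simp
      then show "a i = 0" using \<open>i \<in> I\<close> assms by (simp add: delta_def if_distrib cong: if_cong)
    qed
  qed simp
  ultimately show "fv.dim (supported I :: ('a \<Rightarrow> 'k) set) = card I" by linarith
qed

lemma projection_exists:
  fixes W :: "('a \<Rightarrow> 'k::field) set"
  assumes "fv.subspace W"
  obtains p where "flin p" "\<And>x. p x \<in> W" "\<And>x. x \<in> W \<Longrightarrow> p x = x"
proof -
  have "flin (\<lambda>x::'a \<Rightarrow> 'k. x)" by (rule flinI) auto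
  then show thesis
    using fp.linear_exists_left_inverse_on[OF _ assms, of "\<lambda>x. x"] that by (auto simp: image_subset_iff)
qed

lemma right_inverse_exists:
  assumes "flin f" "fv.subspace V"
  obtains g where "flin g" "\<And>x. g x \<in> V" "\<And>v. v \<in> f ` V \<Longrightarrow> f (g v) = v"
  using fp.linear_exists_right_inverse_on[OF assms] that by (auto simp: image_subset_iff)

lemma dim_inter:
  assumes "fv.subspace A" "fv.subspace B" "fd L" "fv.subspace L"
    and "A \<subseteq> L" "B \<subseteq> L" "\<And>x. x \<in> L \<Longrightarrow> \<exists>a\<in>A. \<exists>b\<in>B. x = a + b"
  shows "fv.dim (A \<inter> B) + fv.dim L = fv.dim A + fv.dim B"
proof -
  obtain p where p: "flin p" "\<And>x. p x \<in> A" "\<And>x. x \<in> A \<Longrightarrow> p x = x"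
    using projection_exists[OF assms(1)] by metis
  let ?T = "\<lambda>x. x - p x"
  have T: "flin ?T" by (rule flinI) (auto simp: flin_simps[OF p(1)] fv.scale_right_diff_distrib)
  have ker: "?T x = 0 \<longleftrightarrow> x \<in> A" for x using p by (metis eq_iff_diff_eq_0)
  have "fv.dim B = fv.dim {x \<in> B. ?T x = 0} + fv.dim (?T ` B)"
    using rank_nullity[OF T assms(2)] fd_subset assms by blast
  moreover have "fv.dim L = fv.dim {x \<in> L. ?T x = 0} + fv.dim (?T ` L)"
    using rank_nullity[OF T assms(4,3)] .
  moreover have "{x \<in> B. ?T x = 0} = A \<inter> B" "{x \<in> L. ?T x = 0} = A"
    using ker assms(5) by auto
  moreover have "?T ` L = ?T ` B"
  proof
    show "?T ` L \<subseteq> ?T ` B"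
    proof
      fix y assume "y \<in> ?T ` L"
      then obtain x where x: "x \<in> L" "y = ?T x" by blast
      then obtain a b where ab: "a \<in> A" "b \<in> B" "x = a + b" using assms(7) by blast
      have "?T x = ?T a + ?T b" unfolding ab(3) by (rule flin_add[OF T])
      also have "?T a = 0" using ker ab(1) by blast
      finally have "y = ?T b" using x(2) by (simp only: add_0)
      then show "y \<in> ?T ` B" using ab(2) by (rule image_eqI)
    qed
    show "?T ` B \<subseteq> ?T ` L" using assms(6) by blast
  qed
  ultimately show ?thesis by simp
qed

definition functional :: "(('a \<Rightarrow> 'k::field) \<Rightarrow> 'k) \<Rightarrow> bool" where
  "functional l \<longleftrightarrow> (\<forall>x y. l (x + y) = l x + l y) \<and> (\<forall>c x. l (fscale c x) = c * l x)"

text \<open>Bases of a quotient space, without quotients: vectors independent modulo \<open>W1\<close> together with dual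
functionals that vanish on \<open>W1\<close>.\<close>

lemma dual_family:
  fixes W W1 :: "('a \<Rightarrow> 'k::field) set"
  assumes "fv.subspace W" "fv.subspace W1" "W1 \<subseteq> W" "fd W"
  shows "\<exists>b l. (\<forall>i < fv.dim W - fv.dim W1. b i \<in> W) \<and> (\<forall>i::nat. functional (l i))
    \<and> (\<forall>i. \<forall>x\<in>W1. l i x = 0)
    \<and> (\<forall>i < fv.dim W - fv.dim W1. \<forall>j < fv.dim W - fv.dim W1. l i (b j) = (if i = j then 1 else 0))"
proof -
  let ?r = "fv.dim W - fv.dim W1"
  obtain A where A: "A \<subseteq> W1" "fv.independent A" "W1 \<subseteq> fv.span A" "card A = fv.dim W1" "finite A"
    using fd_basis[OF fd_subset[OF assms(4,3)]] by metis
  obtain B where B: "A \<subseteq> B" "B \<subseteq> W" "fv.independent B" "W \<subseteq> fv.span B"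
    using fv.maximal_independent_subset_extend[of A W] A assms(3) by blast
  have fB: "finite B" using fd_independent[OF assms(4) B(3,2)] by blast
  have "card B = fv.dim W" using B fv.basis_card_eq_dim by metis
  then have "card (B - A) = ?r" using A B fB by (simp add: card_Diff_subset)
  then obtain b where b: "bij_betw b {..<?r} (B - A)"
    using fB by (metis finite_Diff finite_same_card_bij finite_lessThan card_lessThan)
  have "\<exists>g :: ('a \<Rightarrow> 'k) \<Rightarrow> unit \<Rightarrow> 'k. flin g \<and> (\<forall>x\<in>B. g x = (\<lambda>_. if x = b i then 1 else 0))" for i
    by (rule fp.linear_independent_extend[OF B(3)])
  then obtain g :: "nat \<Rightarrow> ('a \<Rightarrow> 'k) \<Rightarrow> unit \<Rightarrow> 'k"
    where g: "\<And>i. flin (g i)" "\<And>i x. x \<in> B \<Longrightarrow> g i x = (\<lambda>_. if x = b i then 1 else 0)"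
    by metis
  define l where "l i x = (if i < ?r then g i x () else 0)" for i x
  have bB: "b i \<in> B - A" if "i < ?r" for i using b that by (auto simp: bij_betw_def)
  have "b i \<in> W" if "i < ?r" for i using bB[OF that] B(2) by blast
  moreover have "functional (l i)" for i
      unfolding functional_def l_def by (auto simp: flin_simps[OF g(1)])
  moreover have "l i x = 0" if "x \<in> W1" for i x
    proof (cases "i < ?r")
      case True
      have "g i x = 0"
      proof (rule fp.linear_eq_0_on_span[OF g(1)])
        show "x \<in> fv.span A" using that A(3) by blast
        fix y assume "y \<in> A"
        then have "y \<in> B" "y \<noteq> b i" using B(1) bB[OF True] by auto
        then show "g i y = 0" using g(2)[of y i] by (simp only: if_False zero_fun_def)
      qed
      then show ?thesis by (simp add: l_def)
    qed (simp add: l_def)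
  moreover have "l i (b j) = (if i = j then 1 else 0)" if "i < ?r" "j < ?r" for i j
    proof -
      have "b j = b i \<longleftrightarrow> i = j" using b that by (auto simp: bij_betw_def inj_on_def)
      then show ?thesis using that g(2)[of "b j" i] bB[OF that(2)] by (simp add: l_def)
    qed
  ultimately show ?thesis by blast
qed

section \<open>Invariant bilinear forms\<close>

declare fv.scale_minus_left [simp del]

type_synonym ('a, 'k) form = "('a \<Rightarrow> 'k) \<times> ('a \<Rightarrow> 'k) \<Rightarrow> 'k"

text \<open>A form is itself a vector, indexed by pairs. It is required to vanish outside the product of its two spaces, so
that it is determined by its values there and equality of forms is equality of functions.\<close>

definition forms :: "('a \<Rightarrow> 'k::field) set \<Rightarrow> ('a \<Rightarrow> 'k) set \<Rightarrow> ('a, 'k) form set" where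
  "forms W U = {B. (\<forall>x y. \<not> (x \<in> W \<and> y \<in> U) \<longrightarrow> B (x, y) = 0) \<and>
     (\<forall>x\<in>W. \<forall>x'\<in>W. \<forall>y\<in>U. B (x + x', y) = B (x, y) + B (x', y)) \<and>
     (\<forall>x\<in>W. \<forall>y\<in>U. \<forall>y'\<in>U. B (x, y + y') = B (x, y) + B (x, y')) \<and>
     (\<forall>c. \<forall>x\<in>W. \<forall>y\<in>U. B (fscale c x, y) = c * B (x, y)) \<and>
     (\<forall>c. \<forall>x\<in>W. \<forall>y\<in>U. B (x, fscale c y) = c * B (x, y))}"

lemma formsI:
  assumes "\<And>x y. \<not> (x \<in> W \<and> y \<in> U) \<Longrightarrow> B (x, y) = 0"
    and "\<And>x x' y. x \<in> W \<Longrightarrow> x' \<in> W \<Longrightarrow> y \<in> U \<Longrightarrow> B (x + x', y) = B (x, y) + B (x', y)"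
    and "\<And>x y y'. x \<in> W \<Longrightarrow> y \<in> U \<Longrightarrow> y' \<in> U \<Longrightarrow> B (x, y + y') = B (x, y) + B (x, y')"
    and "\<And>c x y. x \<in> W \<Longrightarrow> y \<in> U \<Longrightarrow> B (fscale c x, y) = c * B (x, y)"
    and "\<And>c x y. x \<in> W \<Longrightarrow> y \<in> U \<Longrightarrow> B (x, fscale c y) = c * B (x, y)"
  shows "B \<in> forms W U"
  unfolding forms_def using assms by blast

lemma forms_outside: "B \<in> forms W U \<Longrightarrow> \<not> (x \<in> W \<and> y \<in> U) \<Longrightarrow> B (x, y) = 0"
  by (simp add: forms_def)
lemma forms_add1: "B \<in> forms W U \<Longrightarrow> x \<in> W \<Longrightarrow> x' \<in> W \<Longrightarrow> y \<in> U \<Longrightarrow> B (x + x', y) = B (x, y) + B (x', y)"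
  by (simp add: forms_def)
lemma forms_add2: "B \<in> forms W U \<Longrightarrow> x \<in> W \<Longrightarrow> y \<in> U \<Longrightarrow> y' \<in> U \<Longrightarrow> B (x, y + y') = B (x, y) + B (x, y')"
  by (simp add: forms_def)
lemma forms_scale1: "B \<in> forms W U \<Longrightarrow> x \<in> W \<Longrightarrow> y \<in> U \<Longrightarrow> B (fscale c x, y) = c * B (x, y)"
  by (simp add: forms_def)
lemma forms_scale2: "B \<in> forms W U \<Longrightarrow> x \<in> W \<Longrightarrow> y \<in> U \<Longrightarrow> B (x, fscale c y) = c * B (x, y)"
  by (simp add: forms_def)

lemma forms_diff1: "B \<in> forms W U \<Longrightarrow> fv.subspace W \<Longrightarrow> x \<in> W \<Longrightarrow> x' \<in> W \<Longrightarrow> y \<in> U \<Longrightarrow> B (x - x', y) = B (x, y) - B (x', y)"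
  using forms_add1[of B W U x "fscale (- 1) x'" y] forms_scale1[of B W U x' y "- 1"] fv.subspace_scale[of W x' "- 1"] by (simp add: fv.scale_minus_left)
lemma forms_diff2: "B \<in> forms W U \<Longrightarrow> fv.subspace U \<Longrightarrow> x \<in> W \<Longrightarrow> y \<in> U \<Longrightarrow> y' \<in> U \<Longrightarrow> B (x, y - y') = B (x, y) - B (x, y')"
  using forms_add2[of B W U x y "fscale (- 1) y'"] forms_scale2[of B W U x y' "- 1"] fv.subspace_scale[of U y' "- 1"] by (simp add: fv.scale_minus_left)
lemma forms_zero1: "B \<in> forms W U \<Longrightarrow> fv.subspace W \<Longrightarrow> B (0, y) = 0"
  using forms_scale1[of B W U 0 y 0] forms_outside[of B W U 0 y] fv.subspace_0 by (cases "y \<in> U") auto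
lemma forms_zero2: "B \<in> forms W U \<Longrightarrow> fv.subspace U \<Longrightarrow> B (x, 0) = 0"
  using forms_scale2[of B W U x 0 0] forms_outside[of B W U x 0] fv.subspace_0 by (cases "x \<in> W") auto

lemma subspace_forms [simp]: "fv.subspace (forms W U)"
  unfolding fv.subspace_def
proof (intro conjI ballI allI)
  show "0 \<in> forms W U" by (rule formsI) auto
  fix B C assume BC: "B \<in> forms W U" "C \<in> forms W U"
  show "B + C \<in> forms W U"
    by (rule formsI) (use BC in \<open>auto simp: forms_outside forms_add1 forms_add2 forms_scale1 forms_scale2 algebra_simps\<close>)
next
  fix c B assume "B \<in> forms W U"
  then show "fscale c B \<in> forms W U"
    by (intro formsI) (auto simp: forms_outside forms_add1 forms_add2 forms_scale1 forms_scale2 algebra_simps)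
qed

lemma forms_eq_0I:
  assumes "B \<in> forms W U" "fv.subspace W" "fv.subspace U"
    and "A \<subseteq> W" "W \<subseteq> fv.span A" "C \<subseteq> U" "U \<subseteq> fv.span C"
    and "\<And>a c. a \<in> A \<Longrightarrow> c \<in> C \<Longrightarrow> B (a, c) = 0"
  shows "B = 0"
proof -
  have 1: "B (x, c) = 0" if "x \<in> W" "c \<in> C" for x c
  proof -
    have "fv.subspace {x \<in> W. B (x, c) = 0}"
      using assms that by (auto simp: fv.subspace_def forms_add1[OF assms(1)] forms_scale1[OF assms(1)] forms_zero1[OF assms(1,2)] subset_iff)
    moreover have "A \<subseteq> {x \<in> W. B (x, c) = 0}" using assms that by blast
    ultimately show ?thesis using fv.span_minimal[of A "{x \<in> W. B (x, c) = 0}"] assms(5) that by blast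
  qed
  have 2: "B (x, y) = 0" if "x \<in> W" "y \<in> U" for x y
  proof -
    have "fv.subspace {y \<in> U. B (x, y) = 0}"
      using assms that by (auto simp: fv.subspace_def forms_add2[OF assms(1)] forms_scale2[OF assms(1)] forms_zero2[OF assms(1,3)])
    moreover have "C \<subseteq> {y \<in> U. B (x, y) = 0}" using assms 1 that by blast
    ultimately show ?thesis using fv.span_minimal[of C "{y \<in> U. B (x, y) = 0}"] assms(7) that by blast
  qed
  show "B = 0"
  proof
    fix p show "B p = 0 p"
      using 2 forms_outside[OF assms(1)] by (cases p) auto
  qed
qed

lemma fd_forms:
  assumes "fv.subspace W" "fv.subspace U" "fd W" "fd U"
  shows "fd (forms W U)"
proof -
  obtain A where A: "A \<subseteq> W" "W \<subseteq> fv.span A" "finite A" using fd_basis[OF assms(3)] by metis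
  obtain C where C: "C \<subseteq> U" "U \<subseteq> fv.span C" "finite C" using fd_basis[OF assms(4)] by metis
  let ?T = "\<lambda>B p. if p \<in> A \<times> C then B p else 0"
  show ?thesis
  proof (rule dim_le_of_inj(1)[of ?T "forms W U" "supported (A \<times> C)"])
    show "flin ?T" by (rule flinI) (auto simp: fun_eq_iff)
    show "fd (supported (A \<times> C))" using A C by (intro supported_dim) auto
    show "?T ` forms W U \<subseteq> supported (A \<times> C)" by (auto simp: supported_def)
    fix B assume B: "B \<in> forms W U" "?T B = 0"
    have "B (a, c) = 0" if "a \<in> A" "c \<in> C" for a c
      using fun_cong[OF B(2), of "(a, c)"] that by simp
    then show "B = 0" using forms_eq_0I[OF B(1) assms(1,2) A(1,2) C(1,2)] by blast
  qed simp
qed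

lemma functional_add: "functional l \<Longrightarrow> l (x + y) = l x + l y"
  and functional_scale: "functional l \<Longrightarrow> l (fscale c x) = c * l x"
  by (simp_all add: functional_def)

definition outer :: "('a \<Rightarrow> 'k::field) set \<Rightarrow> ('a \<Rightarrow> 'k) set \<Rightarrow> (('a \<Rightarrow> 'k) \<Rightarrow> 'k) \<Rightarrow> (('a \<Rightarrow> 'k) \<Rightarrow> 'k) \<Rightarrow> ('a, 'k) form" where
  "outer W U l m = (\<lambda>(x, y). if x \<in> W \<and> y \<in> U then l x * m y else 0)"

lemma outer_in_forms:
  "functional l \<Longrightarrow> functional m \<Longrightarrow> fv.subspace W \<Longrightarrow> fv.subspace U \<Longrightarrow> outer W U l m \<in> forms W U"
  by (rule formsI) (auto simp: outer_def functional_add functional_scale fv.subspace_add fv.subspace_scale algebra_simps)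

lemma card_le_pairs: "2 * card {(i, k). i \<le> k \<and> k < (r::nat)} = r * r + r"
proof -
  have "{(i, k). i \<le> k \<and> k < r} = (\<Union>k<r. (\<lambda>i. (i, k)) ` {..k})" by auto
  also have "card \<dots> = (\<Sum>k<r. Suc k)"
    by (subst card_UN_disjoint) (auto simp: card_image inj_on_def)
  finally have "card {(i, k). i \<le> k \<and> k < r} = (\<Sum>k<r. Suc k)" .
  moreover have "2 * (\<Sum>k<r. Suc k) = r * r + r" by (induction r) auto
  ultimately show ?thesis by simp
qed

lemma card_less_pairs: "2 * card {(i, k). i < k \<and> k < (r::nat)} + r = r * r"
proof -
  have "{(i, k). i < k \<and> k < r} = (\<Union>k<r. (\<lambda>i. (i, k)) ` {..<k})" by auto
  also have "card \<dots> = (\<Sum>k<r. k)"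
    by (subst card_UN_disjoint) (auto simp: card_image inj_on_def)
  finally have "card {(i, k). i < k \<and> k < r} = (\<Sum>k<r. k)" .
  moreover have "2 * (\<Sum>k<r. k) + r = r * r" by (induction r) auto
  ultimately show ?thesis by simp
qed

text \<open>An invertible operator \<open>g\<close> on \<open>V\<close> is given together with its inverse \<open>h\<close> because \<open>h\<close> is the adjoint of \<open>g\<close>
for every invariant form.\<close>

locale inverse_pair =
  fixes g h :: "('a \<Rightarrow> 'k::field) \<Rightarrow> 'a \<Rightarrow> 'k" and V :: "('a \<Rightarrow> 'k) set"
  assumes lin_g: "flin g" and lin_h: "flin h" and subV: "fv.subspace V" and fdV: "fd V"
    and gV: "\<And>x. x \<in> V \<Longrightarrow> g x \<in> V" and hV: "\<And>x. x \<in> V \<Longrightarrow> h x \<in> V"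
    and hg: "\<And>x. x \<in> V \<Longrightarrow> h (g x) = x" and gh: "\<And>x. x \<in> V \<Longrightarrow> g (h x) = x"
begin

definition stable :: "('a \<Rightarrow> 'k) set \<Rightarrow> bool" where
  "stable W \<longleftrightarrow> fv.subspace W \<and> W \<subseteq> V \<and> (\<forall>x\<in>W. g x \<in> W) \<and> (\<forall>x\<in>W. h x \<in> W)"

text \<open>For an invariant form, \<open>M z\<close> is the adjoint of \<open>N z\<close>.\<close>

definition N :: "'k \<Rightarrow> ('a \<Rightarrow> 'k) \<Rightarrow> 'a \<Rightarrow> 'k" where "N z x = g x - fscale z x"
definition M :: "'k \<Rightarrow> ('a \<Rightarrow> 'k) \<Rightarrow> 'a \<Rightarrow> 'k" where "M z x = h x - fscale z x"

lemma lin_N: "flin (N z)"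
  by (rule flinI) (auto simp: N_def flin_simps[OF lin_g] fv.scale_right_diff_distrib fv.scale_left_commute fv.scale_right_distrib)
lemma lin_M: "flin (M z)"
  by (rule flinI) (auto simp: M_def flin_simps[OF lin_h] fv.scale_right_diff_distrib fv.scale_left_commute fv.scale_right_distrib)

lemma stable_V: "stable V" by (simp add: stable_def subV gV hV)

lemma stable_subspace: "stable W \<Longrightarrow> fv.subspace W" by (simp add: stable_def)
lemma stable_fd: "stable W \<Longrightarrow> fd W" using fd_subset[OF fdV] by (simp add: stable_def)
lemma stable_inV: "stable W \<Longrightarrow> x \<in> W \<Longrightarrow> x \<in> V" by (auto simp: stable_def)
lemma stable_g: "stable W \<Longrightarrow> x \<in> W \<Longrightarrow> g x \<in> W" by (auto simp: stable_def)
lemma stable_h: "stable W \<Longrightarrow> x \<in> W \<Longrightarrow> h x \<in> W" by (auto simp: stable_def)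
lemma stable_N: "stable W \<Longrightarrow> x \<in> W \<Longrightarrow> N z x \<in> W"
  by (simp add: N_def stable_g stable_subspace fv.subspace_diff fv.subspace_scale)
lemma stable_M: "stable W \<Longrightarrow> x \<in> W \<Longrightarrow> M z x \<in> W"
  by (simp add: M_def stable_h stable_subspace fv.subspace_diff fv.subspace_scale)
lemma stable_hpow: "stable W \<Longrightarrow> x \<in> W \<Longrightarrow> (h ^^ j) x \<in> W"
  by (induction j) (auto simp: stable_h)

lemma hpow_lin: "flin (h ^^ j)"
proof (induction j)
  case (Suc j)
  show ?case
  proof (rule flinI)
    show "(h ^^ Suc j) (x + y) = (h ^^ Suc j) x + (h ^^ Suc j) y" for x y
      by (simp only: funpow.simps o_apply flin_add[OF Suc] flin_add[OF lin_h])
    show "(h ^^ Suc j) (fscale c x) = fscale c ((h ^^ Suc j) x)" for c x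
      by (simp only: funpow.simps o_apply flin_scale[OF Suc] flin_scale[OF lin_h])
  qed
qed (rule flinI, auto)

lemma N_g: "N z (g x) = g (N z x)" by (simp add: N_def flin_simps[OF lin_g])
lemma M_h: "M z (h x) = h (M z x)" by (simp add: M_def flin_simps[OF lin_h])
lemma N_h: "x \<in> V \<Longrightarrow> N z (h x) = h (N z x)" by (simp add: N_def flin_simps[OF lin_h] gh hg)
lemma M_g: "x \<in> V \<Longrightarrow> M z (g x) = g (M z x)" by (simp add: M_def flin_simps[OF lin_g] gh hg)
lemma N_scale: "N z (fscale c x) = fscale c (N z x)" by (rule flin_scale[OF lin_N])
lemma M_scale: "M z (fscale c x) = fscale c (M z x)" by (rule flin_scale[OF lin_M])

lemma stable_N_image: assumes "stable W" shows "stable (N z ` W)"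
  unfolding stable_def
proof (intro conjI ballI)
  show "fv.subspace (N z ` W)" by (rule fp.linear_subspace_image[OF lin_N stable_subspace[OF assms]])
  show "N z ` W \<subseteq> V" using stable_N[OF assms] stable_inV[OF assms] by auto
  fix x assume "x \<in> N z ` W"
  then obtain y where y: "y \<in> W" "x = N z y" by blast
  show "g x \<in> N z ` W" using y stable_g[OF assms] by (metis N_g imageI)
  show "h x \<in> N z ` W" using y stable_h[OF assms] stable_inV[OF assms] by (metis N_h imageI)
qed

lemma stable_M_image: assumes "stable W" shows "stable (M z ` W)"
  unfolding stable_def
proof (intro conjI ballI)
  show "fv.subspace (M z ` W)" by (rule fp.linear_subspace_image[OF lin_M stable_subspace[OF assms]])
  show "M z ` W \<subseteq> V" using stable_M[OF assms] stable_inV[OF assms] by auto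
  fix x assume "x \<in> M z ` W"
  then obtain y where y: "y \<in> W" "x = M z y" by blast
  show "g x \<in> M z ` W" using y stable_g[OF assms] stable_inV[OF assms] by (metis M_g imageI)
  show "h x \<in> M z ` W" using y stable_h[OF assms] by (metis M_h imageI)
qed

lemma N_image_subset: "stable W \<Longrightarrow> N z ` W \<subseteq> W" using stable_N by blast
lemma M_image_subset: "stable W \<Longrightarrow> M z ` W \<subseteq> W" using stable_M by blast

definition inv_forms :: "('a \<Rightarrow> 'k) set \<Rightarrow> ('a \<Rightarrow> 'k) set \<Rightarrow> ('a, 'k) form set" where
  "inv_forms W U = {B \<in> forms W U. \<forall>x\<in>W. \<forall>y\<in>U. B (g x, g y) = B (x, y)}"

lemma inv_formsD: "B \<in> inv_forms W U \<Longrightarrow> B \<in> forms W U" by (simp add: inv_forms_def)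

lemma inv_g: "B \<in> inv_forms W U \<Longrightarrow> x \<in> W \<Longrightarrow> y \<in> U \<Longrightarrow> B (g x, g y) = B (x, y)"
  by (simp add: inv_forms_def)

lemma inv_h: "B \<in> inv_forms W U \<Longrightarrow> stable W \<Longrightarrow> stable U \<Longrightarrow> x \<in> W \<Longrightarrow> y \<in> U \<Longrightarrow> B (h x, h y) = B (x, y)"
  using inv_g[of B W U "h x" "h y"] by (simp add: gh stable_h stable_inV)

lemma inv_hpow: "B \<in> inv_forms W U \<Longrightarrow> stable W \<Longrightarrow> stable U \<Longrightarrow> x \<in> W \<Longrightarrow> y \<in> U \<Longrightarrow> B ((h^^j) x, (h^^j) y) = B (x, y)"
  by (induction j) (auto simp: inv_h stable_hpow)

lemma inv_g1: "B \<in> inv_forms W U \<Longrightarrow> stable W \<Longrightarrow> stable U \<Longrightarrow> x \<in> W \<Longrightarrow> y \<in> U \<Longrightarrow> B (g x, y) = B (x, h y)"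
  using inv_g[of B W U x "h y"] by (simp add: gh stable_h stable_inV)

lemma inv_N: "B \<in> inv_forms W U \<Longrightarrow> stable W \<Longrightarrow> stable U \<Longrightarrow> x \<in> W \<Longrightarrow> y \<in> U \<Longrightarrow> B (N z x, y) = B (x, M z y)"
  by (simp add: N_def M_def forms_diff1[OF inv_formsD] forms_diff2[OF inv_formsD] stable_subspace
      stable_g stable_h fv.subspace_scale forms_scale1[OF inv_formsD] forms_scale2[OF inv_formsD] inv_g1)

lemma inv_formsI:
  assumes "B \<in> forms W U" "stable W" "stable U"
    and "\<And>x y. x \<in> W \<Longrightarrow> y \<in> U \<Longrightarrow> B (N z x, y) = B (x, M z y)"
  shows "B \<in> inv_forms W U"
proof -
  have "B (g x, g y) = B (x, y)" if xy: "x \<in> W" "y \<in> U" for x y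
  proof -
    have "g x = N z x + fscale z x" "y = M z (g y) + fscale z (g y)"
      using xy hg stable_inV[OF assms(3)] by (auto simp: N_def M_def)
    then have "B (g x, g y) = B (N z x, g y) + z * B (x, g y)" "B (x, y) = B (x, M z (g y)) + z * B (x, g y)"
      using xy assms stable_g stable_N stable_M fv.subspace_scale[OF stable_subspace]
      by (metis forms_add1 forms_scale1, metis forms_add2 forms_scale2)
    then show ?thesis using assms(4)[of x "g y"] xy stable_g assms by simp
  qed
  then show ?thesis using assms(1) by (simp add: inv_forms_def)
qed

lemma subspace_inv_forms: "fv.subspace (inv_forms W U)"
  unfolding fv.subspace_def inv_forms_def
  using fv.subspace_add[OF subspace_forms] fv.subspace_scale[OF subspace_forms] fv.subspace_0[OF subspace_forms]
  by auto

lemma fd_inv_forms: "stable W \<Longrightarrow> stable U \<Longrightarrow> fd (inv_forms W U)"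
  using fd_subset[OF fd_forms[of W U], of "inv_forms W U"] stable_subspace stable_fd inv_formsD by blast

text \<open>An invariant form \<open>B\<close> induces a form on the images of \<open>N z\<close> and \<open>M z\<close> by \<open>(N z x, M z y) \<mapsto> B (N z x, y)\<close>.
This is well defined, since \<open>B (N z x, y) = B (x, M z y)\<close> depends on \<open>y\<close> only through \<open>M z y\<close>. It is onto: choosing linear
sections of \<open>N z\<close> and \<open>M z\<close> extends an invariant form on the images back to \<open>W\<close> and \<open>U\<close>.\<close>

lemma step_map:
  assumes W: "stable W" and U: "stable U"
  shows "\<exists>\<rho>. flin \<rho>
    \<and> (\<forall>B\<in>inv_forms W U. \<rho> B \<in> inv_forms (N z ` W) (M z ` U))
    \<and> (\<forall>B\<in>inv_forms W U. \<forall>x\<in>W. \<forall>y\<in>U. \<rho> B (N z x, M z y) = B (N z x, y))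
    \<and> (\<forall>B'\<in>inv_forms (N z ` W) (M z ` U). \<exists>B\<in>inv_forms W U. \<rho> B = B')"
proof -
  let ?W1 = "N z ` W" and ?U1 = "M z ` U"
  have W1: "stable ?W1" and U1: "stable ?U1" using stable_N_image stable_M_image assms by auto
  have W1W: "x \<in> W" if "x \<in> ?W1" for x using that stable_N[OF W] by auto
  have U1U: "x \<in> U" if "x \<in> ?U1" for x using that stable_M[OF U] by auto
  obtain R where R: "flin R" "\<And>x. R x \<in> U" "\<And>v. v \<in> ?U1 \<Longrightarrow> M z (R v) = v"
    using right_inverse_exists[OF lin_M stable_subspace[OF U]] by metis
  define \<rho> :: "('a,'k) form \<Rightarrow> ('a,'k) form"
    where "\<rho> B = (\<lambda>(x, y). if x \<in> ?W1 \<and> y \<in> ?U1 then B (x, R y) else 0)" for B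
  have val: "\<rho> B (N z x, M z y) = B (N z x, y)" if "B \<in> inv_forms W U" "x \<in> W" "y \<in> U" for B x y
    using that R inv_N[OF that(1) W U] by (simp add: \<rho>_def)
  have lin: "flin \<rho>" by (rule flinI) (auto simp: \<rho>_def fun_eq_iff)
  have mem: "\<rho> B \<in> inv_forms ?W1 ?U1" if B: "B \<in> inv_forms W U" for B
  proof (rule inv_formsI[OF _ W1 U1, of _ z])
    note F = inv_formsD[OF B]
    show "\<rho> B \<in> forms ?W1 ?U1"
      by (rule formsI) (use W1W R(2) W1 U1 in \<open>auto simp: \<rho>_def flin_simps[OF R(1)] forms_add1[OF F] forms_add2[OF F]
          forms_scale1[OF F] forms_scale2[OF F] fv.subspace_add[OF stable_subspace] fv.subspace_scale[OF stable_subspace]\<close>)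
    fix x y assume xy: "x \<in> ?W1" "y \<in> ?U1"
    then obtain x' y' where e: "x' \<in> W" "x = N z x'" "y' \<in> U" "y = M z y'" by blast
    have "\<rho> B (N z x, y) = B (N z x, y')" using val[OF B, of x y'] e W1W[OF xy(1)] by simp
    also have "\<dots> = B (x, y)" using inv_N[OF B W U W1W[OF xy(1)] e(3)] e(4) by simp
    also have "\<dots> = \<rho> B (x, M z y)" using val[OF B e(1) U1U[OF xy(2)]] e(2) by simp
    finally show "\<rho> B (N z x, y) = \<rho> B (x, M z y)" .
  qed
  have surj: "\<exists>B\<in>inv_forms W U. \<rho> B = B'" if B': "B' \<in> inv_forms ?W1 ?U1" for B'
  proof -
    obtain p where p: "flin p" "\<And>x. p x \<in> ?W1" "\<And>x. x \<in> ?W1 \<Longrightarrow> p x = x"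
      using projection_exists[OF stable_subspace[OF W1]] by metis
    obtain q where q: "flin q" "\<And>x. q x \<in> ?U1" "\<And>x. x \<in> ?U1 \<Longrightarrow> q x = x"
      using projection_exists[OF stable_subspace[OF U1]] by metis
    note F = inv_formsD[OF B']
    define L where "L x = N z (x - p x)" for x
    have linL: "flin L"
      by (rule flinI) (simp_all add: L_def flin_simps[OF p(1)] flin_simps[OF lin_N] fv.scale_right_diff_distrib)
    define B where "B = (\<lambda>(x, y). if x \<in> W \<and> y \<in> U then B' (p x, M z y) + B' (L x, q y) else 0)"
    have mem1: "L x \<in> ?W1" if "x \<in> W" for x
      unfolding L_def using that p(2) W1W fv.subspace_diff[OF stable_subspace[OF W]] by blast
    have BF: "B \<in> forms W U"
      by (rule formsI) (use W U p(2) q(2) mem1 in \<open>auto simp: B_def flin_add[OF linL] flin_scale[OF linL] flin_add[OF p(1)] flin_scale[OF p(1)] flin_add[OF q(1)] flin_scale[OF q(1)] flin_add[OF lin_M] M_scale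
          forms_add1[OF F] forms_add2[OF F] forms_scale1[OF F] forms_scale2[OF F] algebra_simps
          fv.subspace_add[OF stable_subspace] fv.subspace_scale[OF stable_subspace]\<close>)
    have BN: "B (N z x, y) = B' (N z x, M z y)" if "x \<in> W" "y \<in> U" for x y
      using that stable_N[OF W] p(3)[of "N z x"] forms_zero1[OF F stable_subspace[OF W1]] by (simp add: B_def L_def flin_0[OF lin_N])
    have BM: "B (x, M z y) = B' (N z x, M z y)" if xy: "x \<in> W" "y \<in> U" for x y
    proof -
      have "B (x, M z y) = B' (p x, M z (M z y)) + B' (N z (x - p x), M z y)"
        using xy stable_M[OF U] q(3)[of "M z y"] by (simp add: B_def L_def)
      also have "B' (p x, M z (M z y)) = B' (N z (p x), M z y)"
        using inv_N[OF B' W1 U1 p(2)] xy by auto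
      also have "N z (x - p x) = N z x - N z (p x)" by (rule flin_diff[OF lin_N])
      also have "B' (N z (p x), M z y) + B' (N z x - N z (p x), M z y) = B' (N z x, M z y)"
        using forms_diff1[OF F stable_subspace[OF W1]] xy W1W[OF p(2)] by simp
      finally show ?thesis .
    qed
    have B: "B \<in> inv_forms W U" by (rule inv_formsI[OF BF W U, of z]) (use BN BM in simp)
    moreover have "\<rho> B = B'"
    proof
      fix w
      show "\<rho> B w = B' w"
      proof (cases "w \<in> ?W1 \<times> ?U1")
        case True
        then obtain x y where "x \<in> W" "y \<in> U" "w = (N z x, M z y)" by auto
        then show ?thesis using val[OF B] BN by simp
      next
        case False
        then show ?thesis using forms_outside[OF F] by (cases w) (auto simp: \<rho>_def)
      qed
    qed
    ultimately show ?thesis by blast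
  qed
  show ?thesis using lin mem val surj by blast
qed

lemma step_kernelI:
  assumes "stable W" "stable U" "B \<in> inv_forms W U" "C \<in> inv_forms (N z ` W) (M z ` U)"
    and "\<And>x y. x \<in> W \<Longrightarrow> y \<in> U \<Longrightarrow> C (N z x, M z y) = B (N z x, y)"
    and "\<And>x y. x \<in> W \<Longrightarrow> y \<in> U \<Longrightarrow> B (N z x, y) = 0"
  shows "C = 0"
proof
  fix w
  show "C w = 0 w"
  proof (cases "w \<in> N z ` W \<times> M z ` U")
    case True then show ?thesis using assms(5,6) by auto
  next
    case False then show ?thesis using forms_outside[OF inv_formsD[OF assms(4)]] by (cases w) auto
  qed
qed

text \<open>The kernel of the step map contains all forms that live on the quotients of \<open>W\<close> and \<open>U\<close> by the images.\<close>

lemma inv_forms_step: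
  assumes W: "stable W" and U: "stable U"
  shows "(fv.dim W - fv.dim (N z ` W)) * (fv.dim U - fv.dim (M z ` U)) + fv.dim (inv_forms (N z ` W) (M z ` U))
    \<le> fv.dim (inv_forms W U)"
proof -
  let ?r = "fv.dim W - fv.dim (N z ` W)" and ?s = "fv.dim U - fv.dim (M z ` U)"
  obtain \<rho> where \<rho>0: "flin \<rho>" "\<forall>B\<in>inv_forms W U. \<rho> B \<in> inv_forms (N z ` W) (M z ` U)"
    "\<forall>B\<in>inv_forms W U. \<forall>x\<in>W. \<forall>y\<in>U. \<rho> B (N z x, M z y) = B (N z x, y)"
    "\<forall>B'\<in>inv_forms (N z ` W) (M z ` U). \<exists>B\<in>inv_forms W U. \<rho> B = B'"
    using step_map[OF W U, of z] by (elim exE conjE)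
  note \<rho> = \<rho>0(1) \<rho>0(2,3,4)[rule_format]
  obtain b l where l0: "\<forall>i < ?r. b i \<in> W" "\<forall>i::nat. functional (l i)" "\<forall>i. \<forall>x\<in>N z ` W. l i x = 0"
    "\<forall>i < ?r. \<forall>j < ?r. l i (b j) = (if i = j then 1 else 0)"
    using dual_family[OF stable_subspace[OF W] stable_subspace[OF stable_N_image[OF W]] N_image_subset[OF W] stable_fd[OF W], of z]
    by (elim exE conjE)
  note l = l0[rule_format]
  obtain c m where m0: "\<forall>i < ?s. c i \<in> U" "\<forall>i::nat. functional (m i)" "\<forall>i. \<forall>x\<in>M z ` U. m i x = 0"
    "\<forall>i < ?s. \<forall>j < ?s. m i (c j) = (if i = j then 1 else 0)"
    using dual_family[OF stable_subspace[OF U] stable_subspace[OF stable_M_image[OF U]] M_image_subset[OF U] stable_fd[OF U], of z]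
    by (elim exE conjE)
  note m = m0[rule_format]
  let ?K = "{B \<in> inv_forms W U. \<rho> B = 0}"
  have "card ({..<?r} \<times> {..<?s}) \<le> fv.dim ?K"
  proof (rule family_card_le_dim[of _ _ "\<lambda>(i,j). outer W U (l i) (m j)"])
    show "fd ?K" by (rule fd_subset[OF fd_inv_forms[OF W U]]) blast
    fix p assume "p \<in> {..<?r} \<times> {..<?s}"
    obtain i j where p: "p = (i, j)" by (cases p)
    let ?B = "outer W U (l i) (m j)"
    have 0: "?B (N z x, y) = 0" "?B (x, M z y) = 0" if "x \<in> W" "y \<in> U" for x y
      using that l(3) m(3) by (auto simp: outer_def)
    have B: "?B \<in> inv_forms W U"
      by (rule inv_formsI[OF outer_in_forms W U, of _ _ z]) (use l m W U 0 stable_subspace in auto)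
    then have "\<rho> ?B = 0" using step_kernelI[OF W U B \<rho>(2)[OF B] \<rho>(3)[OF B]] 0 by blast
    then show "(case p of (i, j) \<Rightarrow> outer W U (l i) (m j)) \<in> ?K" using B p by simp
  next
    fix a assume a: "(\<Sum>p\<in>{..<?r} \<times> {..<?s}. fscale (a p) (case p of (i, j) \<Rightarrow> outer W U (l i) (m j))) = 0"
    show "\<forall>p\<in>{..<?r} \<times> {..<?s}. a p = 0"
    proof
      fix q assume q: "q \<in> {..<?r} \<times> {..<?s}"
      then obtain i j where ij: "q = (i, j)" "i < ?r" "j < ?s" by auto
      have "0 = (\<Sum>p\<in>{..<?r} \<times> {..<?s}. fscale (a p) (case p of (i, j) \<Rightarrow> outer W U (l i) (m j))) (b i, c j)"
        using a by simp
      also have "\<dots> = (\<Sum>p\<in>{..<?r} \<times> {..<?s}. if p = q then a q else 0)"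
        unfolding sum_fun_apply
      proof (rule sum.cong[OF refl])
        fix p assume "p \<in> {..<?r} \<times> {..<?s}"
        then show "(fscale (a p) (case p of (i, j) \<Rightarrow> outer W U (l i) (m j))) (b i, c j) = (if p = q then a q else 0)"
          using ij l(1)[of i] m(1)[of j] by (auto simp: outer_def l(4) m(4) split: if_splits)
      qed
      also have "\<dots> = a q" using q by simp
      finally show "a q = 0" by simp
    qed
  qed simp
  then have "?r * ?s \<le> fv.dim ?K" by (simp add: card_cartesian_product)
  moreover have "inv_forms (N z ` W) (M z ` U) \<subseteq> \<rho> ` inv_forms W U" using \<rho>(4) by blast
  then have "fv.dim (inv_forms (N z ` W) (M z ` U)) \<le> fv.dim (\<rho> ` inv_forms W U)"
    by (rule fd_dim_mono[OF fd_image[OF \<rho>(1) fd_inv_forms[OF W U]]])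
  moreover have "fv.dim (inv_forms W U) = fv.dim ?K + fv.dim (\<rho> ` inv_forms W U)"
    by (rule rank_nullity[OF \<rho>(1) subspace_inv_forms fd_inv_forms[OF W U]])
  ultimately show ?thesis by linarith
qed

text \<open>Invariant forms that are symmetric up to the sign \<open>e\<close> and a twist by a power of \<open>h\<close>.\<close>

definition tw_forms :: "'k \<Rightarrow> nat \<Rightarrow> ('a \<Rightarrow> 'k) set \<Rightarrow> ('a, 'k) form set" where
  "tw_forms e j W = {B \<in> inv_forms W W. \<forall>x\<in>W. \<forall>y\<in>W. B (x, y) = e * B (y, (h ^^ j) x)}"

lemma tw_formsD: "B \<in> tw_forms e j W \<Longrightarrow> B \<in> inv_forms W W"
  and tw_sym: "B \<in> tw_forms e j W \<Longrightarrow> x \<in> W \<Longrightarrow> y \<in> W \<Longrightarrow> B (x, y) = e * B (y, (h ^^ j) x)"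
  by (simp_all add: tw_forms_def)

lemma subspace_tw_forms: "fv.subspace (tw_forms e j W)"
  unfolding fv.subspace_def tw_forms_def
  using fv.subspace_add[OF subspace_inv_forms] fv.subspace_scale[OF subspace_inv_forms] fv.subspace_0[OF subspace_inv_forms]
  by (auto simp: algebra_simps)

lemma fd_tw_forms: "stable W \<Longrightarrow> fd (tw_forms e j W)"
  using fd_subset[OF fd_inv_forms[of W W], of "tw_forms e j W"] tw_formsD by blast

lemma hpow_g: "x \<in> V \<Longrightarrow> (h ^^ j) (g x) = g ((h ^^ j) x)"
proof (induction j)
  case (Suc j) then show ?case using stable_hpow[OF stable_V Suc.prems, of j] by (simp add: hg gh)
qed simp

definition twist :: "'k \<Rightarrow> nat \<Rightarrow> ('a \<Rightarrow> 'k) set \<Rightarrow> ('a, 'k) form \<Rightarrow> ('a, 'k) form" where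
  "twist e j W B = (\<lambda>(x, y). if x \<in> W \<and> y \<in> W then e * B (y, (h ^^ j) x) else 0)"

lemma lin_twist: "flin (twist e j W)"
  by (rule flinI) (auto simp: twist_def fun_eq_iff algebra_simps)

lemma twist_inv_forms:
  assumes W: "stable W" and B: "B \<in> inv_forms W W"
  shows "twist e j W B \<in> inv_forms W W"
proof -
  note F = inv_formsD[OF B]
  have "twist e j W B \<in> forms W W"
    by (rule formsI) (use W stable_subspace[OF W] stable_hpow[OF W] in \<open>auto simp: twist_def flin_add[OF hpow_lin] flin_scale[OF hpow_lin] forms_add1[OF F]
          forms_add2[OF F] forms_scale1[OF F] forms_scale2[OF F] fv.subspace_add fv.subspace_scale algebra_simps\<close>)
  then show ?thesis using B W stable_g[OF W] stable_hpow[OF W] inv_g[OF B] stable_inV[OF W]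
    by (simp add: inv_forms_def twist_def hpow_g)
qed

lemma tw_formsI:
  assumes "stable W" "B \<in> inv_forms W W" "twist e j W B = B"
  shows "B \<in> tw_forms e j W"
proof -
  have "B (x, y) = e * B (y, (h ^^ j) x)" if "x \<in> W" "y \<in> W" for x y
    using fun_cong[OF assms(3), of "(x, y)"] that by (simp add: twist_def)
  then show ?thesis using assms(2) by (simp add: tw_forms_def)
qed

lemma twist_twist:
  assumes W: "stable W" and B: "B \<in> inv_forms W W" and e: "e * e = 1"
  shows "twist e j W (twist e j W B) = B"
proof
  fix p show "twist e j W (twist e j W B) p = B p"
    using forms_outside[OF inv_formsD[OF B]] stable_hpow[OF W] inv_hpow[OF B W W] e
    by (cases p) (auto simp: twist_def mult.assoc[symmetric])
qed

lemma N_of_M: "x \<in> V \<Longrightarrow> z * z = 1 \<Longrightarrow> N z (fscale (- z) (h x)) = M z x"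
  by (simp add: N_def M_def flin_simps[OF lin_g] gh fun_eq_iff algebra_simps flip: mult.assoc)
lemma M_of_N: "x \<in> V \<Longrightarrow> z * z = 1 \<Longrightarrow> M z (fscale (- z) (g x)) = N z x"
  by (simp add: N_def M_def flin_simps[OF lin_h] hg fun_eq_iff algebra_simps flip: mult.assoc)

lemma M_image_eq: assumes W: "stable W" and z: "z * z = 1" shows "M z ` W = N z ` W"
proof
  show "M z ` W \<subseteq> N z ` W"
  proof
    fix y assume "y \<in> M z ` W"
    then obtain x where "x \<in> W" "y = M z x" by blast
    then have "y = N z (fscale (- z) (h x))" "fscale (- z) (h x) \<in> W"
      using N_of_M[OF stable_inV[OF W] z] stable_h[OF W] fv.subspace_scale[OF stable_subspace[OF W]] by auto
    then show "y \<in> N z ` W" by (rule image_eqI)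
  qed
  show "N z ` W \<subseteq> M z ` W"
  proof
    fix y assume "y \<in> N z ` W"
    then obtain x where "x \<in> W" "y = N z x" by blast
    then have "y = M z (fscale (- z) (g x))" "fscale (- z) (g x) \<in> W"
      using M_of_N[OF stable_inV[OF W] z] stable_g[OF W] fv.subspace_scale[OF stable_subspace[OF W]] by auto
    then show "y \<in> M z ` W" by (rule image_eqI)
  qed
qed

text \<open>For \<open>z = 1\<close> and \<open>z = - 1\<close> the operators \<open>N z\<close> and \<open>M z\<close> differ by the factor \<open>- z h\<close>. Hence the step map
sends forms with twist \<open>(e, j)\<close> to forms with twist \<open>(- z e, j + 1)\<close>.\<close>

lemma tw_forms_step_aux:
  assumes W: "stable W" and z: "z * z = 1" and e: "e * e = 1" and two: "(2::'k) \<noteq> 0"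
  shows "\<exists>\<rho>. flin \<rho> \<and> (\<forall>B\<in>tw_forms e j W. \<forall>x\<in>W. \<forall>y\<in>W. \<rho> B (N z x, M z y) = B (N z x, y))
    \<and> (\<forall>B\<in>tw_forms e j W. \<rho> B \<in> inv_forms (N z ` W) (M z ` W))
    \<and> tw_forms (- z * e) (Suc j) (N z ` W) \<subseteq> \<rho> ` tw_forms e j W"
proof -
  let ?W1 = "N z ` W"
  note W1 = stable_N_image[OF W, of z] and eq = M_image_eq[OF W z]
  obtain \<rho> where \<rho>0: "flin \<rho>" "\<forall>B\<in>inv_forms W W. \<rho> B \<in> inv_forms (N z ` W) (M z ` W)"
    "\<forall>B\<in>inv_forms W W. \<forall>x\<in>W. \<forall>y\<in>W. \<rho> B (N z x, M z y) = B (N z x, y)"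
    "\<forall>B'\<in>inv_forms (N z ` W) (M z ` W). \<exists>B\<in>inv_forms W W. \<rho> B = B'"
    using step_map[OF W W, of z] by (elim exE conjE)
  note \<rho> = \<rho>0(1) \<rho>0(2,3,4)[rule_format]
  have "B' \<in> \<rho> ` tw_forms e j W" if B': "B' \<in> tw_forms (- z * e) (Suc j) ?W1" for B'
  proof -
    have "B' \<in> inv_forms ?W1 (M z ` W)" using tw_formsD[OF B'] eq by simp
    then obtain B0 where B0: "B0 \<in> inv_forms W W" "\<rho> B0 = B'" using \<rho>(4) by blast
    let ?T = "twist e j W B0"
    have T: "?T \<in> inv_forms W W" by (rule twist_inv_forms[OF W B0(1)])
    \<comment> \<open>the step map intertwines the two twisted transpositions\<close>
    have \<rho>T: "\<rho> ?T = B'"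
    proof
      fix p show "\<rho> ?T p = B' p"
      proof (cases "p \<in> ?W1 \<times> (M z ` W)")
        case True
        then obtain x y where xy: "x \<in> W" "y \<in> W" "p = (N z x, M z y)" by auto
        let ?hx = "(h ^^ j) x"
        have hx: "?hx \<in> W" by (rule stable_hpow[OF W xy(1)])
        have sc: "fscale c u \<in> W" if "u \<in> W" for c u by (rule fv.subspace_scale[OF stable_subspace[OF W] that])
        have c1: "(h ^^ j) (N z x) = M z (fscale (- z) (g ?hx))"
          using M_of_N[OF stable_inV[OF W hx] z] hpow_g[OF stable_inV[OF W xy(1)]]
          by (simp add: N_def flin_diff[OF hpow_lin] flin_scale[OF hpow_lin])
        have c2: "(h ^^ Suc j) (N z x) = M z (fscale (- z) ?hx)"
          using c1 hx stable_g[OF W hx] stable_inV[OF W hx] by (simp add: M_h[symmetric] flin_scale[OF lin_h] hg)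
        have "\<rho> ?T p = e * B0 (y, (h ^^ j) (N z x))"
          using \<rho>(3)[OF T xy(1,2)] xy stable_N[OF W] by (simp add: twist_def)
        also have "\<dots> = e * B0 (N z y, fscale (- z) (g ?hx))"
          unfolding c1 using inv_N[OF B0(1) W W xy(2) sc[OF stable_g[OF W hx]]] by simp
        also have "\<dots> = - z * e * B0 (N z y, g ?hx)"
          using forms_scale2[OF inv_formsD[OF B0(1)] stable_N[OF W xy(2)] stable_g[OF W hx], of z "- z"] by simp
        finally have 1: "\<rho> ?T p = - z * e * B0 (N z y, g ?hx)" .
        have "B' p = - z * e * B' (M z y, (h ^^ Suc j) (N z x))"
          using tw_sym[OF B'] xy eq by blast
        also have "B' (M z y, (h ^^ Suc j) (N z x)) = \<rho> B0 (N z (fscale (- z) (h y)), M z (fscale (- z) ?hx))"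
          unfolding c2 B0(2) using N_of_M[OF stable_inV[OF W xy(2)] z] by simp
        also have "\<dots> = B0 (M z y, fscale (- z) ?hx)"
          using \<rho>(3)[OF B0(1) sc[OF stable_h[OF W xy(2)], of "- z"] sc[OF hx, of "- z"]] N_of_M[OF stable_inV[OF W xy(2)] z]
          by simp
        also have "\<dots> = B0 (fscale (- z) (h (N z y)), fscale (- z) ?hx)"
          using N_of_M[OF stable_inV[OF W xy(2)] z] N_scale[of z "- z" "h y"] N_h[OF stable_inV[OF W xy(2)]] by simp
        also have "\<dots> = (- z) * ((- z) * B0 (h (N z y), ?hx))"
          using forms_scale1[OF inv_formsD[OF B0(1)] stable_h[OF W stable_N[OF W xy(2)]] sc[OF hx]]
            forms_scale2[OF inv_formsD[OF B0(1)] stable_h[OF W stable_N[OF W xy(2)]] hx] by simp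
        also have "\<dots> = B0 (h (N z y), ?hx)" using z by (simp flip: mult.assoc)
        also have "\<dots> = B0 (N z y, g ?hx)"
          using inv_g[OF B0(1) stable_h[OF W stable_N[OF W xy(2)]] hx] gh stable_inV[OF W stable_N[OF W xy(2)]] by simp
        finally show ?thesis using 1 by simp
      next
        case False
        then show ?thesis
          using forms_outside[OF inv_formsD[OF \<rho>(2)[OF T]]] forms_outside[OF inv_formsD[OF tw_formsD[OF B']]] eq
          by (cases p) auto
      qed
    qed
    define B where "B = fscale (1/2) (B0 + ?T)"
    have Bi: "B \<in> inv_forms W W"
      unfolding B_def using fv.subspace_add[OF subspace_inv_forms B0(1) T] fv.subspace_scale[OF subspace_inv_forms] by blast
    have "twist e j W B = B"
      unfolding B_def flin_scale[OF lin_twist] flin_add[OF lin_twist] twist_twist[OF W B0(1) e] by (simp only: add.commute)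
    then have "B \<in> tw_forms e j W" using tw_formsI[OF W Bi] by blast
    moreover have "\<rho> B = B'"
      unfolding B_def flin_scale[OF \<rho>(1)] flin_add[OF \<rho>(1)] \<rho>T B0(2) using two by (simp add: fun_eq_iff field_simps)
    ultimately show ?thesis by blast
  qed
  then show ?thesis using \<rho>0 tw_formsD by (intro exI[of _ \<rho>]) blast
qed

definition sym_outer :: "'k \<Rightarrow> ('a \<Rightarrow> 'k) set \<Rightarrow> (('a \<Rightarrow> 'k) \<Rightarrow> 'k) \<Rightarrow> (('a \<Rightarrow> 'k) \<Rightarrow> 'k) \<Rightarrow> ('a, 'k) form" where
  "sym_outer s W l m = outer W W l m + fscale s (outer W W m l)"

text \<open>On the quotient of \<open>W\<close> by the image of \<open>N z\<close> the operator is the scalar \<open>z\<close>, so the twisted symmetry there is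
ordinary symmetry or antisymmetry according to the sign \<open>s\<close>; the index set \<open>I\<close> lists basis forms of the right kind.\<close>

lemma tw_forms_step_kernel:
  assumes W: "stable W" and z: "z * z = 1" and e: "e * e = 1" and two: "(2::'k) \<noteq> 0"
    and s: "s = e * z ^ j"
    and I: "I \<subseteq> {(i, k). i \<le> k \<and> k < fv.dim W - fv.dim (N z ` W)}" "s = 1 \<or> (\<forall>i. (i, i) \<notin> I)"
  shows "card I + fv.dim (tw_forms (- z * e) (Suc j) (N z ` W)) \<le> fv.dim (tw_forms e j W)"
proof -
  let ?r = "fv.dim W - fv.dim (N z ` W)"
  obtain \<rho> where \<rho>0: "flin \<rho>" "\<forall>B\<in>tw_forms e j W. \<forall>x\<in>W. \<forall>y\<in>W. \<rho> B (N z x, M z y) = B (N z x, y)"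
    "\<forall>B\<in>tw_forms e j W. \<rho> B \<in> inv_forms (N z ` W) (M z ` W)"
    "tw_forms (- z * e) (Suc j) (N z ` W) \<subseteq> \<rho> ` tw_forms e j W"
    using tw_forms_step_aux[OF W z e two, of j] by (elim exE conjE)
  note \<rho> = \<rho>0(1) \<rho>0(2,3)[rule_format] \<rho>0(4)
  obtain b l where l0: "\<forall>i < ?r. b i \<in> W" "\<forall>i::nat. functional (l i)" "\<forall>i. \<forall>x\<in>N z ` W. l i x = 0"
    "\<forall>i < ?r. \<forall>j < ?r. l i (b j) = (if i = j then 1 else 0)"
    using dual_family[OF stable_subspace[OF W] stable_subspace[OF stable_N_image[OF W]] N_image_subset[OF W] stable_fd[OF W], of z]
    by (elim exE conjE)
  note l = l0[rule_format]
  have ss: "s * s = 1" using e z unfolding s by (simp add: power_mult_distrib flip: power2_eq_square) (metis mult.commute power_mult power_one power2_eq_square)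
  have lM: "l i (M z x) = 0" if "x \<in> W" for i x using l(3) that M_image_eq[OF W z] by blast
  have lh: "l i ((h ^^ n) x) = z ^ n * l i x" if x: "x \<in> W" for i n x
  proof (induction n)
    case (Suc n)
    have "(h ^^ Suc n) x = M z ((h ^^ n) x) + fscale z ((h ^^ n) x)" by (simp add: M_def)
    then show ?case using lM[OF stable_hpow[OF W x]] Suc
      by (simp only: functional_add[OF l(2)] functional_scale[OF l(2)]) simp
  qed simp
  let ?K = "{B \<in> tw_forms e j W. \<rho> B = 0}"
  let ?f = "\<lambda>(i, k). sym_outer s W (l i) (l k)"
  have finI: "finite I"
    by (rule finite_subset[of _ "{..<?r} \<times> {..<?r}"]) (use I(1) in auto)
  have "card I \<le> fv.dim ?K"
  proof (rule family_card_le_dim[of _ _ ?f])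
    show "fd ?K" by (rule fd_subset[OF fd_tw_forms[OF W]]) blast
    fix p assume p: "p \<in> I"
    obtain i k where ik: "p = (i, k)" by (cases p)
    let ?B = "sym_outer s W (l i) (l k)"
    have 0: "?B (N z x, y) = 0" "?B (x, M z y) = 0" if "x \<in> W" "y \<in> W" for x y
      using that l(3) lM by (auto simp: sym_outer_def outer_def)
    have "?B \<in> forms W W" unfolding sym_outer_def
      using outer_in_forms[OF l(2) l(2)] stable_subspace[OF W] fv.subspace_add[OF subspace_forms] fv.subspace_scale[OF subspace_forms] by blast
    then have Bi: "?B \<in> inv_forms W W"
      by (rule inv_formsI[OF _ W W, of _ z]) (use 0 in auto)
    have "?B (x, y) = e * ?B (y, (h ^^ j) x)" if "x \<in> W" "y \<in> W" for x y
    proof -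
      have "e * ?B (y, (h ^^ j) x) = s * (l k x * l i y) + (s * s) * (l i x * l k y)"
        using that stable_hpow[OF W] unfolding s by (simp add: sym_outer_def outer_def lh algebra_simps)
      also have "\<dots> = ?B (x, y)" using that unfolding ss by (simp add: sym_outer_def outer_def)
      finally show ?thesis by simp
    qed
    then have B: "?B \<in> tw_forms e j W" using Bi by (simp add: tw_forms_def)
    then have "\<rho> ?B = 0" using step_kernelI[OF W W Bi \<rho>(3)[OF B] \<rho>(2)[OF B]] 0 by blast
    then show "?f p \<in> ?K" using B ik by simp
  next
    fix a assume a: "(\<Sum>p\<in>I. fscale (a p) (?f p)) = 0"
    show "\<forall>p\<in>I. a p = 0"
    proof
      fix q assume q: "q \<in> I"
      then obtain i k where ik: "q = (i, k)" "i \<le> k" "k < ?r" using I(1) by auto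
      let ?c = "if i = k then 2 else 1 :: 'k"
      have "0 = (\<Sum>p\<in>I. fscale (a p) (?f p)) (b i, b k)" using a by simp
      also have "\<dots> = (\<Sum>p\<in>I. if p = q then ?c * a q else 0)"
        unfolding sum_fun_apply
      proof (rule sum.cong[OF refl])
        fix p assume p: "p \<in> I"
        obtain i' k' where p': "p = (i', k')" "i' \<le> k'" "k' < ?r" using I(1) p by auto
        have "s = 1" if "i = k" using I(2) q that ik by auto
        then show "(fscale (a p) (?f p)) (b i, b k) = (if p = q then ?c * a q else 0)"
          using p' ik l(1)[of i] l(1)[of k] by (auto simp: sym_outer_def outer_def l(4))
      qed
      also have "\<dots> = ?c * a q" using q finI by simp
      finally show "a q = 0" using two by (auto split: if_splits)
    qed
  qed (rule finI)
  moreover have "fv.dim (tw_forms (- z * e) (Suc j) (N z ` W)) \<le> fv.dim (\<rho> ` tw_forms e j W)"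
    by (rule fd_dim_mono[OF fd_image[OF \<rho>(1) fd_tw_forms[OF W]] \<rho>(4)])
  moreover have "fv.dim (tw_forms e j W) = fv.dim ?K + fv.dim (\<rho> ` tw_forms e j W)"
    by (rule rank_nullity[OF \<rho>(1) subspace_tw_forms fd_tw_forms[OF W]])
  ultimately show ?thesis by linarith
qed

lemma tw_forms_step_plus:
  assumes "stable W" "z * z = 1" "e * e = 1" "(2::'k) \<noteq> 0" "e * z ^ j = 1"
    and r: "r = fv.dim W - fv.dim (N z ` W)"
  shows "r * r + r + 2 * fv.dim (tw_forms (- z * e) (Suc j) (N z ` W)) \<le> 2 * fv.dim (tw_forms e j W)"
  using tw_forms_step_kernel[OF assms(1-4) assms(5)[symmetric], of "{(i, k). i \<le> k \<and> k < r}"] card_le_pairs[of r] r by simp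

lemma tw_forms_step_minus:
  assumes "stable W" "z * z = 1" "e * e = 1" "(2::'k) \<noteq> 0"
    and r: "r = fv.dim W - fv.dim (N z ` W)"
  shows "r * r + 2 * fv.dim (tw_forms (- z * e) (Suc j) (N z ` W)) \<le> 2 * fv.dim (tw_forms e j W) + r"
  using tw_forms_step_kernel[OF assms(1-4) refl, of "{(i, k). i < k \<and> k < r}" j] card_less_pairs[of r] r by (auto simp: subset_iff)

text \<open>The map \<open>B \<mapsto> ((x, y) \<mapsto> B (g x - h x, y))\<close> is injective and exchanges the two eigenspaces of the twisted
transposition, so each of them has half of the dimension.\<close>

lemma tw_forms_half:
  assumes W: "stable W" and e: "e * e = 1" and inj: "\<And>x. x \<in> W \<Longrightarrow> g x = h x \<Longrightarrow> x = 0"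
  shows "fv.dim (inv_forms W W) \<le> 2 * fv.dim (tw_forms e j W)"
proof -
  let ?T = "\<lambda>B. B + twist e j W B"
  have T: "flin ?T" by (rule flinI) (auto simp: flin_simps[OF lin_twist] fv.scale_right_distrib)
  have im: "?T ` inv_forms W W \<subseteq> tw_forms e j W"
  proof
    fix C assume "C \<in> ?T ` inv_forms W W"
    then obtain B where B: "B \<in> inv_forms W W" "C = ?T B" by blast
    have "twist e j W C = C" unfolding B(2) flin_add[OF lin_twist] twist_twist[OF W B(1) e] by (simp only: add.commute)
    moreover have "C \<in> inv_forms W W"
      unfolding B(2) by (rule fv.subspace_add[OF subspace_inv_forms B(1) twist_inv_forms[OF W B(1)]])
    ultimately show "C \<in> tw_forms e j W" using tw_formsI[OF W] by blast
  qed
  have ker: "{B \<in> inv_forms W W. ?T B = 0} \<subseteq> tw_forms (- e) j W"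
  proof
    fix B assume "B \<in> {B \<in> inv_forms W W. ?T B = 0}"
    then have B: "B \<in> inv_forms W W" "?T B = 0" by auto
    have "B (x, y) = - e * B (y, (h ^^ j) x)" if "x \<in> W" "y \<in> W" for x y
      using fun_cong[OF B(2), of "(x, y)"] that by (simp add: twist_def add_eq_0_iff)
    then show "B \<in> tw_forms (- e) j W" using B(1) by (simp add: tw_forms_def)
  qed
  let ?D = "\<lambda>x. g x - h x"
  have D: "flin ?D" by (rule flinI) (auto simp: flin_simps[OF lin_g] flin_simps[OF lin_h] fv.scale_right_diff_distrib)
  have DW: "?D x \<in> W" if "x \<in> W" for x
    using that stable_g[OF W] stable_h[OF W] fv.subspace_diff[OF stable_subspace[OF W]] by blast
  have "?D ` W = W"
  proof (rule fd_dim_equal)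
    show "fv.subspace (?D ` W)" by (rule fp.linear_subspace_image[OF D stable_subspace[OF W]])
    show "fd W" by (rule stable_fd[OF W])
    show "?D ` W \<subseteq> W" using DW by blast
    have D0: "?D x = 0 \<Longrightarrow> g x = h x" for x by (simp only: right_minus_eq)
    show "fv.dim W \<le> fv.dim (?D ` W)"
      by (rule dim_le_of_inj(2)[OF D stable_subspace[OF W] _ fd_image[OF D stable_fd[OF W]] order_refl])
        (use inj D0 in blast)
  qed
  define G where "G = (\<lambda>(B::('a,'k) form) (x, y). if x \<in> W \<and> y \<in> W then B (?D x, y) else 0)"
  have G: "flin G" by (rule flinI) (auto simp: G_def fun_eq_iff)
  have "fv.dim (tw_forms (- e) j W) \<le> fv.dim (tw_forms e j W)"
  proof (rule dim_le_of_inj(2)[OF G subspace_tw_forms _ fd_tw_forms[OF W]])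
    fix B assume B: "B \<in> tw_forms (- e) j W" "G B = 0"
    note F = inv_formsD[OF tw_formsD[OF B(1)]]
    have "B p = 0" for p
    proof (cases "p \<in> W \<times> W")
      case True
      then obtain x y where "x \<in> W" "y \<in> W" "p = (?D x, y)" using \<open>?D ` W = W\<close> by (metis (no_types, lifting) SigmaE imageE)
      then show ?thesis using fun_cong[OF B(2), of "(x, y)"] by (simp add: G_def)
    next
      case False then show ?thesis using forms_outside[OF F] by (cases p) auto
    qed
    then show "B = 0" by (simp add: fun_eq_iff)
  next
    show "G ` tw_forms (- e) j W \<subseteq> tw_forms e j W"
    proof
      fix C assume "C \<in> G ` tw_forms (- e) j W"
      then obtain B where B: "B \<in> tw_forms (- e) j W" "C = G B" by blast
      note Bi = tw_formsD[OF B(1)] and F = inv_formsD[OF tw_formsD[OF B(1)]]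
      have CF: "C \<in> forms W W" unfolding B(2)
      proof (rule formsI)
        fix c x x' y assume a: "x \<in> W" "y \<in> W" "x' \<in> W"
        show "G B (x + x', y) = G B (x, y) + G B (x', y)"
          using a DW forms_add1[OF F DW[OF a(1)] DW[OF a(3)] a(2)] flin_add[OF D, of x x'] fv.subspace_add[OF stable_subspace[OF W]]
          by (simp add: G_def)
        show "G B (x', y + x) = G B (x', y) + G B (x', x)"
          using a DW forms_add2[OF F DW[OF a(3)] a(2) a(1)] fv.subspace_add[OF stable_subspace[OF W]] by (simp add: G_def)
      next
        fix c x y assume a: "x \<in> W" "y \<in> W"
        show "G B (fscale c x, y) = c * G B (x, y)"
          using a DW forms_scale1[OF F DW[OF a(1)] a(2), of c] flin_scale[OF D, of c x] fv.subspace_scale[OF stable_subspace[OF W]]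
          by (simp add: G_def)
        show "G B (x, fscale c y) = c * G B (x, y)"
          using a DW forms_scale2[OF F DW[OF a(1)] a(2), of c] fv.subspace_scale[OF stable_subspace[OF W]] by (simp add: G_def)
      qed (auto simp: G_def)
      have Dg: "?D (g x) = g (?D x)" if "x \<in> W" for x
        using stable_inV[OF W that] by (simp add: flin_simps[OF lin_g] hg gh)
      have "C (g x, g y) = C (x, y)" if "x \<in> W" "y \<in> W" for x y
        unfolding B(2) using that stable_g[OF W] Dg[OF that(1)] inv_g[OF Bi DW[OF that(1)] that(2)] by (simp add: G_def)
      then have Ci: "C \<in> inv_forms W W" using CF by (simp add: inv_forms_def)
      have "C (x, y) = e * C (y, (h ^^ j) x)" if xy: "x \<in> W" "y \<in> W" for x y
      proof -
        have a1: "B (g x, y) = B (x, h y)" by (rule inv_g1[OF Bi W W xy])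
        have a2: "B (h x, y) = B (x, g y)"
          using inv_g[OF Bi stable_h[OF W xy(1)] xy(2)] gh stable_inV[OF W xy(1)] by simp
        have "C (x, y) = B (g x, y) - B (h x, y)"
          unfolding B(2) using xy forms_diff1[OF F stable_subspace[OF W]] stable_g[OF W] stable_h[OF W] by (simp add: G_def)
        also have "\<dots> = - B (x, ?D y)"
          using a1 a2 xy forms_diff2[OF F stable_subspace[OF W] xy(1)] stable_g[OF W] stable_h[OF W] by simp
        also have "\<dots> = e * B (?D y, (h ^^ j) x)" using tw_sym[OF B(1) xy(1) DW[OF xy(2)]] by simp
        also have "\<dots> = e * C (y, (h ^^ j) x)" unfolding B(2) using xy stable_hpow[OF W] by (simp add: G_def)
        finally show ?thesis .
      qed
      then show "C \<in> tw_forms e j W" using Ci by (simp add: tw_forms_def)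
    qed
  qed
  moreover have "fv.dim (inv_forms W W) = fv.dim {B \<in> inv_forms W W. ?T B = 0} + fv.dim (?T ` inv_forms W W)"
    by (rule rank_nullity[OF T subspace_inv_forms fd_inv_forms[OF W W]])
  moreover have "fv.dim {B \<in> inv_forms W W. ?T B = 0} \<le> fv.dim (tw_forms (- e) j W)"
    by (rule fd_dim_mono[OF fd_tw_forms[OF W] ker])
  moreover have "fv.dim (?T ` inv_forms W W) \<le> fv.dim (tw_forms e j W)"
    by (rule fd_dim_mono[OF fd_tw_forms[OF W] im])
  ultimately show ?thesis by linarith
qed

end

section \<open>Isometries of a symplectic form\<close>

lemma flin_compose: "flin f \<Longrightarrow> flin g \<Longrightarrow> flin (\<lambda>x. f (g x))"
  by (rule flinI) (simp_all only: flin_add flin_scale)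

lemma alternating_antisym:
  assumes "B \<in> forms W W" "fv.subspace W" "\<And>x. x \<in> W \<Longrightarrow> B (x, x) = 0" "x \<in> W" "y \<in> W"
  shows "B (y, x) = - B (x, y)"
proof -
  have m: "x + y \<in> W" by (rule fv.subspace_add[OF assms(2,4,5)])
  have "B (x + y, x + y) = B (x, x) + B (y, x) + (B (x, y) + B (y, y))"
    unfolding forms_add2[OF assms(1) m assms(4,5)] using assms(4,5) by (simp only: forms_add1[OF assms(1)])
  then have "B (y, x) + B (x, y) = 0" using assms(3)[OF m] assms(3)[OF assms(4)] assms(3)[OF assms(5)] by simp
  then show ?thesis by (simp only: eq_neg_iff_add_eq_0)
qed

text \<open>Induction on the dimension: a hyperbolic plane splits off as long as the form is not zero.\<close>

lemma alternating_even_rank: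
  fixes B :: "('a, 'k::field) form"
  assumes "B \<in> forms W W" "fv.subspace W" "fd W" "\<And>x. x \<in> W \<Longrightarrow> B (x, x) = 0"
  shows "\<exists>k. fv.dim W = fv.dim {x \<in> W. \<forall>y\<in>W. B (x, y) = 0} + 2 * k"
  using assms
proof (induction "fv.dim W" arbitrary: W B rule: less_induct)
  case less
  note F = less.prems(1) and sW = less.prems(2) and fW = less.prems(3) and alt = less.prems(4)
  have anti: "B (y, x) = - B (x, y)" if "x \<in> W" "y \<in> W" for x y
    by (rule alternating_antisym[OF F sW _ that]) (rule alt)
  let ?R = "{x \<in> W. \<forall>y\<in>W. B (x, y) = 0}"
  show ?case
  proof (cases "?R = W")
    case True then show ?thesis by auto
  next
    case False
    then obtain x y where xy: "x \<in> W" "y \<in> W" "B (x, y) \<noteq> 0" by blast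
    let ?c = "B (x, y)"
    obtain p where p: "flin p" "\<And>x. p x \<in> W" "\<And>x. x \<in> W \<Longrightarrow> p x = x"
      using projection_exists[OF sW] by metis
    define T where "T z = (\<lambda>i::nat. if i = 0 then B (p z, x) else if i = 1 then B (p z, y) else 0)" for z
    have T: "flin T"
      by (rule flinI) (auto simp: T_def fun_eq_iff flin_add[OF p(1)] flin_scale[OF p(1)] forms_add1[OF F] forms_scale1[OF F] p(2) xy)
    let ?W = "{z \<in> W. T z = 0}"
    have W': "z \<in> ?W \<longleftrightarrow> z \<in> W \<and> B (z, x) = 0 \<and> B (z, y) = 0" for z
      by (auto simp: T_def fun_eq_iff p(3))
    have sW': "fv.subspace ?W" using fp.linear_subspace_kernel[OF T] sW by (auto simp: fv.subspace_def)
    have fW': "fd ?W" by (rule fd_subset[OF fW]) blast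
    have "T ` W = supported {..<2::nat}"
    proof
      show "T ` W \<subseteq> supported {..<2}" by (auto simp: T_def supported_def)
      show "supported {..<2} \<subseteq> T ` W"
      proof
        fix f :: "nat \<Rightarrow> 'k" assume f: "f \<in> supported {..<2}"
        let ?z = "fscale (- f 0 / ?c) y + fscale (f 1 / ?c) x"
        have z: "?z \<in> W" using xy fv.subspace_add[OF sW] fv.subspace_scale[OF sW] by blast
        have "B (?z, x) = f 0" "B (?z, y) = f 1"
          using xy fv.subspace_scale[OF sW] alt anti[OF xy(1,2)]
          by (simp_all add: forms_add1[OF F] forms_scale1[OF F])
        then have "T ?z = f" using f z by (auto simp: T_def fun_eq_iff supported_def p(3))
        then show "f \<in> T ` W" using z by (metis imageI)
      qed
    qed
    then have "fv.dim (T ` W) = 2" using supported_dim(2)[of "{..<2::nat}"] by simp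
    then have dW: "fv.dim W = fv.dim ?W + 2" using rank_nullity[OF T sW fW] by simp
    define B' where "B' = (\<lambda>(u, v). if u \<in> ?W \<and> v \<in> ?W then B (u, v) else 0)"
    have F': "B' \<in> forms ?W ?W"
    proof (rule formsI)
      fix c u v w assume u: "u \<in> ?W" and v: "v \<in> ?W" and w: "w \<in> ?W"
      show "B' (u + v, w) = B' (u, w) + B' (v, w)" "B' (u, v + w) = B' (u, v) + B' (u, w)"
        using u v w fv.subspace_add[OF sW' u v] fv.subspace_add[OF sW' v w]
        by (auto simp: B'_def forms_add1[OF F] forms_add2[OF F])
    next
      fix c u v assume u: "u \<in> ?W" and v: "v \<in> ?W"
      show "B' (fscale c u, v) = c * B' (u, v)" "B' (u, fscale c v) = c * B' (u, v)"
        using u v fv.subspace_scale[OF sW' u, of c] fv.subspace_scale[OF sW' v, of c]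
        by (auto simp: B'_def forms_scale1[OF F] forms_scale2[OF F])
    qed (auto simp: B'_def)
    obtain k where k: "fv.dim ?W = fv.dim {u \<in> ?W. \<forall>v\<in>?W. B' (u, v) = 0} + 2 * k"
      using less.hyps[OF _ F' sW' fW'] dW alt by (auto simp: B'_def)
    have "{u \<in> ?W. \<forall>v\<in>?W. B' (u, v) = 0} = ?R"
    proof
      show "?R \<subseteq> {u \<in> ?W. \<forall>v\<in>?W. B' (u, v) = 0}" using W' xy by (auto simp: B'_def)
      show "{u \<in> ?W. \<forall>v\<in>?W. B' (u, v) = 0} \<subseteq> ?R"
      proof
        fix u assume u: "u \<in> {u \<in> ?W. \<forall>v\<in>?W. B' (u, v) = 0}"
        then have uW: "u \<in> W" "B (u, x) = 0" "B (u, y) = 0" using W' by auto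
        have "B (u, w) = 0" if w: "w \<in> W" for w
        proof -
          let ?s = "fscale (- (B (w, y) / ?c)) x" and ?t = "fscale (B (w, x) / ?c) y"
          let ?w = "w + (?s + ?t)"
          have st: "?s \<in> W" "?t \<in> W" using xy fv.subspace_scale[OF sW] by auto
          have m: "?s + ?t \<in> W" "?w \<in> W" using st w fv.subspace_add[OF sW] by auto
          have "B (?w, x) = 0" "B (?w, y) = 0"
            using st m w xy alt anti[OF xy(1,2)] by (simp_all add: forms_add1[OF F] forms_scale1[OF F])
          then have "?w \<in> ?W" using W' m by blast
          then have "B (u, ?w) = 0" using u by (auto simp: B'_def)
          then show ?thesis using uW st m w xy by (simp add: forms_add2[OF F] forms_scale2[OF F])
        qed
        then show "u \<in> ?R" using uW by blast
      qed
    qed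
    then show ?thesis using k dW by (intro exI[of _ "Suc k"]) simp
  qed
qed

text \<open>The kernel of an operator is orthogonal to the range of its adjoint.\<close>

lemma dim_range_adjoint_le:
  fixes \<omega> :: "('a, 'k::field) form"
  assumes F: "\<omega> \<in> forms V V" and sV: "fv.subspace V" and fV: "fd V"
    and nd: "\<And>y. y \<in> V \<Longrightarrow> (\<And>x. x \<in> V \<Longrightarrow> \<omega> (x, y) = 0) \<Longrightarrow> y = 0"
    and S: "flin S" "\<And>x. x \<in> V \<Longrightarrow> S x \<in> V" and T: "flin T" "\<And>x. x \<in> V \<Longrightarrow> T x \<in> V"
    and adj: "\<And>x y. x \<in> V \<Longrightarrow> y \<in> V \<Longrightarrow> \<omega> (S x, y) = \<omega> (x, T y)"
  shows "fv.dim (T ` V) \<le> fv.dim (S ` V)"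
proof -
  obtain A where A: "A \<subseteq> S ` V" "S ` V \<subseteq> fv.span A" "card A = fv.dim (S ` V)" "finite A"
    using fd_basis[OF fd_image[OF S(1) fV]] by metis
  obtain p where p: "flin p" "\<And>x. p x \<in> V" "\<And>x. x \<in> V \<Longrightarrow> p x = x"
    using projection_exists[OF sV] by metis
  have AV: "A \<subseteq> V" using A(1) S(2) by blast
  define P where "P y = (\<lambda>a. if a \<in> A then \<omega> (a, p y) else 0)" for y
  have P: "flin P"
    using AV by (intro flinI) (auto simp: P_def fun_eq_iff flin_add[OF p(1)] flin_scale[OF p(1)] forms_add2[OF F] forms_scale2[OF F] p(2))
  have ker: "{y \<in> V. P y = 0} \<subseteq> {y \<in> V. T y = 0}"
  proof
    fix y assume "y \<in> {y \<in> V. P y = 0}"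
    then have y: "y \<in> V" "P y = 0" by auto
    have a0: "\<omega> (a, y) = 0" if "a \<in> A" for a using fun_cong[OF y(2), of a] that y(1) by (simp add: P_def p(3))
    have "fv.subspace {x \<in> V. \<omega> (x, y) = 0}"
      using sV y(1) by (auto simp: fv.subspace_def forms_add1[OF F] forms_scale1[OF F] forms_zero1[OF F sV])
    moreover have "A \<subseteq> {x \<in> V. \<omega> (x, y) = 0}" using a0 AV by blast
    ultimately have "S ` V \<subseteq> {x \<in> V. \<omega> (x, y) = 0}" using A(2) fv.span_minimal by blast
    then have "\<omega> (x, T y) = 0" if "x \<in> V" for x using adj[OF that y(1)] that by auto
    then have "T y = 0" using nd[OF T(2)[OF y(1)]] by blast
    then show "y \<in> {y \<in> V. T y = 0}" using y by blast
  qed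
  have "P ` V \<subseteq> supported A" by (auto simp: P_def supported_def)
  then have "fv.dim (P ` V) \<le> card A"
    using fd_dim_mono[OF supported_dim(1)[OF A(4)]] supported_dim(2)[OF A(4)] by metis
  moreover have "fv.dim {y \<in> V. P y = 0} \<le> fv.dim {y \<in> V. T y = 0}"
    by (rule fd_dim_mono[OF fd_subset[OF fV] ker]) blast
  ultimately show ?thesis
    using rank_nullity[OF P sV fV] rank_nullity[OF T(1) sV fV] A(3) by linarith
qed

locale symplectic_pair = inverse_pair g h V
  for g h :: "('a \<Rightarrow> 'k::field) \<Rightarrow> 'a \<Rightarrow> 'k" and V +
  fixes \<omega> :: "('a, 'k) form"
  assumes omega: "\<omega> \<in> inv_forms V V"
    and alt: "\<And>x. x \<in> V \<Longrightarrow> \<omega> (x, x) = 0"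
    and nondeg: "\<And>y. y \<in> V \<Longrightarrow> (\<And>x. x \<in> V \<Longrightarrow> \<omega> (x, y) = 0) \<Longrightarrow> y = 0"
    and two: "(2::'k) \<noteq> 0"
begin

lemmas om = inv_formsD[OF omega]
lemma om_anti: "x \<in> V \<Longrightarrow> y \<in> V \<Longrightarrow> \<omega> (y, x) = - \<omega> (x, y)"
  by (rule alternating_antisym[OF om subV]) (rule alt)

lemma N_N: "N z (N w x) = N w (N z x)"
  by (simp add: N_def flin_simps[OF lin_g] fun_eq_iff algebra_simps)
lemma M_M: "M z (M w x) = M w (M z x)"
  by (simp add: M_def flin_simps[OF lin_h] fun_eq_iff algebra_simps)
abbreviation NN where "NN \<equiv> fold N"
abbreviation MM where "MM \<equiv> fold M"

lemma NN_lin: "flin (NN zs)"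
proof (induction zs rule: rev_induct)
  case (snoc z zs)
  have "NN (zs @ [z]) = (\<lambda>x. N z (NN zs x))" by (rule ext) simp
  then show ?case using flin_compose[OF lin_N snoc] by metis
qed (rule flinI, auto)
lemma MM_lin: "flin (MM zs)"
proof (induction zs rule: rev_induct)
  case (snoc z zs)
  have "MM (zs @ [z]) = (\<lambda>x. M z (MM zs x))" by (rule ext) simp
  then show ?case using flin_compose[OF lin_M snoc] by metis
qed (rule flinI, auto)

lemma stable_NN: "stable W \<Longrightarrow> stable (NN zs ` W)"
proof (induction zs rule: rev_induct)
  case (snoc z zs) then show ?case using stable_N_image[of "NN zs ` W" z] by (simp add: image_comp o_def)
qed simp
lemma stable_MM: "stable W \<Longrightarrow> stable (MM zs ` W)"
proof (induction zs rule: rev_induct)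
  case (snoc z zs) then show ?case using stable_M_image[of "MM zs ` W" z] by (simp add: image_comp o_def)
qed simp

lemma NN_V: "x \<in> V \<Longrightarrow> NN zs x \<in> V" using stable_inV[OF stable_NN[OF stable_V, of zs]] by blast
lemma MM_V: "x \<in> V \<Longrightarrow> MM zs x \<in> V" using stable_inV[OF stable_MM[OF stable_V, of zs]] by blast

lemma MM_M: "MM zs (M z x) = M z (MM zs x)"
proof (induction zs arbitrary: x)
  case (Cons w zs) then show ?case by (simp add: M_M[of w])
qed simp
lemma NN_N: "NN zs (N z x) = N z (NN zs x)"
proof (induction zs arbitrary: x)
  case (Cons w zs) then show ?case by (simp add: N_N[of w])
qed simp
lemma om_NN: "x \<in> V \<Longrightarrow> y \<in> V \<Longrightarrow> \<omega> (NN zs x, y) = \<omega> (x, MM zs y)"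
proof (induction zs arbitrary: y rule: rev_induct)
  case (snoc z zs)
  then show ?case
    using inv_N[OF omega stable_V stable_V NN_V[OF snoc.prems(1)] snoc.prems(2)] stable_M[OF stable_V]
    by (simp add: MM_M)
qed simp

lemma om_MM: "x \<in> V \<Longrightarrow> y \<in> V \<Longrightarrow> \<omega> (MM zs x, y) = \<omega> (x, NN zs y)"
  using om_NN[of y x zs] om_anti[of "MM zs x" y] om_anti[of x "NN zs y"] NN_V MM_V by simp

lemma nondeg': "x \<in> V \<Longrightarrow> (\<And>y. y \<in> V \<Longrightarrow> \<omega> (x, y) = 0) \<Longrightarrow> x = 0"
proof (rule nondeg)
  fix y assume a: "x \<in> V" "\<And>y. y \<in> V \<Longrightarrow> \<omega> (x, y) = 0" "y \<in> V"
  then show "\<omega> (y, x) = 0" using om_anti[OF a(1,3)] by simp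
qed

lemma dim_NN_MM: "fv.dim (NN zs ` V) = fv.dim (MM zs ` V)"
proof (rule antisym)
  show "fv.dim (NN zs ` V) \<le> fv.dim (MM zs ` V)"
    by (rule dim_range_adjoint_le[OF om subV fdV nondeg MM_lin MM_V NN_lin NN_V om_MM])
  show "fv.dim (MM zs ` V) \<le> fv.dim (NN zs ` V)"
    by (rule dim_range_adjoint_le[OF om subV fdV nondeg NN_lin NN_V MM_lin MM_V om_NN])
qed

lemma MM_image_eq_NN:
  assumes "stable W" "\<And>z. z \<in> set zs \<Longrightarrow> z * z = 1"
  shows "MM zs ` W = NN zs ` W"
  using assms(2)
proof (induction zs rule: rev_induct)
  case (snoc z zs)
  have "MM (zs @ [z]) ` W = M z ` (MM zs ` W)" by (simp add: image_comp o_def)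
  also have "\<dots> = M z ` (NN zs ` W)" using snoc by simp
  also have "\<dots> = N z ` (NN zs ` W)" by (rule M_image_eq[OF stable_NN[OF assms(1)]]) (use snoc in simp)
  finally show ?case by (simp add: image_comp o_def)
qed simp

text \<open>The operator \<open>MM ws \<circ> NN ws\<close> is self-adjoint, so that composing the form with it gives an alternating form.\<close>

lemma even_dim_NN_NN:
  assumes "\<And>z. z \<in> set zs \<Longrightarrow> z * z = 1" "even (fv.dim V)"
  shows "even (fv.dim (NN zs ` (NN zs ` V)))"
proof -
  let ?P = "\<lambda>x. MM zs (NN zs x)"
  have P: "flin ?P" by (rule flinI) (simp_all add: flin_add[OF NN_lin] flin_scale[OF NN_lin] flin_add[OF MM_lin] flin_scale[OF MM_lin])
  have PV: "?P x \<in> V" if "x \<in> V" for x using that NN_V MM_V by blast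
  define B where "B = (\<lambda>(x, y). if x \<in> V \<and> y \<in> V then \<omega> (?P x, y) else 0)"
  have F: "B \<in> forms V V"
    by (rule formsI) (auto simp: B_def flin_add[OF P] flin_scale[OF P] forms_add1[OF om PV PV] forms_add2[OF om PV] forms_scale1[OF om PV] forms_scale2[OF om PV] fv.subspace_add[OF subV] fv.subspace_scale[OF subV])
  have alt: "B (x, x) = 0" if x: "x \<in> V" for x
  proof -
    have "\<omega> (?P x, x) = \<omega> (NN zs x, NN zs x)" by (rule om_MM[OF NN_V[OF x] x])
    then show ?thesis using alt[OF NN_V[OF x]] x by (simp add: B_def)
  qed
  obtain k where k: "fv.dim V = fv.dim {x \<in> V. \<forall>y\<in>V. B (x, y) = 0} + 2 * k"
    using alternating_even_rank[OF F subV fdV alt] by blast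
  have "{x \<in> V. \<forall>y\<in>V. B (x, y) = 0} = {x \<in> V. ?P x = 0}"
    using nondeg'[OF PV] forms_zero1[OF om subV] by (auto simp: B_def)
  then have "even (fv.dim (?P ` V))"
    using k rank_nullity[OF P subV fdV] by simp
  moreover have "?P ` V = NN zs ` (NN zs ` V)"
    using MM_image_eq_NN[OF stable_NN[OF stable_V] assms(1), of zs zs] by (simp add: image_image)
  ultimately show ?thesis by simp
qed

text \<open>If none of the remaining factors annihilates an eigenvector for \<open>z\<close>, then \<open>z\<close> is no eigenvalue.\<close>

lemma NN_eigen: "N z x = 0 \<Longrightarrow> NN zs x = fscale (\<Prod>w\<leftarrow>zs. z - w) x"
proof (induction zs rule: rev_induct)
  case (snoc w zs)
  have "g x = fscale z x" using snoc.prems by (simp only: N_def right_minus_eq)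
  then have Nw: "N w x = fscale (z - w) x" by (simp add: N_def fv.scale_left_diff_distrib)
  have "NN (zs @ [w]) x = N w (NN zs x)" by simp
  also have "\<dots> = fscale (\<Prod>w\<leftarrow>zs. z - w) (fscale (z - w) x)"
    unfolding snoc.IH[OF snoc.prems] N_scale Nw ..
  finally show ?case by (simp add: mult.commute)
qed simp

lemma not_eigenvalue:
  assumes "NN zs x = 0" "z \<notin> set zs" "N z x = 0"
  shows "x = 0"
proof -
  have "(\<Prod>w\<leftarrow>zs. z - w) \<noteq> 0" using assms(2) by (induction zs) auto
  then show ?thesis using NN_eigen[OF assms(3), of zs] assms(1) by (metis fv.scale_eq_0_iff)
qed

lemma N_image_self:
  assumes W: "stable W" and "\<And>x. x \<in> W \<Longrightarrow> N z x = 0 \<Longrightarrow> x = 0"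
  shows "N z ` W = W"
proof (rule fd_dim_equal[OF _ stable_fd[OF W] N_image_subset[OF W]])
  show "fv.subspace (N z ` W)" by (rule stable_subspace[OF stable_N_image[OF W]])
  show "fv.dim W \<le> fv.dim (N z ` W)"
    by (rule dim_le_of_inj(2)[OF lin_N stable_subspace[OF W] assms(2) fd_image[OF lin_N stable_fd[OF W]] order_refl])
qed

text \<open>The rank drops along the powers of one factor decrease, as \<open>N z\<close> maps each quotient of successive images onto the next.\<close>

lemma dim_drop_antimono:
  assumes W: "stable W"
  shows "fv.dim (N z ` W) - fv.dim (N z ` (N z ` W)) \<le> fv.dim W - fv.dim (N z ` W)"
proof -
  note W1 = stable_N_image[OF W, of z]
  have "fv.dim {x \<in> N z ` W. N z x = 0} \<le> fv.dim {x \<in> W. N z x = 0}"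
    by (rule fd_dim_mono[OF fd_subset[OF stable_fd[OF W]]]) (use N_image_subset[OF W] in auto)
  then show ?thesis
    using rank_nullity[OF lin_N stable_subspace[OF W] stable_fd[OF W], of z]
      rank_nullity[OF lin_N stable_subspace[OF W1] stable_fd[OF W1], of z] by linarith
qed

text \<open>Along the powers of a factor with \<open>z = 1\<close> or \<open>z = - 1\<close> the sign \<open>e z\<^sup>j\<close> alternates, so symmetric and
alternating blocks take turns. Because the rank drops decrease, the linear terms telescope to at
least the last one.\<close>

lemma tw_forms_chain:
  assumes "stable W" "z * z = 1" "e * e = 1" "e * z ^ j = 1"
    and r: "\<And>i. r i = fv.dim ((N z ^^ i) ` W) - fv.dim ((N z ^^ Suc i) ` W)"
  shows "(\<Sum>i\<le>2 * k. r i * r i) + r (2 * k) + 2 * fv.dim (tw_forms (- z * e) (j + 2 * k + 1) ((N z ^^ (2 * k + 1)) ` W))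
    \<le> 2 * fv.dim (tw_forms e j W)"
  using assms(1,4) r
proof (induction k arbitrary: W j r)
  case 0
  have p0: "(N z ^^ 0) ` W = W" "(N z ^^ Suc 0) ` W = N z ` W" by (simp_all add: image_comp)
  have "r 0 = fv.dim W - fv.dim (N z ` W)" by (simp only: 0(3)[of 0] p0)
  from tw_forms_step_plus[OF 0(1) assms(2,3) two 0(2) this]
  have "r 0 * r 0 + r 0 + 2 * fv.dim (tw_forms (- z * e) (Suc j) (N z ` W)) \<le> 2 * fv.dim (tw_forms e j W)" .
  moreover have "(\<Sum>i\<le>2 * 0. r i * r i) = r 0 * r 0" "r (2 * 0) = r 0" "j + 2 * 0 + 1 = Suc j" "(N z ^^ (2 * 0 + 1)) ` W = N z ` W"
    by simp_all
  ultimately show ?case by (simp only:)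
next
  case (Suc k)
  let ?W1 = "N z ` W" let ?W2 = "N z ` ?W1"
  note W = Suc.prems(1) note W1 = stable_N_image[OF W, of z] note W2 = stable_N_image[OF W1, of z]
  have e1: "- z * e * (- z * e) = 1" using assms(2,3) by (simp add: algebra_simps)
  have zz: "- z * (- z * e) = e" using assms(2) by (simp add: mult.assoc[symmetric])
  have img: "(N z ^^ i) ` ?W2 = (N z ^^ Suc (Suc i)) ` W" for i
    by (simp add: image_image funpow_swap1)
  have ez: "e * z ^ (j + 2) = 1" using Suc.prems(2) assms(2) by (simp add: power_add power2_eq_square mult.assoc[symmetric])
  have IH: "(\<Sum>i\<le>2 * k. r (Suc (Suc i)) * r (Suc (Suc i))) + r (Suc (Suc (2 * k)))
      + 2 * fv.dim (tw_forms (- z * e) (j + 2 + 2 * k + 1) ((N z ^^ (2 * k + 1)) ` ?W2)) \<le> 2 * fv.dim (tw_forms e (j + 2) ?W2)"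
    by (rule Suc.IH[OF W2 ez, of "\<lambda>i. r (Suc (Suc i))"]) (simp only: img Suc.prems(3))
  have p0: "(N z ^^ 0) ` W = W" "(N z ^^ Suc 0) ` W = ?W1" "(N z ^^ 1) ` W = ?W1" "(N z ^^ Suc 1) ` W = ?W2"
    by (simp_all add: image_image)
  have r0: "r 0 = fv.dim W - fv.dim ?W1" and r1: "r 1 = fv.dim ?W1 - fv.dim ?W2"
    by (simp_all only: Suc.prems(3) p0)
  have "r 1 \<le> r 0" unfolding r0 r1 by (rule dim_drop_antimono[OF W])
  moreover have "r 0 * r 0 + r 0 + 2 * fv.dim (tw_forms (- z * e) (Suc j) ?W1) \<le> 2 * fv.dim (tw_forms e j W)"
    by (rule tw_forms_step_plus[OF W assms(2,3) two Suc.prems(2) r0])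
  moreover have "r 1 * r 1 + 2 * fv.dim (tw_forms e (Suc (Suc j)) ?W2) \<le> 2 * fv.dim (tw_forms (- z * e) (Suc j) ?W1) + r 1"
    using tw_forms_step_minus[OF W1 assms(2) e1 two r1, of "Suc j"] unfolding zz .
  moreover have "(\<Sum>i\<le>2 * Suc k. r i * r i) = r 0 * r 0 + (r 1 * r 1 + (\<Sum>i\<le>2 * k. r (Suc (Suc i)) * r (Suc (Suc i))))"
    by (simp add: sum.atMost_Suc_shift del: sum.atMost_Suc)
  moreover have "(N z ^^ (2 * k + 1)) ` ?W2 = (N z ^^ (2 * Suc k + 1)) ` W"
    unfolding img by simp
  moreover have "j + 2 + 2 * k + 1 = j + 2 * Suc k + 1" "j + 2 = Suc (Suc j)" "r (Suc (Suc (2 * k))) = r (2 * Suc k)" by simp_all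
  moreover note IH
  ultimately show ?case by (simp only:)
qed

end

section \<open>Operators of finite order and Scott's inequality\<close>

lemma sum_lessThan_add: "(\<Sum>i<m + (n::nat). f i) = (\<Sum>i<m. f i) + (\<Sum>i<n. f (m + i) :: 'b::comm_monoid_add)"
  by (induction n) (simp_all add: add.assoc)

context symplectic_pair
begin

lemma NN_replicate: "NN (replicate n z) = N z ^^ n"
  by (induction n) (auto simp: fun_eq_iff funpow_swap1)

lemma NN_comm: "NN us (NN ws x) = NN ws (NN us x)"
  by (induction us arbitrary: x) (simp_all add: NN_N)

text \<open>The dimension that is left after applying the factors \<open>g - z\<close> for the \<open>z\<close> in a list.\<close>

definition D :: "'k list \<Rightarrow> nat" where "D zs = fv.dim (NN zs ` V)"

lemma NN_snoc_image: "NN (us @ [w]) ` W = N w ` (NN us ` W)" by (simp add: image_image)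
lemma MM_snoc_image: "MM (us @ [w]) ` W = M w ` (MM us ` W)" by (simp add: image_image)
lemma NN_append_image: "NN (us @ ws) ` W = NN ws ` (NN us ` W)" by (simp add: image_image)

text \<open>Each linear factor contributes a square block of invariant forms.\<close>

lemma inv_forms_chain:
  "(\<Sum>i<length ws. (D (us @ take i ws) - D (us @ take (Suc i) ws)) * (D (us @ take i ws) - D (us @ take (Suc i) ws)))
    \<le> fv.dim (inv_forms (NN us ` V) (MM us ` V))"
proof (induction ws arbitrary: us)
  case (Cons w ws)
  let ?r = "\<lambda>us ws i. D (us @ take i ws) - D (us @ take (Suc i) ws)"
  have "(\<Sum>i<length (w # ws). ?r us (w # ws) i * ?r us (w # ws) i)
      = (D us - D (us @ [w])) * (D us - D (us @ [w])) + (\<Sum>i<length ws. ?r (us @ [w]) ws i * ?r (us @ [w]) ws i)"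
    by (simp add: sum.lessThan_Suc_shift del: sum.lessThan_Suc)
  also have "\<dots> \<le> (D us - D (us @ [w])) * (D us - D (us @ [w])) + fv.dim (inv_forms (NN (us @ [w]) ` V) (MM (us @ [w]) ` V))"
    using Cons[of "us @ [w]"] by (rule add_left_mono)
  also have "\<dots> \<le> fv.dim (inv_forms (NN us ` V) (MM us ` V))"
    using inv_forms_step[OF stable_NN[OF stable_V] stable_MM[OF stable_V], where z = w]
    unfolding D_def NN_snoc_image[symmetric] MM_snoc_image[symmetric] dim_NN_MM[symmetric] .
  finally show ?case .
qed simp

text \<open>The factors for the eigenvalues \<open>1\<close> and \<open>- 1\<close> are removed first, each by a chain of odd length; on the rest \<open>g - h\<close> is
injective and half of all invariant forms count. The parity statements hold because the rank of an alternating form is even.\<close>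

lemma tw_forms_bound_of_factors:
  assumes zs: "zs = replicate \<mu> 1 @ (if ev then replicate \<mu> (- 1) else []) @ ws"
    and mu: "\<mu> = 2 * k + 1"
    and zero: "\<And>x. x \<in> V \<Longrightarrow> NN zs x = 0"
    and ws: "1 \<notin> set ws" "- 1 \<notin> set ws"
    and even: "even (fv.dim V)"
  shows "\<exists>r. (\<Sum>i<length zs. r i) = fv.dim V
    \<and> (\<Sum>i<length zs. r i * r i) + r (\<mu> - 1) + (if ev then r (2 * \<mu> - 1) else 0) \<le> 2 * fv.dim (tw_forms 1 0 V)
    \<and> even (\<Sum>i<\<mu>. r i) \<and> (ev \<longrightarrow> even (\<Sum>i<2 * \<mu>. r i))"
proof -
  let ?d = "\<lambda>i. D (take i zs)"
  define r where "r i = ?d i - ?d (Suc i)" for i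
  define us where "us = replicate \<mu> (1::'k)"
  define vs where "vs = (if ev then us @ replicate \<mu> (- 1) else us)"
  have zs': "zs = vs @ ws" by (simp add: zs vs_def us_def)
  have one: "1 \<noteq> (- 1 :: 'k)" using two by (metis add.right_inverse one_add_one)
  have mono: "?d (Suc i) \<le> ?d i" for i
  proof (cases "i < length zs")
    case True
    then show ?thesis
      unfolding D_def take_Suc_conv_app_nth[OF True] NN_snoc_image
      by (intro fd_dim_mono[OF stable_fd] N_image_subset stable_NN stable_V)
  qed simp
  have tele: "(\<Sum>i<n. r i) + ?d n = fv.dim V" for n
  proof (induction n)
    case 0
    have "NN [] ` V = V" by simp
    then show ?case by (simp only: D_def take_0 lessThan_0 sum.empty add_0)
  next
    case (Suc n) then show ?case using mono[of n] by (simp add: r_def)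
  qed
  have "NN zs ` V \<subseteq> fv.span {}" using zero by auto
  then have "D zs = 0" unfolding D_def using fv.dim_le_card[of "NN zs ` V" "{}"] by simp
  then have total: "(\<Sum>i<length zs. r i) = fv.dim V" using tele[of "length zs"] by simp
  have sq1: "z * z = 1" if "z \<in> set vs" for z using that by (auto simp: vs_def us_def split: if_splits)
  \<comment> \<open>the eigenvalue 1\<close>
  let ?W = "NN us ` V"
  have sW: "stable ?W" by (rule stable_NN[OF stable_V])
  have tk: "take i zs = replicate i 1" if "i \<le> \<mu>" for i using that by (simp add: zs)
  have r1: "r i = fv.dim ((N 1 ^^ i) ` V) - fv.dim ((N 1 ^^ Suc i) ` V)" if "i < \<mu>" for i
    unfolding r_def D_def tk[OF less_imp_le[OF that]] tk[OF Suc_leI[OF that]] NN_replicate ..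
  have A: "(\<Sum>i<\<mu>. r i * r i) + r (\<mu> - 1) + 2 * fv.dim (tw_forms (- 1) \<mu> ?W) \<le> 2 * fv.dim (tw_forms 1 0 V)"
  proof -
    let ?f = "\<lambda>i. fv.dim ((N 1 ^^ i) ` V) - fv.dim ((N 1 ^^ Suc i) ` V)"
    have "(\<Sum>i\<le>2 * k. ?f i * ?f i) + ?f (2 * k) + 2 * fv.dim (tw_forms (- 1 * 1) (0 + 2 * k + 1) ((N 1 ^^ (2 * k + 1)) ` V)) \<le> 2 * fv.dim (tw_forms 1 0 V)"
      by (rule tw_forms_chain[OF stable_V]) simp_all
    moreover have "(\<Sum>i\<le>2 * k. ?f i * ?f i) = (\<Sum>i<\<mu>. r i * r i)"
      by (rule sum.cong) (use r1 in \<open>auto simp: mu\<close>)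
    moreover have "?f (2 * k) = r (\<mu> - 1)" using r1[of "\<mu> - 1"] by (simp add: mu)
    moreover have "- 1 * 1 = (- 1 :: 'k)" "0 + 2 * k + 1 = \<mu>" "(N 1 ^^ (2 * k + 1)) ` V = ?W"
      by (simp_all add: mu us_def NN_replicate del: replicate_Suc)
    ultimately show ?thesis by (simp only:)
  qed
  have dmu: "?d \<mu> = fv.dim ?W" by (simp add: D_def zs us_def)
  have inj1: "x = 0" if x: "x \<in> ?W" "N 1 x = 0" for x
  proof (rule not_eigenvalue[OF _ _ x(2)])
    let ?rest = "(if ev then replicate \<mu> (- 1) else []) @ ws"
    show "1 \<notin> set ?rest" using ws one by auto
    obtain v where "v \<in> V" "x = NN us v" using x(1) by blast
    then show "NN ?rest x = 0" using zero[of v] by (simp add: zs us_def)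
  qed
  have e1: "even (?d \<mu>)"
  proof -
    let ?us = "replicate (Suc k) (1::'k)"
    have "NN ?us ` (NN ?us ` V) = N 1 ` ?W"
      unfolding NN_append_image[symmetric] replicate_add[symmetric] us_def
      by (simp only: NN_snoc_image[symmetric] mu replicate_append_same[symmetric] replicate_Suc[symmetric]) (simp add: mult_2 del: replicate_Suc)
    also have "\<dots> = ?W" by (rule N_image_self[OF sW inj1])
    finally have "NN ?us ` (NN ?us ` V) = ?W" .
    moreover have "even (fv.dim (NN ?us ` (NN ?us ` V)))" by (rule even_dim_NN_NN[OF _ even]) auto
    ultimately show ?thesis by (simp only: dmu)
  qed
  have p1: "even (\<Sum>i<\<mu>. r i)" using tele[of \<mu>] e1 even by (metis even_add)
  \<comment> \<open>the remaining eigenvalues\<close>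
  let ?U = "NN vs ` V"
  have sU: "stable ?U" by (rule stable_NN[OF stable_V])
  have ws0: "NN ws x = 0" if "x \<in> ?U" for x using that zero by (auto simp: zs')
  have half: "x = 0" if x: "x \<in> ?U" and gh: "g x = h x" for x
  proof -
    have xV: "x \<in> V" by (rule stable_inV[OF sU x])
    have gg: "g (g x) = x" using arg_cong[OF gh, of g] inverse_pair.gh[OF inverse_pair_axioms xV] by simp
    have a: "x + g x \<in> ?U" "x - g x \<in> ?U"
      using x stable_g[OF sU] fv.subspace_add[OF stable_subspace[OF sU]] fv.subspace_diff[OF stable_subspace[OF sU]] by auto
    have "N 1 (x + g x) = 0" "N (- 1) (x - g x) = 0"
      using gg by (simp_all add: N_def flin_simps[OF lin_g] fun_eq_iff)
    then have "x + g x = 0" "x - g x = 0"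
      using not_eigenvalue[OF ws0[OF a(1)] ws(1)] not_eigenvalue[OF ws0[OF a(2)] ws(2)] by blast+
    then have "x i + x i = 0" for i by (metis add_eq_0_iff diff_eq_diff_eq eq_neg_iff_add_eq_0 plus_fun_apply right_minus_eq zero_fun_apply)
    then have "2 * x i = 0" for i by (simp only: mult_2)
    then show "x = 0" using two by (auto simp: fun_eq_iff)
  qed
  have C: "(\<Sum>i<length ws. r (length vs + i) * r (length vs + i)) \<le> 2 * fv.dim (tw_forms e j ?U)" if "e * e = 1" for e j
  proof -
    have "(\<Sum>i<length ws. r (length vs + i) * r (length vs + i))
        = (\<Sum>i<length ws. (D (vs @ take i ws) - D (vs @ take (Suc i) ws)) * (D (vs @ take i ws) - D (vs @ take (Suc i) ws)))"
      by (simp add: r_def zs')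
    also have "\<dots> \<le> fv.dim (inv_forms (NN vs ` V) (MM vs ` V))" by (rule inv_forms_chain)
    also have "MM vs ` V = ?U" by (rule MM_image_eq_NN[OF stable_V sq1])
    also have "fv.dim (inv_forms ?U ?U) \<le> 2 * fv.dim (tw_forms e j ?U)" by (rule tw_forms_half[OF sU that half])
    finally show ?thesis .
  qed
  have len: "(\<Sum>i<length zs. r i * r i) = (\<Sum>i<length vs. r i * r i) + (\<Sum>i<length ws. r (length vs + i) * r (length vs + i))"
    by (simp add: zs' sum_lessThan_add)
  show ?thesis
  proof (cases ev)
    case False
    then have vs: "vs = us" "length vs = \<mu>" by (simp_all add: vs_def us_def)
    have "(\<Sum>i<length zs. r i * r i) + r (\<mu> - 1) \<le> 2 * fv.dim (tw_forms 1 0 V)"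
      using A C[of "- 1" \<mu>] len vs by simp
    then show ?thesis using total p1 False by (intro exI[of _ r]) simp
  next
    case True
    then have vs: "vs = us @ replicate \<mu> (- 1)" "length vs = \<mu> + \<mu>" by (simp_all add: vs_def us_def)
    have tk2: "take (\<mu> + i) zs = us @ replicate i (- 1)" if "i \<le> \<mu>" for i
      using that True by (simp add: zs us_def)
    have r2: "r (\<mu> + i) = fv.dim ((N (- 1) ^^ i) ` ?W) - fv.dim ((N (- 1) ^^ Suc i) ` ?W)" if "i < \<mu>" for i
      unfolding r_def D_def tk2[OF less_imp_le[OF that]] add_Suc_right[symmetric] tk2[OF Suc_leI[OF that]] NN_append_image NN_replicate ..
    have U: "?U = (N (- 1) ^^ \<mu>) ` ?W" unfolding vs NN_append_image NN_replicate ..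
    have B: "(\<Sum>i<\<mu>. r (\<mu> + i) * r (\<mu> + i)) + r (\<mu> + (\<mu> - 1)) + 2 * fv.dim (tw_forms (- 1) (\<mu> + \<mu>) ?U) \<le> 2 * fv.dim (tw_forms (- 1) \<mu> ?W)"
    proof -
      let ?f = "\<lambda>i. fv.dim ((N (- 1) ^^ i) ` ?W) - fv.dim ((N (- 1) ^^ Suc i) ` ?W)"
      have "(\<Sum>i\<le>2 * k. ?f i * ?f i) + ?f (2 * k) + 2 * fv.dim (tw_forms (- (- 1) * - 1) (\<mu> + 2 * k + 1) ((N (- 1) ^^ (2 * k + 1)) ` ?W)) \<le> 2 * fv.dim (tw_forms (- 1) \<mu> ?W)"
        by (rule tw_forms_chain[OF sW]) (simp_all add: mu)
      moreover have "(\<Sum>i\<le>2 * k. ?f i * ?f i) = (\<Sum>i<\<mu>. r (\<mu> + i) * r (\<mu> + i))"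
        by (rule sum.cong) (use r2 in \<open>auto simp: mu\<close>)
      moreover have "?f (2 * k) = r (\<mu> + (\<mu> - 1))" using r2[of "\<mu> - 1"] by (simp add: mu)
      moreover have "- (- 1) * - 1 = (- 1 :: 'k)" "\<mu> + 2 * k + 1 = \<mu> + \<mu>" "(N (- 1) ^^ (2 * k + 1)) ` ?W = ?U"
        unfolding U by (simp_all add: mu)
      ultimately show ?thesis by (simp only:)
    qed
    have "(\<Sum>i<length zs. r i * r i) + r (\<mu> - 1) + r (2 * \<mu> - 1) \<le> 2 * fv.dim (tw_forms 1 0 V)"
    proof -
      have i: "\<mu> + (\<mu> - 1) = 2 * \<mu> - 1" using mu by simp
      have "(\<Sum>i<length vs. r i * r i) = (\<Sum>i<\<mu>. r i * r i) + (\<Sum>i<\<mu>. r (\<mu> + i) * r (\<mu> + i))"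
        unfolding vs(2) by (rule sum_lessThan_add)
      moreover have "(- 1) * (- 1) = (1::'k)" by simp
      note C[OF this, of "\<mu> + \<mu>"]
      ultimately show ?thesis using A B len unfolding i by linarith
    qed
    moreover have "even (\<Sum>i<2 * \<mu>. r i)"
    proof -
      let ?us = "replicate (Suc k) (1::'k)" and ?vs = "replicate (Suc k) (- 1::'k)"
      have Uinj: "x = 0" if "x \<in> ?U" "N (- 1) x = 0" for x
        using not_eigenvalue[OF ws0[OF that(1)] ws(2) that(2)] .
      have f: "N z ^^ Suc k = NN (replicate (Suc k) z)" for z by (simp only: NN_replicate)
      have sk: "Suc k + Suc k = Suc \<mu>" by (simp add: mu)
      have "NN (?us @ ?vs) (NN (?us @ ?vs) x) = NN ?vs (NN ?vs (NN ?us (NN ?us x)))" for x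
        unfolding fold_append o_apply NN_comm[of ?us ?vs "NN ?us x"] ..
      then have "NN (?us @ ?vs) ` (NN (?us @ ?vs) ` V) = NN ?vs ` (NN ?vs ` (NN ?us ` (NN ?us ` V)))"
        by (simp only: image_image)
      also have "NN ?us ` (NN ?us ` V) = NN (replicate (Suc \<mu>) 1) ` V"
        unfolding NN_append_image[symmetric] replicate_add[symmetric] sk ..
      also have "\<dots> = N 1 ` ?W" unfolding us_def NN_snoc_image[symmetric] replicate_append_same by simp
      also have "\<dots> = ?W" by (rule N_image_self[OF sW inj1])
      also have "NN ?vs ` (NN ?vs ` ?W) = NN (replicate (Suc \<mu>) (- 1)) ` ?W"
        by (simp only: NN_append_image[symmetric] append_assoc replicate_add[symmetric] sk)
      also have "\<dots> = N (- 1) ` ?U" unfolding vs NN_append_image NN_snoc_image[symmetric] replicate_append_same by simp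
      also have "\<dots> = ?U" by (rule N_image_self[OF sU Uinj])
      finally have "NN (?us @ ?vs) ` (NN (?us @ ?vs) ` V) = ?U" .
      moreover have "even (fv.dim (NN (?us @ ?vs) ` (NN (?us @ ?vs) ` V)))" by (rule even_dim_NN_NN[OF _ even]) auto
      ultimately have "even (fv.dim ?U)" by (simp only:)
      moreover have "?d (2 * \<mu>) = fv.dim ?U" using tk2[of \<mu>] by (simp add: D_def vs mult_2)
      ultimately show ?thesis using tele[of "2 * \<mu>"] even by (metis even_add)
    qed
    ultimately show ?thesis using total p1 True by (intro exI[of _ r]) simp
  qed
qed

end

definition polyop :: "(('a \<Rightarrow> 'k::field) \<Rightarrow> 'a \<Rightarrow> 'k) \<Rightarrow> 'k poly \<Rightarrow> ('a \<Rightarrow> 'k) \<Rightarrow> 'a \<Rightarrow> 'k" where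
  "polyop g p = fold_coeffs (\<lambda>c T v. fscale c v + g (T v)) p (\<lambda>v. 0)"

context
  fixes g :: "('a \<Rightarrow> 'k::field) \<Rightarrow> 'a \<Rightarrow> 'k"
  assumes g: "flin g"
begin

lemma polyop_0 [simp]: "polyop g 0 v = 0"
  by (simp add: polyop_def)

lemma polyop_pCons: "polyop g (pCons c p) v = fscale c v + g (polyop g p v)"
  by (cases "p = 0 \<and> c = 0") (auto simp: polyop_def flin_0[OF g])

lemma polyop_add: "polyop g (p + q) v = polyop g p v + polyop g q v"
proof (induction p q rule: poly_induct2)
  case (pCons a p b q)
  then show ?case
    by (simp only: add_pCons polyop_pCons flin_add[OF g] fv.scale_left_distrib add.assoc add.left_commute)
qed simp

lemma polyop_smult: "polyop g (smult c p) v = fscale c (polyop g p v)"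
proof (induction p)
  case (pCons a p)
  then show ?case
    by (simp only: smult_pCons polyop_pCons flin_scale[OF g] fv.scale_right_distrib fv.scale_scale)
qed simp

lemma polyop_linear_factor: "polyop g ([:- z, 1:] * p) v = g (polyop g p v) - fscale z (polyop g p v)"
proof -
  have "[:- z, 1:] * p = smult (- z) p + pCons 0 p" by simp
  then have "polyop g ([:- z, 1:] * p) v = fscale (- z) (polyop g p v) + g (polyop g p v)"
    by (simp only: polyop_add polyop_smult polyop_pCons fv.scale_zero_left add_0)
  then show ?thesis by (simp only: fv.scale_minus_left minus_add_cancel uminus_add_conv_diff)
qed

lemma polyop_X_power: "polyop g (Polynomial.monom 1 n) v = (g ^^ n) v"
  by (induction n) (simp_all add: polyop_pCons monom_0 monom_Suc flin_0[OF g])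

end

text \<open>In characteristic \<open>p\<close> one has \<open>X\<^sup>a - 1 = (X\<^sup>b - 1)\<^sup>\<mu>\<close>, where \<open>\<mu>\<close> is the \<open>p\<close>-part of \<open>a\<close> and \<open>b = a / \<mu>\<close>. As \<open>p\<close> is odd, so is
\<open>\<mu>\<close>, and \<open>X\<^sup>b - 1\<close> has simple roots, among which \<open>- 1\<close> occurs exactly for even \<open>a\<close>.\<close>

lemma unity_roots_list:
  fixes a :: nat
  assumes "prime CHAR('k::alg_closed_field)" "CHAR('k) \<noteq> 2" "a > 0"
  obtains \<mu> ws where "odd \<mu>" "\<mu> dvd a"
    and "Polynomial.monom 1 a - 1 = (\<Prod>z\<leftarrow>replicate \<mu> 1 @ (if even a then replicate \<mu> (- 1) else []) @ ws. [:- z, 1 :: 'k:])"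
    and "length (replicate \<mu> 1 @ (if even a then replicate \<mu> (- 1) else []) @ ws) = a"
    and "1 \<notin> set ws" "- 1 \<notin> set ws"
proof -
  let ?p = "CHAR('k)"
  obtain m where m: "a = ?p ^ multiplicity ?p a * m" "\<not> ?p dvd m"
    using multiplicity_decompose'[of a ?p] assms(1,3) by (metis bot_nat_0.not_eq_extremum not_prime_unit)
  define \<mu> where "\<mu> = ?p ^ multiplicity ?p a"
  have oddp: "odd ?p" using prime_odd_nat[OF assms(1)] prime_ge_2_nat[OF assms(1)] assms(2) by linarith
  then have oddmu: "odd \<mu>" by (simp add: \<mu>_def)
  have am: "a = \<mu> * m" using m(1) by (simp add: \<mu>_def)
  have m0: "m > 0" using assms(3) am by (cases m) auto
  have mk: "(of_nat m :: 'k) \<noteq> 0" using m(2) by (simp add: of_nat_eq_0_iff_char_dvd)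
  let ?q = "Polynomial.monom 1 m - 1 :: 'k poly"
  have cq: "Polynomial.coeff ?q m = 1" using m0 by simp
  have dq: "degree ?q = m"
  proof (rule antisym)
    show "degree ?q \<le> m" by (rule degree_diff_le) (simp_all add: degree_monom_le)
    show "m \<le> degree ?q" by (rule le_degree) (simp only: cq one_neq_zero not_False_eq_True)
  qed
  have q0: "?q \<noteq> 0" using dq m0 by auto
  obtain A where A: "size A = m" "?q = (\<Prod>x\<in>#A. [:-x, 1:])"
    using alg_closed_imp_factorization[OF q0] dq cq by auto
  have pq: "poly ?q x = x ^ m - 1" for x by (simp add: poly_monom)
  have root: "x \<in># A \<longleftrightarrow> x ^ m = 1" for x
  proof -
    have "poly ?q x = (\<Prod>y\<in>#A. x - y)" unfolding A(2) poly_prod_mset image_mset.compositionality by (simp add: o_def)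
    then have "poly ?q x = 0 \<longleftrightarrow> x \<in># A" by auto
    then show ?thesis unfolding pq by auto
  qed
  have simple: "x \<notin># B" if "A = add_mset x B" for x B
  proof -
    have xm: "x ^ m = 1" using root[of x] that by simp
    have "?q = [:-x, 1:] * (\<Prod>y\<in>#B. [:-y, 1:])" unfolding A(2) that by simp
    then have "pderiv ?q = pderiv ([:-x, 1:] * (\<Prod>y\<in>#B. [:-y, 1:]))" by (simp only:)
    also have "poly \<dots> x = poly (\<Prod>y\<in>#B. [:-y, 1:]) x"
      unfolding pderiv_mult by (simp add: pderiv_pCons del: mult_pCons_left)
    finally have "poly (pderiv ?q) x = poly (\<Prod>y\<in>#B. [:-y, 1:]) x" .
    moreover have "poly (pderiv ?q) x = of_nat m * x ^ (m - 1)"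
      by (simp add: pderiv_diff pderiv_monom poly_monom)
    moreover have "x ^ (m - 1) \<noteq> 0" using xm m0 by (metis power_not_zero power_0_left zero_neq_one not_gr_zero)
    ultimately have "poly (\<Prod>y\<in>#B. [:-y, 1:]) x \<noteq> 0" using mk by (metis mult_eq_0_iff)
    then show ?thesis unfolding poly_prod_mset image_mset.compositionality by (auto simp: o_def)
  qed
  have two: "(2::'k) \<noteq> 0"
    using oddp of_nat_eq_0_iff_char_dvd[of 2, where 'a='k] assms(1)
    by (metis assms(2) of_nat_numeral prime_nat_iff primes_dvd_imp_eq two_is_prime_nat)
  then have one: "1 \<noteq> (- 1 :: 'k)" by (metis add.right_inverse one_add_one)
  obtain B where B: "A = add_mset 1 B" using root[of 1] by (metis mset_add power_one)
  have 1: "1 \<notin># B" using simple[OF B] .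
  have eva: "even a \<longleftrightarrow> even m" using am oddmu by simp
  have "\<exists>C. 1 \<notin># C \<and> - 1 \<notin># C \<and> A = add_mset 1 ((if even a then {#- 1#} else {#}) + C)"
  proof (cases "even a")
    case True
    then have "(- 1 :: 'k) \<in># A" using root[of "- 1"] eva by simp
    then have "- 1 \<in># B" using B one by simp
    then obtain C where C: "B = add_mset (- 1) C" by (metis mset_add)
    have "- 1 \<notin># C" using simple[of "- 1" "add_mset 1 C"] B C by (simp add: add_mset_commute)
    then show ?thesis using 1 B C True by (intro exI[of _ C]) simp
  next
    case False
    then have "- 1 \<notin># B" using root[of "- 1"] eva B one by simp
    then show ?thesis using 1 B False by (intro exI[of _ B]) simp
  qed
  then obtain C where C: "1 \<notin># C" "- 1 \<notin># C" "A = add_mset 1 ((if even a then {#- 1#} else {#}) + C)" by blast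
  obtain cs where cs: "mset cs = C" using ex_mset by blast
  define ws where "ws = concat (replicate \<mu> cs)"
  let ?f = "\<lambda>z. [:- z, 1 :: 'k:]"
  have mu0: "\<mu> > 0" using oddmu by (cases \<mu>) auto
  have pm: "prod_list (map ?f cs) = (\<Prod>x\<in>#C. ?f x)" unfolding cs[symmetric] by (simp flip: prod_mset_prod_list mset_map)
  have pr: "prod_list (map ?f (replicate n x)) = ?f x ^ n" for n x by (induction n) simp_all
  have pc: "prod_list (map ?f (concat (replicate n cs))) = prod_list (map ?f cs) ^ n" for n by (induction n) simp_all
  have "(\<Prod>z\<leftarrow>replicate \<mu> 1 @ (if even a then replicate \<mu> (- 1) else []) @ ws. ?f z) = ?q ^ \<mu>"
    unfolding A(2) C(3) ws_def using pm by (simp add: pr pc power_mult_distrib del: mult_pCons_left mult_pCons_right)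
  also have "?q ^ \<mu> = Polynomial.monom 1 a - 1"
  proof -
    have "(Polynomial.monom 1 m + (- 1)) ^ \<mu> = Polynomial.monom 1 m ^ \<mu> + (- 1 :: 'k poly) ^ \<mu>"
      by (rule freshmans_dream') (simp_all add: assms(1) \<mu>_def)
    also have "Polynomial.monom 1 m ^ \<mu> = (Polynomial.monom 1 a :: 'k poly)" by (simp add: monom_power am mult.commute)
    also have "(- 1 :: 'k poly) ^ \<mu> = - 1" using oddmu by simp
    finally show ?thesis by simp
  qed
  finally have prod: "Polynomial.monom 1 a - 1 = (\<Prod>z\<leftarrow>replicate \<mu> 1 @ (if even a then replicate \<mu> (- 1) else []) @ ws. ?f z)" ..
  have lc: "length (concat (replicate n cs)) = n * length cs" for n by (induction n) simp_all
  have "length (replicate \<mu> (1::'k) @ (if even a then replicate \<mu> (- 1) else []) @ ws) = \<mu> * size A"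
    unfolding C(3) ws_def cs[symmetric] by (simp add: lc algebra_simps)
  then have len: "length (replicate \<mu> (1::'k) @ (if even a then replicate \<mu> (- 1) else []) @ ws) = a" using A(1) am by simp
  have "1 \<notin> set ws" "- 1 \<notin> set ws" using C(1,2) cs by (auto simp: ws_def)
  then show thesis using that[OF oddmu _ prod len] am by simp
qed

text \<open>The number \<open>r i\<close> is the rank drop at the \<open>i\<close>-th linear factor of \<open>X\<^sup>a - 1\<close>, ordered so that the factors
\<open>X - 1\<close> come first and the factors \<open>X + 1\<close> next.\<close>

lemma tw_forms_bound:
  fixes g h :: "('a \<Rightarrow> 'k::alg_closed_field) \<Rightarrow> 'a \<Rightarrow> 'k"
  assumes "symplectic_pair g h V \<omega>" "prime CHAR('k)" "CHAR('k) \<noteq> 2" "a > 0" "even (fv.dim V)"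
    and ga: "\<And>x. x \<in> V \<Longrightarrow> (g ^^ a) x = x"
  shows "\<exists>\<mu> r. odd \<mu> \<and> \<mu> dvd a \<and> (\<Sum>i<a. r i) = fv.dim V
    \<and> (\<Sum>i<a. r i * r i) + r (\<mu> - 1) + (if even a then r (2 * \<mu> - 1) else 0) \<le> 2 * fv.dim (inverse_pair.tw_forms g h 1 0 V)
    \<and> even (\<Sum>i<\<mu>. r i) \<and> (even a \<longrightarrow> even (\<Sum>i<2 * \<mu>. r i))"
proof -
  interpret symplectic_pair g h V \<omega> by (rule assms(1))
  obtain \<mu> ws where w: "odd \<mu>" "\<mu> dvd a"
    "Polynomial.monom 1 a - 1 = (\<Prod>z\<leftarrow>replicate \<mu> 1 @ (if even a then replicate \<mu> (- 1) else []) @ ws. [:- z, 1 :: 'k:])"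
    "length (replicate \<mu> 1 @ (if even a then replicate \<mu> (- 1) else []) @ ws) = a"
    "1 \<notin> set ws" "- 1 \<notin> set ws"
    by (rule unity_roots_list[OF assms(2,3,4)])
  let ?zs = "replicate \<mu> 1 @ (if even a then replicate \<mu> (- 1) else []) @ ws"
  have NNp: "NN zs v = polyop g (\<Prod>z\<leftarrow>rev zs. [:- z, 1:]) v" for zs v
  proof (induction zs rule: rev_induct)
    case Nil show ?case by (simp add: one_pCons polyop_pCons[OF lin_g] polyop_0[OF lin_g] flin_0[OF lin_g])
  next
    case (snoc z zs)
    then show ?case using polyop_linear_factor[OF lin_g] by (simp add: N_def)
  qed
  have pr: "(\<Prod>z\<leftarrow>rev zs. [:- z, 1:]) = (\<Prod>z\<leftarrow>zs. [:- z, 1 :: 'k:])" for zs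
    by (induction zs) (simp_all add: mult.commute)
  have "NN ?zs x = 0" if "x \<in> V" for x
  proof -
    have "NN ?zs x = polyop g (Polynomial.monom 1 a + smult (- 1) 1) x"
      unfolding NNp pr w(3)[symmetric] by (simp only: smult_minus_left smult_1_left diff_conv_add_uminus)
    also have "\<dots> = (g ^^ a) x + fscale (- 1) (polyop g 1 x)"
      by (simp only: polyop_add[OF lin_g] polyop_smult[OF lin_g] polyop_X_power[OF lin_g])
    also have "polyop g 1 x = x" by (simp add: one_pCons polyop_pCons[OF lin_g] polyop_0[OF lin_g] flin_0[OF lin_g])
    finally show ?thesis unfolding ga[OF that] by (simp only: fv.scale_minus_left fv.scale_one add.right_inverse)
  qed
  moreover obtain k where "\<mu> = 2 * k + 1" using w(1) by (elim oddE)
  ultimately have "\<exists>r. (\<Sum>i<length ?zs. r i) = fv.dim V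
    \<and> (\<Sum>i<length ?zs. r i * r i) + r (\<mu> - 1) + (if even a then r (2 * \<mu> - 1) else 0) \<le> 2 * fv.dim (tw_forms 1 0 V)
    \<and> even (\<Sum>i<\<mu>. r i) \<and> (even a \<longrightarrow> even (\<Sum>i<2 * \<mu>. r i))"
    by (intro tw_forms_bound_of_factors[OF refl _ _ w(5,6) assms(5)])
  then show ?thesis using w(1,2) unfolding w(4) by blast
qed

text \<open>Scott's argument: a vector with \<open>X (Y v) = v\<close> yields \<open>v - Y v = X (Y v) - Y v\<close>, which lies in the ranges of both \<open>1 - X\<close>
and \<open>1 - Y\<close>. It determines \<open>v\<close>, since there is no common fixed vector, and the intersection of the ranges is small, since they span \<open>L\<close>.\<close>

lemma scott_inequality:
  assumes L: "fv.subspace L" "fd L" and X: "flin X" "\<And>v. v \<in> L \<Longrightarrow> X v \<in> L" and Y: "flin Y" "\<And>v. v \<in> L \<Longrightarrow> Y v \<in> L"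
    and inj: "\<And>v. v \<in> L \<Longrightarrow> X v = 0 \<Longrightarrow> v = 0"
    and fixed: "\<And>v. v \<in> L \<Longrightarrow> X v = v \<Longrightarrow> Y v = v \<Longrightarrow> v = 0"
    and cofixed: "\<And>v. v \<in> L \<Longrightarrow> \<exists>a\<in>L. \<exists>b\<in>L. v = (a - X a) + (b - Y b)"
  shows "fv.dim {v \<in> L. X v = v} + fv.dim {v \<in> L. Y v = v} + fv.dim {v \<in> L. X (Y v) = v} \<le> fv.dim L"
proof -
  let ?X = "\<lambda>v. v - X v" and ?Y = "\<lambda>v. v - Y v" and ?XY = "\<lambda>v. X (v - Y v)"
  have lX: "flin ?X" by (rule flinI) (auto simp: flin_simps[OF X(1)] fv.scale_right_diff_distrib)
  have lY: "flin ?Y" by (rule flinI) (auto simp: flin_simps[OF Y(1)] fv.scale_right_diff_distrib)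
  have lXY: "flin ?XY" by (rule flin_compose[OF X(1) lY])
  have memX: "?X v \<in> L" if "v \<in> L" for v using that X(2) fv.subspace_diff[OF L(1)] by blast
  have memY: "?Y v \<in> L" if "v \<in> L" for v using that Y(2) fv.subspace_diff[OF L(1)] by blast
  have k1: "{v \<in> L. ?X v = 0} = {v \<in> L. X v = v}" by (auto simp only: right_minus_eq)
  have k2: "{v \<in> L. ?XY v = 0} = {v \<in> L. Y v = v}"
    using inj memY flin_0[OF X(1)] by (auto simp only: right_minus_eq) (metis right_minus_eq)+
  let ?A = "?X ` L" and ?B = "?XY ` L"
  have sA: "fv.subspace ?A" by (rule fp.linear_subspace_image[OF lX L(1)])
  have sB: "fv.subspace ?B" by (rule fp.linear_subspace_image[OF lXY L(1)])
  have AB: "fv.dim (?A \<inter> ?B) + fv.dim L = fv.dim ?A + fv.dim ?B"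
  proof (rule dim_inter[OF sA sB L(2,1)])
    show "?A \<subseteq> L" "?B \<subseteq> L" using memX memY X(2) by auto
    fix v assume "v \<in> L"
    then obtain a b where ab: "a \<in> L" "b \<in> L" "v = ?X a + ?Y b" using cofixed by blast
    have "v = ?X (a + ?Y b) + ?XY b" unfolding ab(3) by (simp add: flin_simps[OF X(1)])
    moreover have "a + ?Y b \<in> L" using ab memY fv.subspace_add[OF L(1)] by blast
    ultimately show "\<exists>a\<in>?A. \<exists>b\<in>?B. v = a + b" using ab(2) by blast
  qed
  let ?R = "{v \<in> L. X (Y v) = v}"
  have sR: "fv.subspace ?R"
    using L(1) by (auto simp: fv.subspace_def flin_simps[OF X(1)] flin_simps[OF Y(1)])
  have "fv.dim ?R \<le> fv.dim (?A \<inter> ?B)"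
  proof (rule dim_le_of_inj(2)[OF lX sR])
    show "fd (?A \<inter> ?B)" by (rule fd_subset[OF fd_image[OF lX L(2)]]) blast
    show "?X ` ?R \<subseteq> ?A \<inter> ?B"
    proof
      fix w assume "w \<in> ?X ` ?R"
      then obtain v where v: "v \<in> L" "X (Y v) = v" "w = ?X v" by blast
      have "w = ?XY (fscale (- 1) v)"
        unfolding v(3) by (simp add: flin_simps[OF X(1)] flin_simps[OF Y(1)] v(2) fun_eq_iff)
      moreover have "fscale (- 1) v \<in> L" by (rule fv.subspace_scale[OF L(1) v(1)])
      ultimately show "w \<in> ?A \<inter> ?B" using v by blast
    qed
    fix v assume v: "v \<in> ?R" "?X v = 0"
    then have v': "v \<in> L" "X v = v" "X (Y v) = v" by (auto simp only: right_minus_eq mem_Collect_eq)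
    then have "X (?Y v) = 0" by (simp add: flin_diff[OF X(1)])
    then have "?Y v = 0" using inj memY v' by blast
    then have "Y v = v" by (simp only: right_minus_eq)
    then show "v = 0" using fixed v' by blast
  qed
  then show ?thesis
    using AB rank_nullity[OF lX L] rank_nullity[OF lXY L] unfolding k1 k2 by linarith
qed

section \<open>Symmetric forms on the standard symplectic space\<close>

definition space :: "nat \<Rightarrow> (nat \<Rightarrow> 'k::field) set" where
  "space m = supported {..<2 * m}"

text \<open>The standard symplectic form; it is the form whose Gram matrix is \<open>symplectic_form m\<close>.\<close>

definition om :: "nat \<Rightarrow> (nat, 'k::field) form" where
  "om m = (\<lambda>(x, y). if x \<in> space m \<and> y \<in> space m then \<Sum>i<m. x i * y (i + m) - x (i + m) * y i else 0)"

lemma subspace_space [simp]: "fv.subspace (space m)" by (simp add: space_def)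
lemma fd_space [simp]: "fd (space m)" by (simp add: space_def supported_dim)
lemma dim_space [simp]: "fv.dim (space m :: (nat \<Rightarrow> 'k::field) set) = 2 * m"
  by (simp add: space_def supported_dim)

lemma space_add [simp]: "x \<in> space m \<Longrightarrow> y \<in> space m \<Longrightarrow> x + y \<in> space m"
  by (rule fv.subspace_add[OF subspace_space])
lemma space_diff [simp]: "x \<in> space m \<Longrightarrow> y \<in> space m \<Longrightarrow> x - y \<in> space m"
  by (rule fv.subspace_diff[OF subspace_space])
lemma space_scale [simp]: "x \<in> space m \<Longrightarrow> fscale c x \<in> space m"
  by (rule fv.subspace_scale[OF subspace_space])
lemma space_zero [simp]: "0 \<in> space m"
  by (rule fv.subspace_0[OF subspace_space])
lemma space_delta [simp]: "i < 2 * m \<Longrightarrow> delta i \<in> space m"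
  by (simp add: space_def)

lemma om_eq: "x \<in> space m \<Longrightarrow> y \<in> space m \<Longrightarrow> om m (x, y) = (\<Sum>i<m. x i * y (i + m) - x (i + m) * y i)"
  by (simp add: om_def)

lemma om_forms: "om m \<in> forms (space m) (space m)"
  by (rule formsI) (auto simp: om_def sum.distrib sum_subtractf sum_distrib_left algebra_simps)

lemma om_alt: "om m (x, x) = 0"
  by (simp add: om_def mult.commute)

lemma om_anti: "om m (y, x) = - om m (x, y)"
  by (simp add: om_def sum_negf[symmetric] mult.commute)

lemma om_add1: "x \<in> space m \<Longrightarrow> x' \<in> space m \<Longrightarrow> y \<in> space m \<Longrightarrow> om m (x + x', y) = om m (x, y) + om m (x', y)"
  by (rule forms_add1[OF om_forms])
lemma om_add2: "x \<in> space m \<Longrightarrow> y' \<in> space m \<Longrightarrow> y \<in> space m \<Longrightarrow> om m (x, y + y') = om m (x, y) + om m (x, y')"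
  by (rule forms_add2[OF om_forms])
lemma om_diff1: "x \<in> space m \<Longrightarrow> x' \<in> space m \<Longrightarrow> y \<in> space m \<Longrightarrow> om m (x - x', y) = om m (x, y) - om m (x', y)"
  by (rule forms_diff1[OF om_forms subspace_space])
lemma om_diff2: "x \<in> space m \<Longrightarrow> y' \<in> space m \<Longrightarrow> y \<in> space m \<Longrightarrow> om m (x, y - y') = om m (x, y) - om m (x, y')"
  by (rule forms_diff2[OF om_forms subspace_space])
lemma om_scale1: "x \<in> space m \<Longrightarrow> y \<in> space m \<Longrightarrow> om m (fscale c x, y) = c * om m (x, y)"
  by (rule forms_scale1[OF om_forms])
lemma om_scale2: "x \<in> space m \<Longrightarrow> y \<in> space m \<Longrightarrow> om m (x, fscale c y) = c * om m (x, y)"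
  by (rule forms_scale2[OF om_forms])
lemmas om_simps = om_add1 om_add2 om_diff1 om_diff2 om_scale1 om_scale2 om_alt

text \<open>The vector representing the coordinate function of index \<open>i\<close>.\<close>

definition coord_vec :: "nat \<Rightarrow> nat \<Rightarrow> nat \<Rightarrow> 'k::field" where
  "coord_vec m i = (if i < m then fscale (- 1) (delta (i + m)) else delta (i - m))"

lemma coord_vec_space: "i < 2 * m \<Longrightarrow> coord_vec m i \<in> space m"
  by (auto simp: coord_vec_def)

lemma om_coord_vec:
  assumes "i < 2 * m" "x \<in> space m"
  shows "om m (coord_vec m i, x) = x i"
proof (cases "i < m")
  case True
  have "om m (coord_vec m i, x) = (\<Sum>j<m. if j = i then x i else 0)"
    unfolding om_eq[OF coord_vec_space[OF assms(1)] assms(2)]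
    by (rule sum.cong) (use True in \<open>auto simp: coord_vec_def delta_apply\<close>)
  then show ?thesis using True by simp
next
  case False
  have "om m (coord_vec m i, x) = (\<Sum>j<m. if j = i - m then x i else 0)"
    unfolding om_eq[OF coord_vec_space[OF assms(1)] assms(2)]
    by (rule sum.cong) (use False assms(1) in \<open>auto simp: coord_vec_def delta_apply\<close>)
  then show ?thesis using False assms(1) by simp
qed

lemma om_nondeg: "y \<in> space m \<Longrightarrow> (\<And>x. x \<in> space m \<Longrightarrow> om m (x, y) = 0) \<Longrightarrow> y = 0"
proof
  fix i assume y: "y \<in> space m" "\<And>x. x \<in> space m \<Longrightarrow> om m (x, y) = 0"
  show "y i = 0 i"
  proof (cases "i < 2 * m")
    case True then show ?thesis using om_coord_vec[OF True y(1)] y(2)[OF coord_vec_space[OF True]] by simp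
  next
    case False then show ?thesis using y(1) by (simp add: space_def supported_def)
  qed
qed

text \<open>Operators are linear on all functions, but isometries only on \<open>space m\<close>.\<close>

definition sp_op :: "nat \<Rightarrow> ((nat \<Rightarrow> 'k::field) \<Rightarrow> nat \<Rightarrow> 'k) \<Rightarrow> bool" where
  "sp_op m T \<longleftrightarrow> flin T \<and> (\<forall>x\<in>space m. T x \<in> space m) \<and>
     (\<forall>x\<in>space m. \<forall>y\<in>space m. om m (T x, T y) = om m (x, y))"

lemma sp_opD:
  assumes "sp_op m T"
  shows "flin T" "x \<in> space m \<Longrightarrow> T x \<in> space m"
    "x \<in> space m \<Longrightarrow> y \<in> space m \<Longrightarrow> om m (T x, T y) = om m (x, y)"
  using assms by (auto simp: sp_op_def)

definition sym_forms :: "nat \<Rightarrow> (nat, 'k::field) form set" where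
  "sym_forms m = {B \<in> forms (space m) (space m). \<forall>x\<in>space m. \<forall>y\<in>space m. B (x, y) = B (y, x)}"

lemma sym_formsD: "B \<in> sym_forms m \<Longrightarrow> B \<in> forms (space m) (space m)"
  and sym_forms_sym: "B \<in> sym_forms m \<Longrightarrow> x \<in> space m \<Longrightarrow> y \<in> space m \<Longrightarrow> B (x, y) = B (y, x)"
  by (simp_all add: sym_forms_def)

lemma subspace_sym_forms: "fv.subspace (sym_forms m)"
  unfolding fv.subspace_def sym_forms_def
  using fv.subspace_add[OF subspace_forms] fv.subspace_scale[OF subspace_forms] fv.subspace_0[OF subspace_forms]
  by auto

lemma space_span: "space m \<subseteq> fv.span (delta ` {..<2 * m})"
proof
  fix x :: "nat \<Rightarrow> 'k::field" assume "x \<in> space m"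
  then have "x = (\<Sum>i<2 * m. fscale (x i) (delta i))"
    unfolding space_def by (intro supported_expand) auto
  also have "\<dots> \<in> fv.span (delta ` {..<2 * m})"
    by (intro fv.span_sum fv.span_scale fv.span_base) auto
  finally show "x \<in> fv.span (delta ` {..<2 * m})" .
qed

lemma form_eq_0_on_basis:
  assumes "B \<in> forms (space m) (space m)" "\<And>i j. i < 2 * m \<Longrightarrow> j < 2 * m \<Longrightarrow> B (delta i, delta j) = 0"
  shows "B = 0"
  by (rule forms_eq_0I[OF assms(1) _ _ _ space_span _ space_span]) (use assms(2) in auto)

lemma sym_forms_dim:
  shows "fd (sym_forms m :: (nat, 'k::field) form set)" "fv.dim (sym_forms m :: (nat, 'k::field) form set) \<le> m * (2 * m + 1)"
proof -
  let ?I = "{(i, k). i \<le> k \<and> k < 2 * m}"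
  let ?T = "\<lambda>(B :: (nat, 'k) form) (i, k). if (i, k) \<in> ?I then B (delta i, delta k) else 0"
  have fin: "finite ?I" by (rule finite_subset[of _ "{..<2*m} \<times> {..<2*m}"]) auto
  have T: "flin ?T" by (rule flinI) (auto simp: fun_eq_iff)
  have im: "?T ` sym_forms m \<subseteq> supported ?I" by (auto simp: supported_def)
  have inj: "B = 0" if B: "B \<in> sym_forms m" "?T B = 0" for B
  proof (rule form_eq_0_on_basis[OF sym_formsD[OF B(1)]])
    fix i j assume ij: "i < 2 * m" "j < 2 * m"
    have z: "B (delta i, delta k) = 0" if "i \<le> k" "k < 2 * m" for i k
      using fun_cong[OF B(2), of "(i, k)"] that by simp
    show "B (delta i, delta j) = 0"
      using z[of i j] z[of j i] ij sym_forms_sym[OF B(1), of "delta i" "delta j"] by (cases "i \<le> j") auto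
  qed
  show "fd (sym_forms m :: (nat, 'k) form set)"
    by (rule dim_le_of_inj(1)[OF T subspace_sym_forms inj supported_dim(1)[OF fin] im])
  have "fv.dim (sym_forms m :: (nat, 'k) form set) \<le> card ?I"
    using dim_le_of_inj(2)[OF T subspace_sym_forms inj supported_dim(1)[OF fin] im] unfolding supported_dim(2)[OF fin] .
  moreover have "2 * card ?I = 2 * (m * (2 * m + 1))" using card_le_pairs[of "2 * m"] by (simp add: algebra_simps)
  ultimately show "fv.dim (sym_forms m :: (nat, 'k) form set) \<le> m * (2 * m + 1)" by linarith
qed

definition pullback :: "nat \<Rightarrow> ((nat \<Rightarrow> 'k::field) \<Rightarrow> nat \<Rightarrow> 'k) \<Rightarrow> (nat, 'k) form \<Rightarrow> (nat, 'k) form" where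
  "pullback m T B = (\<lambda>(x, y). if x \<in> space m \<and> y \<in> space m then B (T x, T y) else 0)"

lemma lin_pullback: "flin (pullback m T)"
  by (rule flinI) (auto simp: pullback_def fun_eq_iff)

lemma pullback_sym_forms:
  assumes T: "sp_op m T" and B: "B \<in> sym_forms m"
  shows "pullback m T B \<in> sym_forms m"
proof -
  note F = sym_formsD[OF B] and t = sp_opD[OF T]
  have "pullback m T B \<in> forms (space m) (space m)"
    by (rule formsI) (use t(2) in \<open>auto simp: pullback_def flin_add[OF t(1)] flin_scale[OF t(1)] forms_add1[OF F]
        forms_add2[OF F] forms_scale1[OF F] forms_scale2[OF F]\<close>)
  then show ?thesis using sym_forms_sym[OF B] t(2) by (simp add: sym_forms_def pullback_def)
qed

lemma pullback_fixed_iff: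
  assumes "B \<in> sym_forms m"
  shows "pullback m T B = B \<longleftrightarrow> (\<forall>x\<in>space m. \<forall>y\<in>space m. B (T x, T y) = B (x, y))"
  using forms_outside[OF sym_formsD[OF assms]] by (auto simp: pullback_def fun_eq_iff)

abbreviation fixed_dim :: "nat \<Rightarrow> ((nat \<Rightarrow> 'k::field) \<Rightarrow> nat \<Rightarrow> 'k) \<Rightarrow> nat" where
  "fixed_dim m T \<equiv> fv.dim {B \<in> sym_forms m. pullback m T B = B}"

lemma funpow_space: "sp_op m T \<Longrightarrow> x \<in> space m \<Longrightarrow> (T ^^ j) x \<in> space m"
  by (induction j) (auto simp: sp_opD)

lemma flin_funpow:
  fixes T :: "('a \<Rightarrow> 'k::field) \<Rightarrow> 'a \<Rightarrow> 'k"
  shows "flin T \<Longrightarrow> flin (T ^^ j)"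
proof (induction j)
  case (Suc j)
  then show ?case using flin_compose[of T "T ^^ j"] by (simp only: funpow.simps o_def)
qed (rule flinI, auto)

lemma sp_op_symplectic_pair:
  fixes T :: "(nat \<Rightarrow> 'k::field) \<Rightarrow> nat \<Rightarrow> 'k"
  assumes T: "sp_op m T" and a: "a > 0" "\<forall>x\<in>space m. (T ^^ a) x = x" and two: "(2::'k) \<noteq> 0"
  shows "symplectic_pair T (T ^^ (a - 1)) (space m) (om m)"
proof -
  note t = sp_opD[OF T]
  have 1: "(T ^^ (a - 1)) (T x) = x" "T ((T ^^ (a - 1)) x) = x" if "x \<in> space m" for x
    using bspec[OF a(2) that] a(1) by (metis Suc_pred' comp_apply funpow_Suc_right, metis Suc_pred' comp_apply funpow.simps(2))
  interpret inverse_pair T "T ^^ (a - 1)" "space m"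
    by (rule inverse_pair.intro) (simp_all only: t flin_funpow funpow_space[OF T] 1 subspace_space fd_space)
  show ?thesis
  proof
    show "om m \<in> inv_forms (space m) (space m)" using om_forms t by (auto simp: inv_forms_def)
  qed (auto simp: om_alt two intro: om_nondeg)
qed

lemma fixed_dim_tw_forms:
  assumes "inverse_pair T h (space m)"
  shows "{B \<in> sym_forms m. pullback m T B = B} = inverse_pair.tw_forms T h 1 0 (space m)"
proof -
  interpret inverse_pair T h "space m" by (rule assms)
  show ?thesis
    using pullback_fixed_iff by (auto simp: tw_forms_def inv_forms_def sym_forms_def)
qed

text \<open>The invariant symmetric forms are the forms of trivial twist, so the general bound applies.\<close>

lemma fixed_dim_bound:
  fixes T :: "(nat \<Rightarrow> 'k::alg_closed_field) \<Rightarrow> nat \<Rightarrow> 'k"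
  assumes T: "sp_op m T" and a: "a > 0" "\<forall>x\<in>space m. (T ^^ a) x = x"
    and p: "prime CHAR('k)" "CHAR('k) \<noteq> 2" and two: "(2::'k) \<noteq> 0"
  shows "\<exists>\<mu> r. odd \<mu> \<and> \<mu> dvd a \<and> (\<Sum>i<a. r i) = 2 * m
    \<and> (\<Sum>i<a. r i * r i) + r (\<mu> - 1) + (if even a then r (2 * \<mu> - 1) else 0) \<le> 2 * fixed_dim m T
    \<and> even (\<Sum>i<\<mu>. r i) \<and> (even a \<longrightarrow> even (\<Sum>i<2 * \<mu>. r i))"
proof -
  note sp = sp_op_symplectic_pair[OF T a two]
  then have ip: "inverse_pair T (T ^^ (a - 1)) (space m)" by (rule symplectic_pair.axioms)
  have "even (fv.dim (space m :: (nat \<Rightarrow> 'k) set))" by simp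
  from tw_forms_bound[OF sp p a(1) this bspec[OF a(2)]] show ?thesis
    unfolding fixed_dim_tw_forms[OF ip, symmetric] dim_space .
qed

context
  fixes T :: "(nat \<Rightarrow> 'k::alg_closed_field) \<Rightarrow> nat \<Rightarrow> 'k" and m a :: nat
  assumes T: "sp_op m T" and a: "a > 0" "\<forall>x\<in>space m. (T ^^ a) x = x"
    and p: "prime CHAR('k)" "CHAR('k) \<noteq> 2" and two: "(2::'k) \<noteq> 0"
begin

lemma fixed_dim_ge_rank: "m \<le> fixed_dim m T"
proof -
  obtain \<mu> r where mu: "odd \<mu>" "\<mu> dvd a" and r: "(\<Sum>i<a. r i) = 2 * m"
    "(\<Sum>i<a. r i * r i) + r (\<mu> - 1) + (if even a then r (2 * \<mu> - 1) else 0) \<le> 2 * fixed_dim m T"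
    "even (\<Sum>i<\<mu>. r i)" "even a \<longrightarrow> even (\<Sum>i<2 * \<mu>. r i)"
    using fixed_dim_bound[OF T a p two] by (elim exE conjE)
  have "(\<Sum>i<a. r i) \<le> (\<Sum>i<a. r i * r i)" by (rule sum_mono) simp
  then show ?thesis using r by linarith
qed

text \<open>Tangent bounds: the two quadratic terms are bounded below by linear ones of the common slope \<open>s\<close>.\<close>

lemma fixed_dim_tangent:
  assumes A: "\<And>r::nat. s * r \<le> r * r + A" and B: "\<And>r::nat. s * r \<le> r * r + r + B"
    and e: "e = (if even a then 2 else 1)"
  shows "s * (2 * m) \<le> 2 * fixed_dim m T + (a - e) * A + e * B"
proof -
  obtain \<mu> r where mu: "odd \<mu>" "\<mu> dvd a" and r: "(\<Sum>i<a. r i) = 2 * m"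
    "(\<Sum>i<a. r i * r i) + r (\<mu> - 1) + (if even a then r (2 * \<mu> - 1) else 0) \<le> 2 * fixed_dim m T"
    "even (\<Sum>i<\<mu>. r i)" "even a \<longrightarrow> even (\<Sum>i<2 * \<mu>. r i)"
    using fixed_dim_bound[OF T a p two] by (elim exE conjE)
  define E where "E = (if even a then {\<mu> - 1, 2 * \<mu> - 1} else {\<mu> - 1})"
  have mu0: "\<mu> > 0" using mu(1) by (cases \<mu>) auto
  have "2 * \<mu> dvd a" if "even a" using that mu by (simp add: divides_mult coprime_commute)
  then have E: "E \<subseteq> {..<a}" "card E = e"
    using mu0 dvd_imp_le[OF mu(2) a(1)] dvd_imp_le[of "2 * \<mu>" a] a(1) by (auto simp: E_def e)
  have sE: "(\<Sum>i\<in>E. r i) = r (\<mu> - 1) + (if even a then r (2 * \<mu> - 1) else 0)"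
    using mu0 by (auto simp: E_def)
  have fE: "finite E" using E(1) finite_subset by blast
  have "s * (2 * m) = (\<Sum>i<a. s * r i)" by (simp add: r(1)[symmetric] sum_distrib_left)
  also have "\<dots> \<le> (\<Sum>i<a. r i * r i + (if i \<in> E then r i + B else A))"
    by (rule sum_mono) (use A B in \<open>auto simp: add.assoc[symmetric]\<close>)
  also have "\<dots> = (\<Sum>i<a. r i * r i) + ((\<Sum>i\<in>E. r i + B) + (\<Sum>i\<in>{..<a} - E. A))"
    using E(1) by (simp add: sum.distrib sum.If_cases Int_absorb1 Diff_eq)
  also have "(\<Sum>i\<in>{..<a} - E. A) = (a - e) * A" using E fE by (simp add: card_Diff_subset)
  also have "(\<Sum>i\<in>E. r i + B) = (\<Sum>i\<in>E. r i) + e * B" using E(2) by (simp add: sum.distrib)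
  finally show ?thesis using r(2) sE by linarith
qed

text \<open>For integers \<open>(r - k) (r - k - 1) \<ge> 0\<close>, which is a linear lower bound for \<open>r\<^sup>2\<close>; summation over all factors
leaves a bound in terms of \<open>2 m\<close>. The \<open>e\<close> exceptional factors carry the additional linear term.\<close>

lemma fixed_dim_odd_slope:
  assumes "e = (if even a then 2 else 1)"
  shows "(2 * k + 1) * (2 * m) \<le> 2 * fixed_dim m T + (a - e) * (k * (k + 1)) + e * (k * k)"
proof (rule fixed_dim_tangent[OF _ _ assms])
  fix r :: nat
  have "0 \<le> (int r - int k) * (int r - int k - 1)" by (cases "int r \<le> int k") (auto simp: zero_le_mult_iff)
  then have "int ((2 * k + 1) * r) \<le> int (r * r + k * (k + 1))" by (simp add: algebra_simps)
  then show "(2 * k + 1) * r \<le> r * r + k * (k + 1)" by (simp only: of_nat_le_iff)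
  have "0 \<le> (int r - int k) * (int r - int k)" by simp
  then have "int ((2 * k + 1) * r) \<le> int (r * r + r + k * k)" by (simp add: algebra_simps)
  then show "(2 * k + 1) * r \<le> r * r + r + k * k" by (simp only: of_nat_le_iff)
qed

lemma fixed_dim_even_slope:
  assumes "e = (if even a then 2 else 1)"
  shows "(2 * k + 2) * (2 * m) \<le> 2 * fixed_dim m T + (a - e) * ((k + 1) * (k + 1)) + e * ((k + 1) * k)"
proof (rule fixed_dim_tangent[OF _ _ assms])
  fix r :: nat
  have "0 \<le> (int r - int k) * (int r - int k - 1)" by (cases "int r \<le> int k") (auto simp: zero_le_mult_iff)
  then have "int ((2 * k + 2) * r) \<le> int (r * r + r + (k + 1) * k)" by (simp add: algebra_simps)
  then show "(2 * k + 2) * r \<le> r * r + r + (k + 1) * k" by (simp only: of_nat_le_iff)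
  have "0 \<le> (int r - int k - 1) * (int r - int k - 1)" by simp
  then have "int ((2 * k + 2) * r) \<le> int (r * r + (k + 1) * (k + 1))" by (simp add: algebra_simps)
  then show "(2 * k + 2) * r \<le> r * r + (k + 1) * (k + 1)" by (simp only: of_nat_le_iff)
qed

text \<open>The two eigenspaces of an involutory isometry are orthogonal to each other, hence have even dimension; for odd \<open>m\<close> they cannot both have dimension \<open>m\<close>.\<close>

lemma fixed_dim_involution:
  assumes "a = 2" "odd m"
  shows "m * m + m + 1 \<le> fixed_dim m T"
proof -
  obtain \<mu> r where mu: "odd \<mu>" "\<mu> dvd a" and r: "(\<Sum>i<a. r i) = 2 * m"
    "(\<Sum>i<a. r i * r i) + r (\<mu> - 1) + (if even a then r (2 * \<mu> - 1) else 0) \<le> 2 * fixed_dim m T"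
    "even (\<Sum>i<\<mu>. r i)" "even a \<longrightarrow> even (\<Sum>i<2 * \<mu>. r i)"
    using fixed_dim_bound[OF T a p two] by (elim exE conjE)
  have "\<mu> \<le> 2" using dvd_imp_le[OF mu(2)] assms(1) by simp
  then have mu1: "\<mu> = 1" using mu(1) by (cases "\<mu> = 0"; cases "\<mu> = 1"; cases "\<mu> = 2") auto
  have ev: "even (r 0)" and s: "r 0 + r 1 = 2 * m"
    and le: "r 0 * r 0 + r 1 * r 1 + r 0 + r 1 \<le> 2 * fixed_dim m T"
    using r assms(1) mu1 by (auto simp: numeral_2_eq_2)
  obtain u where u: "r 0 = 2 * u" using ev by (elim evenE)
  define v where "v = m - u"
  have v: "r 1 = 2 * v" "u + v = m" using s u by (auto simp: v_def)
  have "u \<noteq> v" using v(2) assms(2) by auto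
  then have "1 \<le> (int u - int v) * (int u - int v)"
    by (cases "u < v") (auto simp: int_one_le_iff_zero_less zero_less_mult_iff)
  moreover have "int (r 0 * r 0 + r 1 * r 1) = 2 * int m * int m + 2 * ((int u - int v) * (int u - int v))"
    unfolding u v(1) v(2)[symmetric] by (simp add: algebra_simps)
  ultimately have "2 * int m * int m + 2 \<le> int (r 0 * r 0 + r 1 * r 1)" by linarith
  then have "int (2 * (m * m) + 2) \<le> int (r 0 * r 0 + r 1 * r 1)" by (simp add: mult.assoc)
  then have "2 * (m * m) + 2 \<le> r 0 * r 0 + r 1 * r 1" by (simp only: of_nat_le_iff)
  then show ?thesis using le s by linarith
qed

text \<open>The tangent bound gives only 3 here; parity of the rank drops excludes equality.\<close>

lemma fixed_dim_4_rank_2: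
  assumes "a = 4" "m = 2"
  shows "4 \<le> fixed_dim m T"
proof -
  obtain \<mu> r where mu: "odd \<mu>" "\<mu> dvd a" and r: "(\<Sum>i<a. r i) = 2 * m"
    "(\<Sum>i<a. r i * r i) + r (\<mu> - 1) + (if even a then r (2 * \<mu> - 1) else 0) \<le> 2 * fixed_dim m T"
    "even (\<Sum>i<\<mu>. r i)" "even a \<longrightarrow> even (\<Sum>i<2 * \<mu>. r i)"
    using fixed_dim_bound[OF T a p two] by (elim exE conjE)
  have "\<mu> \<le> 4" using dvd_imp_le[OF mu(2)] assms(1) by simp
  then have "\<mu> = 1 \<or> \<mu> = 3" using mu(1) by presburger
  moreover have "\<mu> \<noteq> 3" using mu(2) assms(1) by auto
  ultimately have mu1: "\<mu> = 1" by simp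
  have sum4: "(\<Sum>i<a. f i) = f 0 + f 1 + f 2 + f 3" for f :: "nat \<Rightarrow> nat"
    using assms(1) by (simp add: numeral_eq_Suc)
  have eva: "even a" using assms(1) by simp
  have s: "r 0 + r 1 + r 2 + r 3 = 4" using r(1) assms(2) unfolding sum4 by simp
  have le: "r 0 * r 0 + r 1 * r 1 + r 2 * r 2 + r 3 * r 3 + r 0 + r 1 \<le> 2 * fixed_dim m T"
    using r(2) eva mu1 unfolding sum4 by simp
  have ev: "even (r 0)" "even (r 0 + r 1)" using r(3,4) eva mu1 by (auto simp: numeral_2_eq_2)
  have e: "3 * x \<le> x * x + x" if "even x" for x :: nat
  proof -
    obtain y where y: "x = 2 * y" using \<open>even x\<close> by (elim evenE)
    have "y \<le> y * y" by simp
    then show ?thesis unfolding y by simp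
  qed
  have o: "3 * x \<le> x * x + 2" for x :: nat
  proof (cases "x \<le> 2")
    case True
    then have "x = 0 \<or> x = 1 \<or> x = 2" by linarith
    then show ?thesis by auto
  next
    case False
    then have "3 * x \<le> x * x" by (intro mult_le_mono1) simp
    then show ?thesis by linarith
  qed
  have "even (r 1)" using ev by presburger
  from e[OF this] e[OF ev(1)] o[of "r 2"] o[of "r 3"] s le show ?thesis by linarith
qed

text \<open>As for order 4, the parity of the rank drops improves the tangent bound by one.\<close>

lemma fixed_dim_6_rank_3:
  assumes "a = 6" "m = 3"
  shows "5 \<le> fixed_dim m T"
proof (rule ccontr)
  assume "\<not> 5 \<le> fixed_dim m T"
  then have D: "2 * fixed_dim m T \<le> 8" by simp
  obtain \<mu> r where mu: "odd \<mu>" "\<mu> dvd a" and r: "(\<Sum>i<a. r i) = 2 * m"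
    "(\<Sum>i<a. r i * r i) + r (\<mu> - 1) + (if even a then r (2 * \<mu> - 1) else 0) \<le> 2 * fixed_dim m T"
    "even (\<Sum>i<\<mu>. r i)" "even a \<longrightarrow> even (\<Sum>i<2 * \<mu>. r i)"
    using fixed_dim_bound[OF T a p two] by (elim exE conjE)
  have "\<mu> \<le> 6" using dvd_imp_le[OF mu(2)] assms(1) by simp
  then have "\<mu> = 1 \<or> \<mu> = 3 \<or> \<mu> = 5" using mu(1) by presburger
  moreover have "\<mu> \<noteq> 5" using mu(2) assms(1) by auto
  ultimately have mu1: "\<mu> = 1 \<or> \<mu> = 3" by simp
  have sum6: "(\<Sum>i<a. f i) = f 0 + f 1 + f 2 + f 3 + f 4 + f 5" for f :: "nat \<Rightarrow> nat"
    using assms(1) by (simp add: numeral_eq_Suc)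
  have q: "2 * x \<le> x * x + 1" "x \<noteq> 1 \<Longrightarrow> 2 * x + 1 \<le> x * x + 1" "2 * x \<le> x * x + x" "x \<ge> 2 \<Longrightarrow> 2 * x + 1 \<le> x * x + x" for x :: nat
  proof -
    have i: "0 \<le> (int x - 1) * (int x - 1)" by simp
    show 1: "2 * x \<le> x * x + 1"
    proof -
      have "int (2 * x) \<le> int (x * x + 1)" using i by (simp add: algebra_simps)
      then show ?thesis by (simp only: of_nat_le_iff)
    qed
    show "2 * x + 1 \<le> x * x + 1" if "x \<noteq> 1" using that by (cases x; cases "x - 1") auto
    show "2 * x \<le> x * x + x" by (cases x) auto
    show "2 * x + 1 \<le> x * x + x" if "x \<ge> 2" using that mult_le_mono1[of 2 x x] by linarith
  qed
  have s: "r 0 + r 1 + r 2 + r 3 + r 4 + r 5 = 6" using r(1) assms(2) sum6[of r] by simp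
  from mu1 show False
  proof
    assume m1: "\<mu> = 1"
    have le: "r 0 * r 0 + r 1 * r 1 + r 2 * r 2 + r 3 * r 3 + r 4 * r 4 + r 5 * r 5 + r 0 + r 1 \<le> 8"
      using r(2) D m1 assms(1) unfolding sum6 by simp
    have "even a" using assms(1) by simp
    then have ev: "even (r 0)" "even (r 0 + r 1)" using r(3,4) m1 by (auto simp: numeral_2_eq_2)
    have "r 2 = 1"
    proof (rule ccontr)
      assume "r 2 \<noteq> 1"
      from q(2)[OF this] le s q(3)[of "r 0"] q(3)[of "r 1"] q(1)[of "r 3"] q(1)[of "r 4"] q(1)[of "r 5"] show False by linarith
    qed
    moreover have "r 3 = 1"
    proof (rule ccontr)
      assume "r 3 \<noteq> 1"
      from q(2)[OF this] le s q(3)[of "r 0"] q(3)[of "r 1"] q(1)[of "r 2"] q(1)[of "r 4"] q(1)[of "r 5"] show False by linarith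
    qed
    moreover have "r 4 = 1"
    proof (rule ccontr)
      assume "r 4 \<noteq> 1"
      from q(2)[OF this] le s q(3)[of "r 0"] q(3)[of "r 1"] q(1)[of "r 2"] q(1)[of "r 3"] q(1)[of "r 5"] show False by linarith
    qed
    moreover have "r 5 = 1"
    proof (rule ccontr)
      assume "r 5 \<noteq> 1"
      from q(2)[OF this] le s q(3)[of "r 0"] q(3)[of "r 1"] q(1)[of "r 2"] q(1)[of "r 3"] q(1)[of "r 4"] show False by linarith
    qed
    moreover have "r 0 < 2"
    proof (rule ccontr)
      assume "\<not> r 0 < 2"
      then have "r 0 \<ge> 2" by simp
      from q(4)[OF this] le s q(3)[of "r 1"] q(1)[of "r 2"] q(1)[of "r 3"] q(1)[of "r 4"] q(1)[of "r 5"] show False by linarith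
    qed
    moreover have "r 1 < 2"
    proof (rule ccontr)
      assume "\<not> r 1 < 2"
      then have "r 1 \<ge> 2" by simp
      from q(4)[OF this] le s q(3)[of "r 0"] q(1)[of "r 2"] q(1)[of "r 3"] q(1)[of "r 4"] q(1)[of "r 5"] show False by linarith
    qed
    ultimately show False using s ev by presburger
  next
    assume m3: "\<mu> = 3"
    have le: "r 0 * r 0 + r 1 * r 1 + r 2 * r 2 + r 3 * r 3 + r 4 * r 4 + r 5 * r 5 + r 2 + r 5 \<le> 8"
      using r(2) D m3 assms(1) unfolding sum6 by simp
    have ev: "even (r 0 + r 1 + r 2)" using r(3) m3 by (simp add: numeral_3_eq_3 numeral_2_eq_2)
    have "r 0 = 1"
    proof (rule ccontr)
      assume "r 0 \<noteq> 1"
      from q(2)[OF this] le s q(3)[of "r 2"] q(3)[of "r 5"] q(1)[of "r 1"] q(1)[of "r 3"] q(1)[of "r 4"] show False by linarith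
    qed
    moreover have "r 1 = 1"
    proof (rule ccontr)
      assume "r 1 \<noteq> 1"
      from q(2)[OF this] le s q(3)[of "r 2"] q(3)[of "r 5"] q(1)[of "r 0"] q(1)[of "r 3"] q(1)[of "r 4"] show False by linarith
    qed
    moreover have "r 3 = 1"
    proof (rule ccontr)
      assume "r 3 \<noteq> 1"
      from q(2)[OF this] le s q(3)[of "r 2"] q(3)[of "r 5"] q(1)[of "r 0"] q(1)[of "r 1"] q(1)[of "r 4"] show False by linarith
    qed
    moreover have "r 4 = 1"
    proof (rule ccontr)
      assume "r 4 \<noteq> 1"
      from q(2)[OF this] le s q(3)[of "r 2"] q(3)[of "r 5"] q(1)[of "r 0"] q(1)[of "r 1"] q(1)[of "r 3"] show False by linarith
    qed
    moreover have "r 2 < 2"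
    proof (rule ccontr)
      assume "\<not> r 2 < 2"
      then have "r 2 \<ge> 2" by simp
      from q(4)[OF this] le s q(3)[of "r 5"] q(1)[of "r 0"] q(1)[of "r 1"] q(1)[of "r 3"] q(1)[of "r 4"] show False by linarith
    qed
    moreover have "r 5 < 2"
    proof (rule ccontr)
      assume "\<not> r 5 < 2"
      then have "r 5 \<ge> 2" by simp
      from q(4)[OF this] le s q(3)[of "r 2"] q(1)[of "r 0"] q(1)[of "r 1"] q(1)[of "r 3"] q(1)[of "r 4"] show False by linarith
    qed
    ultimately show False using s ev by presburger
  qed
qed

end

text \<open>The symmetric square of two vectors, seen as a symmetric form through the symplectic form.\<close>

definition square_form :: "nat \<Rightarrow> (nat \<Rightarrow> 'k::field) \<Rightarrow> (nat \<Rightarrow> 'k) \<Rightarrow> (nat, 'k) form" where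
  "square_form m u v = (\<lambda>(x, y). if x \<in> space m \<and> y \<in> space m
     then om m (u, x) * om m (v, y) + om m (v, x) * om m (u, y) else 0)"

lemma square_form_sym_forms:
  assumes "u \<in> space m" "v \<in> space m"
  shows "square_form m u v \<in> sym_forms m"
proof -
  have "square_form m u v \<in> forms (space m) (space m)"
    by (rule formsI) (use assms in \<open>auto simp: square_form_def om_simps algebra_simps\<close>)
  then show ?thesis by (simp add: sym_forms_def square_form_def algebra_simps)
qed

lemma sym_form_expand:
  assumes B: "B \<in> sym_forms m" and two: "(2::'k::field) \<noteq> 0"
  shows "B = fscale (1/2) (\<Sum>i<2 * m. \<Sum>j<2 * m. fscale (B (delta i, delta j)) (square_form m (coord_vec m i) (coord_vec m j :: nat \<Rightarrow> 'k)))"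
    (is "B = ?R")
proof -
  have R: "?R \<in> forms (space m) (space m)"
    by (intro fv.subspace_scale fv.subspace_sum subspace_forms sym_formsD[OF square_form_sym_forms] coord_vec_space) auto
  have "B - ?R = 0"
  proof (rule form_eq_0_on_basis)
    show "B - ?R \<in> forms (space m) (space m)" by (rule fv.subspace_diff[OF subspace_forms sym_formsD[OF B] R])
    fix k l assume kl: "k < 2 * m" "l < 2 * m"
    have "(\<Sum>i<2 * m. \<Sum>j<2 * m. B (delta i, delta j) * square_form m (coord_vec m i) (coord_vec m j) (delta k, delta l))
      = (\<Sum>i<2 * m. \<Sum>j<2 * m. (if i = k \<and> j = l then B (delta k, delta l) else 0) + (if i = l \<and> j = k then B (delta l, delta k) else 0))"
    proof (intro sum.cong refl)
      fix i j assume "i \<in> {..<2 * m}" "j \<in> {..<2 * m}"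
      then have "square_form m (coord_vec m i) (coord_vec m j) (delta k, delta l)
          = (if i = k then 1 else 0) * (if j = l then 1 else 0) + (if j = k then 1 else 0) * (if i = l then 1 else (0::'k))"
        using kl by (simp add: square_form_def om_coord_vec delta_apply)
      then show "B (delta i, delta j) * square_form m (coord_vec m i) (coord_vec m j) (delta k, delta l)
        = (if i = k \<and> j = l then B (delta k, delta l) else 0) + (if i = l \<and> j = k then B (delta l, delta k) else 0)"
        by (cases "i = k"; cases "j = l"; cases "i = l"; cases "j = k") simp_all
    qed
    also have "\<dots> = B (delta k, delta l) + B (delta l, delta k)"
    proof -
      have "(\<Sum>i<2 * m. \<Sum>j<2 * m. if i = p \<and> j = q then c else 0) = c" if "p < 2 * m" "q < 2 * m" for p q and c :: 'k
      proof -
        have "(\<Sum>i<2 * m. \<Sum>j<2 * m. if i = p \<and> j = q then c else 0) = (\<Sum>i<2 * m. if i = p then c else 0)"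
          by (rule sum.cong) (use that in auto)
        then show ?thesis using that by simp
      qed
      then show ?thesis using kl by (simp add: sum.distrib)
    qed
    also have "B (delta l, delta k) = B (delta k, delta l)" using sym_forms_sym[OF B] kl by simp
    finally show "(B - ?R) (delta k, delta l) = 0" using two by (simp add: field_simps)
  qed
  then show ?thesis by (simp only: right_minus_eq)
qed

text \<open>Only invariant forms have to be excluded, not invariant functionals: a functional \<open>l\<close> on symmetric forms gives the form
\<open>(u, v) \<mapsto> l (square_form m u v)\<close>, which is symmetric, and invariant when \<open>l\<close> is.\<close>

theorem scott_symmetric_forms:
  fixes X Y :: "(nat \<Rightarrow> 'k::field) \<Rightarrow> nat \<Rightarrow> 'k"
  assumes X: "sp_op m X" and Y: "sp_op m Y" and surj: "Y ` space m = space m" and two: "(2::'k) \<noteq> 0"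
    and irr: "\<And>B. B \<in> sym_forms m \<Longrightarrow> pullback m X B = B \<Longrightarrow> pullback m Y B = B \<Longrightarrow> B = 0"
  shows "fixed_dim m X + fixed_dim m Y + fixed_dim m (\<lambda>x. X (Y x)) \<le> m * (2 * m + 1)"
proof -
  let ?L = "sym_forms m :: (nat, 'k) form set"
  let ?PX = "pullback m X" and ?PY = "pullback m Y"
  have XY: "?PY (?PX B) = pullback m (\<lambda>x. X (Y x)) B" for B
    using sp_opD[OF Y] by (auto simp: pullback_def fun_eq_iff)
  have inj: "B = 0" if B: "B \<in> ?L" "?PY B = 0" for B
  proof
    fix q show "B q = 0 q"
    proof (cases "q \<in> space m \<times> space m")
      case True
      then obtain q1 q2 where q: "q = (q1, q2)" "q1 \<in> Y ` space m" "q2 \<in> Y ` space m" unfolding surj by blast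
      then obtain x y where "x \<in> space m" "y \<in> space m" "q = (Y x, Y y)" by blast
      then show ?thesis using fun_cong[OF B(2), of "(x, y)"] by (simp add: pullback_def)
    next
      case False then show ?thesis using forms_outside[OF sym_formsD[OF B(1)]] by (cases q) auto
    qed
  qed
  define dX where "dX B = B - ?PX B" for B
  define dY where "dY B = B - ?PY B" for B
  have lX: "flin dX" unfolding dX_def by (rule flinI) (auto simp: flin_simps[OF lin_pullback] fv.scale_right_diff_distrib)
  have lY: "flin dY" unfolding dY_def by (rule flinI) (auto simp: flin_simps[OF lin_pullback] fv.scale_right_diff_distrib)
  define M where "M = {x + y |x y. x \<in> dY ` ?L \<and> y \<in> dX ` ?L}"
  have sM: "fv.subspace M" unfolding M_def
    by (rule fv.subspace_sums) (rule fp.linear_subspace_image[OF lY subspace_sym_forms], rule fp.linear_subspace_image[OF lX subspace_sym_forms])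
  have dM: "dY B \<in> M" "dX B \<in> M" if "B \<in> ?L" for B
  proof -
    have "dY B = dY B + dX 0" "dX B = dY 0 + dX B" by (simp_all only: flin_0[OF lX] flin_0[OF lY] add_0_left add_0_right)
    then show "dY B \<in> M" "dX B \<in> M" unfolding M_def using that fv.subspace_0[OF subspace_sym_forms] by blast+
  qed
  have cofixed: "B \<in> M" if B: "B \<in> ?L" for B
  proof -
    obtain P where P: "flin P" "\<And>x. P x \<in> M" "\<And>x. x \<in> M \<Longrightarrow> P x = x"
      using projection_exists[OF sM] by metis
    have "B = P B"
    proof
      fix q
      \<comment> \<open>a functional vanishing on all differences, hence an invariant symmetric tensor\<close>
      define l where "l C = C q - P C q" for C
      have l_add: "l (C + C') = l C + l C'" and l_scale: "l (fscale c C) = c * l C" for c C C'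
        by (simp_all add: l_def flin_simps[OF P(1)] algebra_simps)
      have l_sum: "l (\<Sum>i\<in>I. f i) = (\<Sum>i\<in>I. l (f i))" for I :: "nat set" and f
        by (simp add: l_def flin_sum[OF P(1)] sum_subtractf)
      have lM: "l C = 0" if "C \<in> M" for C using P(3)[OF that] by (simp add: l_def)
      have l_diff: "l (C - C') = l C - l C'" for C C' by (simp add: l_def flin_diff[OF P(1)])
      have lX: "l (?PX C) = l C" if "C \<in> ?L" for C using lM[OF dM(2)[OF that]] l_diff by (simp add: dX_def)
      have lY: "l (?PY C) = l C" if "C \<in> ?L" for C using lM[OF dM(1)[OF that]] l_diff by (simp add: dY_def)
      define C where "C = (\<lambda>(u, v). if u \<in> space m \<and> v \<in> space m then l (square_form m u v) else 0)"
      have C: "C \<in> ?L"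
      proof -
        have sq: "square_form m (u + u') v = square_form m u v + square_form m u' v"
          "square_form m (fscale c u) v = fscale c (square_form m u v)" if "u \<in> space m" "u' \<in> space m" "v \<in> space m" for c u u' v
          using that by (auto simp: square_form_def fun_eq_iff om_simps algebra_simps)
        have sy: "square_form m u v = square_form m v u" for u v
          by (auto simp: square_form_def fun_eq_iff algebra_simps)
        have "C \<in> forms (space m) (space m)"
        proof (rule formsI)
          fix x y z :: "nat \<Rightarrow> 'k" assume a: "x \<in> space m" "y \<in> space m" "z \<in> space m"
          show "C (x + y, z) = C (x, z) + C (y, z)" using a sq(1)[OF a] by (simp add: C_def l_add)
          show "C (x, y + z) = C (x, y) + C (x, z)"
            using a sq(1)[OF a(2,3,1)] sy[of x] by (simp add: C_def l_add)
        next
          fix c and x y :: "nat \<Rightarrow> 'k" assume a: "x \<in> space m" "y \<in> space m"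
          show "C (fscale c x, y) = c * C (x, y)" using a sq(2)[OF a(1,1,2)] by (simp add: C_def l_scale)
          show "C (x, fscale c y) = c * C (x, y)" using a sq(2)[OF a(2,2,1)] sy[of x] by (simp add: C_def l_scale)
        qed (auto simp: C_def)
        moreover have "C (x, y) = C (y, x)" for x y using sy[of x y] by (simp add: C_def)
        ultimately show ?thesis unfolding sym_forms_def by blast
      qed
      have "l (square_form m (T u) (T v)) = l (square_form m u v)"
        if T: "sp_op m T" "\<And>C. C \<in> ?L \<Longrightarrow> l (pullback m T C) = l C" and uv: "u \<in> space m" "v \<in> space m" for T u v
      proof -
        have "pullback m T (square_form m (T u) (T v)) = square_form m u v"
          using uv sp_opD[OF T(1)] by (auto simp: pullback_def square_form_def fun_eq_iff)
        then show ?thesis using T(2)[OF square_form_sym_forms[OF sp_opD(2)[OF T(1) uv(1)] sp_opD(2)[OF T(1) uv(2)]]] by simp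
      qed
      then have "pullback m T C = C" if "sp_op m T" "\<And>C. C \<in> ?L \<Longrightarrow> l (pullback m T C) = l C" for T
        unfolding pullback_fixed_iff[OF C] using that sp_opD(2)[OF that(1)] by (simp add: C_def)
      then have "C = 0" using irr[OF C] X Y lX lY by blast
      then have C0: "C (u, v) = 0" for u v by (simp only: zero_fun_apply)
      have l0: "l (square_form m u v) = 0" if "u \<in> space m" "v \<in> space m" for u v
      proof -
        have "C (u, v) = l (square_form m u v)" using that by (simp add: C_def)
        then show ?thesis by (simp only: C0)
      qed
      have "l B = 0"
        by (subst sym_form_expand[OF B two]) (simp add: l_scale l_sum l0 coord_vec_space)
      then show "B q = P B q" by (simp add: l_def)
    qed
    then show ?thesis using P(2)[of B] by simp
  qed
  have "fv.dim {v \<in> ?L. ?PY v = v} + fv.dim {v \<in> ?L. ?PX v = v} + fv.dim {v \<in> ?L. ?PY (?PX v) = v} \<le> fv.dim ?L"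
  proof (rule scott_inequality[OF subspace_sym_forms sym_forms_dim(1) lin_pullback pullback_sym_forms[OF Y] lin_pullback pullback_sym_forms[OF X] inj])
    show "B = 0" if "B \<in> ?L" "?PY B = B" "?PX B = B" for B using irr that by blast
    show "\<exists>a\<in>?L. \<exists>b\<in>?L. B = (a - ?PY a) + (b - ?PX b)" if "B \<in> ?L" for B
      using cofixed[OF that] unfolding M_def dX_def dY_def by blast
  qed
  then show ?thesis using sym_forms_dim(2)[of m, where 'k='k] unfolding XY by linarith
qed

lemmas pointwise = zero_fun_apply plus_fun_apply sum_fun_apply fscale_apply minus_apply uminus_apply
declare pointwise [simp del]

section \<open>Fixed vectors of semilinear maps\<close>

text \<open>The exponent \<open>q\<close> need not be known to be a power of the characteristic; additivity of \<open>\<phi>\<close> suffices.\<close>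

locale semilinear_bijection =
  fixes V :: "('a \<Rightarrow> 'k::alg_closed_field) set" and \<phi> :: "('a \<Rightarrow> 'k) \<Rightarrow> 'a \<Rightarrow> 'k" and q :: nat
  assumes subV: "fv.subspace V" and fdV: "fd V"
    and phi_V: "\<And>x. x \<in> V \<Longrightarrow> \<phi> x \<in> V"
    and phi_add: "\<And>x y. x \<in> V \<Longrightarrow> y \<in> V \<Longrightarrow> \<phi> (x + y) = \<phi> x + \<phi> y"
    and phi_scale: "\<And>c x. x \<in> V \<Longrightarrow> \<phi> (fscale c x) = fscale (c ^ q) (\<phi> x)"
    and phi_inj: "\<And>x. x \<in> V \<Longrightarrow> \<phi> x = 0 \<Longrightarrow> x = 0"
    and q2: "q \<ge> 2"
begin

lemma phi_0: "\<phi> 0 = 0"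
  using phi_scale[of 0 0] fv.subspace_0[OF subV] q2 by (simp add: power_0_left)

lemma phi_diff: "x \<in> V \<Longrightarrow> y \<in> V \<Longrightarrow> \<phi> (x - y) = \<phi> x - \<phi> y"
  using phi_add[of "x - y" y] fv.subspace_diff[OF subV] by (simp add: algebra_simps)

lemma phi_sum: "(\<And>i. i \<in> I \<Longrightarrow> f i \<in> V) \<Longrightarrow> \<phi> (\<Sum>i\<in>I. f i) = (\<Sum>i\<in>I. \<phi> (f i))"
proof (induction I rule: infinite_finite_induct)
  case (insert x F)
  then have "(\<Sum>i\<in>F. f i) \<in> V" using fv.subspace_sum[OF subV] by blast
  then show ?case using insert phi_add by simp
qed (simp_all add: phi_0)

lemma phi_pow_V: "x \<in> V \<Longrightarrow> (\<phi> ^^ i) x \<in> V"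
  by (induction i) (auto simp: phi_V)

definition Fix :: "('a \<Rightarrow> 'k) set" where "Fix = {x \<in> V. \<phi> x = x}"
definition U :: "('a \<Rightarrow> 'k) set" where "U = fv.span Fix"

lemma U_V: "U \<subseteq> V" unfolding U_def by (rule fv.span_minimal[OF _ subV]) (auto simp: Fix_def)
lemma Fix_U: "f \<in> Fix \<Longrightarrow> f \<in> U" by (simp add: U_def fv.span_base)
lemma subU: "fv.subspace U" by (simp add: U_def)

lemma U_induct [consumes 1, case_names zero step]:
  assumes "u \<in> U" "P 0" "\<And>c f y. f \<in> Fix \<Longrightarrow> y \<in> U \<Longrightarrow> P y \<Longrightarrow> P (fscale c f + y)"
  shows "P u"
proof -
  have "u \<in> U \<and> P u"
    using assms(1) unfolding U_def
  proof (induction rule: fv.span_induct_alt)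
    case base show ?case using assms(2) fv.span_zero by blast
  next
    case (step c f y)
    then have y: "y \<in> U" "P y" by (simp_all add: U_def)
    have "fscale c f + y \<in> U" using fv.span_base[OF step(1)] y(1) fv.subspace_add[OF subU] fv.subspace_scale[OF subU] by (simp add: U_def)
    then show ?case using assms(3)[OF step(1) y] by (simp add: U_def)
  qed
  then show ?thesis by blast
qed

lemma root_additive:
  assumes "n \<ge> 2"
  shows "\<exists>x::'k. x ^ n - x = c"
proof -
  let ?p = "Polynomial.monom 1 n - [:c, 1:] :: 'k poly"
  have "Polynomial.coeff ?p n = 1" using assms by (auto simp: coeff_pCons split: nat.splits)
  then have "degree ?p \<ge> n" by (intro le_degree) (simp only: one_neq_zero not_False_eq_True)
  then have "degree ?p > 0" using assms by linarith
  then obtain x where "poly ?p x = 0" using alg_closed_imp_poly_has_root by blast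
  then have "x ^ n - x = c" by (simp add: poly_monom algebra_simps)
  then show ?thesis ..
qed

text \<open>On a fixed vector the equation becomes \<open>t\<^sup>q - t = c\<close>, which is solvable over an algebraically closed field.\<close>

lemma U_artin_schreier: "u \<in> U \<Longrightarrow> \<exists>w\<in>U. \<phi> w - w = u"
proof (induction rule: U_induct)
  case zero show ?case using fv.subspace_0[OF subU] phi_0 by (intro bexI[of _ 0]) auto
next
  case (step c f y)
  then obtain w where w: "w \<in> U" "\<phi> w - w = y" by blast
  obtain d where d: "d ^ q - d = c" using root_additive[OF q2] by blast
  have f: "f \<in> V" "\<phi> f = f" "f \<in> U" using step(1) Fix_U[OF step(1)] by (auto simp: Fix_def)
  have df: "fscale d f \<in> U" using f(3) fv.subspace_scale[OF subU] by blast
  have "\<phi> (fscale d f + w) = fscale (d ^ q) f + \<phi> w"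
    using phi_add[of "fscale d f" w] phi_scale[OF f(1)] f(2) df w(1) U_V by auto
  then have "\<phi> (fscale d f + w) - (fscale d f + w) = fscale (d ^ q - d) f + (\<phi> w - w)"
    by (simp add: fun_eq_iff pointwise algebra_simps)
  then show ?case using d w df fv.subspace_add[OF subU] by metis
qed

lemma U_image: "u \<in> U \<Longrightarrow> \<exists>w\<in>U. \<phi> w = u"
proof (induction rule: U_induct)
  case zero show ?case using fv.subspace_0[OF subU] phi_0 by (intro bexI[of _ 0]) auto
next
  case (step c f y)
  then obtain w where w: "w \<in> U" "\<phi> w = y" by blast
  obtain d where d: "d ^ q = c" using nth_root_exists[of q c] q2 by auto
  have f: "f \<in> V" "\<phi> f = f" "f \<in> U" using step(1) Fix_U[OF step(1)] by (auto simp: Fix_def)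
  have df: "fscale d f \<in> U" using f(3) fv.subspace_scale[OF subU] by blast
  have "\<phi> (fscale d f + w) = fscale c f + y"
    using phi_add[of "fscale d f" w] phi_scale[OF f(1)] f(2) df w U_V d by auto
  then show ?case using df w(1) fv.subspace_add[OF subU] by blast
qed

lemma U_image_pow: "u \<in> U \<Longrightarrow> \<exists>w\<in>U. (\<phi> ^^ k) w = u"
proof (induction k arbitrary: u)
  case (Suc k)
  then obtain w where "w \<in> U" "\<phi> w = u" using U_image by blast
  moreover then obtain w' where "w' \<in> U" "(\<phi> ^^ k) w' = w" using Suc by blast
  ultimately show ?case by (intro bexI[of _ w']) auto
qed auto

lemma phi_pow_inj: "x \<in> V \<Longrightarrow> y \<in> V \<Longrightarrow> (\<phi> ^^ k) x = (\<phi> ^^ k) y \<Longrightarrow> x = y"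
proof (induction k)
  case (Suc k)
  have "\<phi> ((\<phi> ^^ k) x - (\<phi> ^^ k) y) = 0" using Suc.prems phi_diff phi_pow_V by simp
  then have "(\<phi> ^^ k) x - (\<phi> ^^ k) y = 0" using phi_inj fv.subspace_diff[OF subV] phi_pow_V Suc.prems by blast
  then show ?case using Suc by (simp only: right_minus_eq)
qed simp

definition orbit_span :: "('a \<Rightarrow> 'k) \<Rightarrow> nat \<Rightarrow> ('a \<Rightarrow> 'k) set" where
  "orbit_span v k = {u + (\<Sum>i<k. fscale (a i) ((\<phi> ^^ i) v)) |u a. u \<in> U}"

lemma orbit_spanI: "u \<in> U \<Longrightarrow> x = u + (\<Sum>i<k. fscale (a i) ((\<phi> ^^ i) v)) \<Longrightarrow> x \<in> orbit_span v k"
  unfolding orbit_span_def by blast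

lemma subspace_orbit_span: "fv.subspace (orbit_span v k)"
  unfolding fv.subspace_def
proof (intro conjI ballI allI)
  show "0 \<in> orbit_span v k"
    by (rule orbit_spanI[OF fv.subspace_0[OF subU], where a = "\<lambda>_. 0"]) simp
  fix x assume "x \<in> orbit_span v k"
  then obtain u a where x: "u \<in> U" "x = u + (\<Sum>i<k. fscale (a i) ((\<phi> ^^ i) v))" unfolding orbit_span_def by blast
  {
    fix y assume "y \<in> orbit_span v k"
    then obtain w b where y: "w \<in> U" "y = w + (\<Sum>i<k. fscale (b i) ((\<phi> ^^ i) v))" unfolding orbit_span_def by blast
    show "x + y \<in> orbit_span v k"
      by (rule orbit_spanI[OF fv.subspace_add[OF subU x(1) y(1)], where a = "\<lambda>i. a i + b i"])
        (unfold x(2) y(2), simp only: fv.scale_left_distrib sum.distrib add.assoc add.left_commute)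
  }
  fix c
  show "fscale c x \<in> orbit_span v k"
    by (rule orbit_spanI[OF fv.subspace_scale[OF subU x(1)], where a = "\<lambda>i. c * a i"])
      (unfold x(2), simp only: fv.scale_right_distrib fv.scale_sum_right fv.scale_scale)
qed

lemma orbit_span_V: "v \<in> V \<Longrightarrow> orbit_span v k \<subseteq> V"
proof
  fix x assume v: "v \<in> V" and "x \<in> orbit_span v k"
  then obtain u a where x: "u \<in> U" "x = u + (\<Sum>i<k. fscale (a i) ((\<phi> ^^ i) v))" unfolding orbit_span_def by blast
  show "x \<in> V" unfolding x(2)
    by (intro fv.subspace_add[OF subV] fv.subspace_sum[OF subV] fv.subspace_scale[OF subV] phi_pow_V v)
      (use x(1) U_V in blast)
qed

lemma orbit_span_Suc: "orbit_span v k \<subseteq> orbit_span v (Suc k)"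
proof
  fix x assume "x \<in> orbit_span v k"
  then obtain u a where x: "u \<in> U" "x = u + (\<Sum>i<k. fscale (a i) ((\<phi> ^^ i) v))" unfolding orbit_span_def by blast
  show "x \<in> orbit_span v (Suc k)"
    by (rule orbit_spanI[OF x(1), where a = "\<lambda>i. if i < k then a i else 0"]) (simp add: x(2))
qed

lemma orbit_span_last: "(\<phi> ^^ k) v \<in> orbit_span v (Suc k)"
  by (rule orbit_spanI[OF fv.subspace_0[OF subU], where a = "\<lambda>i. if i < k then 0 else 1"]) simp

text \<open>Otherwise the spans of the orbit segments would have unbounded dimension.\<close>

lemma orbit_relation: assumes v: "v \<in> V" shows "\<exists>k. (\<phi> ^^ k) v \<in> orbit_span v k"
proof (rule ccontr)
  assume no: "\<nexists>k. (\<phi> ^^ k) v \<in> orbit_span v k"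
  have fdo: "fd (orbit_span v k)" for k using fd_subset[OF fdV orbit_span_V[OF v]] .
  have "k \<le> fv.dim (orbit_span v k)" for k
  proof (induction k)
    case (Suc k)
    have "\<not> fv.dim (orbit_span v (Suc k)) \<le> fv.dim (orbit_span v k)"
    proof
      assume "fv.dim (orbit_span v (Suc k)) \<le> fv.dim (orbit_span v k)"
      then have "orbit_span v k = orbit_span v (Suc k)"
        by (rule fd_dim_equal[OF subspace_orbit_span fdo orbit_span_Suc])
      then show False using no orbit_span_last by blast
    qed
    then show ?case using Suc by linarith
  qed simp
  then have "Suc (fv.dim V) \<le> fv.dim (orbit_span v (Suc (fv.dim V)))" .
  also have "\<dots> \<le> fv.dim V" by (rule fd_dim_mono[OF fdV orbit_span_V[OF v]])
  finally show False by simp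
qed

text \<open>If \<open>\<phi>\<^sup>k v\<close> is a combination of the earlier members of the orbit, then a vector \<open>\<Sum> t\<^sub>i \<phi>\<^sup>i v\<close> is fixed exactly when its
coefficients solve a recursion; this polynomial expresses the \<open>i\<close>-th coefficient through the last one.\<close>

primrec recursion_poly :: "(nat \<Rightarrow> 'k) \<Rightarrow> nat \<Rightarrow> 'k poly" where
  "recursion_poly a 0 = Polynomial.monom (a 0) q"
| "recursion_poly a (Suc i) = recursion_poly a i ^ q + Polynomial.monom (a (Suc i)) q"

lemma recursion_poly_degree:
  "recursion_poly a i = 0 \<or> q \<le> degree (recursion_poly a i)"
  "(\<exists>j\<le>i. a j \<noteq> 0) \<Longrightarrow> recursion_poly a i \<noteq> 0"
proof (induction i)
  case 0
  { case 1 show ?case by (cases "a 0 = 0") (auto simp: degree_monom_eq) }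
  { case 2 then show ?case by auto }
next
  case (Suc i)
  let ?p = "recursion_poly a i"
  have big: "degree (recursion_poly a (Suc i)) = degree (?p ^ q) \<and> q \<le> degree (?p ^ q) \<and> recursion_poly a (Suc i) \<noteq> 0" if "?p \<noteq> 0"
  proof -
    have "q \<le> degree ?p" using Suc(1) that by blast
    then have "q * 2 \<le> q * degree ?p" using q2 by (intro mult_le_mono2) linarith
    then have d: "q < degree (?p ^ q)" using q2 that by (simp add: degree_power_eq mult.commute)
    have "degree (Polynomial.monom (a (Suc i)) q) \<le> q" by (rule degree_monom_le)
    then have "degree (recursion_poly a (Suc i)) = degree (?p ^ q)" using d by (simp add: degree_add_eq_left)
    then show ?thesis using d by auto
  qed
  have zero: "recursion_poly a (Suc i) = Polynomial.monom (a (Suc i)) q" if "?p = 0" using that q2 by (simp add: power_0_left)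
  { case 1
    show ?case
    proof (cases "?p = 0")
      case True
      show ?thesis unfolding zero[OF True] by (cases "a (Suc i) = 0") (auto simp: degree_monom_eq)
    next
      case False
      then show ?thesis using big by simp
    qed }
  { case 2
    show ?case
    proof (cases "?p = 0")
      case True
      then have "\<not> (\<exists>j\<le>i. a j \<noteq> 0)" using Suc(2) by blast
      then have "a (Suc i) \<noteq> 0" using 2 le_Suc_eq by auto
      then show ?thesis unfolding zero[OF True] by simp
    qed (use big in blast) }
qed

lemma monom_q: "Polynomial.monom c q = Polynomial.monom 1 2 * Polynomial.monom (c :: 'k) (q - 2)"
  by (simp only: mult_monom mult_1_left le_add_diff_inverse[OF q2])

lemma recursion_poly_dvd: "Polynomial.monom 1 2 dvd recursion_poly a i"
proof (induction i)
  case 0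
  show ?case by (simp only: recursion_poly.simps monom_q dvd_triv_left)
next
  case (Suc i)
  have "Polynomial.monom 1 2 dvd Polynomial.monom (a (Suc i)) q" by (simp only: monom_q dvd_triv_left)
  moreover have "recursion_poly a i dvd recursion_poly a i ^ q" using q2 by (simp add: dvd_power)
  then have "Polynomial.monom 1 2 dvd recursion_poly a i ^ q" by (rule dvd_trans[OF Suc])
  ultimately show ?case unfolding recursion_poly.simps by (intro dvd_add)
qed

text \<open>The polynomial is divisible by the square of the indeterminate, so subtracting the indeterminate leaves a nonzero root.\<close>

lemma recursion_root:
  assumes "recursion_poly a i \<noteq> 0"
  shows "\<exists>t. t \<noteq> 0 \<and> poly (recursion_poly a i) t = t"
proof -
  obtain r where r: "recursion_poly a i = Polynomial.monom 1 2 * r" using recursion_poly_dvd by blast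
  have "r \<noteq> 0" using r assms by auto
  then have "degree (pCons (- 1) r) > 0" by simp
  then obtain t where t: "poly (pCons (- 1) r) t = 0" using alg_closed_imp_poly_has_root by blast
  then have "t * poly r t = 1" by simp
  moreover have "poly (recursion_poly a i) t = t * (t * poly r t)" unfolding r by (simp add: poly_monom power2_eq_square)
  ultimately show ?thesis by (intro exI[of _ t]) auto
qed

text \<open>If some vector were outside the span \<open>U\<close> of the fixed vectors, a linear recursion in its orbit would produce a vector that is
fixed modulo \<open>U\<close> and not in \<open>U\<close>. Since \<open>\<phi> - 1\<close> maps \<open>U\<close> onto itself, it can be corrected by an element of \<open>U\<close> to a
fixed vector outside \<open>U\<close>, a contradiction.\<close>

theorem fixed_vectors_span: "V \<subseteq> fv.span {x \<in> V. \<phi> x = x}"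
proof (rule ccontr)
  assume "\<not> ?thesis"
  then obtain v where v: "v \<in> V" "v \<notin> U" by (auto simp: U_def Fix_def)
  define k where "k = (LEAST k. (\<phi> ^^ k) v \<in> orbit_span v k)"
  have k: "(\<phi> ^^ k) v \<in> orbit_span v k" unfolding k_def using orbit_relation[OF v(1)] by (rule LeastI_ex)
  have min: "(\<phi> ^^ j) v \<notin> orbit_span v j" if "j < k" for j using that not_less_Least unfolding k_def by blast
  obtain u a where ua: "u \<in> U" "(\<phi> ^^ k) v = u + (\<Sum>i<k. fscale (a i) ((\<phi> ^^ i) v))"
    using k unfolding orbit_span_def by blast
  have indep: "\<forall>i<k. b i = 0" if b: "(\<Sum>i<k. fscale (b i) ((\<phi> ^^ i) v)) \<in> U" for b
  proof (rule ccontr)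
    assume "\<not> (\<forall>i<k. b i = 0)"
    then have ne: "{i. i < k \<and> b i \<noteq> 0} \<noteq> {}" by auto
    define j where "j = Max {i. i < k \<and> b i \<noteq> 0}"
    have j: "j < k" "b j \<noteq> 0" using Max_in[OF _ ne] by (auto simp: j_def)
    have above: "b i = 0" if "j < i" "i < k" for i
    proof (rule ccontr)
      assume "b i \<noteq> 0"
      then have "i \<le> j" unfolding j_def using that by (intro Max_ge) auto
      then show False using that by simp
    qed
    let ?s = "\<Sum>i<k. fscale (b i) ((\<phi> ^^ i) v)"
    have "?s = (\<Sum>i<Suc j. fscale (b i) ((\<phi> ^^ i) v))"
      by (rule sum.mono_neutral_right) (use j above in \<open>auto simp: not_less less_Suc_eq_le\<close>)
    then have "fscale (b j) ((\<phi> ^^ j) v) = ?s - (\<Sum>i<j. fscale (b i) ((\<phi> ^^ i) v))" by (simp add: algebra_simps)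
    then have e: "b j * (\<phi> ^^ j) v p = ?s p - (\<Sum>i<j. b i * (\<phi> ^^ i) v p)" for p
      by (simp add: fun_eq_iff pointwise)
    have "(\<phi> ^^ j) v = fscale (1 / b j) ?s + (\<Sum>i<j. fscale (- (b i / b j)) ((\<phi> ^^ i) v))"
    proof
      fix p
      have "(\<Sum>i<j. - (b i / b j) * (\<phi> ^^ i) v p) = - (\<Sum>i<j. b i * (\<phi> ^^ i) v p) / b j"
        by (simp add: sum_divide_distrib sum_negf)
      moreover have "(\<phi> ^^ j) v p = ?s p / b j - (\<Sum>i<j. b i * (\<phi> ^^ i) v p) / b j"
        using e[of p] j(2) by (simp only: diff_divide_distrib[symmetric]) (simp add: field_simps)
      ultimately show "(\<phi> ^^ j) v p = (fscale (1 / b j) ?s + (\<Sum>i<j. fscale (- (b i / b j)) ((\<phi> ^^ i) v))) p"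
        by (simp only: plus_fun_apply fscale_apply sum_fun_apply) simp
    qed
    then have "(\<phi> ^^ j) v \<in> orbit_span v j"
      by (rule orbit_spanI[OF fv.subspace_scale[OF subU b]])
    then show False using min j(1) by blast
  qed
  have k0: "k > 0"
  proof (rule ccontr)
    assume "\<not> k > 0"
    then have "v \<in> U" using ua by simp
    then show False using v by blast
  qed
  have "\<exists>i<k. a i \<noteq> 0"
  proof (rule ccontr)
    assume "\<not> (\<exists>i<k. a i \<noteq> 0)"
    then have "(\<phi> ^^ k) v = u" using ua(2) by simp
    moreover obtain w where "w \<in> U" "(\<phi> ^^ k) w = u" using U_image_pow[OF ua(1)] by blast
    ultimately have "w \<in> U" "(\<phi> ^^ k) v = (\<phi> ^^ k) w" by simp_all
    then show False using phi_pow_inj[OF v(1), of w k] v(2) U_V by (metis subsetD)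
  qed
  then obtain i where i: "i < k" "a i \<noteq> 0" by blast
  then have "i \<le> k - 1" by simp
  then have "recursion_poly a (k - 1) \<noteq> 0" using i(2) by (intro recursion_poly_degree(2)) blast
  then obtain t where t: "t \<noteq> 0" "poly (recursion_poly a (k - 1)) t = t" using recursion_root by blast
  \<comment> \<open>a vector outside \<open>U\<close> that is fixed modulo \<open>U\<close>\<close>
  define b where "b i = poly (recursion_poly a i) t" for i
  define x where "x = (\<Sum>i<k. fscale (b i) ((\<phi> ^^ i) v))"
  have xV: "x \<in> V" unfolding x_def by (intro fv.subspace_sum[OF subV] fv.subspace_scale[OF subV] phi_pow_V v)
  obtain k' where k': "k = Suc k'" using k0 by (cases k) auto
  have bk: "b k' = t" using t k' by (simp add: b_def)
  have b0: "b 0 = a 0 * t ^ q" and bS: "b (Suc i) = b i ^ q + a (Suc i) * t ^ q" for i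
    by (simp_all add: b_def poly_monom)
  have "\<phi> x = (\<Sum>i<k. fscale (b i ^ q) ((\<phi> ^^ Suc i) v))"
  proof -
    have "\<phi> x = (\<Sum>i<k. \<phi> (fscale (b i) ((\<phi> ^^ i) v)))"
      unfolding x_def by (rule phi_sum) (intro fv.subspace_scale[OF subV] phi_pow_V v)
    also have "\<dots> = (\<Sum>i<k. fscale (b i ^ q) ((\<phi> ^^ Suc i) v))"
      by (rule sum.cong) (simp_all only: phi_scale[OF phi_pow_V[OF v(1)]] funpow.simps o_apply)
    finally show ?thesis .
  qed
  also have "\<dots> = (\<Sum>i<k'. fscale (b i ^ q) ((\<phi> ^^ Suc i) v)) + fscale (t ^ q) ((\<phi> ^^ k) v)"
    by (simp only: k' sum.lessThan_Suc bk)
  also have "\<dots> = fscale (t ^ q) u + x"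
  proof
    fix p
    have "(\<Sum>i<k. a i * t ^ q * (\<phi> ^^ i) v p) + (\<Sum>i<k'. b i ^ q * (\<phi> ^^ Suc i) v p) = (\<Sum>i<k. b i * (\<phi> ^^ i) v p)"
      unfolding k' sum.lessThan_Suc_shift[of _ k'] b0 bS by (simp add: sum.distrib algebra_simps)
    then show "((\<Sum>i<k'. fscale (b i ^ q) ((\<phi> ^^ Suc i) v)) + fscale (t ^ q) ((\<phi> ^^ k) v)) p = (fscale (t ^ q) u + x) p"
      unfolding ua(2) x_def by (simp add: pointwise algebra_simps sum_distrib_left sum_distrib_right)
  qed
  finally have phx: "\<phi> x = fscale (t ^ q) u + x" .
  obtain w where w: "w \<in> U" "\<phi> w - w = fscale (t ^ q) u"
    using U_artin_schreier[OF fv.subspace_scale[OF subU ua(1)]] by blast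
  have wV: "w \<in> V" using w(1) U_V by blast
  have "\<phi> (x - w) = x - w"
    unfolding phi_diff[OF xV wV] phx w(2)[symmetric] by (simp add: fun_eq_iff pointwise)
  then have "x - w \<in> U" unfolding U_def by (intro fv.span_base) (simp add: Fix_def fv.subspace_diff[OF subV xV wV])
  then have "(x - w) + w \<in> U" using w(1) fv.subspace_add[OF subU] by blast
  then have "x \<in> U" by simp
  then have "b k' = 0" using indep[of b] k' unfolding x_def by blast
  then show False using bk t(1) by simp
qed

end

section \<open>Transvections\<close>

definition tv :: "nat \<Rightarrow> (nat \<Rightarrow> 'k::field) \<Rightarrow> 'k \<Rightarrow> (nat \<Rightarrow> 'k) \<Rightarrow> nat \<Rightarrow> 'k" where
  "tv m v s x = x + fscale (s * om m (x, v)) v"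

definition rv :: "nat \<Rightarrow> (nat \<Rightarrow> 'k::field) \<Rightarrow> (nat \<Rightarrow> 'k) \<Rightarrow> 'k \<Rightarrow> (nat \<Rightarrow> 'k) \<Rightarrow> nat \<Rightarrow> 'k" where
  "rv m v w s x = x + fscale s (fscale (om m (x, v)) w + fscale (om m (x, w)) v)"

text \<open>Invariance under the transvection along \<open>v\<close> forces \<open>B (v, v) = 0\<close> for \<open>v\<close> in \<open>S\<close>. As \<open>S\<close> is closed under addition,
polarization gives \<open>2 B (v, w) = 0\<close>.\<close>

lemma transvections_no_invariant_form:
  fixes B :: "(nat, 'k::field) form"
  assumes B: "B \<in> sym_forms m" and two: "(2::'k) \<noteq> 0"
    and S: "S \<subseteq> space m" "space m \<subseteq> fv.span S" "\<And>x y. x \<in> S \<Longrightarrow> y \<in> S \<Longrightarrow> x + y \<in> S"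
    and inv: "\<And>v. v \<in> S \<Longrightarrow> \<exists>s. s \<noteq> 0 \<and> (\<forall>x\<in>space m. \<forall>y\<in>space m. B (tv m v s x, tv m v s y) = B (x, y))"
  shows "B = 0"
proof -
  note F = sym_formsD[OF B]
  have diag: "B (v, v) = 0" if v: "v \<in> S" for v
  proof (cases "v = 0")
    case True then show ?thesis using forms_zero1[OF F subspace_space] by simp
  next
    case False
    have vV: "v \<in> space m" using v S(1) by blast
    obtain x where x: "x \<in> space m" "om m (x, v) \<noteq> 0" using om_nondeg[OF vV] False by blast
    obtain s where s: "s \<noteq> 0" "\<forall>x\<in>space m. \<forall>y\<in>space m. B (tv m v s x, tv m v s y) = B (x, y)" using inv[OF v] by blast
    have "tv m v s v = v" by (simp add: tv_def om_alt)
    then have "B (x, v) = B (x + fscale (s * om m (x, v)) v, v)" using s(2) x(1) vV by (metis tv_def)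
    also have "\<dots> = B (x, v) + s * om m (x, v) * B (v, v)" using x(1) vV by (simp add: forms_add1[OF F] forms_scale1[OF F])
    finally show ?thesis using s(1) x(2) by simp
  qed
  have "B (v, w) = 0" if vw: "v \<in> S" "w \<in> S" for v w
  proof -
    have V: "v \<in> space m" "w \<in> space m" using vw S(1) by auto
    have "B (v + w, v + w) = B (v, v) + B (v, w) + (B (w, v) + B (w, w))"
      using V by (simp add: forms_add1[OF F] forms_add2[OF F])
    then have "2 * B (v, w) = 0" using diag S(3) vw sym_forms_sym[OF B V] by simp
    then show ?thesis using two by simp
  qed
  then show ?thesis using forms_eq_0I[OF F subspace_space subspace_space S(1,2) S(1,2)] by blast
qed

section \<open>Matrices as operators\<close>

definition act :: "nat \<Rightarrow> 'k::field mat \<Rightarrow> (nat \<Rightarrow> 'k) \<Rightarrow> nat \<Rightarrow> 'k" where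
  "act m A x = (\<lambda>i. if i < 2 * m then \<Sum>j<2 * m. A $$ (i, j) * x j else 0)"

definition mof :: "nat \<Rightarrow> ((nat \<Rightarrow> 'k::field) \<Rightarrow> nat \<Rightarrow> 'k) \<Rightarrow> 'k mat" where
  "mof m T = mat (2 * m) (2 * m) (\<lambda>(i, j). T (delta j) i)"

lemma flin_act: "flin (act m A)"
  by (rule flinI) (auto simp: act_def fun_eq_iff pointwise sum.distrib sum_distrib_left algebra_simps)

lemma act_space [simp]: "act m A x \<in> space m"
  by (auto simp: act_def space_def supported_def)

lemma mof_carrier [simp]: "mof m T \<in> carrier_mat (2 * m) (2 * m)"
  by (simp add: mof_def)

lemma act_delta: "j < 2 * m \<Longrightarrow> act m A (delta j) = (\<lambda>i. if i < 2 * m then A $$ (i, j) else 0)"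
  by (auto simp: act_def delta_apply fun_eq_iff pointwise if_distrib cong: if_cong)

lemma space_expand: "x \<in> space m \<Longrightarrow> x = (\<Sum>i<2 * m. fscale (x i) (delta i))"
  unfolding space_def by (rule supported_expand) auto

lemma flin_eq_on_space:
  assumes "flin f" "flin g" "\<And>j. j < 2 * m \<Longrightarrow> f (delta j) = g (delta j)" "x \<in> space m"
  shows "f x = g x"
proof -
  have "f x = (\<Sum>i<2 * m. fscale (x i) (f (delta i)))"
    by (subst space_expand[OF assms(4)]) (simp only: flin_sum[OF assms(1)] flin_scale[OF assms(1)])
  also have "\<dots> = (\<Sum>i<2 * m. fscale (x i) (g (delta i)))" by (rule sum.cong) (use assms(3) in auto)
  also have "\<dots> = g x"
    by (subst (2) space_expand[OF assms(4)]) (simp only: flin_sum[OF assms(2)] flin_scale[OF assms(2)])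
  finally show ?thesis .
qed

lemma act_mof:
  assumes "flin T" "\<And>x. x \<in> space m \<Longrightarrow> T x \<in> space m" "x \<in> space m"
  shows "act m (mof m T) x = T x"
proof (rule flin_eq_on_space[OF flin_act assms(1) _ assms(3)])
  fix j assume j: "j < 2 * m"
  have "T (delta j) \<in> space m" using assms(2) j by simp
  then show "act m (mof m T) (delta j) = T (delta j)"
    unfolding act_delta[OF j] using j by (auto simp: mof_def space_def supported_def fun_eq_iff pointwise)
qed

lemma act_mult:
  assumes "A \<in> carrier_mat (2 * m) (2 * m)" "B \<in> carrier_mat (2 * m) (2 * m)" "x \<in> space m"
  shows "act m (A * B) x = act m A (act m B x)"
proof (rule flin_eq_on_space[OF flin_act flin_compose[OF flin_act flin_act] _ assms(3)])
  fix j assume j: "j < 2 * m"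
  show "act m (A * B) (delta j) = act m A (act m B (delta j))"
    unfolding act_delta[OF j] using assms(1,2) j
    by (auto simp: act_def fun_eq_iff pointwise scalar_prod_def atLeast0LessThan)
qed

lemma act_one: "x \<in> space m \<Longrightarrow> act m (1\<^sub>m (2 * m)) x = x"
  by (rule flin_eq_on_space[OF flin_act, of "\<lambda>x. x"])
    (auto simp: act_delta delta_apply fun_eq_iff pointwise intro: flinI)

lemma act_inject:
  assumes "A \<in> carrier_mat (2 * m) (2 * m)" "B \<in> carrier_mat (2 * m) (2 * m)"
    and "\<And>x. x \<in> space m \<Longrightarrow> act m A x = act m B x"
  shows "A = B"
proof (rule eq_matI)
  fix i j assume "i < dim_row B" "j < dim_col B"
  then have ij: "i < 2 * m" "j < 2 * m" using assms(2) by auto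
  have "act m A (delta j) i = act m B (delta j) i" using assms(3)[of "delta j"] ij by simp
  then show "A $$ (i, j) = B $$ (i, j)" using ij by (simp add: act_delta)
qed (use assms in auto)

lemma symplectic_form_carrier: "symplectic_form m \<in> carrier_mat (2 * m) (2 * m)"
  using four_block_carrier_mat[of "0\<^sub>m m m" m m "0\<^sub>m m m" m m] by (simp add: symplectic_form_def mult_2)

lemma symplectic_form_entry:
  assumes "i < 2 * m" "j < 2 * m"
  shows "symplectic_form m $$ (i, j) = (if j = i + m then 1 else if i = j + m then - 1 else (0::'k::field))"
  using assms unfolding symplectic_form_def by (auto simp: four_block_mat_def Let_def)

lemma gram_entry:
  assumes A: "A \<in> carrier_mat (2 * m) (2 * m)" and kl: "k < 2 * m" "l < 2 * m"
  shows "(transpose_mat A * symplectic_form m * A) $$ (k, l) = om m (act m A (delta k), act m A (delta l))"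
proof -
  note J = symplectic_form_carrier[of m, where 'a='a]
  have "(transpose_mat A * symplectic_form m * A) $$ (k, l)
      = (\<Sum>j<2 * m. (\<Sum>i<2 * m. A $$ (i, k) * symplectic_form m $$ (i, j)) * A $$ (j, l))"
    using A J kl by (simp add: scalar_prod_def atLeast0LessThan sum_distrib_left sum_distrib_right mult.assoc) (rule sum.swap)
  also have "\<dots> = (\<Sum>j<m + m. (\<Sum>i<m + m. A $$ (i, k) * symplectic_form m $$ (i, j)) * A $$ (j, l))" by (simp only: mult_2)
  also have "\<dots> = (\<Sum>j<m. - A $$ (j + m, k) * A $$ (j, l)) + (\<Sum>j<m. A $$ (j, k) * A $$ (j + m, l))"
    unfolding sum_lessThan_add
  proof (intro arg_cong2[of _ _ _ _ "(+)"] sum.cong refl arg_cong2[of _ _ _ _ "(*)"])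
    fix j assume "j \<in> {..<m}"
    then have j: "j < m" by simp
    have "(\<Sum>i<m. A $$ (i, k) * symplectic_form m $$ (i, j)) = 0"
      by (rule sum.neutral) (use j in \<open>auto simp: symplectic_form_entry\<close>)
    moreover have "(\<Sum>i<m. A $$ (m + i, k) * symplectic_form m $$ (m + i, j)) = (\<Sum>i<m. if i = j then - A $$ (j + m, k) else 0)"
      by (rule sum.cong) (use j in \<open>auto simp: symplectic_form_entry add.commute\<close>)
    ultimately show "(\<Sum>i<m. A $$ (i, k) * symplectic_form m $$ (i, j)) + (\<Sum>i<m. A $$ (m + i, k) * symplectic_form m $$ (m + i, j)) = - A $$ (j + m, k)"
      using j by simp
    have "(\<Sum>i<m. A $$ (i, k) * symplectic_form m $$ (i, m + j)) = (\<Sum>i<m. if i = j then A $$ (j, k) else 0)"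
      by (rule sum.cong) (use j in \<open>auto simp: symplectic_form_entry add.commute\<close>)
    moreover have "(\<Sum>i<m. A $$ (m + i, k) * symplectic_form m $$ (m + i, m + j)) = 0"
      by (rule sum.neutral) (use j in \<open>auto simp: symplectic_form_entry\<close>)
    ultimately show "(\<Sum>i<m. A $$ (i, k) * symplectic_form m $$ (i, m + j)) + (\<Sum>i<m. A $$ (m + i, k) * symplectic_form m $$ (m + i, m + j)) = A $$ (j, k)"
      using j by simp
  qed (simp_all add: add.commute)
  also have "\<dots> = om m (act m A (delta k), act m A (delta l))"
    unfolding om_eq[OF act_space act_space] using kl by (simp add: act_delta sum_subtractf sum_negf)
  finally show ?thesis .
qed

lemma om_delta:
  assumes "k < 2 * m" "l < 2 * m"
  shows "om m (delta k, delta l) = (symplectic_form m $$ (k, l) :: 'k::field)"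
proof -
  have "om m (delta k, delta l) = (\<Sum>i<m. (if i = k \<and> l = k + m then 1 else 0) - (if i = l \<and> k = l + m then 1 else (0::'k)))"
    using assms by (auto simp: om_eq delta_apply intro!: sum.cong)
  also have "\<dots> = (if l = k + m then 1 else 0) - (if k = l + m then 1 else 0)"
  proof -
    have "(\<Sum>i<m. if i = p \<and> Q then 1 else (0::'k)) = (if Q then 1 else 0)" if "Q \<Longrightarrow> p < m" for p Q
      using that by (cases Q) auto
    from this[of "l = k + m" k] this[of "k = l + m" l] show ?thesis using assms by (simp add: sum_subtractf)
  qed
  finally show ?thesis using assms by (auto simp: symplectic_form_entry)
qed

lemma symplectic_group_iff:
  "A \<in> carrier (symplectic_group m) \<longleftrightarrow> A \<in> carrier_mat (2 * m) (2 * m) \<and> sp_op m (act m (A :: 'k::field mat))"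
proof -
  have "transpose_mat A * symplectic_form m * A = symplectic_form m \<longleftrightarrow> sp_op m (act m A)"
    if A: "A \<in> carrier_mat (2 * m) (2 * m)"
  proof
    assume e: "transpose_mat A * symplectic_form m * A = symplectic_form m"
    define B where "B = (\<lambda>(x, y). if x \<in> space m \<and> y \<in> space m then om m (act m A x, act m A y) else 0)"
    have BF: "B \<in> forms (space m) (space m)"
      by (rule formsI) (auto simp: B_def flin_add[OF flin_act] flin_scale[OF flin_act] om_simps)
    have "B - om m = 0"
    proof (rule form_eq_0_on_basis[OF fv.subspace_diff[OF subspace_forms BF om_forms]])
      fix i j assume ij: "i < 2 * m" "j < 2 * m"
      show "(B - om m) (delta i, delta j) = 0"
        using gram_entry[OF A ij] om_delta[OF ij, where 'k='k] ij e by (simp add: B_def pointwise)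
    qed
    then have Bom: "B = om m" by (simp only: right_minus_eq)
    have "om m (act m A x, act m A y) = om m (x, y)" if "x \<in> space m" "y \<in> space m" for x y
    proof -
      have "B (x, y) = om m (act m A x, act m A y)" using that by (simp add: B_def)
      then show ?thesis by (simp only: Bom)
    qed
    then show "sp_op m (act m A)" by (simp add: sp_op_def flin_act)
  next
    assume s: "sp_op m (act m A)"
    show "transpose_mat A * symplectic_form m * A = symplectic_form m"
    proof (rule eq_matI)
      fix i j assume "i < dim_row (symplectic_form m :: 'k mat)" "j < dim_col (symplectic_form m :: 'k mat)"
      then have ij: "i < 2 * m" "j < 2 * m" using symplectic_form_carrier[of m, where 'a='k] by auto
      show "(transpose_mat A * symplectic_form m * A) $$ (i, j) = symplectic_form m $$ (i, j)"
        using gram_entry[OF A ij] om_delta[OF ij, where 'k='k] ij sp_opD(3)[OF s] by simp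
    qed (use A symplectic_form_carrier[of m, where 'a='k] in auto)
  qed
  then show ?thesis by (auto simp: symplectic_group_def matrix_group_def)
qed

section \<open>The symplectic group and its transvections\<close>

abbreviation Sp :: "nat \<Rightarrow> 'k::field mat set" where
  "Sp m \<equiv> carrier (symplectic_group m)"

lemma Sp_carrier: "A \<in> Sp m \<Longrightarrow> A \<in> carrier_mat (2 * m) (2 * m)"
  and Sp_op: "A \<in> Sp m \<Longrightarrow> sp_op m (act m A)"
  by (simp_all add: symplectic_group_iff)

lemma Sp_om: "A \<in> Sp m \<Longrightarrow> x \<in> space m \<Longrightarrow> y \<in> space m \<Longrightarrow> om m (act m A x, act m A y) = om m (x, y)"
  by (rule sp_opD(3)[OF Sp_op])

lemma mof_Sp: assumes "sp_op m T" shows "mof m T \<in> Sp m"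
  unfolding symplectic_group_iff
  using act_mof[OF sp_opD(1)[OF assms] sp_opD(2)[OF assms]] sp_opD(2,3)[OF assms] by (simp add: sp_op_def flin_act)

lemma act_mof_sp: "sp_op m T \<Longrightarrow> x \<in> space m \<Longrightarrow> act m (mof m T) x = T x"
  by (rule act_mof) (auto simp: sp_opD)

lemma Sp_act_mult: "A \<in> Sp m \<Longrightarrow> B \<in> Sp m \<Longrightarrow> x \<in> space m \<Longrightarrow> act m (A * B) x = act m A (act m B x)"
  by (rule act_mult) (auto simp: Sp_carrier)

lemma Sp_mult: "A \<in> Sp m \<Longrightarrow> B \<in> Sp m \<Longrightarrow> A * B \<in> Sp m"
  unfolding symplectic_group_iff[of "A * B"] sp_op_def
  using mult_carrier_mat[OF Sp_carrier Sp_carrier, of A m B] by (simp add: flin_act Sp_act_mult Sp_om)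

lemma Sp_one: "1\<^sub>m (2 * m) \<in> Sp m"
  by (auto simp: symplectic_group_iff sp_op_def flin_act act_one)

lemma Sp_eqI: "A \<in> Sp m \<Longrightarrow> B \<in> Sp m \<Longrightarrow> (\<And>x. x \<in> space m \<Longrightarrow> act m A x = act m B x) \<Longrightarrow> A = B"
  by (rule act_inject) (auto simp: Sp_carrier)

lemma Sp_act_inj: "A \<in> Sp m \<Longrightarrow> x \<in> space m \<Longrightarrow> act m A x = 0 \<Longrightarrow> x = (0 :: nat \<Rightarrow> 'k::field)"
proof (rule om_nondeg)
  fix y :: "nat \<Rightarrow> 'k" assume a: "A \<in> Sp m" "x \<in> space m" "act m A x = 0" "y \<in> space m"
  have "om m (y, x) = om m (act m A y, act m A x)" using Sp_om[OF a(1,4,2)] by simp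
  then show "om m (y, x) = 0" using forms_zero2[OF om_forms subspace_space] a(3) by simp
qed

lemma Sp_act_surj: assumes "A \<in> Sp m" shows "act m A ` space m = space m"
proof (rule fd_dim_equal)
  show "fv.subspace (act m A ` space m)" by (rule fp.linear_subspace_image[OF flin_act subspace_space])
  show "fv.dim (space m :: (nat \<Rightarrow> 'a) set) \<le> fv.dim (act m A ` space m)"
    by (rule dim_le_of_inj(2)[where f = "act m A" and U = "space m"])
      (use Sp_act_inj[OF assms] fd_image[OF flin_act fd_space] in \<open>auto simp: flin_act\<close>)
qed auto

lemma Sp_inverse:
  assumes A: "A \<in> Sp m"
  obtains B where "B \<in> Sp m" "B * A = 1\<^sub>m (2 * m)" "A * B = 1\<^sub>m (2 * m)"
proof -
  obtain g where g: "flin g" "\<And>x. g x \<in> space m" "\<And>v. v \<in> act m A ` space m \<Longrightarrow> act m A (g v) = v"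
    using right_inverse_exists[OF flin_act subspace_space] by metis
  have ag: "act m A (g v) = v" if "v \<in> space m" for v using g(3) that Sp_act_surj[OF A] by blast
  have sp: "sp_op m g"
    unfolding sp_op_def
  proof (intro conjI ballI)
    fix x y :: "nat \<Rightarrow> 'a" assume "x \<in> space m" "y \<in> space m"
    then show "om m (g x, g y) = om m (x, y)" using Sp_om[OF A g(2)[of x] g(2)[of y]] ag by simp
  qed (use g in auto)
  let ?B = "mof m g"
  have B: "?B \<in> Sp m" by (rule mof_Sp[OF sp])
  have "A * ?B = 1\<^sub>m (2 * m)"
    by (rule Sp_eqI[OF Sp_mult[OF A B] Sp_one]) (simp add: Sp_act_mult[OF A B] act_mof_sp[OF sp] ag act_one)
  moreover then have "?B * A = 1\<^sub>m (2 * m)"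
    by (rule mat_mult_left_right_inverse[OF Sp_carrier[OF A] Sp_carrier[OF B]])
  ultimately show thesis using that B by blast
qed

text \<open>The maps given by formulas with \<open>om\<close> are linear only on \<open>space m\<close>, where \<open>om\<close> is bilinear; this is enough to define a symplectic matrix.\<close>

definition sp_map :: "nat \<Rightarrow> ((nat \<Rightarrow> 'k::field) \<Rightarrow> nat \<Rightarrow> 'k) \<Rightarrow> bool" where
  "sp_map m T \<longleftrightarrow> (\<forall>x\<in>space m. \<forall>y\<in>space m. T (x + y) = T x + T y) \<and> (\<forall>c. \<forall>x\<in>space m. T (fscale c x) = fscale c (T x))
     \<and> (\<forall>x\<in>space m. T x \<in> space m) \<and> (\<forall>x\<in>space m. \<forall>y\<in>space m. om m (T x, T y) = om m (x, y))"

lemma sp_map_mof: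
  assumes T: "sp_map m (T :: (nat \<Rightarrow> 'k::field) \<Rightarrow> nat \<Rightarrow> 'k)"
  shows "mof m T \<in> Sp m" "x \<in> space m \<Longrightarrow> act m (mof m T) x = T x"
proof -
  define p :: "(nat \<Rightarrow> 'k) \<Rightarrow> nat \<Rightarrow> 'k" where "p x = (\<lambda>i. if i < 2 * m then x i else 0)" for x
  have p: "p (x + y) = p x + p y" "p (fscale c x) = fscale c (p x)" "p x \<in> space m" for x y c
    by (auto simp: p_def fun_eq_iff pointwise space_def supported_def)
  have p_id: "p x = x" if "x \<in> space m" for x
    using that by (auto simp: p_def fun_eq_iff space_def supported_def)
  let ?T = "\<lambda>x. T (p x)"
  have "flin ?T" using T p by (intro flinI) (auto simp: sp_map_def)
  then have sp: "sp_op m ?T" using T p_id by (simp add: sp_op_def sp_map_def)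
  have "mof m T = mof m ?T" by (rule eq_matI) (auto simp: mof_def p_id)
  then show "mof m T \<in> Sp m" "x \<in> space m \<Longrightarrow> act m (mof m T) x = T x"
    using mof_Sp[OF sp] act_mof_sp[OF sp] p_id by auto
qed

lemma sp_map_tv: "v \<in> space m \<Longrightarrow> sp_map m (tv m v s)"
  unfolding sp_map_def
proof (intro conjI ballI allI)
  fix x y :: "nat \<Rightarrow> 'a" assume a: "v \<in> space m" "x \<in> space m" "y \<in> space m"
  show "tv m v s (x + y) = tv m v s x + tv m v s y" "tv m v s x \<in> space m"
    using a by (simp_all add: tv_def om_simps fun_eq_iff pointwise algebra_simps)
  show "om m (tv m v s x, tv m v s y) = om m (x, y)"
    using a om_anti[of m v y] by (simp add: tv_def om_simps algebra_simps)
next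
  fix c :: 'a and x :: "nat \<Rightarrow> 'a" assume a: "v \<in> space m" "x \<in> space m"
  show "tv m v s (fscale c x) = fscale c (tv m v s x)"
    using a by (simp add: tv_def om_simps fun_eq_iff pointwise algebra_simps)
qed

lemma sp_map_rv: "v \<in> space m \<Longrightarrow> w \<in> space m \<Longrightarrow> om m (v, w) = 0 \<Longrightarrow> sp_map m (rv m v w s)"
  unfolding sp_map_def
proof (intro conjI ballI allI)
  fix x y :: "nat \<Rightarrow> 'a" assume a: "v \<in> space m" "w \<in> space m" "om m (v, w) = 0" "x \<in> space m" "y \<in> space m"
  show "rv m v w s (x + y) = rv m v w s x + rv m v w s y" "rv m v w s x \<in> space m"
    using a by (simp_all add: rv_def om_simps fun_eq_iff pointwise algebra_simps)
  show "om m (rv m v w s x, rv m v w s y) = om m (x, y)"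
    using a om_anti[of m v y] om_anti[of m w y] om_anti[of m w v] by (simp add: rv_def om_simps algebra_simps)
next
  fix c :: 'a and x :: "nat \<Rightarrow> 'a" assume a: "v \<in> space m" "w \<in> space m" "x \<in> space m"
  show "rv m v w s (fscale c x) = fscale c (rv m v w s x)"
    using a by (simp add: rv_def om_simps fun_eq_iff pointwise algebra_simps)
qed

abbreviation TV :: "nat \<Rightarrow> (nat \<Rightarrow> 'k::field) \<Rightarrow> 'k \<Rightarrow> 'k mat" where "TV m v s \<equiv> mof m (tv m v s)"
abbreviation RV :: "nat \<Rightarrow> (nat \<Rightarrow> 'k::field) \<Rightarrow> (nat \<Rightarrow> 'k) \<Rightarrow> 'k \<Rightarrow> 'k mat" where "RV m v w s \<equiv> mof m (rv m v w s)"

lemmas TV_Sp = sp_map_mof(1)[OF sp_map_tv]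
lemmas TV_act = sp_map_mof(2)[OF sp_map_tv]
lemmas RV_Sp = sp_map_mof(1)[OF sp_map_rv]
lemmas RV_act = sp_map_mof(2)[OF sp_map_rv]

lemma TV_conj:
  assumes "A \<in> Sp m" "v \<in> space m"
  shows "A * TV m v s = TV m (act m A v) s * A"
proof (rule Sp_eqI[where m = m])
  fix x :: "nat \<Rightarrow> 'a" assume x: "x \<in> space m"
  show "act m (A * TV m v s) x = act m (TV m (act m A v) s * A) x"
    using x assms Sp_om[OF assms(1) x assms(2)]
    by (simp add: Sp_act_mult TV_Sp TV_act) (simp add: tv_def flin_add[OF flin_act] flin_scale[OF flin_act])
qed (use assms in \<open>auto intro!: Sp_mult TV_Sp\<close>)

lemma TV_add: "v \<in> space m \<Longrightarrow> TV m v s * TV m v s' = TV m v (s + s')"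
  by (rule Sp_eqI[where m = m])
    (auto simp: Sp_act_mult TV_Sp TV_act Sp_mult tv_def om_simps fun_eq_iff pointwise algebra_simps)

lemma TV_0: "v \<in> space m \<Longrightarrow> TV m v 0 = 1\<^sub>m (2 * m)"
  by (rule Sp_eqI[where m = m]) (auto simp: TV_Sp TV_act Sp_one act_one tv_def)

lemma TV_scale: "v \<in> space m \<Longrightarrow> TV m (fscale c v) s = TV m v (c * c * s)"
  by (rule Sp_eqI[where m = m]) (auto simp: TV_Sp TV_act tv_def om_simps fun_eq_iff pointwise algebra_simps)

lemma RV_conj:
  assumes "A \<in> Sp m" "v \<in> space m" "w \<in> space m" "om m (v, w) = 0"
  shows "A * RV m v w s = RV m (act m A v) (act m A w) s * A"
proof (rule Sp_eqI[where m = m])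
  have o: "om m (act m A v, act m A w) = 0" using Sp_om[OF assms(1-3)] assms(4) by simp
  show "RV m (act m A v) (act m A w) s * A \<in> Sp m" by (rule Sp_mult[OF RV_Sp[OF act_space act_space o] assms(1)])
  fix x :: "nat \<Rightarrow> 'a" assume x: "x \<in> space m"
  show "act m (A * RV m v w s) x = act m (RV m (act m A v) (act m A w) s * A) x"
    using x assms o Sp_om[OF assms(1) x assms(2)] Sp_om[OF assms(1) x assms(3)]
    by (simp add: Sp_act_mult RV_Sp RV_act) (simp add: rv_def flin_add[OF flin_act] flin_scale[OF flin_act])
qed (rule Sp_mult[OF assms(1) RV_Sp[OF assms(2-4)]])

lemma RV_shift:
  assumes e: "e \<in> space m" "om m (e, v) = 0" and v: "v \<in> space m"
  shows "RV m (e + fscale c v) v s = TV m v (2 * s * c) * RV m e v s"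
proof (rule Sp_eqI[where m = m])
  have o: "om m (e + fscale c v, v) = 0" "e + fscale c v \<in> space m" using assms by (simp_all add: om_simps)
  show "RV m (e + fscale c v) v s \<in> Sp m" by (rule RV_Sp[OF o(2) v o(1)])
  show "TV m v (2 * s * c) * RV m e v s \<in> Sp m" by (rule Sp_mult[OF TV_Sp[OF v] RV_Sp[OF e(1) v e(2)]])
  fix x :: "nat \<Rightarrow> 'a" assume x: "x \<in> space m"
  have "om m (rv m e v s x, v) = om m (x, v)" "rv m e v s x \<in> space m"
    using x assms by (simp_all add: rv_def om_simps)
  then show "act m (RV m (e + fscale c v) v s) x = act m (TV m v (2 * s * c) * RV m e v s) x"
    using x assms o by (simp add: Sp_act_mult RV_Sp TV_Sp RV_act TV_act tv_def)
      (simp add: rv_def om_simps fun_eq_iff pointwise algebra_simps)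
qed

text \<open>A transvection is a commutator of elements of the unipotent radical of the stabilizer of a line.\<close>

lemma RV_commutator:
  assumes e: "e \<in> space m" "om m (e, v) = 0" and v: "v \<in> space m" and f: "f \<in> space m" "om m (v, f) = 0"
  shows "RV m v f s' * RV m e v s = TV m v (2 * s * s' * om m (e, f)) * RV m e v s * RV m v f s'"
proof -
  have S: "RV m v f s' \<in> Sp m" by (rule RV_Sp[OF v f])
  have 1: "act m (RV m v f s') v = v" using v f by (simp add: RV_act rv_def om_simps)
  have 2: "act m (RV m v f s') e = e + fscale (s' * om m (e, f)) v" using e v f by (simp add: RV_act rv_def om_simps)
  have "RV m v f s' * RV m e v s = RV m (e + fscale (s' * om m (e, f)) v) v s * RV m v f s'"
    using RV_conj[OF S e(1) v e(2)] unfolding 1 2 .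
  then show ?thesis unfolding RV_shift[OF e v] by (simp add: mult.assoc)
qed

lemma TV_sum:
  assumes a: "a \<in> space m" and b: "b \<in> space m" and o: "om m (a, b) = 0"
  shows "TV m (a + b) s = TV m (b - a) s * RV m a b (2 * s)"
proof (rule Sp_eqI[where m = m])
  have o': "om m (b, a) = 0" using o om_anti[of m b a] by simp
  have ab: "a + b \<in> space m" "b - a \<in> space m" using a b by simp_all
  show "TV m (a + b) s \<in> Sp m" by (rule TV_Sp[OF ab(1)])
  show "TV m (b - a) s * RV m a b (2 * s) \<in> Sp m" by (rule Sp_mult[OF TV_Sp[OF ab(2)] RV_Sp[OF a b o]])
  fix x :: "nat \<Rightarrow> 'a" assume x: "x \<in> space m"
  have "om m (rv m a b (2 * s) x, b - a) = om m (x, b - a)" "rv m a b (2 * s) x \<in> space m"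
    using x a b o o' by (simp_all add: rv_def om_simps)
  then show "act m (TV m (a + b) s) x = act m (TV m (b - a) s * RV m a b (2 * s)) x"
    using x a b o ab by (simp add: Sp_act_mult RV_Sp TV_Sp RV_act TV_act tv_def)
      (simp add: rv_def om_simps fun_eq_iff pointwise algebra_simps)
qed

inductive_set tgen :: "nat \<Rightarrow> (nat \<Rightarrow> 'k::field) set \<Rightarrow> 'k mat set" for m S where
  one: "1\<^sub>m (2 * m) \<in> tgen m S"
| step: "v \<in> S \<Longrightarrow> v \<in> space m \<Longrightarrow> A \<in> tgen m S \<Longrightarrow> TV m v s * A \<in> tgen m S"

lemma tgen_Sp: "A \<in> tgen m S \<Longrightarrow> A \<in> Sp m"
  by (induction rule: tgen.induct) (auto intro: Sp_one Sp_mult TV_Sp)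

lemma tgen_mono: "A \<in> tgen m S \<Longrightarrow> S \<subseteq> S' \<Longrightarrow> A \<in> tgen m S'"
  by (induction rule: tgen.induct) (auto intro: tgen.intros)

lemma tgen_TV: "v \<in> S \<Longrightarrow> v \<in> space m \<Longrightarrow> TV m v s \<in> tgen m S"
  using tgen.step[OF _ _ tgen.one, of v S m s] right_mult_one_mat[OF mof_carrier] by metis

lemma tgen_mult: "A \<in> tgen m S \<Longrightarrow> B \<in> tgen m S \<Longrightarrow> A * B \<in> tgen m S"
proof (induction rule: tgen.induct)
  case one
  then show ?case using left_mult_one_mat[OF Sp_carrier[OF tgen_Sp]] by metis
next
  case (step v A s)
  have "TV m v s * A * B = TV m v s * (A * B)"
    by (rule assoc_mult_mat[OF mof_carrier Sp_carrier[OF tgen_Sp[OF step(3)]] Sp_carrier[OF tgen_Sp[OF step(5)]]])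
  then show ?case using step tgen.step by metis
qed

lemma tgen_inverse:
  "A \<in> tgen m S \<Longrightarrow> \<exists>B\<in>tgen m S. B * A = 1\<^sub>m (2 * m) \<and> A * B = 1\<^sub>m (2 * m)"
proof (induction rule: tgen.induct)
  case one
  then show ?case using tgen.one by (intro bexI[of _ "1\<^sub>m (2 * m)"]) auto
next
  case (step v A s)
  then obtain B where B: "B \<in> tgen m S" "B * A = 1\<^sub>m (2 * m)" "A * B = 1\<^sub>m (2 * m)" by blast
  let ?T = "TV m v s" and ?T' = "TV m v (- s)"
  note c = Sp_carrier[OF tgen_Sp[OF step(3)]] Sp_carrier[OF tgen_Sp[OF B(1)]]
  have TT: "?T' * ?T = 1\<^sub>m (2 * m)" "?T * ?T' = 1\<^sub>m (2 * m)" using TV_add[OF step(2)] TV_0[OF step(2)] by simp_all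
  have "(B * ?T') * (?T * A) = B * (?T' * (?T * A))"
    by (rule assoc_mult_mat[OF c(2) mof_carrier mult_carrier_mat[OF mof_carrier c(1)]])
  also have "?T' * (?T * A) = (?T' * ?T) * A" by (rule assoc_mult_mat[OF mof_carrier mof_carrier c(1), symmetric])
  finally have "(B * ?T') * (?T * A) = B * ((?T' * ?T) * A)" .
  then have 1: "(B * ?T') * (?T * A) = 1\<^sub>m (2 * m)" using TT(1) B(2) c by simp
  have "(?T * A) * (B * ?T') = 1\<^sub>m (2 * m)"
    by (rule mat_mult_left_right_inverse[OF _ _ 1]) (use c in \<open>auto intro!: mult_carrier_mat[of _ "2 * m" "2 * m"]\<close>)
  moreover have "B * ?T' \<in> tgen m S" by (rule tgen_mult[OF B(1) tgen_TV[OF step(1,2)]])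
  ultimately show ?case using 1 by blast
qed

lemma tgen_fix:
  assumes "A \<in> tgen m S" "x \<in> space m" "\<And>v. v \<in> S \<Longrightarrow> v \<in> space m \<Longrightarrow> om m (x, v) = 0"
  shows "act m A x = x"
  using assms(1)
proof (induction rule: tgen.induct)
  case (step v A s)
  then show ?case using assms(2,3) by (simp add: Sp_act_mult TV_Sp tgen_Sp TV_act tv_def)
qed (simp add: act_one assms(2))

text \<open>The symplectic subspace spanned by the coordinate planes of index at least \<open>i\<close>.\<close>

definition tail :: "nat \<Rightarrow> nat \<Rightarrow> (nat \<Rightarrow> 'k::field) set" where
  "tail m i = {x \<in> space m. \<forall>j<i. x j = 0 \<and> x (j + m) = 0}"

lemma tail_space: "x \<in> tail m i \<Longrightarrow> x \<in> space m" by (simp add: tail_def)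
lemma tail_add: "x \<in> tail m i \<Longrightarrow> y \<in> tail m i \<Longrightarrow> x + y \<in> tail m i" by (simp add: tail_def pointwise)
lemma tail_diff: "x \<in> tail m i \<Longrightarrow> y \<in> tail m i \<Longrightarrow> x - y \<in> tail m i" by (simp add: tail_def pointwise)
lemma tail_delta: "i \<le> j \<Longrightarrow> j < m \<Longrightarrow> delta j \<in> tail m i" "i \<le> j \<Longrightarrow> j < m \<Longrightarrow> delta (j + m) \<in> tail m i"
  by (auto simp: tail_def delta_apply)
lemma tail_0: "tail m 0 = space m" by (auto simp: tail_def)

lemma om_delta_right:
  assumes "x \<in> space m" "j < m"
  shows "om m (x, delta j) = - x (j + m)" "om m (x, delta (j + m)) = x j"
proof -
  have "om m (x, delta j) = (\<Sum>i<m. if i = j then - x (j + m) else 0)"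
    unfolding om_eq[OF assms(1) space_delta[of j m, OF trans_less_add1[OF assms(2), of m, folded mult_2]]]
    by (rule sum.cong) (use assms in \<open>auto simp: delta_apply\<close>)
  then show "om m (x, delta j) = - x (j + m)" using assms(2) by simp
  have jm: "delta (j + m) \<in> space m" using assms(2) by (intro space_delta) simp
  have "om m (x, delta (j + m)) = (\<Sum>i<m. if i = j then x j else 0)"
    unfolding om_eq[OF assms(1) jm]
    by (rule sum.cong) (use assms in \<open>auto simp: delta_apply\<close>)
  then show "om m (x, delta (j + m)) = x j" using assms(2) by simp
qed

lemma om_delta_left:
  assumes "x \<in> space m" "j < m"
  shows "om m (delta j, x) = x (j + m)" "om m (delta (j + m), x) = - x j"
  unfolding om_anti[of m "delta j" x] om_anti[of m "delta (j + m)" x] om_delta_right[OF assms] by simp_all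

text \<open>A copy of \<open>Sp (2 (m - i))\<close>: the pointwise stabilizer of the first \<open>i\<close> coordinate planes.\<close>

definition stab :: "nat \<Rightarrow> nat \<Rightarrow> 'k::field mat set" where
  "stab m i = {A \<in> Sp m. \<forall>j<i. act m A (delta j) = delta j \<and> act m A (delta (j + m)) = delta (j + m)}"

lemma stab_Sp: "A \<in> stab m i \<Longrightarrow> A \<in> Sp m" by (simp add: stab_def)

lemma tail_iff: "i \<le> m \<Longrightarrow> x \<in> tail m i \<longleftrightarrow> x \<in> space m \<and> (\<forall>j<i. om m (x, delta j) = 0 \<and> om m (x, delta (j + m)) = 0)"
  by (auto simp: tail_def om_delta_right)

lemma stab_tail: assumes "A \<in> stab m i" "i \<le> m" "x \<in> tail m i" shows "act m A x \<in> tail m i"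
proof -
  have "om m (act m A x, delta j) = 0" "om m (act m A x, delta (j + m)) = 0" if "j < i" for j
  proof -
    have d: "delta j \<in> space m" "delta (j + m) \<in> space m" using that assms(2) by (auto intro!: space_delta)
    have A: "act m A (delta j) = delta j" "act m A (delta (j + m)) = delta (j + m)" using assms(1) that by (auto simp: stab_def)
    show "om m (act m A x, delta j) = 0" "om m (act m A x, delta (j + m)) = 0"
      using Sp_om[OF stab_Sp[OF assms(1)] tail_space[OF assms(3)] d(1)] Sp_om[OF stab_Sp[OF assms(1)] tail_space[OF assms(3)] d(2)] A
        assms(3) that tail_iff[OF assms(2)] by auto
  qed
  then show ?thesis unfolding tail_iff[OF assms(2)] by simp
qed

lemma tgen_stab: assumes "A \<in> tgen m (tail m i)" "i \<le> m" shows "A \<in> stab m i"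
proof -
  have "act m A (delta j) = delta j \<and> act m A (delta (j + m)) = delta (j + m)" if "j < i" for j
  proof (intro conjI; rule tgen_fix[OF assms(1)])
    fix v assume "v \<in> tail m i"
    then show "om m (delta j, v) = 0" "om m (delta (j + m), v) = 0"
      using that assms(2) by (auto simp: om_delta_left tail_def)
  qed (use that assms(2) in \<open>auto intro!: space_delta\<close>)
  then show ?thesis using tgen_Sp[OF assms(1)] by (simp add: stab_def)
qed

lemma stab_mult: "A \<in> stab m i \<Longrightarrow> B \<in> stab m i \<Longrightarrow> i \<le> m \<Longrightarrow> A * B \<in> stab m i"
  by (auto simp: stab_def Sp_mult Sp_act_mult)

lemma stab_inverse:
  assumes "A \<in> stab m i" "B \<in> Sp m" "B * A = 1\<^sub>m (2 * m)" "i \<le> m"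
  shows "B \<in> stab m i"
proof -
  have "act m B (act m A x) = x" if "x \<in> space m" for x
    using Sp_act_mult[OF assms(2) stab_Sp[OF assms(1)] that] act_one[OF that] assms(3) by simp
  note inv = this
  have "act m B (delta j) = delta j" "act m B (delta (j + m)) = delta (j + m)" if "j < i" for j
  proof -
    have A: "act m A (delta j) = delta j" "act m A (delta (j + m)) = delta (j + m)" using assms(1) that by (auto simp: stab_def)
    show "act m B (delta j) = delta j" using inv[of "delta j"] that assms(4) unfolding A by simp
    show "act m B (delta (j + m)) = delta (j + m)" using inv[of "delta (j + m)"] that assms(4) unfolding A by simp
  qed
  then show ?thesis using assms(2) by (simp add: stab_def)
qed

lemma transvection_moves:
  assumes "x \<in> space m" "y \<in> space m" "om m (x, y) \<noteq> (0::'k::field)"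
  shows "tv m (y - x) (1 / om m (x, y)) x = y"
  using assms by (simp add: tv_def om_simps fun_eq_iff pointwise)

text \<open>Either the transvection along \<open>y - x\<close> maps \<open>x\<close> to \<open>y\<close>, or the detour through \<open>x + z\<close> works; all directions involved are
  orthogonal to \<open>z\<close>.\<close>

lemma tgen_transitive_on_level:
  fixes z :: "nat \<Rightarrow> 'k::field"
  assumes z: "z \<in> tail m i" and x: "x \<in> tail m i" and y: "y \<in> tail m i"
    and e: "om m (z, x) = om m (z, y)" "om m (z, x) \<noteq> 0"
  shows "\<exists>A\<in>tgen m {v \<in> tail m i. om m (z, v) = 0}. act m A x = y"
proof -
  let ?S = "{v \<in> tail m i. om m (z, v) = 0}"
  have step: "\<exists>A\<in>tgen m ?S. act m A a = b"
    if "a \<in> tail m i" "b \<in> tail m i" "om m (z, a) = om m (z, b)" "om m (a, b) \<noteq> 0" for a b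
  proof -
    note V = tail_space[OF that(1)] tail_space[OF that(2)] tail_space[OF z]
    have "b - a \<in> ?S" using that V by (simp add: tail_diff om_simps)
    then have "TV m (b - a) (1 / om m (a, b)) \<in> tgen m ?S" using V by (intro tgen_TV) auto
    moreover have "act m (TV m (b - a) (1 / om m (a, b))) a = b"
      using V transvection_moves[OF V(1,2) that(4)] by (simp add: TV_act)
    ultimately show ?thesis by blast
  qed
  show ?thesis
  proof (cases "om m (x, y) = 0")
    case False then show ?thesis using step x y e by blast
  next
    case True
    note V = tail_space[OF x] tail_space[OF y] tail_space[OF z]
    have "om m (x, x + z) \<noteq> 0" "om m (x + z, y) \<noteq> 0" "om m (z, x) = om m (z, x + z)" "om m (z, x + z) = om m (z, y)"
      using V e True om_anti[of m z x] by (auto simp: om_simps)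
    then obtain A B where A: "A \<in> tgen m ?S" "act m A x = x + z" and B: "B \<in> tgen m ?S" "act m B (x + z) = y"
      using step[OF x tail_add[OF x z]] step[OF tail_add[OF x z] y] by blast
    have "act m (B * A) x = y" using A B V by (simp add: Sp_act_mult tgen_Sp)
    then show ?thesis using tgen_mult[OF B(1) A(1)] by blast
  qed
qed

lemma tail_nondeg:
  assumes "x \<in> tail m i" "x \<noteq> 0" "i \<le> m"
  obtains z where "z \<in> tail m i" "om m (z, x) \<noteq> 0"
proof -
  have "\<exists>j<2*m. x j \<noteq> 0"
  proof (rule ccontr)
    assume "\<not> ?thesis"
    then have "x j = 0" for j using tail_space[OF assms(1)] by (cases "j < 2 * m") (auto simp: space_def supported_def)
    then have "x = 0" by (auto simp: fun_eq_iff pointwise)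
    then show False using assms(2) by blast
  qed
  then obtain j where j: "j < 2 * m" "x j \<noteq> 0" by blast
  show thesis
  proof (cases "j < m")
    case True
    then have "i \<le> j" using assms(1) j(2) by (auto simp: tail_def not_less[symmetric])
    then show thesis using True j(2) om_delta_left[OF tail_space[OF assms(1)] True] by (intro that[of "delta (j + m)"] tail_delta) auto
  next
    case False
    then obtain k where k: "j = k + m" "k < m" using j(1) by (intro that[of "j - m"]) auto
    then have "i \<le> k" using assms(1) j(2) by (auto simp: tail_def not_less[symmetric])
    then show thesis using k j(2) om_delta_left[OF tail_space[OF assms(1)] k(2)] by (intro that[of "delta k"] tail_delta) auto
  qed
qed

text \<open>Two vectors that are not orthogonal are related by one transvection; otherwise a third vector mediates.\<close>

lemma tgen_transitive:
  fixes x y :: "nat \<Rightarrow> 'k::field"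
  assumes x: "x \<in> tail m i" "x \<noteq> 0" and y: "y \<in> tail m i" "y \<noteq> 0" and i: "i \<le> m"
  shows "\<exists>A\<in>tgen m (tail m i). act m A x = y"
proof -
  have step: "\<exists>A\<in>tgen m (tail m i). act m A a = b"
    if "a \<in> tail m i" "b \<in> tail m i" "om m (a, b) \<noteq> 0" for a b
  proof -
    note V = tail_space[OF that(1)] tail_space[OF that(2)]
    have "TV m (b - a) (1 / om m (a, b)) \<in> tgen m (tail m i)" using V that by (intro tgen_TV tail_diff) auto
    moreover have "act m (TV m (b - a) (1 / om m (a, b))) a = b"
      using V transvection_moves[OF V that(3)] by (simp add: TV_act)
    ultimately show ?thesis by blast
  qed
  obtain z1 where z1: "z1 \<in> tail m i" "om m (z1, x) \<noteq> 0" by (rule tail_nondeg[OF x i])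
  obtain z2 where z2: "z2 \<in> tail m i" "om m (z2, y) \<noteq> 0" by (rule tail_nondeg[OF y i])
  note V = tail_space[OF x(1)] tail_space[OF y(1)] tail_space[OF z1(1)] tail_space[OF z2(1)]
  have "\<exists>z\<in>tail m i. om m (z, x) \<noteq> 0 \<and> om m (z, y) \<noteq> 0"
  proof (cases "om m (z1, y) = 0")
    case False then show ?thesis using z1 by blast
  next
    case True
    show ?thesis
    proof (cases "om m (z2, x) = 0")
      case False then show ?thesis using z2 by blast
    next
      case F: True
      show ?thesis using z1 z2 True F V by (intro bexI[of _ "z1 + z2"]) (auto simp: om_simps tail_add)
    qed
  qed
  then obtain z where z: "z \<in> tail m i" "om m (z, x) \<noteq> 0" "om m (z, y) \<noteq> 0" by blast
  have "om m (x, z) \<noteq> 0" using z(2) om_anti[of m z x] by auto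
  then obtain A where A: "A \<in> tgen m (tail m i)" "act m A x = z" using step x z by blast
  obtain B where B: "B \<in> tgen m (tail m i)" "act m B z = y" using step y z by blast
  have "act m (B * A) x = y" using A B V by (simp add: Sp_act_mult tgen_Sp)
  then show ?thesis using tgen_mult[OF B(1) A(1)] by blast
qed

lemma delta_nonzero [simp]: "delta j \<noteq> (0 :: nat \<Rightarrow> 'k::field)"
  by (auto simp: fun_eq_iff delta_apply pointwise intro!: exI[of _ j])

text \<open>The pointwise stabilizers of hyperbolic planes, and of one further vector, consist of products of transvections.\<close>

lemma stab_Suc_of_pair:
  assumes "A \<in> stab m i" "act m A (delta i) = delta i" "act m A (delta (i + m)) = delta (i + m)"
  shows "A \<in> stab m (Suc i)"
  using assms by (auto simp: stab_def less_Suc_eq)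

lemma left_cancel_tgen:
  assumes "B \<in> tgen m S" "A \<in> Sp m" "B * A \<in> tgen m S"
  shows "A \<in> tgen m S"
proof -
  obtain C where C: "C \<in> tgen m S" "C * B = 1\<^sub>m (2 * m)" using tgen_inverse[OF assms(1)] by blast
  note c = Sp_carrier[OF tgen_Sp[OF C(1)]] Sp_carrier[OF tgen_Sp[OF assms(1)]] Sp_carrier[OF assms(2)]
  have "C * (B * A) = C * B * A" using assoc_mult_mat[OF c] by simp
  also have "\<dots> = A" using C(2) c(3) by simp
  finally show ?thesis using tgen_mult[OF C(1) assms(3)] by simp
qed

lemma stab_subset_tgen_aux:
  assumes IH: "stab m (Suc i) \<subseteq> (tgen m (tail m (Suc i)) :: 'k::field mat set)" and i: "i < m"
    and A: "A \<in> stab m i" "act m A (delta i) = delta i"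
  shows "A \<in> tgen m {v \<in> tail m i. om m (delta i, v) = (0::'k)}"
proof -
  let ?S = "{v \<in> tail m i. om m (delta i, v) = 0}"
  have d: "(delta i :: nat \<Rightarrow> 'k) \<in> tail m i" "(delta (i + m) :: nat \<Rightarrow> 'k) \<in> tail m i" using tail_delta[of i i m] i by auto
  note V = tail_space[OF d(1)] tail_space[OF d(2)]
  have e: "om m (delta i, delta (i + m)) = (1::'k)" using om_delta_left(1)[OF V(2) i] by (simp add: delta_apply)
  let ?y = "act m A (delta (i + m))"
  have y: "?y \<in> tail m i" using stab_tail[OF A(1) _ d(2)] i by simp
  have ey: "om m (delta i, ?y) = 1" using Sp_om[OF stab_Sp[OF A(1)] V] A(2) e by simp
  obtain B where B: "B \<in> tgen m ?S" "act m B ?y = delta (i + m)"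
    using tgen_transitive_on_level[OF d(1) y d(2)] e ey by auto
  have Bt: "B \<in> tgen m (tail m i)" by (rule tgen_mono[OF B(1)]) blast
  have Bi: "act m B (delta i) = delta i" by (rule tgen_fix[OF B(1) V(1)]) simp
  have BA: "B * A \<in> stab m i" using stab_mult[OF tgen_stab[OF Bt] A(1)] i by simp
  have "B * A \<in> stab m (Suc i)"
    by (rule stab_Suc_of_pair[OF BA]) (use V B(2) Bi A(2) in \<open>simp_all add: Sp_act_mult[OF tgen_Sp[OF Bt] stab_Sp[OF A(1)]]\<close>)
  then have "B * A \<in> tgen m (tail m (Suc i))" using IH by blast
  moreover have "tail m (Suc i) \<subseteq> ?S" using i by (auto simp: tail_def om_delta_left)
  ultimately have "B * A \<in> tgen m ?S" using tgen_mono by blast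
  then show ?thesis using left_cancel_tgen[OF B(1) stab_Sp[OF A(1)]] by blast
qed

lemma stab_subset_tgen: "i \<le> m \<Longrightarrow> stab m i \<subseteq> (tgen m (tail m i) :: 'k::field mat set)"
proof (induction "m - i" arbitrary: i)
  case 0
  then have im: "i = m" by simp
  show ?case
  proof
    fix A :: "'k mat" assume A: "A \<in> stab m i"
    have "A = 1\<^sub>m (2 * m)"
    proof (rule Sp_eqI[OF stab_Sp[OF A] Sp_one])
      fix x :: "nat \<Rightarrow> 'k" assume x: "x \<in> space m"
      have "act m A x = x"
      proof (rule flin_eq_on_space[OF flin_act _ _ x, of "\<lambda>x. x"])
        fix j assume j: "j < 2 * m"
        show "act m A (delta j) = delta j"
        proof (cases "j < m")
          case True then show ?thesis using A im by (simp add: stab_def)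
        next
          case False
          then obtain k where k: "j = k + m" "k < m" using j by (intro that[of "j - m"]) auto
          then show ?thesis using A im by (simp add: stab_def)
        qed
      qed (auto intro: flinI)
      then show "act m A x = act m (1\<^sub>m (2 * m)) x" using act_one[OF x] by simp
    qed
    then show "A \<in> tgen m (tail m i)" using tgen.one by blast
  qed
next
  case (Suc k)
  then have i: "i < m" by simp
  have IH: "stab m (Suc i) \<subseteq> (tgen m (tail m (Suc i)) :: 'k mat set)" using Suc(1)[of "Suc i"] Suc(2) i by simp
  show ?case
  proof
    fix A :: "'k mat" assume A: "A \<in> stab m i"
    have d: "(delta i :: nat \<Rightarrow> 'k) \<in> tail m i" using tail_delta[of i i m] i by auto
    let ?y = "act m A (delta i)"
    have y: "?y \<in> tail m i" using stab_tail[OF A _ d] i by simp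
    have "?y \<noteq> 0" using Sp_act_inj[OF stab_Sp[OF A] tail_space[OF d]] delta_nonzero[of i] by metis
    then obtain B where B: "B \<in> tgen m (tail m i)" "act m B ?y = delta i"
      using tgen_transitive[OF y _ d] i by auto
    have BA: "B * A \<in> stab m i" using stab_mult[OF tgen_stab[OF B(1)] A] i by simp
    have "act m (B * A) (delta i) = delta i"
      using B tail_space[OF d] by (simp add: Sp_act_mult[OF tgen_Sp[OF B(1)] stab_Sp[OF A]])
    then have "B * A \<in> tgen m {v \<in> tail m i. om m (delta i, v) = 0}"
      using stab_subset_tgen_aux[OF IH i BA] by blast
    then have "B * A \<in> tgen m (tail m i)" by (rule tgen_mono) blast
    then show "A \<in> tgen m (tail m i)" using left_cancel_tgen[OF B(1) stab_Sp[OF A]] by blast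
  qed
qed

lemma stab_vector_subset_tgen:
  assumes "i < m" "A \<in> stab m i" "act m A (delta i) = delta i"
  shows "A \<in> tgen m {v \<in> tail m i. om m (delta i, v) = (0::'k::field)}"
  using stab_subset_tgen_aux[OF stab_subset_tgen assms(1,2,3)] assms(1) by simp

section \<open>Laurent polynomial functions\<close>

lemma infinite_alg_closed: "infinite (UNIV :: 'k::alg_closed_field set)"
proof
  assume fin: "finite (UNIV :: 'k set)"
  let ?q = "\<Prod>a\<in>(UNIV :: 'k set). [:- a, 1:]"
  have "degree ?q = (\<Sum>a\<in>(UNIV :: 'k set). 1)" by (subst degree_prod_eq_sum_degree) auto
  then have "degree ?q = card (UNIV :: 'k set)" by simp
  moreover have "card (UNIV :: 'k set) > 0" using fin by (simp add: card_gt_0_iff)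
  ultimately have "degree (?q + 1) > 0" by (subst degree_add_eq_left) auto
  then obtain x where "poly (?q + 1) x = 0" using alg_closed_imp_poly_has_root by blast
  moreover have "poly ?q x = 0" using fin by (auto simp: poly_prod)
  ultimately show False by simp
qed

lemma poly_eq_0_of_nonzero:
  fixes P :: "'k::alg_closed_field poly"
  assumes "\<And>t. t \<noteq> 0 \<Longrightarrow> poly P t = 0"
  shows "P = 0"
proof (rule ccontr)
  assume "P \<noteq> 0"
  then have "finite {t. poly P t = 0}" by (rule poly_roots_finite)
  moreover have "UNIV - {0} \<subseteq> {t. poly P t = 0}" using assms by auto
  ultimately show False using infinite_alg_closed by (metis finite_Diff2 finite.emptyI finite_insert finite_subset)
qed

lemma power_int_split: "t \<noteq> (0::'k::field) \<Longrightarrow> - int M \<le> l \<Longrightarrow> t ^ M * t powi l = t ^ nat (l + int M)"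
proof -
  assume a: "t \<noteq> 0" "- int M \<le> l"
  have "t ^ M * t powi l = t powi (int M + l)" using a(1) by (simp add: power_int_add)
  also have "int M + l = int (nat (l + int M))" using a(2) by simp
  also have "t powi (int (nat (l + int M))) = t ^ nat (l + int M)" by (rule power_int_of_nat)
  finally show ?thesis .
qed

lemma powi_sum_zero:
  fixes c :: "int \<Rightarrow> 'k::alg_closed_field"
  assumes I: "finite I" and z: "\<And>t. t \<noteq> 0 \<Longrightarrow> (\<Sum>l\<in>I. t powi l * c l) = 0" and l: "l \<in> I"
  shows "c l = 0"
proof -
  obtain M :: nat where M: "\<And>l. l \<in> I \<Longrightarrow> - int M \<le> l"
  proof -
    let ?M = "Max (insert 0 ((\<lambda>l. nat (- l)) ` I))"
    have "- int ?M \<le> l" if "l \<in> I" for l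
    proof -
      have "nat (- l) \<le> ?M" using I that by (intro Max_ge) auto
      then show ?thesis by linarith
    qed
    then show thesis using that by blast
  qed
  define P where "P = (\<Sum>l\<in>I. Polynomial.monom (c l) (nat (l + int M)))"
  have "P = 0"
  proof (rule poly_eq_0_of_nonzero)
    fix t :: 'k assume t: "t \<noteq> 0"
    have "poly P t = (\<Sum>l\<in>I. t ^ M * (t powi l * c l))"
      unfolding P_def poly_sum poly_monom
      by (rule sum.cong[OF refl]) (simp add: power_int_split[OF t M, symmetric] mult.commute mult.left_commute)
    also have "\<dots> = 0" unfolding sum_distrib_left[symmetric] z[OF t] by simp
    finally show "poly P t = 0" .
  qed
  have "Polynomial.coeff P (nat (l + int M)) = (\<Sum>k\<in>I. if k = l then c k else 0)"
    unfolding P_def coeff_sum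
  proof (rule sum.cong[OF refl])
    fix k assume "k \<in> I"
    then have "nat (k + int M) = nat (l + int M) \<longleftrightarrow> k = l" using M[of k] M[OF l] by linarith
    then show "Polynomial.coeff (Polynomial.monom (c k) (nat (k + int M))) (nat (l + int M)) = (if k = l then c k else 0)" by simp
  qed
  then show ?thesis using \<open>P = 0\<close> I l by simp
qed

text \<open>The entries of \<open>F\<close> along one-parameter families of matrices are polynomial or Laurent polynomial functions of the parameter; only their
behaviour for nonzero parameters matters in the second case.\<close>

definition polyf :: "('k::field \<Rightarrow> 'k) \<Rightarrow> bool" where "polyf f \<longleftrightarrow> (\<exists>P. \<forall>t. f t = poly P t)"
definition laurent :: "('k::field \<Rightarrow> 'k) \<Rightarrow> bool" where "laurent f \<longleftrightarrow> (\<exists>P M. \<forall>t. t \<noteq> 0 \<longrightarrow> t ^ M * f t = poly P t)"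

lemma polyf_const: "polyf (\<lambda>t. c)" unfolding polyf_def by (intro exI[of _ "[:c:]"]) simp
lemma polyf_id: "polyf (\<lambda>t. t)" unfolding polyf_def by (intro exI[of _ "[:0, 1:]"]) simp
lemma polyf_add: "polyf f \<Longrightarrow> polyf g \<Longrightarrow> polyf (\<lambda>t. f t + g t)"
  unfolding polyf_def by (metis poly_add)
lemma polyf_mult: "polyf f \<Longrightarrow> polyf g \<Longrightarrow> polyf (\<lambda>t. f t * g t)"
  unfolding polyf_def by (metis poly_mult)
lemma polyf_sum: "(\<And>i. i \<in> I \<Longrightarrow> polyf (f i)) \<Longrightarrow> polyf (\<lambda>t. \<Sum>i\<in>I. f i t)"
  by (induction I rule: infinite_finite_induct) (auto intro: polyf_const polyf_add)

lemma laurent_polyf: "polyf f \<Longrightarrow> laurent f"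
  unfolding polyf_def laurent_def by (elim exE, rename_tac P, rule_tac x = P in exI, rule_tac x = 0 in exI) simp
lemma laurent_const: "laurent (\<lambda>t. c)" by (rule laurent_polyf[OF polyf_const])
lemma laurent_inverse: "laurent (\<lambda>t. inverse t)"
  unfolding laurent_def by (rule exI[of _ 1], rule exI[of _ 1]) simp
lemma laurent_add: assumes "laurent f" "laurent g" shows "laurent (\<lambda>t. f t + g t)"
proof -
  obtain P M Q K where a: "\<forall>t. t \<noteq> 0 \<longrightarrow> t ^ M * f t = poly P t" "\<forall>t. t \<noteq> 0 \<longrightarrow> t ^ K * g t = poly Q t"
    using assms unfolding laurent_def by blast
  have "t ^ (M + K) * (f t + g t) = poly (Polynomial.monom 1 K * P + Polynomial.monom 1 M * Q) t" if "t \<noteq> 0" for t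
  proof -
    have "t ^ (M + K) * (f t + g t) = t ^ K * (t ^ M * f t) + t ^ M * (t ^ K * g t)" by (simp add: power_add algebra_simps)
    then show ?thesis using a that by (simp add: poly_monom)
  qed
  then show ?thesis unfolding laurent_def by blast
qed
lemma laurent_mult: assumes "laurent f" "laurent g" shows "laurent (\<lambda>t. f t * g t)"
proof -
  obtain P M Q K where a: "\<forall>t. t \<noteq> 0 \<longrightarrow> t ^ M * f t = poly P t" "\<forall>t. t \<noteq> 0 \<longrightarrow> t ^ K * g t = poly Q t"
    using assms unfolding laurent_def by blast
  have "t ^ (M + K) * (f t * g t) = poly (P * Q) t" if "t \<noteq> 0" for t
  proof -
    have "t ^ (M + K) * (f t * g t) = (t ^ M * f t) * (t ^ K * g t)" by (simp add: power_add algebra_simps)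
    then show ?thesis using a that by simp
  qed
  then show ?thesis unfolding laurent_def by blast
qed
lemma laurent_sum: "(\<And>i. i \<in> I \<Longrightarrow> laurent (f i)) \<Longrightarrow> laurent (\<lambda>t. \<Sum>i\<in>I. f i t)"
  by (induction I rule: infinite_finite_induct) (auto intro: laurent_const laurent_add)

lemma entry_polynomials_polyf:
  assumes "f \<in> entry_polynomials n" "\<And>i j. i < n \<Longrightarrow> j < n \<Longrightarrow> polyf (\<lambda>t. A t $$ (i, j))"
  shows "polyf (\<lambda>t. f (A t))"
  using assms(1) by (induction rule: entry_polynomials.induct) (auto intro: polyf_const polyf_add polyf_mult assms(2))

lemma entry_polynomials_laurent:
  assumes "f \<in> entry_polynomials n" "\<And>i j. i < n \<Longrightarrow> j < n \<Longrightarrow> laurent (\<lambda>t. A t $$ (i, j))"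
  shows "laurent (\<lambda>t. f (A t))"
  using assms(1) by (induction rule: entry_polynomials.induct) (auto intro: laurent_const laurent_add laurent_mult assms(2))

text \<open>This replaces passing to the limit: a quantity that is polynomial along a line and has only nonpositive torus weights may be
  evaluated at the parameter 0.\<close>

lemma poly_nonpositive_const:
  fixes P :: "'k::alg_closed_field poly"
  assumes J: "finite J" "\<And>j. j \<in> J \<Longrightarrow> j \<le> 0" and e: "\<And>t. t \<noteq> 0 \<Longrightarrow> poly P t = (\<Sum>j\<in>J. t powi j * c j)"
  shows "poly P t = poly P 0"
proof -
  have cz: "Polynomial.coeff P k = 0" if k: "k > 0" for k
  proof (rule ccontr)
    assume nz: "Polynomial.coeff P k \<noteq> 0"
    then have kd: "k \<le> degree P" by (rule le_degree)
    let ?I = "int ` {..degree P} \<union> J"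
    define d where "d l = (if l \<in> int ` {..degree P} then Polynomial.coeff P (nat l) else 0) - (if l \<in> J then c l else 0)" for l
    have "(\<Sum>l\<in>?I. t powi l * d l) = 0" if t: "t \<noteq> 0" for t
    proof -
      have "(\<Sum>l\<in>?I. t powi l * d l) = (\<Sum>l\<in>?I. if l \<in> int ` {..degree P} then t powi l * Polynomial.coeff P (nat l) else 0)
          - (\<Sum>l\<in>?I. if l \<in> J then t powi l * c l else 0)"
        unfolding sum_subtractf[symmetric] by (rule sum.cong) (auto simp: d_def algebra_simps)
      also have "(\<Sum>l\<in>?I. if l \<in> J then t powi l * c l else 0) = (\<Sum>l\<in>J. t powi l * c l)"
        by (rule sum.mono_neutral_cong_right) (use J in auto)
      also have "(\<Sum>l\<in>?I. if l \<in> int ` {..degree P} then t powi l * Polynomial.coeff P (nat l) else 0)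
          = (\<Sum>l\<in>int ` {..degree P}. t powi l * Polynomial.coeff P (nat l))"
        by (rule sum.mono_neutral_cong_right) (use J in auto)
      also have "\<dots> = (\<Sum>k\<le>degree P. t ^ k * Polynomial.coeff P k)"
        by (subst sum.reindex) auto
      also have "\<dots> = poly P t" by (simp add: poly_altdef mult.commute)
      finally show ?thesis using e[OF t] by simp
    qed
    then have "d (int k) = 0" by (rule powi_sum_zero[rotated]) (use J kd in auto)
    moreover have "int k \<notin> J" using J(2)[of "int k"] k by auto
    ultimately show False using nz kd by (auto simp: d_def)
  qed
  have "degree P = 0" using cz leading_coeff_0_iff by (metis degree_0 gr0I)
  then obtain a where "P = [:a:]" by (rule degree_eq_zeroE)
  then show ?thesis by simp
qed

section \<open>The standard torus\<close>

text \<open>The one-dimensional torus acting on the \<open>i\<close>-th coordinate plane, and below the Weyl group element that inverts it.\<close>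

definition dg :: "nat \<Rightarrow> nat \<Rightarrow> 'k::field \<Rightarrow> (nat \<Rightarrow> 'k) \<Rightarrow> nat \<Rightarrow> 'k" where
  "dg m i t x = (\<lambda>j. if j = i then t * x j else if j = i + m then inverse t * x j else x j)"

definition fl :: "nat \<Rightarrow> nat \<Rightarrow> (nat \<Rightarrow> 'k::field) \<Rightarrow> nat \<Rightarrow> 'k" where
  "fl m i x = (\<lambda>j. if j = i then x (i + m) else if j = i + m then - x i else x j)"

abbreviation DM :: "nat \<Rightarrow> nat \<Rightarrow> 'k::field \<Rightarrow> 'k mat" where "DM m i t \<equiv> mof m (dg m i t)"
abbreviation FL :: "nat \<Rightarrow> nat \<Rightarrow> 'k::field mat" where "FL m i \<equiv> mof m (fl m i)"

lemma sp_map_dg: "i < m \<Longrightarrow> t \<noteq> 0 \<Longrightarrow> sp_map m (dg m i t)"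
  unfolding sp_map_def
proof (intro conjI ballI allI)
  fix x y :: "nat \<Rightarrow> 'a" assume a: "i < m" "t \<noteq> 0" "x \<in> space m" "y \<in> space m"
  show "dg m i t (x + y) = dg m i t x + dg m i t y" by (auto simp: dg_def fun_eq_iff pointwise algebra_simps)
  have V: "dg m i t x \<in> space m" if "x \<in> space m" for x using that a(1) by (auto simp: dg_def space_def supported_def)
  then show "dg m i t x \<in> space m" using a by blast
  show "om m (dg m i t x, dg m i t y) = om m (x, y)"
    unfolding om_eq[OF V[OF a(3)] V[OF a(4)]] om_eq[OF a(3,4)]
    by (rule sum.cong) (use a(1,2) in \<open>auto simp: dg_def field_simps\<close>)
qed (auto simp: dg_def fun_eq_iff pointwise)

lemma sp_map_fl: "i < m \<Longrightarrow> sp_map m (fl m i)"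
  unfolding sp_map_def
proof (intro conjI ballI allI)
  fix x y :: "nat \<Rightarrow> 'a" assume a: "i < m" "x \<in> space m" "y \<in> space m"
  show "fl m i (x + y) = fl m i x + fl m i y" by (auto simp: fl_def fun_eq_iff pointwise algebra_simps)
  have V: "fl m i x \<in> space m" if "x \<in> space m" for x using that a(1) by (auto simp: fl_def space_def supported_def)
  then show "fl m i x \<in> space m" using a by blast
  show "om m (fl m i x, fl m i y) = om m (x, y)"
    unfolding om_eq[OF V[OF a(2)] V[OF a(3)]] om_eq[OF a(2,3)]
    by (rule sum.cong) (use a(1) in \<open>auto simp: fl_def algebra_simps\<close>)
qed (auto simp: fl_def fun_eq_iff pointwise)

lemmas DM_Sp = sp_map_mof(1)[OF sp_map_dg]
lemmas DM_act = sp_map_mof(2)[OF sp_map_dg]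
lemmas FL_Sp = sp_map_mof(1)[OF sp_map_fl]
lemmas FL_act = sp_map_mof(2)[OF sp_map_fl]

lemma dg_space: "i < m \<Longrightarrow> x \<in> space m \<Longrightarrow> dg m i t x \<in> space m"
  by (auto simp: dg_def space_def supported_def)
lemma fl_space: "i < m \<Longrightarrow> x \<in> space m \<Longrightarrow> fl m i x \<in> space m"
  by (auto simp: fl_def space_def supported_def)

lemma DM_mult: "i < m \<Longrightarrow> t \<noteq> 0 \<Longrightarrow> u \<noteq> 0 \<Longrightarrow> DM m i t * DM m i u = DM m i (t * u)"
  by (rule Sp_eqI[where m = m]) (simp_all add: DM_Sp Sp_mult Sp_act_mult DM_act dg_space, auto simp: dg_def fun_eq_iff)

lemma DM_one: "i < m \<Longrightarrow> DM m i 1 = 1\<^sub>m (2 * m)"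
  by (rule Sp_eqI[where m = m]) (auto simp: DM_Sp Sp_one DM_act act_one dg_def fun_eq_iff)

lemma FL_DM: "i < m \<Longrightarrow> t \<noteq> 0 \<Longrightarrow> DM m i t * FL m i = FL m i * DM m i (inverse t)"
  by (rule Sp_eqI[where m = m]) (simp_all add: DM_Sp FL_Sp Sp_mult Sp_act_mult DM_act FL_act dg_space fl_space, auto simp: dg_def fl_def fun_eq_iff)

lemma dg_delta: "i < m \<Longrightarrow> dg m i t (delta j) = (if j = i then fscale t (delta i) else if j = i + m then fscale (inverse t) (delta (i + m)) else delta j)"
  by (auto simp: dg_def delta_apply fun_eq_iff pointwise)

lemma DM_stab: "i' \<le> i \<Longrightarrow> i < m \<Longrightarrow> t \<noteq> 0 \<Longrightarrow> DM m i t \<in> stab m i'"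
  by (auto simp: stab_def DM_Sp DM_act dg_delta)

lemma FL_stab: "i' \<le> i \<Longrightarrow> i < m \<Longrightarrow> FL m i \<in> stab m i'"
  by (auto simp: stab_def FL_Sp FL_act fl_def delta_apply fun_eq_iff)

lemma dg_expand: "i < m \<Longrightarrow> dg m i t x = x + (fscale ((t - 1) * x i) (delta i) + fscale ((inverse t - 1) * x (i + m)) (delta (i + m)))"
  by (auto simp: dg_def delta_apply fun_eq_iff pointwise algebra_simps)

lemma stab_commutes_DM:
  assumes A: "A \<in> stab m (Suc i)" and i: "i < m" and t: "t \<noteq> 0"
  shows "A * DM m i t = DM m i t * A"
proof (rule Sp_eqI[where m = m])
  note S = stab_Sp[OF A]
  have d: "delta i \<in> space m" "delta (i + m) \<in> space m" using i by auto
  have Ad: "act m A (delta i) = delta i" "act m A (delta (i + m)) = delta (i + m)" using A by (auto simp: stab_def)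
  fix x :: "nat \<Rightarrow> 'a" assume x: "x \<in> space m"
  have "act m A x i = x i" "act m A x (i + m) = x (i + m)"
    using Sp_om[OF S x d(1)] Sp_om[OF S x d(2)] Ad om_delta_right[OF x i] om_delta_right[OF act_space i, of A x] by simp_all
  then show "act m (A * DM m i t) x = act m (DM m i t * A) x"
    using x i t S Ad by (simp add: Sp_act_mult DM_Sp DM_act dg_space) (simp add: dg_expand flin_add[OF flin_act] flin_scale[OF flin_act])
qed (use assms stab_Sp[OF A] in \<open>auto intro: Sp_mult DM_Sp\<close>)

lemma TV_polyf:
  assumes v: "\<And>t. v t \<in> space m" "\<And>j. polyf (\<lambda>t. v t j)" "polyf s" and ij: "i < 2 * m" "j < 2 * m"
  shows "polyf (\<lambda>t. TV m (v t) (s t) $$ (i, j))"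
proof -
  have "TV m (v t) (s t) $$ (i, j) = delta j i + s t * ((\<Sum>k<m. delta j k * v t (k + m) + (- 1) * (delta j (k + m) * v t k)) * v t i)" for t
    using ij v(1)[of t] by (simp add: mof_def tv_def om_eq pointwise mult.assoc)
  then show ?thesis using v by (simp only:) (intro polyf_add polyf_mult polyf_sum polyf_const)
qed

lemma DM_laurent:
  assumes "i < 2 * m" "j < 2 * m"
  shows "laurent (\<lambda>t. DM m l t $$ (i, j))"
proof -
  have eq: "DM m l t $$ (i, j) = (if i = l then t * delta j i else if i = l + m then inverse t * delta j i else delta j i)" for t :: 'a
    using assms by (simp add: mof_def dg_def)
  show ?thesis unfolding eq
    by (cases "i = l"; cases "i = l + m")
      (simp_all only: simp_thms if_True if_False laurent_mult[OF laurent_polyf[OF polyf_id] laurent_const] laurent_mult[OF laurent_inverse laurent_const] laurent_const)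
qed

section \<open>Weights\<close>

text \<open>The endomorphism is studied through the representation \<open>\<rho>\<close> that it induces on the standard module.\<close>

locale symplectic_endomorphism =
  fixes m :: nat and F :: "'k::alg_closed_field mat \<Rightarrow> 'k mat"
  assumes m2: "m \<ge> 2" and two: "(2::'k) \<noteq> 0"
    and F_Sp: "\<And>A. A \<in> Sp m \<Longrightarrow> F A \<in> Sp m"
    and F_mult: "\<And>A B. A \<in> Sp m \<Longrightarrow> B \<in> Sp m \<Longrightarrow> F (A * B) = F A * F B"
    and F_surj: "F ` Sp m = Sp m"
    and F_poly: "\<And>i j. i < 2 * m \<Longrightarrow> j < 2 * m \<Longrightarrow> \<exists>f\<in>entry_polynomials (2 * m). \<forall>A\<in>Sp m. F A $$ (i, j) = f A"
begin

definition \<rho> :: "'k mat \<Rightarrow> (nat \<Rightarrow> 'k) \<Rightarrow> nat \<Rightarrow> 'k" where "\<rho> A = act m (F A)"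

lemma rho_lin: "flin (\<rho> A)" unfolding \<rho>_def by (rule flin_act)
lemma rho_space [simp]: "\<rho> A x \<in> space m" by (simp add: \<rho>_def)
lemma rho_mult: "A \<in> Sp m \<Longrightarrow> B \<in> Sp m \<Longrightarrow> x \<in> space m \<Longrightarrow> \<rho> (A * B) x = \<rho> A (\<rho> B x)"
  by (simp add: \<rho>_def F_mult Sp_act_mult F_Sp)

lemma F_one: "F (1\<^sub>m (2 * m)) = 1\<^sub>m (2 * m)"
proof -
  obtain A where A: "A \<in> Sp m" "F A = 1\<^sub>m (2 * m)" using F_surj Sp_one by (metis imageE)
  have "F (A * 1\<^sub>m (2 * m)) = F A * F (1\<^sub>m (2 * m))" by (rule F_mult[OF A(1) Sp_one])
  then show ?thesis using A Sp_carrier[OF A(1)] Sp_carrier[OF F_Sp[OF Sp_one]] by simp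
qed

lemma rho_one: "x \<in> space m \<Longrightarrow> \<rho> (1\<^sub>m (2 * m)) x = x" by (simp add: \<rho>_def F_one act_one)

lemma rho_cancel: "A \<in> Sp m \<Longrightarrow> B \<in> Sp m \<Longrightarrow> A * B = 1\<^sub>m (2 * m) \<Longrightarrow> x \<in> space m \<Longrightarrow> \<rho> A (\<rho> B x) = x"
  using rho_mult[of A B x] rho_one by simp

lemma rho_nonzero: "A \<in> Sp m \<Longrightarrow> x \<in> space m \<Longrightarrow> x \<noteq> 0 \<Longrightarrow> \<rho> A x \<noteq> 0"
  using Sp_act_inj[OF F_Sp] unfolding \<rho>_def by blast

lemma rho_polyf:
  assumes "\<And>t. A t \<in> Sp m" "\<And>i j. i < 2 * m \<Longrightarrow> j < 2 * m \<Longrightarrow> polyf (\<lambda>t. A t $$ (i, j))"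
  shows "polyf (\<lambda>t. \<rho> (A t) x r)"
proof (cases "r < 2 * m")
  case True
  have "polyf (\<lambda>t. F (A t) $$ (r, j))" if "j < 2 * m" for j
  proof -
    note ex = F_poly[OF True that]
    obtain f where f: "f \<in> entry_polynomials (2 * m)" "\<forall>A\<in>Sp m. F A $$ (r, j) = f A" using ex by blast
    then show ?thesis using entry_polynomials_polyf[OF f(1), of A] assms by simp
  qed
  then show ?thesis unfolding \<rho>_def act_def using True by (simp, intro polyf_sum polyf_mult polyf_const) auto
qed (simp add: \<rho>_def act_def polyf_const)

lemma rho_laurent:
  assumes "\<And>t. t \<noteq> 0 \<Longrightarrow> A t \<in> Sp m" "\<And>i j. i < 2 * m \<Longrightarrow> j < 2 * m \<Longrightarrow> laurent (\<lambda>t. A t $$ (i, j))"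
  shows "laurent (\<lambda>t. \<rho> (A t) x r)"
proof (cases "r < 2 * m")
  case True
  have "laurent (\<lambda>t. F (A t) $$ (r, j))" if "j < 2 * m" for j
  proof -
    note ex = F_poly[OF True that]
    obtain f where f: "f \<in> entry_polynomials (2 * m)" "\<forall>A\<in>Sp m. F A $$ (r, j) = f A" using ex by blast
    have "laurent (\<lambda>t. f (A t))" by (rule entry_polynomials_laurent[OF f(1) assms(2)])
    then show ?thesis using f(2) assms(1) unfolding laurent_def by (metis (no_types, lifting))
  qed
  then show ?thesis unfolding \<rho>_def act_def using True by (simp, intro laurent_sum laurent_mult laurent_const) auto
qed (simp add: \<rho>_def act_def laurent_const)

text \<open>The matrix entries of the action of the torus are Laurent polynomials in the parameter; collecting the coefficient of each power
gives the projections \<open>E\<close> to the weight spaces.\<close>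

lemma weight_expansion:
  assumes i: "i < m"
  shows "\<exists>I E. finite (I :: int set) \<and> (\<forall>l. flin (E l)) \<and> (\<forall>l x. E l x \<in> space m) \<and> (\<forall>l x. l \<notin> I \<longrightarrow> E l x = 0)
    \<and> (\<forall>x\<in>space m. \<forall>t. t \<noteq> 0 \<longrightarrow> \<rho> (DM m i t) x = (\<Sum>l\<in>I. fscale (t powi l) (E l x)))"
proof -
  have "\<exists>P M. \<forall>t. t \<noteq> 0 \<longrightarrow> t ^ M * \<rho> (DM m i t) (delta b) r = poly P t" for b r
  proof -
    have "laurent (\<lambda>t. \<rho> (DM m i t) (delta b) r)"
      by (rule rho_laurent) (rule DM_Sp[OF i], assumption, rule DM_laurent)
    then show ?thesis unfolding laurent_def .
  qed
  then obtain P M where PM: "\<And>b r t. t \<noteq> 0 \<Longrightarrow> t ^ (M b r :: nat) * \<rho> (DM m i t) (delta b) r = poly (P b r) t"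
    by metis
  define K where "K = (\<Sum>b<2 * m. \<Sum>r<2 * m. M b r)"
  have MK: "M b r \<le> K" if "b < 2 * m" "r < 2 * m" for b r
  proof -
    have "M b r \<le> (\<Sum>r<2 * m. M b r)" by (rule member_le_sum) (use that in auto)
    also have "\<dots> \<le> K" unfolding K_def by (rule member_le_sum) (use that in auto)
    finally show ?thesis .
  qed
  define Q where "Q b r = Polynomial.monom 1 (K - M b r) * P b r" for b r
  have Q: "t ^ K * \<rho> (DM m i t) (delta b) r = poly (Q b r) t" if "t \<noteq> 0" "b < 2 * m" "r < 2 * m" for t b r
  proof -
    have "t ^ K = t ^ (K - M b r) * t ^ M b r" using MK[OF that(2,3)] by (simp flip: power_add)
    then show ?thesis using PM[OF that(1), of b r] by (simp add: Q_def poly_monom mult.assoc)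
  qed
  define N where "N = (\<Sum>b<2 * m. \<Sum>r<2 * m. degree (Q b r))"
  have QN: "degree (Q b r) \<le> N" if "b < 2 * m" "r < 2 * m" for b r
  proof -
    have "degree (Q b r) \<le> (\<Sum>r<2 * m. degree (Q b r))" by (rule member_le_sum) (use that in auto)
    also have "\<dots> \<le> N" unfolding N_def by (rule member_le_sum) (use that in auto)
    finally show ?thesis .
  qed
  let ?I = "(\<lambda>k. int k - int K) ` {..N}"
  define E where "E l x = (\<lambda>r. if r < 2 * m \<and> l \<in> ?I then \<Sum>b<2 * m. x b * Polynomial.coeff (Q b r) (nat (l + int K)) else 0)" for l x
  have "\<rho> (DM m i t) x = (\<Sum>l\<in>?I. fscale (t powi l) (E l x))" if x: "x \<in> space m" and t: "t \<noteq> 0" for x t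
  proof
    fix r
    show "\<rho> (DM m i t) x r = (\<Sum>l\<in>?I. fscale (t powi l) (E l x)) r"
    proof (cases "r < 2 * m")
      case True
      have "\<rho> (DM m i t) x = (\<Sum>b<2 * m. fscale (x b) (\<rho> (DM m i t) (delta b)))"
        by (subst space_expand[OF x]) (simp only: flin_sum[OF rho_lin] flin_scale[OF rho_lin])
      then have "t ^ K * \<rho> (DM m i t) x r = (\<Sum>b<2 * m. x b * (t ^ K * \<rho> (DM m i t) (delta b) r))"
        by (simp add: pointwise sum_distrib_left mult.left_commute)
      also have "\<dots> = (\<Sum>b<2 * m. x b * poly (Q b r) t)" using Q[OF t _ True] by simp
      also have "\<dots> = (\<Sum>b<2 * m. x b * (\<Sum>k\<le>N. Polynomial.coeff (Q b r) k * t ^ k))"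
      proof (rule sum.cong[OF refl])
        fix b assume "b \<in> {..<2 * m}"
        then have "degree (Q b r) \<le> N" using QN True by simp
        then have "poly (Q b r) t = (\<Sum>k\<le>N. Polynomial.coeff (Q b r) k * t ^ k)"
          unfolding poly_altdef by (intro sum.mono_neutral_left) (auto intro: coeff_eq_0)
        then show "x b * poly (Q b r) t = x b * (\<Sum>k\<le>N. Polynomial.coeff (Q b r) k * t ^ k)" by simp
      qed
      also have "\<dots> = (\<Sum>k\<le>N. t ^ k * (\<Sum>b<2 * m. x b * Polynomial.coeff (Q b r) k))"
        by (simp add: sum_distrib_left sum_distrib_right mult.assoc mult.commute mult.left_commute) (rule sum.swap)
      also have "\<dots> = (\<Sum>k\<le>N. t ^ K * (t powi (int k - int K) * E (int k - int K) x r))"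
      proof (rule sum.cong[OF refl])
        fix k assume k: "k \<in> {..N}"
        have "E (int k - int K) x r = (\<Sum>b<2 * m. x b * Polynomial.coeff (Q b r) k)" using True k by (simp add: E_def)
        moreover have "t ^ K * t powi (int k - int K) = t ^ k" using power_int_split[OF t, of K "int k - int K"] by simp
        ultimately show "t ^ k * (\<Sum>b<2 * m. x b * Polynomial.coeff (Q b r) k) = t ^ K * (t powi (int k - int K) * E (int k - int K) x r)"
          by (simp flip: mult.assoc)
      qed
      also have "\<dots> = t ^ K * (\<Sum>l\<in>?I. t powi l * E l x r)"
        by (subst sum.reindex) (auto simp: inj_on_def sum_distrib_left)
      finally show ?thesis using t by (simp add: pointwise)
    next
      case False
      then have "\<rho> (DM m i t) x r = 0" by (simp add: \<rho>_def act_def)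
      then show ?thesis using False by (simp add: pointwise E_def)
    qed
  qed
  moreover have "flin (E l)" for l
    by (rule flinI) (auto simp: E_def fun_eq_iff pointwise sum.distrib sum_distrib_left algebra_simps)
  moreover have "E l x \<in> space m" for l x by (auto simp: E_def space_def supported_def)
  moreover have "E l x = 0" if "l \<notin> ?I" for l x using that by (auto simp: E_def fun_eq_iff pointwise)
  ultimately show ?thesis by (intro exI[of _ ?I] exI[of _ E]) blast
qed

definition weight_data :: "nat \<Rightarrow> int set \<times> (int \<Rightarrow> (nat \<Rightarrow> 'k) \<Rightarrow> nat \<Rightarrow> 'k)" where
  "weight_data i = (SOME p. finite (fst p) \<and> (\<forall>l. flin (snd p l)) \<and> (\<forall>l x. snd p l x \<in> space m) \<and> (\<forall>l x. l \<notin> fst p \<longrightarrow> snd p l x = 0)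
    \<and> (\<forall>x\<in>space m. \<forall>t. t \<noteq> 0 \<longrightarrow> \<rho> (DM m i t) x = (\<Sum>l\<in>fst p. fscale (t powi l) (snd p l x))))"

definition I :: "nat \<Rightarrow> int set" where "I i = fst (weight_data i)"
definition E :: "nat \<Rightarrow> int \<Rightarrow> (nat \<Rightarrow> 'k) \<Rightarrow> nat \<Rightarrow> 'k" where "E i = snd (weight_data i)"

lemma weight_data:
  assumes "i < m"
  shows "finite (I i)" "flin (E i l)" "E i l x \<in> space m" "l \<notin> I i \<Longrightarrow> E i l x = 0"
    "x \<in> space m \<Longrightarrow> t \<noteq> 0 \<Longrightarrow> \<rho> (DM m i t) x = (\<Sum>l\<in>I i. fscale (t powi l) (E i l x))"
proof -
  let ?P = "\<lambda>p. finite (fst p) \<and> (\<forall>l. flin (snd p l)) \<and> (\<forall>l x. snd p l x \<in> space m) \<and> (\<forall>l x. l \<notin> fst p \<longrightarrow> snd p l x = 0)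
    \<and> (\<forall>x\<in>space m. \<forall>t. t \<noteq> 0 \<longrightarrow> \<rho> (DM m i t) x = (\<Sum>l\<in>fst p. fscale (t powi l) (snd p l x)))"
  obtain J D where "?P (J, D)" using weight_expansion[OF assms] by (simp only: fst_conv snd_conv) (elim exE)
  then have "?P (weight_data i)" unfolding weight_data_def by (rule someI[where P = ?P])
  note W = this[folded I_def E_def]
  show "finite (I i)" by (rule conjunct1[OF W])
  show "flin (E i l)" using conjunct1[OF conjunct2[OF W]] by (rule spec)
  show "E i l x \<in> space m" by (rule conjunct1[OF conjunct2[OF conjunct2[OF W]], THEN spec, THEN spec])
  show "E i l x = 0" if "l \<notin> I i" by (rule conjunct1[OF conjunct2[OF conjunct2[OF conjunct2[OF W]]], THEN spec, THEN spec, THEN mp, OF that])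
  show "\<rho> (DM m i t) x = (\<Sum>l\<in>I i. fscale (t powi l) (E i l x))" if "x \<in> space m" "t \<noteq> 0"
    by (rule bspec[OF conjunct2[OF conjunct2[OF conjunct2[OF conjunct2[OF W]]]] that(1), THEN spec, THEN mp, OF that(2)])
qed

definition wt :: "nat \<Rightarrow> int \<Rightarrow> (nat \<Rightarrow> 'k) \<Rightarrow> bool" where
  "wt i l f \<longleftrightarrow> f \<in> space m \<and> (\<forall>t. t \<noteq> 0 \<longrightarrow> \<rho> (DM m i t) f = fscale (t powi l) f)"

lemma wtD: "wt i l f \<Longrightarrow> f \<in> space m" "wt i l f \<Longrightarrow> t \<noteq> 0 \<Longrightarrow> \<rho> (DM m i t) f = fscale (t powi l) f"
  by (simp_all add: wt_def)

lemma vector_powi_sum_zero: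
  fixes c :: "int \<Rightarrow> nat \<Rightarrow> 'k"
  assumes "finite J" "\<And>t. t \<noteq> 0 \<Longrightarrow> (\<Sum>l\<in>J. fscale (t powi l) (c l)) = 0" "l \<in> J"
  shows "c l = 0"
proof
  fix r
  have "(\<Sum>l\<in>J. t powi l * c l r) = 0" if "t \<noteq> 0" for t
    using fun_cong[OF assms(2)[OF that], of r] by (simp add: pointwise)
  then show "c l r = 0 r" using powi_sum_zero[OF assms(1) _ assms(3), of "\<lambda>l. c l r"] by (simp add: pointwise)
qed

lemma wt_E: assumes i: "i < m" and x: "x \<in> space m" shows "wt i l (E i l x)"
proof (cases "l \<in> I i")
  case False
  then show ?thesis using weight_data(4)[OF i False] by (simp add: wt_def flin_0[OF rho_lin])
next
  case l: True
  have "\<rho> (DM m i t) (E i l x) = fscale (t powi l) (E i l x)" if t: "t \<noteq> 0" for t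
  proof -
    define c where "c k = \<rho> (DM m i t) (E i k x) - fscale (t powi k) (E i k x)" for k
    have "(\<Sum>k\<in>I i. fscale (u powi k) (c k)) = 0" if u: "u \<noteq> 0" for u
    proof -
      have tu: "t * u \<noteq> 0" using t u by simp
      have "(\<Sum>k\<in>I i. fscale (u powi k) (\<rho> (DM m i t) (E i k x))) = \<rho> (DM m i t) (\<rho> (DM m i u) x)"
        unfolding weight_data(5)[OF i x u] by (simp only: flin_sum[OF rho_lin] flin_scale[OF rho_lin])
      also have "\<dots> = \<rho> (DM m i (t * u)) x" using rho_mult[OF DM_Sp DM_Sp x] DM_mult i t u by metis
      also have "\<dots> = (\<Sum>k\<in>I i. fscale (u powi k) (fscale (t powi k) (E i k x)))"
        unfolding weight_data(5)[OF i x tu] by (rule sum.cong) (simp_all add: power_int_mult_distrib mult.commute)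
      finally show ?thesis
        unfolding c_def fv.scale_right_diff_distrib sum_subtractf by (simp only: right_minus_eq)
    qed
    then have "c l = 0" by (rule vector_powi_sum_zero[OF weight_data(1)[OF i] _ l])
    then show ?thesis unfolding c_def by (simp only: right_minus_eq)
  qed
  then show ?thesis using weight_data(3)[OF i] by (simp add: wt_def)
qed

lemma E_sum: assumes "i < m" "x \<in> space m" shows "x = (\<Sum>l\<in>I i. E i l x)"
proof -
  have "x = \<rho> (DM m i 1) x" unfolding DM_one[OF assms(1)] by (rule rho_one[OF assms(2), symmetric])
  also have "\<dots> = (\<Sum>l\<in>I i. fscale (1 powi l) (E i l x))" by (rule weight_data(5)[OF assms]) simp
  finally show ?thesis by simp
qed

lemma E_wt: assumes i: "i < m" and y: "wt i l' y" shows "E i l y = (if l = l' then y else 0)"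
proof -
  let ?J = "insert l (insert l' (I i))"
  define c where "c k = E i k y - (if k = l' then y else 0)" for k
  have "c l = 0"
  proof (rule vector_powi_sum_zero)
    show "finite ?J" using weight_data(1)[OF i] by simp
    fix t :: 'k assume t: "t \<noteq> 0"
    have "(\<Sum>k\<in>?J. fscale (t powi k) (E i k y)) = (\<Sum>k\<in>I i. fscale (t powi k) (E i k y))"
      by (rule sum.mono_neutral_right) (use weight_data(1,4)[OF i] in auto)
    also have "\<dots> = fscale (t powi l') y" using weight_data(5)[OF i wtD(1)[OF y] t] wtD(2)[OF y t] by simp
    also have "\<dots> = (\<Sum>k\<in>?J. if k = l' then fscale (t powi l') y else 0)"
      using weight_data(1)[OF i] by (subst sum.delta) auto
    also have "\<dots> = (\<Sum>k\<in>?J. fscale (t powi k) (if k = l' then y else 0))" by (rule sum.cong) auto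
    finally show "(\<Sum>k\<in>?J. fscale (t powi k) (c k)) = 0"
      unfolding c_def fv.scale_right_diff_distrib sum_subtractf by (simp only: right_minus_eq)
  qed simp
  then show ?thesis unfolding c_def by (simp only: right_minus_eq)
qed

lemma E_commute:
  assumes i: "i < m" and A: "A \<in> Sp m" "\<And>t. t \<noteq> 0 \<Longrightarrow> A * DM m i t = DM m i t * A" and x: "x \<in> space m"
  shows "\<rho> A (E i l x) = E i l (\<rho> A x)"
proof -
  have w: "wt i k (\<rho> A (E i k x))" for k
    unfolding wt_def
  proof (intro conjI allI impI)
    fix t :: 'k assume t: "t \<noteq> 0"
    have Ex: "E i k x \<in> space m" by (rule weight_data(3)[OF i])
    have "\<rho> (DM m i t) (\<rho> A (E i k x)) = \<rho> A (\<rho> (DM m i t) (E i k x))"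
      using rho_mult[OF DM_Sp[OF i t] A(1) Ex] rho_mult[OF A(1) DM_Sp[OF i t] Ex] A(2)[OF t] by simp
    then show "\<rho> (DM m i t) (\<rho> A (E i k x)) = fscale (t powi k) (\<rho> A (E i k x))"
      using wtD(2)[OF wt_E[OF i x] t] by (simp only: flin_scale[OF rho_lin])
  qed simp
  have "E i l (\<rho> A x) = E i l (\<Sum>k\<in>I i. \<rho> A (E i k x))"
    by (subst (1) E_sum[OF i x]) (simp only: flin_sum[OF rho_lin])
  also have "\<dots> = (\<Sum>k\<in>I i. if l = k then \<rho> A (E i k x) else 0)"
    by (simp only: flin_sum[OF weight_data(2)[OF i]] E_wt[OF i w])
  also have "\<dots> = \<rho> A (E i l x)"
    using weight_data(1,4)[OF i] by (simp add: flin_0[OF rho_lin])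
  finally show ?thesis ..
qed

text \<open>A projection to \<open>U\<close> is applied to the expansion of \<open>\<rho> (DM m i t) x\<close>, which lies in \<open>U\<close>; coefficients of equal powers agree.\<close>

lemma E_subspace:
  assumes i: "i < m" and U: "fv.subspace U" "U \<subseteq> space m" "\<And>x t. x \<in> U \<Longrightarrow> t \<noteq> 0 \<Longrightarrow> \<rho> (DM m i t) x \<in> U" and x: "x \<in> U"
  shows "E i l x \<in> U"
proof (cases "l \<in> I i")
  case False then show ?thesis using weight_data(4)[OF i False] fv.subspace_0[OF U(1)] by simp
next
  case l: True
  obtain p where p: "flin p" "\<And>x. p x \<in> U" "\<And>x. x \<in> U \<Longrightarrow> p x = x" using projection_exists[OF U(1)] by metis
  have "E i l x - p (E i l x) = 0"
  proof (rule vector_powi_sum_zero[OF weight_data(1)[OF i] _ l])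
    fix t :: 'k assume t: "t \<noteq> 0"
    have xV: "x \<in> space m" using x U(2) by blast
    let ?s = "\<Sum>l\<in>I i. fscale (t powi l) (E i l x)"
    have "?s \<in> U" using U(3)[OF x t] weight_data(5)[OF i xV t] by simp
    then have "?s - p ?s = 0" using p(3) by simp
    moreover have "p ?s = (\<Sum>l\<in>I i. fscale (t powi l) (p (E i l x)))" by (simp only: flin_sum[OF p(1)] flin_scale[OF p(1)])
    ultimately show "(\<Sum>l\<in>I i. fscale (t powi l) (E i l x - p (E i l x))) = 0"
      by (simp only: fv.scale_right_diff_distrib sum_subtractf)
  qed
  then show ?thesis using p(2)[of "E i l x"] by (simp only: right_minus_eq)
qed

lemma wt_flip: assumes i: "i < m" and f: "wt i l f" shows "wt i (- l) (\<rho> (FL m i) f)"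
  unfolding wt_def
proof (intro conjI allI impI)
  fix t :: 'k assume t: "t \<noteq> 0"
  have it: "inverse t \<noteq> 0" using t by simp
  have "\<rho> (DM m i t) (\<rho> (FL m i) f) = \<rho> (FL m i) (\<rho> (DM m i (inverse t)) f)"
    using rho_mult[OF DM_Sp[OF i t] FL_Sp[OF i] wtD(1)[OF f]] rho_mult[OF FL_Sp[OF i] DM_Sp[OF i it] wtD(1)[OF f]] FL_DM[OF i t] by simp
  also have "\<dots> = fscale (inverse t powi l) (\<rho> (FL m i) f)" unfolding wtD(2)[OF f it] by (rule flin_scale[OF rho_lin])
  also have "inverse t powi l = t powi (- l)" by (simp add: power_int_minus power_int_inverse)
  finally show "\<rho> (DM m i t) (\<rho> (FL m i) f) = fscale (t powi - l) (\<rho> (FL m i) f)" .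
qed simp

text \<open>Subspaces invariant under the copy of \<open>Sp (2 (m - i))\<close>.\<close>

definition inv_space :: "nat \<Rightarrow> (nat \<Rightarrow> 'k) set \<Rightarrow> bool" where
  "inv_space i U \<longleftrightarrow> fv.subspace U \<and> U \<subseteq> space m \<and> (\<forall>A\<in>stab m i. \<forall>x\<in>U. \<rho> A x \<in> U)"

lemma inv_spaceD:
  assumes "inv_space i U"
  shows "fv.subspace U" "U \<subseteq> space m" "x \<in> U \<Longrightarrow> x \<in> space m" "fd U" "A \<in> stab m i \<Longrightarrow> x \<in> U \<Longrightarrow> \<rho> A x \<in> U"
  using assms fd_subset[OF fd_space] by (auto simp: inv_space_def)

lemma inv_space_E: "inv_space i U \<Longrightarrow> i < m \<Longrightarrow> x \<in> U \<Longrightarrow> E i l x \<in> U"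
  by (rule E_subspace) (auto simp: inv_spaceD DM_stab)

lemma TV_stab: "v \<in> tail m i \<Longrightarrow> i \<le> m \<Longrightarrow> TV m v s \<in> stab m i"
  by (rule tgen_stab[OF tgen_TV]) (auto simp: tail_space)

text \<open>Weights occur in opposite pairs, so the top weight is nonnegative, and if it is zero there are no others.\<close>

lemma top_weight:
  assumes U: "inv_space i U" and i: "i < m" and ne: "U \<noteq> {0}"
  obtains l where "l \<ge> 0" "\<exists>f\<in>U. f \<noteq> 0 \<and> wt i l f" "\<forall>y\<in>U. \<forall>j>l. E i j y = 0"
    "l = 0 \<longrightarrow> (\<forall>y\<in>U. wt i 0 y)"
proof -
  let ?L = "{l \<in> I i. \<exists>y\<in>U. E i l y \<noteq> 0}"
  have fin: "finite ?L" using weight_data(1)[OF i] by simp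
  obtain x where x: "x \<in> U" "x \<noteq> 0" using ne fv.subspace_0[OF inv_spaceD(1)[OF U]] by blast
  have "?L \<noteq> {}"
  proof
    assume "?L = {}"
    then have "(\<Sum>l\<in>I i. E i l x) = 0" using x(1) by (intro sum.neutral) blast
    then show False using E_sum[OF i inv_spaceD(3)[OF U x(1)]] x(2) by simp
  qed
  define l where "l = Max ?L"
  have l: "l \<in> ?L" unfolding l_def by (rule Max_in[OF fin \<open>?L \<noteq> {}\<close>])
  have le: "j \<le> l" if "y \<in> U" "E i j y \<noteq> 0" for y j
  proof -
    have "j \<in> I i" using that(2) weight_data(4)[OF i] by blast
    then show ?thesis unfolding l_def using that by (intro Max_ge[OF fin]) blast
  qed
  \<comment> \<open>the weights are symmetric about zero\<close>
  have ge: "- l \<le> j" if y: "y \<in> U" "E i j y \<noteq> 0" for y j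
  proof -
    let ?f = "\<rho> (FL m i) (E i j y)"
    have w: "wt i (- j) ?f" by (rule wt_flip[OF i wt_E[OF i inv_spaceD(3)[OF U y(1)]]])
    have "?f \<noteq> 0" by (rule rho_nonzero[OF FL_Sp[OF i] weight_data(3)[OF i] y(2)])
    then have "E i (- j) ?f \<noteq> 0" using E_wt[OF i w, of "- j"] by simp
    moreover have "?f \<in> U" by (rule inv_spaceD(5)[OF U FL_stab[OF order_refl i] inv_space_E[OF U i y(1)]])
    ultimately show ?thesis using le by fastforce
  qed
  obtain y where y: "y \<in> U" "E i l y \<noteq> 0" using l by blast
  show thesis
  proof (rule that)
    show "l \<ge> 0" using ge[OF y] by simp
    show "\<exists>f\<in>U. f \<noteq> 0 \<and> wt i l f"
      using y inv_space_E[OF U i y(1)] wt_E[OF i inv_spaceD(3)[OF U y(1)]] by blast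
    show "\<forall>y\<in>U. \<forall>j>l. E i j y = 0" using le by fastforce
    show "l = 0 \<longrightarrow> (\<forall>y\<in>U. wt i 0 y)"
    proof (intro impI ballI)
      fix y assume that: "l = 0" and y: "y \<in> U"
      have "y = (\<Sum>l\<in>I i. if l = 0 then E i 0 y else 0)"
        by (subst E_sum[OF i inv_spaceD(3)[OF U y]], rule sum.cong) (use le[OF y] ge[OF y] that in force)+
      also have "\<dots> = E i 0 y" using weight_data(1,4)[OF i] by simp
      finally show "wt i 0 y" using wt_E[OF i inv_spaceD(3)[OF U y], of 0] by simp
    qed
  qed
qed

text \<open>The Weyl group element \<open>FL m i\<close> exchanges opposite weight spaces.\<close>

lemma half_dim:
  assumes U: "inv_space i U" and i: "i < m" and l: "l > 0"
  shows "2 * fv.dim {y \<in> U. wt i l y} \<le> fv.dim U" "fv.dim {y \<in> U. wt i l y} = fv.dim {y \<in> U. wt i (- l) y}"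
proof -
  note D = inv_spaceD[OF U]
  have sub: "fv.subspace {y \<in> U. wt i k y}" for k
    using D(1) by (auto simp: fv.subspace_def wt_def flin_simps[OF rho_lin] fv.scale_right_distrib fv.scale_left_commute)
  have fdk: "fd {y \<in> U. wt i k y}" for k by (rule fd_subset[OF D(4)]) blast
  have le: "fv.dim {y \<in> U. wt i k y} \<le> fv.dim {y \<in> U. wt i (- k) y}" for k
  proof (rule dim_le_of_inj(2)[OF rho_lin sub _ fdk])
    show "x = 0" if "x \<in> {y \<in> U. wt i k y}" "\<rho> (FL m i) x = 0" for x
      using that rho_nonzero[OF FL_Sp[OF i], of x] D(3) by blast
    show "\<rho> (FL m i) ` {y \<in> U. wt i k y} \<subseteq> {y \<in> U. wt i (- k) y}"
      using wt_flip[OF i] D(5)[OF FL_stab[OF order_refl i]] by auto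
  qed
  show eq: "fv.dim {y \<in> U. wt i l y} = fv.dim {y \<in> U. wt i (- l) y}" using le[of l] le[of "- l"] by simp
  have "{y \<in> U. wt i l y} \<subseteq> E i l ` U"
  proof
    fix y assume y: "y \<in> {y \<in> U. wt i l y}"
    then have "E i l y = y" using E_wt[OF i, of l y l] by simp
    then show "y \<in> E i l ` U" using y by (metis (no_types, lifting) imageI mem_Collect_eq)
  qed
  then have "fv.dim {y \<in> U. wt i l y} \<le> fv.dim (E i l ` U)" by (rule fd_dim_mono[OF fd_image[OF weight_data(2)[OF i] D(4)]])
  moreover have "fv.dim {y \<in> U. wt i (- l) y} \<le> fv.dim {y \<in> U. E i l y = 0}"
    by (rule fd_dim_mono[OF fd_subset[OF D(4)]]) (use E_wt[OF i, of "- l" _ l] l in auto)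
  ultimately show "2 * fv.dim {y \<in> U. wt i l y} \<le> fv.dim U"
    using rank_nullity[OF weight_data(2)[OF i] D(1,4), of l] eq by simp
qed

end

context symplectic_endomorphism
begin

lemma rho_tgen_fix:
  assumes "A \<in> tgen m S" "f \<in> space m" "\<And>v s. v \<in> S \<Longrightarrow> v \<in> space m \<Longrightarrow> \<rho> (TV m v s) f = f"
  shows "\<rho> A f = f"
  using assms(1)
proof (induction rule: tgen.induct)
  case one show ?case by (rule rho_one[OF assms(2)])
next
  case (step v A s)
  have "\<rho> (TV m v s * A) f = \<rho> (TV m v s) (\<rho> A f)" by (rule rho_mult[OF TV_Sp[OF step(2)] tgen_Sp[OF step(3)] assms(2)])
  then show ?case using step(4) assms(3)[OF step(1,2)] by simp
qed

text \<open>The transvections in question generate the stabilizer of \<open>delta i\<close> in \<open>stab m i\<close>.\<close>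

definition hw :: "nat \<Rightarrow> (nat \<Rightarrow> 'k) \<Rightarrow> bool" where
  "hw i f \<longleftrightarrow> f \<in> space m \<and> (\<forall>v\<in>tail m i. om m (delta i, v) = 0 \<longrightarrow> (\<forall>s. \<rho> (TV m v s) f = f))"

lemma hw_space: "hw i f \<Longrightarrow> f \<in> space m"
  and hw_fix: "hw i f \<Longrightarrow> v \<in> tail m i \<Longrightarrow> om m (delta i, v) = 0 \<Longrightarrow> \<rho> (TV m v s) f = f"
  by (auto simp: hw_def)

text \<open>Since the stabilizer of \<open>delta i\<close> is generated by transvections, \<open>\<rho> A f\<close> depends only on the image of \<open>delta i\<close>.\<close>

lemma hw_well_defined:
  assumes hw: "hw i f" and i: "i < m" and A: "A \<in> stab m i" and B: "B \<in> stab m i"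
    and e: "act m A (delta i) = act m B (delta i)"
  shows "\<rho> A f = \<rho> B f"
proof -
  note S = stab_Sp[OF A] stab_Sp[OF B] and f = hw_space[OF hw]
  have d: "(delta i :: nat \<Rightarrow> 'k) \<in> space m" using i by simp
  obtain C where C: "C \<in> Sp m" "C * B = 1\<^sub>m (2 * m)" "B * C = 1\<^sub>m (2 * m)" by (rule Sp_inverse[OF S(2)])
  have Cs: "C \<in> stab m i" by (rule stab_inverse[OF B C(1,2)]) (use i in simp)
  have "act m (C * A) (delta i) = act m (C * B) (delta i)"
    using Sp_act_mult[OF C(1) S(1) d] Sp_act_mult[OF C(1) S(2) d] e by simp
  then have "act m (C * A) (delta i) = delta i" using C(2) act_one[OF d] by simp
  moreover have "C * A \<in> stab m i" by (rule stab_mult[OF Cs A]) (use i in simp)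
  ultimately have t: "C * A \<in> tgen m {v \<in> tail m i. om m (delta i, v) = 0}" by (intro stab_vector_subset_tgen[OF i])
  have "\<rho> (C * A) f = f" by (rule rho_tgen_fix[OF t f]) (use hw_fix[OF hw] in blast)
  moreover have "\<rho> B (\<rho> C (\<rho> A f)) = \<rho> A f" by (rule rho_cancel[OF S(2) C(1,3)]) simp
  ultimately show ?thesis using rho_mult[OF C(1) S(1) f] by simp
qed

text \<open>A multiple of the image of \<open>delta i\<close> is reached by composing with the torus, which acts on \<open>f\<close> through its weight.\<close>

lemma hw_scale:
  assumes hw: "hw i f" and wt: "wt i l f" and i: "i < m" and A: "A \<in> stab m i" and B: "B \<in> stab m i" and c: "c \<noteq> 0"
    and e: "act m A (delta i) = fscale c (act m B (delta i))"
  shows "\<rho> A f = fscale (c powi l) (\<rho> B f)"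
proof -
  have D: "DM m i c \<in> stab m i" by (rule DM_stab[OF order_refl i c])
  have d: "(delta i :: nat \<Rightarrow> 'k) \<in> space m" using i by simp
  have im: "i \<le> m" using i by simp
  have "act m (DM m i c) (delta i) = fscale c (delta i)" using d i c by (simp add: DM_act dg_delta)
  then have "act m (B * DM m i c) (delta i) = act m A (delta i)"
    using Sp_act_mult[OF stab_Sp[OF B] stab_Sp[OF D] d] e by (simp only: flin_scale[OF flin_act])
  then have "\<rho> A f = \<rho> (B * DM m i c) f"
    by (intro hw_well_defined[OF hw i A stab_mult[OF B D im]]) simp
  also have "\<dots> = \<rho> B (\<rho> (DM m i c) f)" by (rule rho_mult[OF stab_Sp[OF B] stab_Sp[OF D] hw_space[OF hw]])
  finally show ?thesis using wtD(2)[OF wt c] by (simp only: flin_scale[OF rho_lin])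
qed

text \<open>Conjugation by the torus contracts a transvection orthogonal to \<open>delta i\<close> to one of the next tail, and because \<open>f\<close> has top weight only
  nonpositive powers of the parameter appear in its image.\<close>

lemma top_weight_hw:
  assumes U: "inv_space i U" and i: "i < m" and top: "\<forall>y\<in>U. \<forall>j>l. E i j y = 0"
    and f: "f \<in> U" "wt i l f" and fx: "\<And>w s. w \<in> tail m (Suc i) \<Longrightarrow> \<rho> (TV m w s) f = f"
  shows "hw i f"
  unfolding hw_def
proof (intro conjI ballI impI allI)
  show fs: "f \<in> space m" by (rule inv_spaceD(3)[OF U f(1)])
  fix v :: "nat \<Rightarrow> 'k" and s assume v: "v \<in> tail m i" "om m (delta i, v) = 0"
  note vs = tail_space[OF v(1)]
  have vi: "v (i + m) = 0" using v(2) om_delta_left(1)[OF vs i] by simp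
  define w where "w = (\<lambda>j. if j = i then 0 else v j)"
  have w: "w \<in> tail m (Suc i)" using v(1) vi by (auto simp: w_def tail_def space_def supported_def less_Suc_eq)
  define u where "u t = fscale (t * v i) (delta i) + w" for t
  have us: "u t \<in> space m" for t using tail_space[OF w] i by (simp add: u_def)
  have u1: "u 1 = v" by (auto simp: u_def w_def fun_eq_iff pointwise delta_apply)
  have u0: "u 0 = w" by (auto simp: u_def fun_eq_iff pointwise)
  have ud: "dg m i t v = u t" for t using vi by (auto simp: dg_def u_def w_def fun_eq_iff pointwise delta_apply)
  define y where "y = \<rho> (TV m v s) f"
  have im: "i \<le> m" using i by simp
  have yU: "y \<in> U" unfolding y_def by (rule inv_spaceD(5)[OF U TV_stab[OF v(1) im] f(1)])
  define h where "h t = \<rho> (TV m (u t) s) f" for t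
  have hp: "polyf (\<lambda>t. h t r)" for r
    unfolding h_def
  proof (rule rho_polyf)
    show "TV m (u t) s \<in> Sp m" for t by (rule TV_Sp[OF us])
    have "polyf (\<lambda>t. u t j)" for j
      unfolding u_def plus_fun_apply fscale_apply by (intro polyf_add polyf_mult polyf_id polyf_const)
    then show "polyf (\<lambda>t. TV m (u t) s $$ (a, b))" if "a < 2 * m" "b < 2 * m" for a b
      using TV_polyf[of u m "\<lambda>t. s"] us that polyf_const by blast
  qed
  have he: "h t = (\<Sum>j\<in>I i. fscale (t powi (j - l)) (E i j y))" if t: "t \<noteq> 0" for t
  proof -
    have D: "DM m i t \<in> Sp m" by (rule DM_Sp[OF i t])
    have "DM m i t * TV m v s = TV m (u t) s * DM m i t"
      using TV_conj[OF D vs] DM_act[OF i t vs] ud by simp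
    then have "\<rho> (DM m i t) y = \<rho> (TV m (u t) s) (\<rho> (DM m i t) f)"
      unfolding y_def using rho_mult[OF D TV_Sp[OF vs] fs, of s] rho_mult[OF TV_Sp[OF us[of t]] D fs, of s] by simp
    also have "\<dots> = fscale (t powi l) (h t)" unfolding wtD(2)[OF f(2) t] h_def by (rule flin_scale[OF rho_lin])
    finally have "fscale (t powi (- l)) (fscale (t powi l) (h t)) = fscale (t powi (- l)) (\<Sum>j\<in>I i. fscale (t powi j) (E i j y))"
      using weight_data(5)[OF i inv_spaceD(3)[OF U yU] t] by simp
    moreover have "t powi (- l) * t powi l = 1" using t by (simp add: power_int_minus)
    moreover have "t powi (- l) * t powi j = t powi (j - l)" for j using t by (simp add: power_int_diff power_int_minus field_simps)
    ultimately show ?thesis by (simp add: fv.scale_sum_right)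
  qed
  have "h 1 r = h 0 r" for r
  proof -
    let ?J = "(\<lambda>j. j - l) ` {j \<in> I i. j \<le> l}"
    obtain P where P: "\<And>t. h t r = poly P t" using hp[of r] unfolding polyf_def by blast
    have "poly P t = (\<Sum>j\<in>?J. t powi j * E i (j + l) y r)" if t: "t \<noteq> 0" for t
    proof -
      have "poly P t = (\<Sum>j\<in>I i. t powi (j - l) * E i j y r)" using P[of t] he[OF t] by (simp add: pointwise)
      also have "\<dots> = (\<Sum>j\<in>{j \<in> I i. j \<le> l}. t powi (j - l) * E i j y r)"
      proof (rule sum.mono_neutral_right)
        show "\<forall>j\<in>I i - {j \<in> I i. j \<le> l}. t powi (j - l) * E i j y r = 0"
        proof
          fix j assume "j \<in> I i - {j \<in> I i. j \<le> l}"
          then have "l < j" by auto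
          then have "E i j y = 0" using top yU by blast
          then show "t powi (j - l) * E i j y r = 0" by (simp add: pointwise)
        qed
      qed (use weight_data(1)[OF i] in auto)
      also have "\<dots> = (\<Sum>j\<in>?J. t powi j * E i (j + l) y r)" by (subst sum.reindex) (auto simp: inj_on_def)
      finally show ?thesis .
    qed
    then have "poly P 1 = poly P 0"
      by (rule poly_nonpositive_const[rotated 2]) (use weight_data(1)[OF i] in auto)
    then show ?thesis using P by simp
  qed
  then have "h 1 = h 0" by (rule ext)
  then show "\<rho> (TV m v s) f = f" using fx[OF w] unfolding h_def u0 u1 by simp
qed

text \<open>All transvections along nonzero vectors of a tail with the same parameter are conjugate under its symplectic group.\<close>

lemma trivial_spread:
  assumes U: "inv_space i U" and i: "i \<le> m" and v0: "v0 \<in> tail m i" "v0 \<noteq> 0"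
    and tr: "\<And>s x. x \<in> U \<Longrightarrow> \<rho> (TV m v0 s) x = x" and v: "v \<in> tail m i" and x: "x \<in> U"
  shows "\<rho> (TV m v s) x = x"
proof (cases "v = 0")
  case True
  have "TV m (fscale 0 v0) s = 1\<^sub>m (2 * m)" using TV_scale[OF tail_space[OF v0(1)], of 0 s] TV_0[OF tail_space[OF v0(1)]] by simp
  then show ?thesis using True rho_one[OF inv_spaceD(3)[OF U x]] by simp
next
  case False
  obtain A where A: "A \<in> tgen m (tail m i)" "act m A v0 = v" using tgen_transitive[OF v0 v False i] by blast
  obtain B where B: "B \<in> tgen m (tail m i)" "A * B = 1\<^sub>m (2 * m)" using tgen_inverse[OF A(1)] by blast
  note S = tgen_Sp[OF A(1)] tgen_Sp[OF B(1)]
  let ?y = "\<rho> B x"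
  have y: "?y \<in> U" by (rule inv_spaceD(5)[OF U tgen_stab[OF B(1) i] x])
  have xy: "\<rho> A ?y = x" by (rule rho_cancel[OF S B(2) inv_spaceD(3)[OF U x]])
  have "A * TV m v0 s = TV m v s * A" using TV_conj[OF S(1) tail_space[OF v0(1)]] A(2) by simp
  then have "\<rho> (TV m v s) (\<rho> A ?y) = \<rho> A (\<rho> (TV m v0 s) ?y)"
    using rho_mult[OF TV_Sp[OF tail_space[OF v]] S(1) inv_spaceD(3)[OF U y], of s] rho_mult[OF S(1) TV_Sp[OF tail_space[OF v0(1)]] inv_spaceD(3)[OF U y], of s] by simp
  then show ?thesis using tr[OF y] xy by simp
qed

lemma exists_torus_element: "\<exists>t::'k. t \<noteq> 0 \<and> t * t \<noteq> 1"
proof (rule ccontr)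
  assume "\<not> ?thesis"
  then have "(UNIV :: 'k set) \<subseteq> {0, 1, - 1}" using square_eq_1_iff by blast
  then show False using infinite_alg_closed finite_subset by (metis finite.emptyI finite_insert)
qed

text \<open>Conjugation by the torus multiplies the parameter of the transvection along \<open>delta i\<close> by \<open>t\<^sup>2\<close>, but the torus acts trivially. So the
parameters \<open>u\<close> and \<open>t\<^sup>2 u\<close> give the same operator, and their difference is arbitrary.\<close>

lemma zero_weight_trivial:
  assumes U: "inv_space i U" and i: "i < m" and z: "\<forall>y\<in>U. wt i 0 y" and y: "y \<in> U"
  shows "\<rho> (TV m (delta i) s) y = y"
proof -
  obtain t :: 'k where t: "t \<noteq> 0" "t * t \<noteq> 1" using exists_torus_element by blast
  have im: "i \<le> m" using i by simp
  have d: "(delta i :: nat \<Rightarrow> 'k) \<in> tail m i" by (rule tail_delta(1)[OF order_refl i])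
  note ds = tail_space[OF d]
  have T: "TV m (delta i) u \<in> Sp m" for u :: 'k by (rule TV_Sp[OF ds])
  have D: "DM m i t \<in> Sp m" by (rule DM_Sp[OF i t(1)])
  have ys: "y \<in> space m" by (rule inv_spaceD(3)[OF U y])
  have TU: "\<rho> (TV m (delta i) u) y \<in> U" for u by (rule inv_spaceD(5)[OF U TV_stab[OF d im] y])
  have w0: "\<rho> (DM m i t) x = x" if "x \<in> U" for x using wtD(2)[OF bspec[OF z that] t(1)] by simp
  have eq: "\<rho> (TV m (delta i) u) y = \<rho> (TV m (delta i) (t * t * u)) y" for u
  proof -
    have "DM m i t * TV m (delta i) u = TV m (delta i) (t * t * u) * DM m i t"
      using TV_conj[OF D ds] DM_act[OF i t(1) ds] dg_delta[OF i, of t i] TV_scale[OF ds] by simp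
    then have "\<rho> (DM m i t) (\<rho> (TV m (delta i) u) y) = \<rho> (TV m (delta i) (t * t * u)) (\<rho> (DM m i t) y)"
      using rho_mult[OF D T ys, of u] rho_mult[OF T D ys, of "t * t * u"] by simp
    then show ?thesis using w0[OF TU] w0[OF y] by simp
  qed
  define u where "u = s / (t * t - 1)"
  have u: "t * t * u = u + s" using t(2) by (simp add: u_def field_simps)
  have "\<rho> (TV m (delta i) u) y = \<rho> (TV m (delta i) u) (\<rho> (TV m (delta i) s) y)"
    using eq[of u] rho_mult[OF T T ys, of u s] TV_add[OF ds, of u s] unfolding u by simp
  then have "\<rho> (TV m (delta i) (- u)) (\<rho> (TV m (delta i) u) y) = \<rho> (TV m (delta i) (- u)) (\<rho> (TV m (delta i) u) (\<rho> (TV m (delta i) s) y))" by simp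
  moreover have "\<rho> (TV m (delta i) (- u)) (\<rho> (TV m (delta i) u) x) = x" if "x \<in> space m" for x
    by (rule rho_cancel[OF T T _ that]) (use TV_add[OF ds, of "- u" u] TV_0[OF ds] in simp)
  ultimately show ?thesis using ys by simp
qed

text \<open>The orbit of a highest weight vector contains vectors of weights \<open>l\<close> and \<open>- l\<close> for each coordinate torus.\<close>

definition hw_family :: "nat \<Rightarrow> (nat \<Rightarrow> 'k) \<Rightarrow> nat \<Rightarrow> nat \<Rightarrow> 'k" where
  "hw_family i f b = \<rho> (SOME A. A \<in> stab m i \<and> act m A (delta i) = delta b) f"

lemma hw_family_stab:
  assumes i: "i < m" and b: "b \<in> {i..<m} \<union> {i + m..<2 * m}"
  obtains A where "A \<in> stab m i" "act m A (delta i) = (delta b :: nat \<Rightarrow> 'k)" "hw_family i f b = \<rho> A f"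
proof -
  have im: "i \<le> m" using i by simp
  have db: "(delta b :: nat \<Rightarrow> 'k) \<in> tail m i"
  proof (cases "b < m")
    case True then show ?thesis using b by (intro tail_delta(1)) auto
  next
    case False
    then have "b = (b - m) + m" "i \<le> b - m" "b - m < m" using b by auto
    then show ?thesis using tail_delta(2)[of i "b - m" m] by simp
  qed
  obtain A where A: "A \<in> tgen m (tail m i)" "act m A (delta i) = (delta b :: nat \<Rightarrow> 'k)"
    using tgen_transitive[OF tail_delta(1)[OF order_refl i] delta_nonzero db delta_nonzero im] by blast
  then have "\<exists>A. A \<in> stab m i \<and> act m A (delta i) = (delta b :: nat \<Rightarrow> 'k)" using tgen_stab[OF A(1) im] by blast
  from someI_ex[OF this] show thesis by (intro that[OF _ _ hw_family_def]) auto
qed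

lemma hw_family_space: "hw_family i f b \<in> space m" by (simp add: hw_family_def)

lemma hw_family_wt:
  assumes hw: "hw i f" and wt: "wt i l f" and i: "i < m" and b: "b \<in> {i..<m} \<union> {i + m..<2 * m}" and j: "i \<le> j" "j < m"
  shows "wt j (if b = j then l else if b = j + m then - l else 0) (hw_family i f b)"
  unfolding wt_def
proof (intro conjI allI impI)
  show "hw_family i f b \<in> space m" by (rule hw_family_space)
  fix t :: 'k assume t: "t \<noteq> 0"
  obtain A where A: "A \<in> stab m i" "act m A (delta i) = (delta b :: nat \<Rightarrow> 'k)" "hw_family i f b = \<rho> A f" by (rule hw_family_stab[OF i b])
  let ?c = "if b = j then t else if b = j + m then inverse t else 1"
  have D: "DM m j t \<in> stab m i" by (rule DM_stab[OF j t])
  have d: "(delta i :: nat \<Rightarrow> 'k) \<in> space m" "(delta b :: nat \<Rightarrow> 'k) \<in> space m" using i b by auto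
  have "act m (DM m j t * A) (delta i) = fscale ?c (act m A (delta i))"
    unfolding Sp_act_mult[OF stab_Sp[OF D] stab_Sp[OF A(1)] d(1)] A(2) DM_act[OF j(2) t d(2)] dg_delta[OF j(2)] by simp
  then have "\<rho> (DM m j t * A) f = fscale (?c powi l) (\<rho> A f)"
    by (intro hw_scale[OF hw wt i stab_mult[OF D A(1)] A(1)]) (use t i in auto)
  moreover have "?c powi l = t powi (if b = j then l else if b = j + m then - l else 0)"
    by (simp add: power_int_minus power_int_inverse)
  ultimately show "\<rho> (DM m j t) (hw_family i f b) = fscale (t powi (if b = j then l else if b = j + m then - l else 0)) (hw_family i f b)"
    using rho_mult[OF stab_Sp[OF D] stab_Sp[OF A(1)] hw_space[OF hw]] A(3) by simp
qed

lemma hw_family_nonzero: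
  assumes "hw i f" "f \<noteq> 0" "i < m" "b \<in> {i..<m} \<union> {i + m..<2 * m}"
  shows "hw_family i f b \<noteq> 0"
proof -
  obtain A where A: "A \<in> stab m i" "hw_family i f b = \<rho> A f" by (rule hw_family_stab[OF assms(3,4)])
  then show ?thesis using rho_nonzero[OF stab_Sp[OF A(1)] hw_space[OF assms(1)] assms(2)] by simp
qed

lemma hw_family_independent:
  assumes hw: "hw i f" and wt: "wt i l f" and l: "l \<noteq> 0" and f: "f \<noteq> 0" and i: "i < m"
    and z: "(\<Sum>b\<in>{i..<m} \<union> {i + m..<2 * m}. fscale (a b) (hw_family i f b)) = 0" and b: "b \<in> {i..<m} \<union> {i + m..<2 * m}"
  shows "a b = 0"
proof -
  let ?B = "{i..<m} \<union> {i + m..<2 * m}"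
  define j where "j = (if b < m then b else b - m)"
  define k where "k = (if b < m then l else - l)"
  have j: "i \<le> j" "j < m" and bj: "b = (if b < m then j else j + m)" using b by (auto simp: j_def)
  have "E j k (\<Sum>c\<in>?B. fscale (a c) (hw_family i f c)) = (\<Sum>c\<in>?B. fscale (a c) (E j k (hw_family i f c)))"
    by (simp only: flin_sum[OF weight_data(2)[OF j(2)]] flin_scale[OF weight_data(2)[OF j(2)]])
  also have "\<dots> = (\<Sum>c\<in>?B. if c = b then fscale (a b) (hw_family i f b) else 0)"
  proof (rule sum.cong[OF refl])
    fix c assume c: "c \<in> ?B"
    have "E j k (hw_family i f c) = (if c = b then hw_family i f c else 0)"
      unfolding E_wt[OF j(2) hw_family_wt[OF hw wt i c j]] k_def using bj l j(2) by (cases "b < m") auto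
    then show "fscale (a c) (E j k (hw_family i f c)) = (if c = b then fscale (a b) (hw_family i f b) else 0)" by auto
  qed
  also have "\<dots> = fscale (a b) (hw_family i f b)" using b by (subst sum.delta) auto
  finally have "fscale (a b) (hw_family i f b) = 0" unfolding z flin_0[OF weight_data(2)[OF j(2)]] by (rule sym)
  then show ?thesis using hw_family_nonzero[OF hw f i b] fv.scale_eq_0_iff by blast
qed

lemma hw_family_card: "i < m \<Longrightarrow> card ({i..<m} \<union> {i + m..<2 * m}) = 2 * (m - i)"
  by (subst card_Un_disjoint) auto

text \<open>The orbit vectors for the standard basis vectors are separated by their weights.\<close>

lemma hw_dim:
  assumes U: "inv_space i U" and hw: "hw i f" and wt: "wt i l f" and l: "l \<noteq> 0" and f: "f \<noteq> 0" "f \<in> U" and i: "i < m"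
  shows "2 * (m - i) \<le> fv.dim U"
  unfolding hw_family_card[OF i, symmetric]
proof (rule family_card_le_dim[OF inv_spaceD(4)[OF U]])
  fix b assume b: "b \<in> {i..<m} \<union> {i + m..<2 * m}"
  show "hw_family i f b \<in> U" by (rule hw_family_stab[OF i b, of f]) (use inv_spaceD(5)[OF U _ f(2)] in simp)
qed (use hw_family_independent[OF hw wt l f(1) i] in auto)

lemma weight_space_inv:
  assumes U: "inv_space i U" and i: "i < m"
  shows "inv_space (Suc i) {y \<in> U. wt i l y}"
  unfolding inv_space_def
proof (intro conjI ballI)
  note D = inv_spaceD[OF U]
  show "fv.subspace {y \<in> U. wt i l y}"
    using D(1) by (auto simp: fv.subspace_def wt_def flin_simps[OF rho_lin] fv.scale_right_distrib fv.scale_left_commute)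
  show "{y \<in> U. wt i l y} \<subseteq> space m" using D(2) by blast
  fix A :: "'k mat" and x assume A: "A \<in> stab m (Suc i)" and x: "x \<in> {y \<in> U. wt i l y}"
  have Ai: "A \<in> stab m i" using A by (auto simp: stab_def)
  note S = stab_Sp[OF Ai]
  have xs: "x \<in> space m" using x D(3) by blast
  have "\<rho> (DM m i t) (\<rho> A x) = fscale (t powi l) (\<rho> A x)" if t: "t \<noteq> 0" for t
  proof -
    have "\<rho> (DM m i t) (\<rho> A x) = \<rho> A (\<rho> (DM m i t) x)"
      using rho_mult[OF DM_Sp[OF i t] S xs] rho_mult[OF S DM_Sp[OF i t] xs] stab_commutes_DM[OF A i t] by simp
    then show ?thesis using wtD(2)[OF _ t, of i l x] x by (simp add: flin_scale[OF rho_lin])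
  qed
  then have "wt i l (\<rho> A x)" by (simp add: wt_def)
  then show "\<rho> A x \<in> {y \<in> U. wt i l y}" using D(5)[OF Ai] x by blast
qed

text \<open>Induction on \<open>m - i\<close>. If the top weight \<open>l\<close> is positive, its weight space has at most half of the dimension, so the next smaller
  symplectic group acts trivially on it. Then a top weight vector is a highest weight vector, and its
  orbit contains \<open>2 (m - i)\<close> independent vectors, too many for \<open>U\<close>.\<close>

lemma small_trivial:
  "i \<le> m \<Longrightarrow> inv_space i U \<Longrightarrow> fv.dim U < 2 * (m - i) \<Longrightarrow> v \<in> tail m i \<Longrightarrow> x \<in> U \<Longrightarrow> \<rho> (TV m v s) x = x"
proof (induction "m - i" arbitrary: i U v x s)
  case 0
  then show ?case by simp
next
  case (Suc n)
  have i: "i < m" using Suc(2) by simp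
  note U = Suc(4)
  show ?case
  proof (cases "U = {0}")
    case True
    then show ?thesis using Suc(7) by (simp add: flin_0[OF rho_lin])
  next
    case False
    obtain l where l: "l \<ge> 0" "\<exists>f\<in>U. f \<noteq> 0 \<and> wt i l f" "\<forall>y\<in>U. \<forall>j>l. E i j y = 0"
      "l = 0 \<longrightarrow> (\<forall>y\<in>U. wt i 0 y)"
      by (rule top_weight[OF U i False])
    obtain f where f: "f \<in> U" "f \<noteq> 0" "wt i l f" using l(2) by blast
    show ?thesis
    proof (cases "l = 0")
      case True
      show ?thesis
        by (rule trivial_spread[OF U Suc(3) tail_delta(1)[OF order_refl i] delta_nonzero zero_weight_trivial[OF U i mp[OF l(4) True]] Suc(6,7)])
    next
      case False
      then have lp: "l > 0" using l(1) by simp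
      let ?W = "{y \<in> U. wt i l y}"
      have W: "inv_space (Suc i) ?W" by (rule weight_space_inv[OF U i])
      have fW: "f \<in> ?W" using f by blast
      have "fv.dim ?W > 0"
      proof (rule ccontr)
        assume "\<not> ?thesis"
        moreover have "fv.independent {f}" using f(2) by simp
        then have "card {f} \<le> fv.dim ?W" using fd_independent[OF inv_spaceD(4)[OF W], of "{f}"] fW by simp
        ultimately show False by simp
      qed
      moreover have "m - i = Suc (m - Suc i)" using i by simp
      then have "fv.dim ?W < Suc (m - Suc i)" using half_dim(1)[OF U i lp] Suc(5) by linarith
      then have "fv.dim ?W \<le> m - Suc i" by simp
      ultimately have dim: "fv.dim ?W < 2 * (m - Suc i)" by linarith
      have "hw i f"
      proof (rule top_weight_hw[OF U i l(3) f(1,3)])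
        show "\<rho> (TV m w s) f = f" if "w \<in> tail m (Suc i)" for w s
          by (rule Suc(1)[OF _ _ W dim that fW]) (use Suc(2) i in auto)
      qed
      then have "2 * (m - i) \<le> fv.dim U" by (rule hw_dim[OF U _ f(3) _ f(2,1) i]) (use lp in simp)
      then show ?thesis using Suc(5) by simp
    qed
  qed
qed

section \<open>The highest weight vector\<close>

lemma inv_space_all: "inv_space 0 (space m)"
  by (auto simp: inv_space_def subspace_space)

lemma not_trivial: "\<exists>v\<in>space m. \<exists>s. \<exists>x\<in>space m. \<rho> (TV m v s) x \<noteq> x"
proof (rule ccontr)
  assume n: "\<not> ?thesis"
  have F1: "F A = 1\<^sub>m (2 * m)" if A: "A \<in> Sp m" for A
  proof (rule Sp_eqI[OF F_Sp[OF A] Sp_one])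
    fix x :: "nat \<Rightarrow> 'k" assume x: "x \<in> space m"
    have "A \<in> stab m 0" using A by (simp add: stab_def)
    then have t: "A \<in> tgen m (tail m 0)" using stab_subset_tgen[of 0 m] by blast
    have "\<rho> A x = x" by (rule rho_tgen_fix[OF t x]) (use n x in blast)
    then show "act m (F A) x = act m (1\<^sub>m (2 * m)) x" using act_one[OF x] by (simp add: \<rho>_def)
  qed
  have d: "(delta 0 :: nat \<Rightarrow> 'k) \<in> space m" "(delta (0 + m) :: nat \<Rightarrow> 'k) \<in> space m" using m2 by (auto intro!: space_delta)
  have "TV m (delta 0) 1 \<in> F ` Sp m" using F_surj TV_Sp[OF d(1)] by blast
  then have "TV m (delta 0) 1 = (1\<^sub>m (2 * m) :: 'k mat)" using F1 by auto
  then have e: "tv m (delta 0) 1 (delta (0 + m)) = (delta (0 + m) :: nat \<Rightarrow> 'k)" using TV_act[OF d, of 1] act_one[OF d(2)] by simp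
  have "om m (delta (0 + m), delta 0) = (- 1 :: 'k)" using om_delta_left(2)[OF d(1), of 0] m2 by (simp add: delta_apply)
  then have "tv m (delta 0) 1 (delta (0 + m)) 0 = (delta (0 + m) 0 - 1 :: 'k)" by (simp add: tv_def pointwise delta_apply)
  then show False unfolding e by simp
qed

lemma not_trivial_one:
  assumes v: "v \<in> space m" "v \<noteq> 0"
  shows "\<exists>s. \<exists>x\<in>space m. \<rho> (TV m v s) x \<noteq> x"
proof (rule ccontr)
  assume n: "\<not> ?thesis"
  have "\<rho> (TV m w s) x = x" if "w \<in> space m" "x \<in> space m" for w s x
    by (rule trivial_spread[OF inv_space_all, of v]) (use n v that in \<open>auto simp: tail_0\<close>)
  then show False using not_trivial by blast
qed

text \<open>The descent needs a weight space of dimension less than \<open>2 (m - 1)\<close>. The remaining case is \<open>m = 2\<close> with just two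
weight spaces, of dimension 2. Then \<open>- 1\<close> in the first torus acts as a scalar, so the transvections along \<open>e\<^sub>0 + e\<^sub>1\<close> and
\<open>e\<^sub>1 - e\<^sub>0\<close> act equally. Their quotient, and then also the commutators of it, act trivially, and among these there
are transvections.\<close>

lemma exceptional_dimension:
  assumes l: "l > 0" and top: "fv.dim {y \<in> space m. wt 0 l y} \<ge> 2 * (m - 1)"
  shows False
proof -
  let ?W = "\<lambda>l. {y \<in> space m. wt 0 l y}"
  have m0: "0 < m" using m2 by simp
  have dV: "fv.dim (space m :: (nat \<Rightarrow> 'k) set) = 2 * m" by (simp add: space_def supported_dim)
  note h = half_dim[OF inv_space_all m0 l]
  have mm: "m = 2" using h(1) top m2 unfolding dV by linarith
  have dl: "fv.dim (?W l) = m" using h(1) top m2 unfolding dV by linarith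
  have kerl: "{y \<in> space m. E 0 l y = 0} = ?W (- l)"
  proof (rule fd_dim_equal[symmetric])
    show "fv.subspace (?W (- l))" by (rule inv_spaceD(1)[OF weight_space_inv[OF inv_space_all m0]])
    show "fd {y \<in> space m. E 0 l y = 0}" by (rule fd_subset[OF fd_space]) blast
    show "?W (- l) \<subseteq> {y \<in> space m. E 0 l y = 0}" using E_wt[OF m0, of "- l" _ l] l by auto
    have "E 0 l ` space m \<subseteq> ?W l" using wt_E[OF m0] weight_data(3)[OF m0] by auto
    then have "fv.dim (E 0 l ` space m) \<le> fv.dim (?W l)"
      by (rule fd_dim_mono[OF inv_spaceD(4)[OF weight_space_inv[OF inv_space_all m0]]])
    moreover have "?W l \<subseteq> E 0 l ` space m"
    proof
      fix y assume y: "y \<in> ?W l"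
      then have "E 0 l y = y" using E_wt[OF m0, of l y l] by simp
      then show "y \<in> E 0 l ` space m" using y by (metis (no_types, lifting) imageI mem_Collect_eq)
    qed
    then have "fv.dim (?W l) \<le> fv.dim (E 0 l ` space m)"
      by (rule fd_dim_mono[OF fd_image[OF weight_data(2)[OF m0] fd_space]])
    ultimately show "fv.dim {y \<in> space m. E 0 l y = 0} \<le> fv.dim (?W (- l))"
      using rank_nullity[OF weight_data(2)[OF m0, of l] subspace_space[of m] fd_space] h(2) dl unfolding dV by linarith
  qed
  \<comment> \<open>so the element \<open>- 1\<close> of the first torus acts as a scalar\<close>
  let ?e = "(- 1) powi l :: 'k"
  have scal: "\<rho> (DM m 0 (- 1)) x = fscale ?e x" if x: "x \<in> space m" for x
  proof -
    let ?p = "E 0 l x" and ?q = "x - E 0 l x"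
    have p: "wt 0 l ?p" by (rule wt_E[OF m0 x])
    have "E 0 l ?q = 0" using E_wt[OF m0 p, of l] by (simp add: flin_diff[OF weight_data(2)[OF m0]])
    then have "?q \<in> ?W (- l)" unfolding kerl[symmetric] using x weight_data(3)[OF m0] subspace_space fv.subspace_diff by blast
    then have q: "wt 0 (- l) ?q" by blast
    have "(- 1) powi (- l) = ?e" by (simp add: power_int_minus power_int_minus_left)
    then have "\<rho> (DM m 0 (- 1)) ?p + \<rho> (DM m 0 (- 1)) ?q = fscale ?e ?p + fscale ?e ?q"
      using wtD(2)[OF p, of "- 1"] wtD(2)[OF q, of "- 1"] by simp
    then have "\<rho> (DM m 0 (- 1)) (?p + ?q) = fscale ?e (?p + ?q)" by (simp only: flin_add[OF rho_lin] fv.scale_right_distrib)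
    then show ?thesis by simp
  qed
  have e0: "?e \<noteq> 0" by simp
  have D: "DM m 0 (- 1) \<in> Sp m" by (rule DM_Sp[OF m0]) simp
  have d: "(delta 0 :: nat \<Rightarrow> 'k) \<in> space m" "(delta 1 :: nat \<Rightarrow> 'k) \<in> space m" "(delta (0 + m) :: nat \<Rightarrow> 'k) \<in> space m" using mm by (auto intro!: space_delta)
  have o: "om m (delta 0, delta 1) = (0::'k)" using om_delta_left(1)[OF d(2) m0] mm by (simp add: delta_apply)
  let ?a = "delta 0 :: nat \<Rightarrow> 'k" and ?b = "delta 1 :: nat \<Rightarrow> 'k" and ?f = "delta (0 + m) :: nat \<Rightarrow> 'k"
  have S: "?a + ?b \<in> space m" "?b - ?a \<in> space m" using d by simp_all
  have conj: "\<rho> (TV m (?a + ?b) s) x = \<rho> (TV m (?b - ?a) s) x" if x: "x \<in> space m" for s x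
  proof -
    have "dg m 0 (- 1) (?a + ?b) = ?b - ?a" using mm by (auto simp: dg_def delta_apply fun_eq_iff pointwise)
    then have "DM m 0 (- 1) * TV m (?a + ?b) s = TV m (?b - ?a) s * DM m 0 (- 1)"
      using TV_conj[OF D S(1)] DM_act[OF m0 _ S(1), of "- 1"] by simp
    then have "\<rho> (DM m 0 (- 1)) (\<rho> (TV m (?a + ?b) s) x) = \<rho> (TV m (?b - ?a) s) (\<rho> (DM m 0 (- 1)) x)"
      using rho_mult[OF D TV_Sp[OF S(1)] x, of s] rho_mult[OF TV_Sp[OF S(2)] D x, of s] by simp
    then have "fscale ?e (\<rho> (TV m (?a + ?b) s) x) = fscale ?e (\<rho> (TV m (?b - ?a) s) x)"
      using scal[OF x] scal[OF rho_space] by (simp only: flin_scale[OF rho_lin])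
    then show ?thesis using e0 by (simp add: fv.scale_left_imp_eq)
  qed
  have R: "RV m ?a ?b s \<in> Sp m" for s by (rule RV_Sp[OF d(1,2) o])
  have Rtriv: "\<rho> (RV m ?a ?b (2 * s)) x = x" if x: "x \<in> space m" for s x
  proof -
    have "\<rho> (TV m (?b - ?a) s) (\<rho> (RV m ?a ?b (2 * s)) x) = \<rho> (TV m (?b - ?a) s) x"
      using rho_mult[OF TV_Sp[OF S(2)] R x, of s "2 * s"] TV_sum[OF d(1,2) o, of s] conj[OF x, of s] by simp
    then have "\<rho> (TV m (?b - ?a) (- s)) (\<rho> (TV m (?b - ?a) s) (\<rho> (RV m ?a ?b (2 * s)) x)) = \<rho> (TV m (?b - ?a) (- s)) (\<rho> (TV m (?b - ?a) s) x)" by simp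
    moreover have "\<rho> (TV m (?b - ?a) (- s)) (\<rho> (TV m (?b - ?a) s) z) = z" if "z \<in> space m" for z
      by (rule rho_cancel[OF TV_Sp[OF S(2)] TV_Sp[OF S(2)] _ that]) (use TV_add[OF S(2), of "- s" s] TV_0[OF S(2)] in simp)
    ultimately show ?thesis using x by simp
  qed
  have of: "om m (?b, ?f) = 0" using om_delta_right(2)[OF d(2) m0] by (simp add: delta_apply)
  have oe: "om m (?a, ?f) = 1" using om_delta_right(2)[OF d(1) m0] by (simp add: delta_apply)
  have "\<rho> (TV m ?b u) x = x" if x: "x \<in> space m" for u x
  proof -
    define s where "s = u / 4"
    have "(4::'k) = 2 * 2" by simp
    then have four: "(4::'k) \<noteq> 0" using two by (metis mult_eq_0_iff)
    have u: "2 * (2 * s) * 1 * 1 = u" using four by (simp add: s_def)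
    let ?G = "RV m ?b ?f 1"
    have G: "?G \<in> Sp m" by (rule RV_Sp[OF d(2,3) of])
    have T: "TV m ?b u \<in> Sp m" by (rule TV_Sp[OF d(2)])
    obtain G' where G': "G' \<in> Sp m" "G' * ?G = 1\<^sub>m (2 * m)" "?G * G' = 1\<^sub>m (2 * m)" by (rule Sp_inverse[OF G])
    let ?y = "\<rho> G' x"
    have xy: "\<rho> ?G ?y = x" by (rule rho_cancel[OF G G'(1,3) x])
    have "?G * RV m ?a ?b (2 * s) = TV m ?b u * RV m ?a ?b (2 * s) * ?G"
      using RV_commutator[OF d(1) o d(2,3) of, of 1 "2 * s"] unfolding oe u .
    then have "\<rho> ?G (\<rho> (RV m ?a ?b (2 * s)) ?y) = \<rho> (TV m ?b u) (\<rho> (RV m ?a ?b (2 * s)) (\<rho> ?G ?y))"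
      using rho_mult[OF G R, of ?y "2 * s"] rho_mult[OF Sp_mult[OF T R] G, of ?y "2 * s"] rho_mult[OF T R, of "\<rho> ?G ?y" "2 * s"] by simp
    then show ?thesis using Rtriv[of ?y s] Rtriv[of "\<rho> ?G ?y" s] xy by simp
  qed
  then show False using not_trivial_one[OF d(2) delta_nonzero] by blast
qed

text \<open>A vector in the top weight space for the first torus: that space is too small for a nontrivial action of the next symplectic group.\<close>

theorem highest_weight_exists:
  obtains f k where "k > 0" "f \<noteq> 0" "wt 0 (int k) f" "hw 0 f"
proof -
  have m0: "0 < m" using m2 by simp
  note U = inv_space_all
  have d: "(delta 0 :: nat \<Rightarrow> 'k) \<in> space m" using m0 by simp
  then have ne: "space m \<noteq> {0 :: nat \<Rightarrow> 'k}" using delta_nonzero[of 0] by (metis singletonD)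
  obtain l where l: "l \<ge> 0" "\<exists>f\<in>space m. f \<noteq> 0 \<and> wt 0 l f" "\<forall>y\<in>space m. \<forall>j>l. E 0 j y = 0"
      "l = 0 \<longrightarrow> (\<forall>y\<in>space m. wt 0 0 y)"
    by (rule top_weight[OF U m0 ne])
  have "l \<noteq> 0"
  proof
    assume "l = 0"
    then show False using zero_weight_trivial[OF U m0 mp[OF l(4)]] not_trivial_one[OF d delta_nonzero] by blast
  qed
  then have lp: "l > 0" using l(1) by simp
  obtain f where f: "f \<in> space m" "f \<noteq> 0" "wt 0 l f" using l(2) by blast
  let ?W = "{y \<in> space m. wt 0 l y}"
  have W: "inv_space (Suc 0) ?W" by (rule weight_space_inv[OF U m0])
  have dim: "fv.dim ?W < 2 * (m - Suc 0)" using exceptional_dimension[OF lp] by (metis One_nat_def not_less)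
  have "hw 0 f"
  proof (rule top_weight_hw[OF U m0 l(3) f(1,3)])
    show "\<rho> (TV m w s) f = f" if "w \<in> tail m (Suc 0)" for w s
      by (rule small_trivial[OF _ W dim that]) (use m2 f in auto)
  qed
  then show thesis using that[of "nat l" f] lp f by simp
qed

end

section \<open>The semilinear map behind an endomorphism\<close>

locale highest_weight = symplectic_endomorphism m F for m :: nat and F :: "'k::alg_closed_field mat \<Rightarrow> 'k mat" +
  fixes f :: "nat \<Rightarrow> 'k" and k :: nat
  assumes k0: "k > 0" and f0: "f \<noteq> 0" and f_wt: "wt 0 (int k) f" and f_hw: "hw 0 f"
begin

lemma m0: "0 < m" using m2 by simp

abbreviation e0 :: "nat \<Rightarrow> 'k" where "e0 \<equiv> delta 0"
abbreviation e0' :: "nat \<Rightarrow> 'k" where "e0' \<equiv> delta (0 + m)"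

lemma e_space: "e0 \<in> space m" "e0' \<in> space m" using m0 by (auto intro!: space_delta)
lemma om_e: "x \<in> space m \<Longrightarrow> om m (e0', x) = - x 0" by (rule om_delta_left(2)[OF _ m0])
lemma f_space: "f \<in> space m" by (rule hw_space[OF f_hw])
lemma stab_0: "stab m 0 = Sp m" by (auto simp: stab_def)

text \<open>The choice of \<open>A\<close> does not matter because the stabilizer of \<open>e0\<close> fixes \<open>f\<close>.\<close>

definition \<phi> :: "(nat \<Rightarrow> 'k) \<Rightarrow> nat \<Rightarrow> 'k" where
  "\<phi> v = (if v = 0 then 0 else \<rho> (SOME A. A \<in> Sp m \<and> act m A e0 = v) f)"

lemma transitive: "v \<in> space m \<Longrightarrow> v \<noteq> 0 \<Longrightarrow> w \<in> space m \<Longrightarrow> w \<noteq> 0 \<Longrightarrow> \<exists>A. A \<in> Sp m \<and> act m A v = w"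
  using tgen_transitive[of v m 0 w] tgen_Sp unfolding tail_0 by blast

lemma act_nonzero: "A \<in> Sp m \<Longrightarrow> x \<in> space m \<Longrightarrow> x \<noteq> 0 \<Longrightarrow> act m A x \<noteq> (0 :: nat \<Rightarrow> 'k)"
  using Sp_act_inj by blast

lemma phi_act: assumes A: "A \<in> Sp m" shows "\<phi> (act m A e0) = \<rho> A f"
proof -
  have nz: "act m A e0 \<noteq> 0" by (rule act_nonzero[OF A e_space(1) delta_nonzero])
  let ?P = "\<lambda>B. B \<in> Sp m \<and> act m B e0 = act m A e0"
  have "?P (SOME B. ?P B)" by (rule someI[where P = ?P and x = A]) (simp add: A)
  then have "\<rho> (SOME B. ?P B) f = \<rho> A f"
    by (intro hw_well_defined[OF f_hw m0]) (simp_all add: stab_0 A)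
  then show ?thesis using nz by (simp add: \<phi>_def)
qed

lemma phi_zero [simp]: "\<phi> 0 = 0" by (simp add: \<phi>_def)
lemma phi_space [simp]: "\<phi> v \<in> space m" using subspace_space[of m] fv.subspace_0 by (auto simp: \<phi>_def)

lemma reach: assumes "v \<in> space m" "v \<noteq> 0" obtains A where "A \<in> Sp m" "v = act m A e0" "\<phi> v = \<rho> A f"
proof -
  obtain A where A: "A \<in> Sp m" "act m A e0 = v" using transitive[OF e_space(1) delta_nonzero assms] by blast
  then show thesis using that[of A] phi_act[OF A(1)] by simp
qed

lemma phi_equiv: assumes B: "B \<in> Sp m" and v: "v \<in> space m" shows "\<rho> B (\<phi> v) = \<phi> (act m B v)"
proof (cases "v = 0")
  case True then show ?thesis by (simp add: flin_0[OF rho_lin] flin_0[OF flin_act])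
next
  case False
  obtain A where A: "A \<in> Sp m" "v = act m A e0" "\<phi> v = \<rho> A f" by (rule reach[OF v False])
  have "\<rho> B (\<phi> v) = \<rho> (B * A) f" using rho_mult[OF B A(1) f_space] A(3) by simp
  also have "\<dots> = \<phi> (act m (B * A) e0)" by (rule phi_act[OF Sp_mult[OF B A(1)], symmetric])
  finally show ?thesis using Sp_act_mult[OF B A(1) e_space(1)] A(2) by simp
qed

lemma phi_e0: "\<phi> e0 = f"
  using phi_act[OF Sp_one] act_one[OF e_space(1)] rho_one[OF f_space] by simp

lemma phi_nonzero: assumes "v \<in> space m" "v \<noteq> 0" shows "\<phi> v \<noteq> 0"
proof -
  obtain A where A: "A \<in> Sp m" "v = act m A e0" "\<phi> v = \<rho> A f" by (rule reach[OF assms])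
  show ?thesis unfolding A(3) by (rule rho_nonzero[OF A(1) f_space f0])
qed

lemma phi_scale: assumes v: "v \<in> space m" shows "\<phi> (fscale c v) = fscale (c ^ k) (\<phi> v)"
proof (cases "c = 0 \<or> v = 0")
  case True then show ?thesis using k0 by (auto simp: zero_power)
next
  case False
  then have c: "c \<noteq> 0" and v0: "v \<noteq> 0" by auto
  obtain A where A: "A \<in> Sp m" "v = act m A e0" "\<phi> v = \<rho> A f" by (rule reach[OF v v0])
  have w0: "fscale c v \<noteq> 0" using c v0 fv.scale_eq_0_iff by blast
  have w: "fscale c v \<in> space m" using v by (rule fv.subspace_scale[OF subspace_space])
  obtain B where B: "B \<in> Sp m" "fscale c v = act m B e0" "\<phi> (fscale c v) = \<rho> B f" by (rule reach[OF w w0])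
  have "\<rho> B f = fscale (c powi int k) (\<rho> A f)"
    by (rule hw_scale[OF f_hw f_wt m0 _ _ c]) (use A B in \<open>simp_all add: stab_0\<close>)
  then show ?thesis using A B by simp
qed

text \<open>Since \<open>F\<close> is surjective, the orbit of \<open>f\<close> consists of all nonzero vectors.\<close>

lemma phi_surj: assumes z: "z \<in> space m" shows "\<exists>v\<in>space m. \<phi> v = z"
proof (cases "z = 0")
  case True then show ?thesis using subspace_space[of m] fv.subspace_0 by (intro bexI[of _ 0]) auto
next
  case False
  obtain B where B: "B \<in> Sp m" "act m B f = z" using transitive[OF f_space f0 z False] by blast
  then obtain A where A: "A \<in> Sp m" "B = F A" using F_surj by blast
  then show ?thesis using phi_act[OF A(1)] B by (intro bexI[of _ "act m A e0"]) (simp_all add: \<rho>_def)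
qed

section \<open>The projection to the top weight\<close>

definition proj :: "(nat \<Rightarrow> 'k) \<Rightarrow> nat \<Rightarrow> 'k" where "proj = E 0 (int k)"

lemma proj_lin: "flin proj" unfolding proj_def by (rule weight_data(2)[OF m0])
lemma proj_space: "proj x \<in> space m" unfolding proj_def by (rule weight_data(3)[OF m0])
lemma proj_wt: "x \<in> space m \<Longrightarrow> wt 0 (int k) (proj x)" unfolding proj_def by (rule wt_E[OF m0])

lemma proj_f: "proj f = f" using E_wt[OF m0 f_wt, of "int k"] by (simp add: proj_def)

text \<open>The orbit vectors attached to the standard basis already have the full dimension, which bounds the weights.\<close>

lemma family_spans:
  assumes x: "x \<in> space m" "x \<noteq> 0" and T: "flin T" "T x = x" "\<And>b. b < 2 * m \<Longrightarrow> T (hw_family 0 f b) = 0"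
  shows False
proof -
  have B: "{0..<m} \<union> {0 + m..<2 * m} = {..<2 * m}" by auto
  let ?g = "\<lambda>b. if b < 2 * m then hw_family 0 f b else x"
  have "card {..<Suc (2 * m)} \<le> fv.dim (space m :: (nat \<Rightarrow> 'k) set)"
  proof (rule family_card_le_dim[OF fd_space])
    show "?g b \<in> space m" for b using x hw_family_space by simp
    fix a assume z: "(\<Sum>b\<in>{..<Suc (2 * m)}. fscale (a b) (?g b)) = 0"
    then have z': "(\<Sum>b<2 * m. fscale (a b) (hw_family 0 f b)) + fscale (a (2 * m)) x = 0" by simp
    have "T ((\<Sum>b<2 * m. fscale (a b) (hw_family 0 f b)) + fscale (a (2 * m)) x) = fscale (a (2 * m)) x"
      by (simp add: flin_add[OF T(1)] flin_sum[OF T(1)] flin_scale[OF T(1)] T(2,3))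
    then have "fscale (a (2 * m)) x = 0" unfolding z' flin_0[OF T(1)] by simp
    then have l: "a (2 * m) = 0" using x(2) fv.scale_eq_0_iff by blast
    then have s: "(\<Sum>b\<in>{0..<m} \<union> {0 + m..<2 * m}. fscale (a b) (hw_family 0 f b)) = 0" using z' unfolding B by simp
    have "a b = 0" if "b < 2 * m" for b
      by (rule hw_family_independent[OF f_hw f_wt _ f0 m0 s]) (use k0 that B in auto)
    then show "\<forall>b\<in>{..<Suc (2 * m)}. a b = 0" using l by (auto simp: less_Suc_eq)
  qed simp
  then show False by (simp add: space_def supported_dim)
qed

lemma family_wt: "b < 2 * m \<Longrightarrow> wt 0 (if b = 0 then int k else if b = m then - int k else 0) (hw_family 0 f b)"
  using hw_family_wt[OF f_hw f_wt m0, of b 0] m0 by (cases "b < m") auto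

text \<open>A further weight would make the space larger than \<open>2 m\<close>.\<close>

lemma weights: assumes j: "j \<notin> {int k, 0, - int k}" and x: "x \<in> space m" shows "E 0 j x = 0"
proof (rule ccontr)
  assume n: "E 0 j x \<noteq> 0"
  show False
  proof (rule family_spans[OF weight_data(3)[OF m0] n weight_data(2)[OF m0]])
    show "E 0 j (E 0 j x) = E 0 j x" using E_wt[OF m0 wt_E[OF m0 x], of j] by simp
    show "E 0 j (hw_family 0 f b) = 0" if "b < 2 * m" for b
      unfolding E_wt[OF m0 family_wt[OF that]] using j by auto
  qed
qed

lemma family_0: "hw_family 0 f 0 = f"
proof -
  have "(0::nat) \<in> {0..<m} \<union> {0 + m..<2 * m}" using m0 by simp
  then obtain A where A: "A \<in> stab m 0" "act m A e0 = e0" "hw_family 0 f 0 = \<rho> A f" by (rule hw_family_stab[OF m0])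
  then show ?thesis using phi_act[OF stab_Sp[OF A(1)]] phi_e0 by simp
qed

text \<open>A top weight vector that is not a multiple of \<open>f\<close> would be independent of the orbit vectors.\<close>

lemma proj_line: assumes x: "x \<in> space m" shows "\<exists>c. proj x = fscale c f"
proof (rule ccontr)
  assume n: "\<not> ?thesis"
  let ?y = "proj x"
  obtain r where r: "f r \<noteq> 0" using f0 by (auto simp: fun_eq_iff pointwise)
  define T where "T z = proj z - fscale (proj z r / f r) f" for z
  define z where "z = T ?y"
  have pp: "proj (proj z) = proj z" if "z \<in> space m" for z
    using E_wt[OF m0 proj_wt[OF that], of "int k"] by (simp add: proj_def)
  have Tl: "flin T"
    by (rule flinI) (simp_all add: T_def flin_add[OF proj_lin] flin_scale[OF proj_lin] fun_eq_iff pointwise add_divide_distrib algebra_simps)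
  have zs: "z \<in> space m" unfolding z_def T_def using proj_space f_space by (intro fv.subspace_diff[OF subspace_space] fv.subspace_scale[OF subspace_space])
  have Tf: "T f = 0" using r by (simp add: T_def proj_f fun_eq_iff pointwise)
  have z: "z = ?y - fscale (?y r / f r) f" unfolding z_def T_def pp[OF x] ..
  have z0: "z \<noteq> 0"
  proof
    assume "z = 0"
    then have "?y = fscale (?y r / f r) f" using z by simp
    then show False using n by blast
  qed
  have "T z = T ?y" unfolding z flin_diff[OF Tl] flin_scale[OF Tl] Tf by simp
  then have Tz: "T z = z" by (simp add: z_def)
  show False
  proof (rule family_spans[OF zs z0 Tl Tz])
    fix b assume b: "b < 2 * m"
    show "T (hw_family 0 f b) = 0"
    proof (cases "b = 0")
      case True then show ?thesis using family_0 Tf by simp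
    next
      case False
      then have "proj (hw_family 0 f b) = 0" unfolding proj_def E_wt[OF m0 family_wt[OF b]] using k0 by auto
      then show ?thesis by (simp add: T_def pointwise)
    qed
  qed
qed

text \<open>The transvections orthogonal to \<open>e0'\<close> lie in the opposite parabolic subgroup: up to transvections that fix \<open>f\<close>, they only add
  components of lower weight.\<close>

lemma proj_opposite:
  assumes v: "v \<in> space m" "v 0 = 0" and x: "x \<in> space m"
  shows "proj (\<rho> (TV m v s) x) = proj x"
proof -
  define w where "w = (\<lambda>j. if j = 0 + m then 0 else v j)"
  have w: "w \<in> tail m (Suc 0)" using v by (auto simp: w_def tail_def space_def supported_def)
  note ws = tail_space[OF w]
  define u where "u t = fscale (t * v (0 + m)) e0' + w" for t
  have us: "u t \<in> space m" for t using ws e_space by (simp add: u_def)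
  have u1: "u 1 = v" by (auto simp: u_def w_def fun_eq_iff pointwise delta_apply)
  have u0: "u 0 = w" by (auto simp: u_def fun_eq_iff pointwise)
  have ud: "dg m 0 t v = u (inverse t)" for t using v(2) m0 by (auto simp: dg_def u_def w_def fun_eq_iff pointwise delta_apply)
  have base: "proj (\<rho> (TV m w s) x) = proj x"
  proof -
    have W: "TV m w s \<in> stab m (Suc 0)" by (rule TV_stab[OF w]) (use m0 in simp)
    have "\<rho> (TV m w s) (proj x) = proj (\<rho> (TV m w s) x)"
      unfolding proj_def by (rule E_commute[OF m0 stab_Sp[OF W] stab_commutes_DM[OF W m0] x])
    moreover obtain c where c: "proj x = fscale c f" using proj_line[OF x] by blast
    moreover have "\<rho> (TV m w s) f = f"
      by (rule hw_fix[OF f_hw]) (use ws w om_delta_left(1)[OF ws m0] in \<open>auto simp: tail_0 tail_def\<close>)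
    ultimately show ?thesis by (simp only: flin_scale[OF rho_lin])
  qed
  have comp: "proj (\<rho> (TV m v s) y) = proj (\<rho> (TV m w s) y)" if y: "wt 0 j y" "j \<le> int k" for y j
  proof -
    note ys = wtD(1)[OF y(1)]
    define h where "h t = proj (\<rho> (TV m (u t) s) y)" for t
    have hp: "polyf (\<lambda>t. h t r)" for r
    proof -
      have "polyf (\<lambda>t. u t j)" for j
        unfolding u_def plus_fun_apply fscale_apply by (intro polyf_add polyf_mult polyf_id polyf_const)
      then have T: "polyf (\<lambda>t. TV m (u t) s $$ (a, b))" if "a < 2 * m" "b < 2 * m" for a b
        using TV_polyf[of u m "\<lambda>t. s"] us that polyf_const by blast
      have "polyf (\<lambda>t. \<rho> (TV m (u t) s) y b)" for b
        by (rule rho_polyf[OF TV_Sp[OF us] T])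
      moreover have "h t r = (\<Sum>b<2 * m. \<rho> (TV m (u t) s) y b * proj (delta b) r)" for t
      proof -
        have "h t = proj (\<Sum>b<2 * m. fscale (\<rho> (TV m (u t) s) y b) (delta b))"
          unfolding h_def by (subst (1) space_expand[OF rho_space]) rule
        then show ?thesis by (simp add: flin_sum[OF proj_lin] flin_scale[OF proj_lin] pointwise)
      qed
      ultimately show ?thesis by (simp only:) (intro polyf_sum polyf_mult polyf_const)
    qed
    have he: "h t = fscale (t powi (j - int k)) (h 1)" if t: "t \<noteq> 0" for t
    proof -
      have it: "inverse t \<noteq> 0" using t by simp
      have D: "DM m 0 (inverse t) \<in> Sp m" by (rule DM_Sp[OF m0 it])
      have "DM m 0 (inverse t) * TV m v s = TV m (u t) s * DM m 0 (inverse t)"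
        using TV_conj[OF D v(1)] DM_act[OF m0 it v(1)] ud[of "inverse t"] by simp
      then have "\<rho> (DM m 0 (inverse t)) (\<rho> (TV m v s) y) = \<rho> (TV m (u t) s) (\<rho> (DM m 0 (inverse t)) y)"
        using rho_mult[OF D TV_Sp[OF v(1)] ys, of s] rho_mult[OF TV_Sp[OF us[of t]] D ys, of s] by simp
      also have "\<dots> = fscale (inverse t powi j) (\<rho> (TV m (u t) s) y)" unfolding wtD(2)[OF y(1) it] by (rule flin_scale[OF rho_lin])
      finally have "proj (\<rho> (DM m 0 (inverse t)) (\<rho> (TV m v s) y)) = fscale (inverse t powi j) (h t)"
        unfolding h_def by (simp only: flin_scale[OF proj_lin])
      moreover have "proj (\<rho> (DM m 0 (inverse t)) (\<rho> (TV m v s) y)) = fscale (inverse t powi int k) (h 1)"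
      proof -
        have "\<rho> (DM m 0 (inverse t)) (proj (\<rho> (TV m v s) y)) = proj (\<rho> (DM m 0 (inverse t)) (\<rho> (TV m v s) y))"
          unfolding proj_def
        proof (rule E_commute[OF m0 D _ rho_space])
          show "DM m 0 (inverse t) * DM m 0 t' = DM m 0 t' * DM m 0 (inverse t)" if "t' \<noteq> 0" for t'
            using DM_mult[OF m0 it that] DM_mult[OF m0 that it] by (simp add: mult.commute)
        qed
        then show ?thesis using wtD(2)[OF proj_wt[OF rho_space] it] by (simp add: h_def u1)
      qed
      ultimately have "fscale (t powi j) (fscale (inverse t powi j) (h t)) = fscale (t powi j) (fscale (inverse t powi int k) (h 1))" by simp
      moreover have "t powi j * inverse t powi j = 1"
        unfolding power_int_inverse by (rule right_inverse) (simp add: t)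
      moreover have "t powi j * inverse t powi int k = t powi (j - int k)"
        unfolding power_int_inverse divide_inverse[symmetric] by (rule power_int_diff[symmetric]) (simp add: t)
      ultimately show ?thesis by (simp only: fv.scale_scale fv.scale_one)
    qed
    have "h 1 r = h 0 r" for r
    proof -
      obtain P where P: "\<And>t. h t r = poly P t" using hp[of r] unfolding polyf_def by blast
      have "poly P t = t powi (j - int k) * h 1 r" if "t \<noteq> 0" for t
        unfolding P[symmetric] using fun_cong[OF he[OF that], of r] unfolding fscale_apply .
      then have "poly P 1 = poly P 0"
        by (intro poly_nonpositive_const[of "{j - int k}" P "\<lambda>_. h 1 r"]) (use y(2) in simp_all)
      then show ?thesis using P by simp
    qed
    then have "h 1 = h 0" by (rule ext)
    then show ?thesis unfolding h_def u0 u1 .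
  qed
  have "proj (\<rho> (TV m v s) x) = (\<Sum>j\<in>I 0. proj (\<rho> (TV m v s) (E 0 j x)))"
    by (subst (1) E_sum[OF m0 x]) (simp only: flin_sum[OF rho_lin] flin_sum[OF proj_lin])
  also have "\<dots> = (\<Sum>j\<in>I 0. proj (\<rho> (TV m w s) (E 0 j x)))"
  proof (rule sum.cong[OF refl])
    fix j
    show "proj (\<rho> (TV m v s) (E 0 j x)) = proj (\<rho> (TV m w s) (E 0 j x))"
    proof (cases "j \<le> int k")
      case True then show ?thesis by (rule comp[OF wt_E[OF m0 x]])
    next
      case False
      then have "E 0 j x = 0" by (intro weights[OF _ x]) auto
      then show ?thesis by (simp add: flin_0[OF rho_lin])
    qed
  qed
  also have "\<dots> = proj (\<rho> (TV m w s) x)"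
    by (subst (2) E_sum[OF m0 x]) (simp only: flin_sum[OF rho_lin] flin_sum[OF proj_lin])
  finally show ?thesis using base by simp
qed

lemma proj_tgen:
  assumes "A \<in> tgen m {v \<in> space m. om m (e0', v) = 0}" "x \<in> space m"
  shows "proj (\<rho> A x) = proj x"
  using assms(1)
proof (induction rule: tgen.induct)
  case one show ?case using rho_one[OF assms(2)] by simp
next
  case (step v A s)
  have "v 0 = 0" using step(1) om_e[OF step(2)] by simp
  then show ?case using proj_opposite[OF step(2) _ rho_space] step(4) rho_mult[OF TV_Sp[OF step(2)] tgen_Sp[OF step(3)] assms(2)] by simp
qed

text \<open>A vector with the same first coordinate as \<open>v\<close> is \<open>v\<^sub>0 e\<^sub>0\<close>; both are related by transvections fixing \<open>e0'\<close>, which do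
not change the top component.\<close>

lemma proj_phi_nonzero: assumes v: "v \<in> space m" "v 0 \<noteq> 0" shows "proj (\<phi> v) = fscale (v 0 ^ k) f"
proof -
  let ?w = "fscale (v 0) e0"
  have w: "?w \<in> space m" using e_space(1) by simp
  have e: "om m (e0', ?w) = om m (e0', v)" "om m (e0', ?w) \<noteq> 0"
    unfolding om_e[OF w] om_e[OF v(1)] using v(2) by (simp_all add: pointwise delta_apply)
  obtain A where A: "A \<in> tgen m {x \<in> space m. om m (e0', x) = 0}" "act m A ?w = v"
    using tgen_transitive_on_level[of e0' m 0 ?w v] e e_space(2) w v(1) unfolding tail_0 by blast
  have "\<phi> v = \<rho> A (\<phi> ?w)" using phi_equiv[OF tgen_Sp[OF A(1)] w] A(2) by simp
  then have "proj (\<phi> v) = proj (\<phi> ?w)" using proj_tgen[OF A(1) phi_space] by simp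
  then show ?thesis unfolding phi_scale[OF e_space(1)] phi_e0 flin_scale[OF proj_lin] proj_f .
qed

lemma phi_TV_polyf:
  assumes "v \<in> space m" "z \<in> space m"
  shows "polyf (\<lambda>s. \<phi> (act m (TV m z s) v) r)"
proof -
  have "polyf (\<lambda>s. TV m z s $$ (a, b))" if "a < 2 * m" "b < 2 * m" for a b
    using TV_polyf[of "\<lambda>s. z" m "\<lambda>s. s" a b] assms that polyf_const polyf_id by blast
  then have "polyf (\<lambda>s. \<rho> (TV m z s) (\<phi> v) r)" by (rule rho_polyf[OF TV_Sp[OF assms(2)]])
  then show ?thesis using phi_equiv[OF TV_Sp[OF assms(2)] assms(1)] by simp
qed

text \<open>For \<open>v\<^sub>0 = 0\<close> the formula follows by continuity: along a transvection line leaving the hyperplane both sides are polynomials.\<close>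

lemma proj_phi: assumes v: "v \<in> space m" shows "proj (\<phi> v) = fscale (v 0 ^ k) f"
proof (cases "v 0 \<noteq> 0 \<or> v = 0")
  case True
  then show ?thesis using proj_phi_nonzero[OF v] k0 by (auto simp: flin_0[OF proj_lin] pointwise zero_power)
next
  case False
  then have v0: "v 0 = 0" and vn: "v \<noteq> 0" by auto
  obtain z1 where z1: "z1 \<in> tail m 0" "om m (z1, v) \<noteq> 0" by (rule tail_nondeg[of v m 0]) (use v vn in \<open>auto simp: tail_0\<close>)
  have z1s: "z1 \<in> space m" using z1(1) by (simp add: tail_0)
  have "\<exists>z\<in>space m. z 0 \<noteq> 0 \<and> om m (v, z) \<noteq> 0"
  proof (cases "z1 0 = 0 \<and> True")
    case False then show ?thesis using z1s z1(2) om_anti[of m v z1] by auto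
  next
    case True
    show ?thesis
    proof (cases "om m (z1 + e0, v) = 0")
      case False
      then show ?thesis using z1s e_space True om_anti[of m v "z1 + e0"]
        by (intro bexI[of _ "z1 + e0"]) (auto simp: pointwise delta_apply)
    next
      case t: True
      have "om m (z1 - e0, v) = 2 * om m (z1, v) - om m (z1 + e0, v)"
        using z1s e_space v by (simp add: om_simps)
      then have "om m (z1 - e0, v) \<noteq> 0" using t z1(2) two by simp
      then show ?thesis using z1s e_space True om_anti[of m v "z1 - e0"]
        by (intro bexI[of _ "z1 - e0"]) (auto simp: pointwise delta_apply)
    qed
  qed
  then obtain z where z: "z \<in> space m" "z 0 \<noteq> 0" "om m (v, z) \<noteq> 0" by blast
  have "proj (\<phi> v) r = 0" for r
  proof -
    let ?u = "\<lambda>s. act m (TV m z s) v"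
    have u: "?u s = v + fscale (s * om m (v, z)) z" for s using TV_act[OF z(1) v] by (simp add: tv_def)
    have u0: "?u 0 = v" unfolding u by (auto simp: fun_eq_iff pointwise)
    have "proj (\<phi> (?u s)) r = (\<Sum>b<2 * m. \<phi> (?u s) b * proj (delta b) r)" for s
    proof -
      have "proj (\<phi> (?u s)) = proj (\<Sum>b<2 * m. fscale (\<phi> (?u s) b) (delta b))"
        by (subst (1) space_expand[OF phi_space]) rule
      then show ?thesis by (simp add: flin_sum[OF proj_lin] flin_scale[OF proj_lin] pointwise)
    qed
    then have "polyf (\<lambda>s. proj (\<phi> (?u s)) r)" by (simp only:) (intro polyf_sum polyf_mult polyf_const phi_TV_polyf[OF v z(1)])
    then obtain P where P: "\<And>s. proj (\<phi> (?u s)) r = poly P s" unfolding polyf_def by blast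
    let ?Q = "P - Polynomial.monom ((om m (v, z) * z 0) ^ k * f r) k"
    have "?Q = 0"
    proof (rule poly_eq_0_of_nonzero)
      fix s :: 'k assume s: "s \<noteq> 0"
      have us: "?u s \<in> space m" by simp
      have c: "?u s 0 = s * (om m (v, z) * z 0)" unfolding u using v0 by (simp add: pointwise)
      have "proj (\<phi> (?u s)) = fscale (?u s 0 ^ k) f" by (rule proj_phi_nonzero[OF us]) (use c s z in simp)
      then have "poly P s = s ^ k * (om m (v, z) * z 0) ^ k * f r" unfolding P[symmetric] c by (simp add: pointwise power_mult_distrib)
      then show "poly ?Q s = 0" by (simp add: poly_monom)
    qed
    then have "poly P 0 = 0" using k0 by (simp add: poly_monom zero_power)
    then show ?thesis using P[of 0] u0 by simp
  qed
  then have "proj (\<phi> v) = 0" by (auto simp: fun_eq_iff pointwise)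
  then show ?thesis using v0 k0 by (simp add: zero_power)
qed

section \<open>Additivity\<close>

text \<open>The vectors \<open>\<phi> (e\<^sub>1 + t e\<^sub>0)\<close> depend polynomially on \<open>t\<close>, as \<open>e\<^sub>1 + t e\<^sub>0\<close> is the image of \<open>e\<^sub>1\<close> under a unipotent
one-parameter group, while the torus expands them in the weights \<open>k\<close>, \<open>0\<close>, \<open>- k\<close>. This leaves \<open>\<phi> e\<^sub>1 + t\<^sup>k f\<close>. Shifting
\<open>t\<close> by 1 with the same group and comparing top components gives \<open>(t + 1)\<^sup>k = t\<^sup>k + 1\<close>.\<close>

lemma power_additive: "(x + y :: 'k) ^ k = x ^ k + y ^ k"
proof -
  let ?e1 = "delta 1 :: nat \<Rightarrow> 'k" and ?g = "delta (1 + m) :: nat \<Rightarrow> 'k"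
  have m1: "1 < m" using m2 by simp
  have d: "?e1 \<in> space m" "?g \<in> space m" using m2 by (auto intro!: space_delta)
  have o: "om m (e0, ?g) = 0" "om m (?e1, ?g) = 1" "om m (?e1, e0) = 0" "om m (e0, e0) = 0"
    using om_delta_right[OF e_space(1) m1] om_delta_right[OF d(1) m1] om_delta_right[OF d(1) m0] e_space m1
    by (simp_all add: delta_apply om_simps)
  have R: "RV m e0 ?g t \<in> Sp m" for t by (rule RV_Sp[OF e_space(1) d(2) o(1)])
  have Re1: "act m (RV m e0 ?g t) ?e1 = ?e1 + fscale t e0" for t
    unfolding RV_act[OF e_space(1) d(2) o(1) d(1)] rv_def o by (simp add: fun_eq_iff pointwise)
  have Re0: "act m (RV m e0 ?g t) e0 = e0" for t
    unfolding RV_act[OF e_space(1) d(2) o(1) e_space(1)] rv_def o by (simp add: fun_eq_iff pointwise)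
  have line: "\<phi> (?e1 + fscale t e0) = \<phi> ?e1 + fscale (t ^ k) f" for t
  proof
    fix r
    let ?y = "\<phi> (?e1 + fscale 1 e0)"
    have ys: "?e1 + fscale 1 e0 \<in> space m" using d e_space by simp
    have "proj ?y = fscale ((?e1 + fscale 1 e0) 0 ^ k) f" by (rule proj_phi[OF ys])
    then have Ek: "E 0 (int k) ?y = f" by (simp add: proj_def pointwise delta_apply)
    have val: "\<phi> (?e1 + fscale t e0) r = t ^ k * f r + E 0 0 ?y r + t powi (- int k) * E 0 (- int k) ?y r" if t: "t \<noteq> 0" for t
    proof -
      have "act m (DM m 0 t) (?e1 + fscale 1 e0) = ?e1 + fscale t e0"
        using DM_act[OF m0 t ys] m1 by (auto simp: dg_def delta_apply fun_eq_iff pointwise)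
      then have "\<phi> (?e1 + fscale t e0) = \<rho> (DM m 0 t) ?y" using phi_equiv[OF DM_Sp[OF m0 t] ys] by simp
      also have "\<dots> = (\<Sum>j\<in>I 0. fscale (t powi j) (E 0 j ?y))" by (rule weight_data(5)[OF m0 phi_space t])
      also have "\<dots> = (\<Sum>j\<in>{int k, 0, - int k}. fscale (t powi j) (E 0 j ?y))"
      proof (rule sum.mono_neutral_cong)
        show "fscale (t powi j) (E 0 j ?y) = 0" if "j \<in> {int k, 0, - int k} - I 0" for j
          using weight_data(4)[OF m0, of j] that by simp
        show "fscale (t powi j) (E 0 j ?y) = 0" if "j \<in> I 0 - {int k, 0, - int k}" for j
          using weights[OF _ phi_space, of j] that by simp
      qed (simp_all add: weight_data(1)[OF m0])
      also have "\<dots> = fscale (t powi int k) f + fscale (t powi 0) (E 0 0 ?y) + fscale (t powi (- int k)) (E 0 (- int k) ?y)"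
        using k0 Ek by (simp add: add.assoc del: power_int_of_nat)
      finally show ?thesis by (simp add: pointwise)
    qed
    have "polyf (\<lambda>t. \<rho> (RV m e0 ?g t) (\<phi> ?e1) r)"
    proof (rule rho_polyf[OF R])
      fix a b assume ab: "a < 2 * m" "b < 2 * m"
      have "RV m e0 ?g t $$ (a, b) = delta b a + t * (om m (delta b, e0) * ?g a + om m (delta b, ?g) * e0 a)" for t
        using ab by (simp add: mof_def rv_def pointwise)
      then show "polyf (\<lambda>t. RV m e0 ?g t $$ (a, b))" by (simp only:) (intro polyf_add polyf_mult polyf_id polyf_const)
    qed
    then have "polyf (\<lambda>t. \<phi> (?e1 + fscale t e0) r)" using phi_equiv[OF R d(1)] Re1 by simp
    then obtain P where P: "\<And>t. \<phi> (?e1 + fscale t e0) r = poly P t" unfolding polyf_def by blast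
    let ?Q = "P - Polynomial.monom (f r) k"
    have "poly ?Q t = poly ?Q 0"
    proof (rule poly_nonpositive_const[of "{0, - int k}" _ "\<lambda>j. E 0 j ?y r"])
      show "poly ?Q t = (\<Sum>j\<in>{0, - int k}. t powi j * E 0 j ?y r)" if "t \<noteq> 0" for t
        using val[OF that] k0 unfolding P by (simp add: poly_monom mult.commute)
    qed auto
    moreover have "poly P 0 = \<phi> ?e1 r" using P[of 0] by simp
    ultimately show "\<phi> (?e1 + fscale t e0) r = (\<phi> ?e1 + fscale (t ^ k) f) r"
      using P[of t] k0 by (simp add: poly_monom pointwise zero_power mult.commute algebra_simps)
  qed
  have unit: "(t + 1) ^ k = t ^ k + (1::'k)" for t
  proof -
    let ?A = "RV m e0 ?g 1" and ?x = "?e1 + fscale t e0"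
    have xs: "?x \<in> space m" using d e_space by simp
    have a: "act m ?A ?x = ?e1 + fscale (t + 1) e0"
      unfolding flin_add[OF flin_act] flin_scale[OF flin_act] Re1 Re0 by (simp add: fun_eq_iff pointwise algebra_simps)
    have "proj (\<rho> ?A (\<phi> ?x)) = proj (\<rho> ?A (\<phi> ?e1) + fscale (t ^ k) (\<rho> ?A f))"
      unfolding line by (simp only: flin_add[OF rho_lin] flin_scale[OF rho_lin])
    also have "\<dots> = proj (\<phi> (act m ?A ?e1)) + fscale (t ^ k) (proj (\<phi> (act m ?A e0)))"
      unfolding phi_equiv[OF R d(1), symmetric] phi_equiv[OF R e_space(1), symmetric] phi_e0
      by (simp only: flin_add[OF proj_lin] flin_scale[OF proj_lin])
    also have "\<dots> = f + fscale (t ^ k) f"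
      unfolding Re1 Re0 phi_e0 proj_f using proj_phi[of "?e1 + fscale 1 e0"] d e_space by (simp add: pointwise delta_apply)
    finally have "proj (\<phi> (act m ?A ?x)) = f + fscale (t ^ k) f" unfolding phi_equiv[OF R xs] .
    moreover have "proj (\<phi> (act m ?A ?x)) = fscale ((t + 1) ^ k) f"
      using proj_phi[OF act_space[of m ?A ?x]] unfolding a by (simp add: pointwise delta_apply)
    ultimately have "fscale ((t + 1) ^ k) f = fscale (1 + t ^ k) f" by (simp add: fv.scale_left_distrib)
    then show ?thesis using fv.scale_right_imp_eq[OF f0] by (metis add.commute)
  qed
  show ?thesis
  proof (cases "y = 0")
    case True then show ?thesis using k0 by (simp add: zero_power)
  next
    case False
    have "x + y = y * (x / y + 1)" using False by (simp add: field_simps)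
    then have "(x + y) ^ k = (y * (x / y + 1)) ^ k" by (rule arg_cong)
    also have "\<dots> = y ^ k * ((x / y) ^ k + 1)" unfolding power_mult_distrib unit ..
    also have "\<dots> = x ^ k + y ^ k" using False by (simp add: power_divide distrib_left)
    finally show ?thesis .
  qed
qed

lemma proj_separates:
  assumes z: "z \<in> space m" "\<And>A. A \<in> Sp m \<Longrightarrow> proj (\<rho> A z) = 0"
  shows "z = 0"
proof (rule ccontr)
  assume n: "z \<noteq> 0"
  obtain B where B: "B \<in> Sp m" "act m B z = f" using transitive[OF z(1) n f_space f0] by blast
  then obtain A where A: "A \<in> Sp m" "B = F A" using F_surj by blast
  then have "\<rho> A z = f" using B by (simp add: \<rho>_def)
  then show False using z(2)[OF A(1)] proj_f f0 by simp
qed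

text \<open>After any \<open>\<rho> A\<close>, the top components of both sides agree by additivity of the \<open>k\<close>-th power, and these components separate vectors.\<close>

theorem phi_additive: assumes x: "x \<in> space m" and y: "y \<in> space m" shows "\<phi> (x + y) = \<phi> x + \<phi> y"
proof -
  have xy: "x + y \<in> space m" using x y by simp
  have "\<phi> (x + y) - (\<phi> x + \<phi> y) = 0"
  proof (rule proj_separates)
    show "\<phi> (x + y) - (\<phi> x + \<phi> y) \<in> space m" by simp
    fix A :: "'k mat" assume A: "A \<in> Sp m"
    have c: "proj (\<rho> A (\<phi> v)) = fscale (act m A v 0 ^ k) f" if "v \<in> space m" for v
      unfolding phi_equiv[OF A that] by (rule proj_phi[OF act_space])
    have s: "act m A (x + y) 0 = act m A x 0 + act m A y 0" by (simp add: flin_add[OF flin_act] pointwise)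
    have "proj (\<rho> A (\<phi> (x + y) - (\<phi> x + \<phi> y))) = proj (\<rho> A (\<phi> (x + y))) - (proj (\<rho> A (\<phi> x)) + proj (\<rho> A (\<phi> y)))"
      by (simp only: flin_add[OF rho_lin] flin_diff[OF rho_lin] flin_add[OF proj_lin] flin_diff[OF proj_lin])
    also have "\<dots> = 0" unfolding c[OF x] c[OF y] c[OF xy] s power_additive by (simp add: fv.scale_left_distrib)
    finally show "proj (\<rho> A (\<phi> (x + y) - (\<phi> x + \<phi> y))) = 0" .
  qed
  then show ?thesis by (simp only: right_minus_eq)
qed

lemma phi_diff: assumes "x \<in> space m" "y \<in> space m" shows "\<phi> (x - y) = \<phi> x - \<phi> y"
proof -
  have "\<phi> ((x - y) + y) = \<phi> (x - y) + \<phi> y" by (rule phi_additive) (use assms in auto)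
  then show ?thesis by simp
qed

lemma phi_inj: assumes "x \<in> space m" "y \<in> space m" "\<phi> x = \<phi> y" shows "x = y"
proof (rule ccontr)
  assume "x \<noteq> y"
  then have "\<phi> (x - y) \<noteq> 0" by (intro phi_nonzero) (use assms in auto)
  then show False using phi_diff[OF assms(1,2)] assms(3) by simp
qed

end

section \<open>The symplectic form and the semilinear map\<close>

lemma eigenvector_exists:
  fixes T :: "(nat \<Rightarrow> 'k::alg_closed_field) \<Rightarrow> nat \<Rightarrow> 'k"
  assumes T: "flin T" "\<And>x. x \<in> space m \<Longrightarrow> T x \<in> space m" and m: "m > 0"
  obtains e v where "v \<in> space m" "v \<noteq> 0" "T v = fscale e v"
proof -
  let ?A = "mof m T"
  have A: "?A \<in> carrier_mat (2 * m) (2 * m)" by simp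
  have "degree (char_poly ?A) > 0" using degree_monic_char_poly[OF A] m by simp
  then obtain e where "poly (char_poly ?A) e = 0" using alg_closed_imp_poly_has_root by blast
  then have "eigenvalue ?A e" using eigenvalue_root_char_poly[OF A] by simp
  then obtain u where u: "u \<in> carrier_vec (2 * m)" "u \<noteq> 0\<^sub>v (2 * m)" "?A *\<^sub>v u = e \<cdot>\<^sub>v u"
    using A unfolding eigenvalue_def eigenvector_def by auto
  define v where "v = (\<lambda>i. if i < 2 * m then u $ i else 0)"
  have v: "v \<in> space m" by (auto simp: v_def space_def supported_def)
  have "v \<noteq> 0"
  proof
    assume z: "v = 0"
    have "u = 0\<^sub>v (2 * m)"
    proof (rule eq_vecI)
      fix i assume "i < dim_vec (0\<^sub>v (2 * m) :: 'k vec)"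
      then show "u $ i = 0\<^sub>v (2 * m) $ i" using fun_cong[OF z, of i] by (simp add: v_def pointwise)
    qed (use u(1) in simp)
    then show False using u(2) by blast
  qed
  moreover have "act m ?A v = fscale e v"
  proof
    fix i
    show "act m ?A v i = fscale e v i"
    proof (cases "i < 2 * m")
      case True
      have "(?A *\<^sub>v u) $ i = (\<Sum>j<2 * m. ?A $$ (i, j) * u $ j)"
        using True carrier_matD[OF A] carrier_vecD[OF u(1)] by (auto simp: scalar_prod_def lessThan_atLeast0 intro!: sum.cong)
      then show ?thesis using True u(1,3) by (simp add: act_def v_def pointwise)
    qed (simp add: act_def v_def pointwise)
  qed
  ultimately show thesis using that[OF v] act_mof[OF T v] by simp
qed

lemma common_nonorthogonal:
  assumes v: "v \<in> space m" "v \<noteq> (0 :: nat \<Rightarrow> 'k::field)" and w: "w \<in> space m" "w \<noteq> 0"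
  obtains x where "x \<in> space m" "om m (x, v) \<noteq> 0" "om m (x, w) \<noteq> 0"
proof -
  obtain x where x: "x \<in> space m" "om m (x, v) \<noteq> 0" using tail_nondeg[of v m 0] v unfolding tail_0 by auto
  obtain y where y: "y \<in> space m" "om m (y, w) \<noteq> 0" using tail_nondeg[of w m 0] w unfolding tail_0 by auto
  show thesis
  proof (cases "om m (x, w) = 0")
    case False then show thesis using that x by blast
  next
    case xw: True
    show thesis
    proof (cases "om m (y, v) = 0")
      case False then show thesis using that y by blast
    next
      case True
      show thesis using x y xw True v w by (intro that[of "x + y"]) (simp_all add: om_simps)
    qed
  qed
qed

context highest_weight
begin

lemma om_e_dual: "om m (e0, e0') = 1"
  using om_delta_right(2)[OF e_space(1) m0] by (simp add: delta_apply)

text \<open>First \<open>e0\<close> is moved to \<open>x\<close>; then the stabilizer of \<open>e0\<close> is used to adjust the partner.\<close>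

lemma hyperbolic_pair:
  assumes x: "x \<in> space m" and y: "y \<in> space m" and o: "om m (x, y) = 1"
  obtains A where "A \<in> Sp m" "act m A e0 = x" "act m A e0' = y"
proof -
  have "x \<noteq> 0" using o forms_zero1[OF om_forms subspace_space, of m y] by auto
  then obtain A where A: "A \<in> Sp m" "act m A e0 = x" using transitive[OF e_space(1) delta_nonzero x] by blast
  obtain A' where A': "A' \<in> Sp m" "A' * A = 1\<^sub>m (2 * m)" "A * A' = 1\<^sub>m (2 * m)" by (rule Sp_inverse[OF A(1)])
  let ?y = "act m A' y"
  have yA: "act m A ?y = y" using Sp_act_mult[OF A(1) A'(1) y] A'(3) act_one[OF y] by simp
  have "om m (e0, ?y) = 1" using Sp_om[OF A(1) e_space(1) act_space[of m A' y]] A(2) yA o by simp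
  then obtain B where B: "B \<in> tgen m {v \<in> tail m 0. om m (e0, v) = 0}" "act m B e0' = ?y"
    using tgen_transitive_on_level[of e0 m 0 e0' ?y] e_space om_e_dual unfolding tail_0 by auto
  have "act m B e0 = e0" by (rule tgen_fix[OF B(1) e_space(1)]) simp
  then show thesis using Sp_act_mult[OF A(1) tgen_Sp[OF B(1)]] e_space A B(2) yA Sp_mult[OF A(1) tgen_Sp[OF B(1)]]
    by (intro that[of "A * B"]) simp_all
qed

definition \<kappa> :: 'k where "\<kappa> = om m (f, \<phi> e0')"

lemma om_phi_nonzero:
  assumes x: "x \<in> space m" and y: "y \<in> space m" and n: "om m (x, y) \<noteq> 0"
  shows "om m (\<phi> x, \<phi> y) = \<kappa> * om m (x, y) ^ k"
proof -
  let ?u = "om m (x, y)" and ?y = "fscale (1 / om m (x, y)) y"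
  have ys: "?y \<in> space m" using y by simp
  have o: "om m (x, ?y) = 1" using n x y by (simp add: om_simps)
  obtain A where A: "A \<in> Sp m" "act m A e0 = x" "act m A e0' = ?y" by (rule hyperbolic_pair[OF x ys o])
  have 1: "\<phi> x = act m (F A) f" using phi_act[OF A(1)] A(2) by (simp add: \<rho>_def)
  have 2: "\<phi> ?y = act m (F A) (\<phi> e0')" using phi_equiv[OF A(1) e_space(2)] A(3) by (simp add: \<rho>_def)
  have "y = fscale ?u ?y" using n by (simp add: fun_eq_iff pointwise)
  then have 3: "\<phi> y = fscale (?u ^ k) (\<phi> ?y)" using phi_scale[OF ys, of ?u] by simp
  have "om m (\<phi> x, \<phi> ?y) = \<kappa>" unfolding 1 2 \<kappa>_def by (rule Sp_om[OF F_Sp[OF A(1)] f_space phi_space])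
  then show ?thesis unfolding 3 using om_scale2[OF phi_space[of x] phi_space[of ?y]] by (simp add: mult.commute)
qed

text \<open>For nonorthogonal pairs this is transitivity on hyperbolic pairs; orthogonal pairs reduce to them by additivity.\<close>

lemma om_phi:
  assumes x: "x \<in> space m" and y: "y \<in> space m"
  shows "om m (\<phi> x, \<phi> y) = \<kappa> * om m (x, y) ^ k"
proof (cases "om m (x, y) = 0")
  case False then show ?thesis by (rule om_phi_nonzero[OF x y])
next
  case o: True
  show ?thesis
  proof (cases "x = 0")
    case True
    then show ?thesis using o k0 forms_zero1[OF om_forms subspace_space, of m "\<phi> y"] by (simp add: zero_power)
  next
    case False
    obtain z where z: "z \<in> space m" "om m (z, x) \<noteq> 0" using tail_nondeg[of x m 0] x False unfolding tail_0 by auto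
    have xz: "om m (x, z) \<noteq> 0" "om m (x, y + z) = om m (x, z)" using z(2) om_anti[of m x z] o x y z(1) by (auto simp: om_simps)
    have "om m (\<phi> x, \<phi> (y + z)) = om m (\<phi> x, \<phi> z)"
      using om_phi_nonzero[OF x z(1)] om_phi_nonzero[OF x, of "y + z"] xz y z(1) by simp
    then have "om m (\<phi> x, \<phi> y) = 0" unfolding phi_additive[OF y z(1)] by (simp add: om_simps)
    then show ?thesis using o k0 by (simp add: zero_power)
  qed
qed

lemma kappa_nonzero: "\<kappa> \<noteq> 0"
proof
  assume n: "\<kappa> = 0"
  obtain z where z: "z \<in> space m" "om m (z, f) \<noteq> 0" using tail_nondeg[of f m 0] f_space f0 unfolding tail_0 by auto
  obtain v where v: "v \<in> space m" "\<phi> v = z" using phi_surj[OF z(1)] by blast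
  have "om m (z, f) = 0" using om_phi[OF v(1) e_space(1)] v(2) phi_e0 n by simp
  then show False using z(2) by blast
qed

lemma F_conj:
  assumes A: "A \<in> Sp m" and C: "C \<in> Sp m" and e: "\<And>x. x \<in> space m \<Longrightarrow> \<phi> (act m A x) = act m C (\<phi> x)"
  shows "F A = C"
proof (rule Sp_eqI[OF F_Sp[OF A] C])
  fix z :: "nat \<Rightarrow> 'k" assume "z \<in> space m"
  then obtain x where x: "x \<in> space m" "\<phi> x = z" using phi_surj by blast
  then show "act m (F A) z = act m C z" using phi_equiv[OF A x(1)] e[OF x(1)] by (simp add: \<rho>_def)
qed

lemma phi_combination:
  assumes "x \<in> space m" "v \<in> space m" "w \<in> space m"
  shows "\<phi> (x + (fscale a v + fscale b w)) = \<phi> x + (fscale (a ^ k) (\<phi> v) + fscale (b ^ k) (\<phi> w))"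
  using phi_additive[OF assms(1), of "fscale a v + fscale b w"] phi_additive[of "fscale a v" "fscale b w"] phi_scale assms
  by simp

lemma F_RV:
  assumes v: "v \<in> space m" and w: "w \<in> space m" and o: "om m (v, w) = 0"
  shows "F (RV m v w s) = RV m (\<phi> v) (\<phi> w) (s ^ k / \<kappa>)"
proof -
  have o': "om m (\<phi> v, \<phi> w) = 0" using om_phi[OF v w] o k0 by (simp add: zero_power)
  show ?thesis
  proof (rule F_conj[OF RV_Sp[OF v w o] RV_Sp[OF phi_space phi_space o']])
    fix x :: "nat \<Rightarrow> 'k" assume x: "x \<in> space m"
    have "rv m v w s x = x + (fscale (s * om m (x, v)) w + fscale (s * om m (x, w)) v)"
      by (simp add: rv_def fv.scale_right_distrib)
    then show "\<phi> (act m (RV m v w s) x) = act m (RV m (\<phi> v) (\<phi> w) (s ^ k / \<kappa>)) (\<phi> x)"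
      unfolding RV_act[OF v w o x] RV_act[OF phi_space phi_space o' phi_space] rv_def[of m "\<phi> v"] om_phi[OF x v] om_phi[OF x w]
      using phi_combination[OF x w v] kappa_nonzero by (simp add: power_mult_distrib fv.scale_right_distrib)
  qed
qed

text \<open>A two-parameter family of isometries supported on the span of two vectors. It contains the root elements for orthogonal vectors
(\<open>a = b\<close>) and the torus elements for hyperbolic pairs.\<close>

lemma sp_map_pair:
  assumes v: "v \<in> space m" and w: "w \<in> space m" and ab: "a - b = a * b * om m (v, w)"
  shows "sp_map m (\<lambda>x. x + (fscale (a * om m (x, w)) v + fscale (b * om m (x, v)) (w :: nat \<Rightarrow> 'k)))"
  unfolding sp_map_def
proof (intro conjI ballI allI)
  let ?T = "\<lambda>x. x + (fscale (a * om m (x, w)) v + fscale (b * om m (x, v)) w)"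
  fix x y :: "nat \<Rightarrow> 'k" assume x: "x \<in> space m" and y: "y \<in> space m"
  show "?T (x + y) = ?T x + ?T y" "?T x \<in> space m"
    using v w x y by (simp_all add: om_simps fun_eq_iff pointwise algebra_simps)
  have "om m (?T x, ?T y) = om m (x, y) + om m (x, v) * om m (y, w) * (a - b - a * b * om m (v, w))
      + om m (x, w) * om m (y, v) * (b - a + a * b * om m (v, w))"
    using v w x y om_anti[of m v y] om_anti[of m w y] om_anti[of m w v] by (simp add: om_simps algebra_simps)
  moreover have "a - b - a * b * om m (v, w) = 0" "b - a + a * b * om m (v, w) = 0"
    using ab by (simp_all add: algebra_simps)
  ultimately show "om m (?T x, ?T y) = om m (x, y)" by simp
next
  fix c :: 'k and x :: "nat \<Rightarrow> 'k" assume x: "x \<in> space m"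
  show "fscale c x + (fscale (a * om m (fscale c x, w)) v + fscale (b * om m (fscale c x, v)) w)
      = fscale c (x + (fscale (a * om m (x, w)) v + fscale (b * om m (x, v)) w))"
    using v w x by (simp add: om_simps fun_eq_iff pointwise algebra_simps)
qed

text \<open>For \<open>k = 1\<close> the map \<open>\<phi>\<close> is linear and \<open>om m (\<phi> x, \<phi> y) = \<kappa> om m (x, y)\<close>. Let \<open>v\<close> be an eigenvector with eigenvalue \<open>e\<close>. As
\<open>\<phi> - \<kappa> / e\<close> has its range in the hyperplane orthogonal to \<open>v\<close>, there is also an eigenvector \<open>w\<close> with eigenvalue \<open>\<kappa> / e\<close>. All isometries
\<open>x \<mapsto> x + a om m (x, w) v + b om m (x, v) w\<close> commute with \<open>\<phi>\<close>, so they are fixed by \<open>F\<close>, and there are infinitely many.\<close>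

lemma k_ge_2:
  assumes fin: "finite {A \<in> Sp m. F A = A}"
  shows "k \<ge> 2"
proof (rule ccontr)
  assume "\<not> ?thesis"
  then have k1: "k = 1" using k0 by simp
  define p :: "(nat \<Rightarrow> 'k) \<Rightarrow> nat \<Rightarrow> 'k" where "p x = (\<lambda>i. if i < 2 * m then x i else 0)" for x
  have p: "p (x + y) = p x + p y" "p (fscale c x) = fscale c (p x)" "p x \<in> space m" for x y c
    by (auto simp: p_def fun_eq_iff pointwise space_def supported_def)
  have p_id: "p x = x" if "x \<in> space m" for x
    using that by (auto simp: p_def fun_eq_iff space_def supported_def)
  have T: "flin (\<lambda>x. \<phi> (p x))" by (rule flinI) (simp_all add: p phi_additive phi_scale k1)
  obtain e v where v: "v \<in> space m" "v \<noteq> 0" "\<phi> v = fscale e v"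
    by (rule eigenvector_exists[OF T _ m0]) (auto simp: p_id)
  have e0: "e \<noteq> 0" using phi_nonzero[OF v(1,2)] v(3) by auto
  let ?g = "\<kappa> / e"
  have ov: "om m (v, \<phi> x) = ?g * om m (v, x)" if "x \<in> space m" for x
  proof -
    have "e * om m (v, \<phi> x) = \<kappa> * om m (v, x)"
      using om_phi[OF v(1) that] om_scale1[OF v(1) phi_space[of x]] by (simp only: v(3) k1 power_one_right)
    note eq = this
    have "om m (v, \<phi> x) = (e * om m (v, \<phi> x)) / e" using e0 by simp
    then show ?thesis unfolding eq times_divide_eq_left .
  qed
  have "\<exists>w\<in>space m. w \<noteq> 0 \<and> \<phi> w = fscale ?g w"
  proof (rule ccontr)
    assume n: "\<not> ?thesis"
    let ?S = "\<lambda>x. \<phi> (p x) - fscale ?g x"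
    have S: "flin ?S" by (rule flinI) (simp_all add: p phi_additive phi_scale k1 fun_eq_iff pointwise algebra_simps)
    have Ss: "?S ` space m \<subseteq> space m" by auto
    have "fv.dim (space m :: (nat \<Rightarrow> 'k) set) \<le> fv.dim (?S ` space m)"
    proof (rule dim_le_of_inj(2)[OF S subspace_space _ fd_image[OF S fd_space[of m]]])
      show "x = 0" if "x \<in> space m" "?S x = 0" for x using n that p_id[OF that(1)] by (metis right_minus_eq)
    qed simp
    then have "?S ` space m = space m"
      by (intro fd_dim_equal[OF fp.linear_subspace_image[OF S subspace_space] fd_space Ss])
    have "om m (y, v) = 0" if "y \<in> space m" for y
    proof -
      have "y \<in> ?S ` space m" using that unfolding \<open>?S ` space m = space m\<close> .
      then obtain x where x: "y = ?S x" "x \<in> space m" by (rule imageE)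
      have "om m (v, y) = om m (v, \<phi> x) - ?g * om m (v, x)"
        unfolding x(1) p_id[OF x(2)] om_diff2[OF v(1) fv.subspace_scale[OF subspace_space x(2)] phi_space] om_scale2[OF v(1) x(2)] ..
      also have "\<dots> = 0" unfolding ov[OF x(2)] by (rule diff_self)
      finally show ?thesis unfolding om_anti[of m y v] by simp
    qed
    then show False using om_nondeg[OF v(1)] v(2) by blast
  qed
  then obtain w where w: "w \<in> space m" "w \<noteq> 0" "\<phi> w = fscale ?g w" by blast
  have g0: "?g \<noteq> 0" using e0 kappa_nonzero by simp
  let ?u = "om m (v, w)"
  define b where "b a = a / (1 + a * ?u)" for a
  define T where "T a x = x + (fscale (a * om m (x, w)) v + fscale (b a * om m (x, v)) w)" for a x
  let ?I = "{a. 1 + a * ?u \<noteq> 0}"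
  have ab: "a - b a = a * b a * ?u" if "a \<in> ?I" for a using that by (simp add: b_def field_simps)
  have spT: "sp_map m (T a)" if "a \<in> ?I" for a unfolding T_def by (rule sp_map_pair[OF v(1) w(1) ab[OF that]])
  have fixT: "F (mof m (T a)) = mof m (T a)" if a: "a \<in> ?I" for a
  proof (rule F_conj[OF sp_map_mof(1)[OF spT[OF a]] sp_map_mof(1)[OF spT[OF a]]])
    fix x :: "nat \<Rightarrow> 'k" assume x: "x \<in> space m"
    have 1: "om m (\<phi> x, v) = ?g * om m (x, v)"
    proof -
      have "e * om m (\<phi> x, v) = \<kappa> * om m (x, v)"
        using om_phi[OF x v(1)] om_scale2[OF phi_space[of x] v(1)] by (simp only: v(3) k1 power_one_right)
      note eq = this
      have "om m (\<phi> x, v) = (e * om m (\<phi> x, v)) / e" using e0 by simp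
      then show ?thesis unfolding eq times_divide_eq_left .
    qed
    have 2: "om m (\<phi> x, w) = e * om m (x, w)"
    proof -
      have "?g * om m (\<phi> x, w) = \<kappa> * om m (x, w)"
        using om_phi[OF x w(1)] om_scale2[OF phi_space[of x] w(1)] by (simp only: w(3) k1 power_one_right)
      also have "\<dots> = ?g * (e * om m (x, w))" using e0 by simp
      finally show ?thesis using g0 by (simp only: mult_cancel_left) simp
    qed
    have "\<phi> (T a x) = T a (\<phi> x)"
      unfolding T_def phi_combination[OF x v(1) w(1)] v(3) w(3) 1 2 k1 by (simp add: mult.commute mult.left_commute)
    then show "\<phi> (act m (mof m (T a)) x) = act m (mof m (T a)) (\<phi> x)"
      unfolding sp_map_mof(2)[OF spT[OF a] x] sp_map_mof(2)[OF spT[OF a] phi_space] .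
  qed
  have inj: "inj_on (\<lambda>a. mof m (T a)) ?I"
  proof (rule inj_onI)
    fix a a' assume a: "a \<in> ?I" "a' \<in> ?I" and eq: "mof m (T a) = mof m (T a')"
    obtain x where x: "x \<in> space m" "om m (x, v) \<noteq> 0" "om m (x, w) \<noteq> 0" by (rule common_nonorthogonal[OF v(1,2) w(1,2)])
    have Tx: "T a x = T a' x"
      using sp_map_mof(2)[OF spT[OF a(1)] x(1)] sp_map_mof(2)[OF spT[OF a(2)] x(1)] eq by simp
    have "om m (v, T a x) = om m (v, x) + b a * om m (x, v) * ?u" "om m (x, T a x) = (a + b a) * om m (x, v) * om m (x, w)" for a
      using v(1) w(1) x(1) by (simp_all add: T_def om_simps algebra_simps)
    then have "b a * om m (x, v) * ?u = b a' * om m (x, v) * ?u" "(a + b a) * om m (x, v) * om m (x, w) = (a' + b a') * om m (x, v) * om m (x, w)"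
      using Tx by (metis add_left_cancel)+
    then have 1: "?u = 0 \<or> b a = b a'" and 2: "a + b a = a' + b a'" using x(2,3) by auto
    show "a = a'"
    proof (cases "?u = 0")
      case True
      then have "2 * a = 2 * a'" using 2 by (simp add: b_def)
      then show ?thesis using two by simp
    next
      case False
      then show ?thesis using 1 2 by simp
    qed
  qed
  have "(\<lambda>a. mof m (T a)) ` ?I \<subseteq> {A \<in> Sp m. F A = A}" using fixT sp_map_mof(1)[OF spT] by blast
  then have "finite ?I" using fin inj finite_subset finite_imageD by blast
  moreover have "finite {a. 1 + a * ?u = 0}"
  proof (cases "?u = 0")
    case False
    then have "{a. 1 + a * ?u = 0} \<subseteq> {- 1 / ?u}" by (auto simp: field_simps add_eq_0_iff)
    then show ?thesis by (rule finite_subset) simp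
  qed simp
  moreover have "UNIV = ?I \<union> {a. 1 + a * ?u = 0}" by blast
  ultimately show False using infinite_alg_closed by (metis finite_Un)
qed

end

section \<open>Transvections in the derived subgroup\<close>

locale finite_highest_weight = highest_weight m F f k for m F and f :: "nat \<Rightarrow> 'k::alg_closed_field" and k +
  assumes fin: "finite {A \<in> Sp m. F A = A}"
begin

sublocale semi: semilinear_bijection "space m" \<phi> k
proof
  show "x = 0" if "x \<in> space m" "\<phi> x = 0" for x using phi_nonzero that by blast
qed (auto simp: subspace_space fd_space phi_additive phi_scale k_ge_2[OF fin])

text \<open>The rational points of the module: they form a vector space over the field of all \<open>c\<close> with \<open>c\<^sup>k = c\<close>.\<close>

definition rational :: "(nat \<Rightarrow> 'k) set" where "rational = {x \<in> space m. \<phi> x = x}"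

lemma rational_space: "x \<in> rational \<Longrightarrow> x \<in> space m" and rational_phi: "x \<in> rational \<Longrightarrow> \<phi> x = x"
  by (simp_all add: rational_def)

lemma rational_span: "space m \<subseteq> fv.span rational"
  unfolding rational_def by (rule semi.fixed_vectors_span)

lemma rational_add: "x \<in> rational \<Longrightarrow> y \<in> rational \<Longrightarrow> x + y \<in> rational"
  by (simp add: rational_def phi_additive)

lemma rational_diff: "x \<in> rational \<Longrightarrow> y \<in> rational \<Longrightarrow> x - y \<in> rational"
  by (simp add: rational_def phi_diff)

lemma rational_om: "x \<in> rational \<Longrightarrow> y \<in> rational \<Longrightarrow> \<kappa> * om m (x, y) ^ k = om m (x, y)"
  using om_phi rational_phi rational_space by metis

lemma rational_scale:
  assumes "x \<in> rational" "\<kappa> * a ^ k = a" "\<kappa> * b ^ k = b"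
  shows "fscale (a / b) x \<in> rational"
proof -
  have "(a / b) ^ k = a / b"
  proof (cases "b = 0")
    case True then show ?thesis using k0 by (simp add: zero_power)
  next
    case False
    have "(a / b) ^ k = (\<kappa> * a ^ k) / (\<kappa> * b ^ k)" using kappa_nonzero by (simp add: power_divide)
    then show ?thesis unfolding assms(2,3) .
  qed
  then show ?thesis using assms(1) by (simp add: rational_def phi_scale)
qed

lemma rational_nondeg:
  assumes x: "x \<in> space m" "x \<noteq> 0"
  obtains y where "y \<in> rational" "om m (x, y) \<noteq> 0"
proof -
  have "\<exists>y\<in>rational. om m (x, y) \<noteq> 0"
  proof (rule ccontr)
    assume n: "\<not> ?thesis"
    let ?W = "{y \<in> space m. om m (x, y) = 0}"
    have "fv.subspace ?W"
      using x(1) fv.subspace_0[OF subspace_space] forms_zero2[OF om_forms subspace_space, of m x] by (auto simp: fv.subspace_def om_simps)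
    moreover have "rational \<subseteq> ?W" using n rational_space by blast
    ultimately have W: "space m \<subseteq> ?W" using fv.span_minimal rational_span by blast
    have "om m (y, x) = 0" if "y \<in> space m" for y using W that om_anti[of m y x] by auto
    then show False using om_nondeg[OF x(1)] x(2) by blast
  qed
  then show thesis using that by blast
qed

text \<open>A rational vector \<open>x\<close> outside the span of \<open>v\<close> and \<open>z\<close> exists since \<open>2 m > 2\<close>; its projection \<open>e\<close> orthogonal to both is rational,
and \<open>g\<close> is obtained from a rational vector not orthogonal to \<open>e\<close> by subtracting a multiple of \<open>z\<close>.\<close>

lemma rational_commutator_data:
  assumes v: "v \<in> rational" "v \<noteq> 0"
  obtains e g where "e \<in> rational" "g \<in> rational" "om m (e, v) = 0" "om m (v, g) = 0" "om m (e, g) \<noteq> 0"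
proof -
  note vs = rational_space[OF v(1)]
  obtain z where z: "z \<in> rational" "om m (v, z) \<noteq> 0" by (rule rational_nondeg[OF vs v(2)])
  note zs = rational_space[OF z(1)]
  have "\<not> rational \<subseteq> fv.span {v, z}"
  proof
    assume "rational \<subseteq> fv.span {v, z}"
    then have "space m \<subseteq> fv.span {v, z}" using rational_span fv.span_minimal[OF _ fv.subspace_span] by blast
    then have "fv.dim (space m :: (nat \<Rightarrow> 'k) set) \<le> card {v, z}" by (rule fv.dim_le_card) simp
    also have "\<dots> \<le> 2" by (simp add: card_insert_if)
    finally show False using m2 by (simp add: space_def supported_dim)
  qed
  then obtain x where x: "x \<in> rational" "x \<notin> fv.span {v, z}" by blast
  note xs = rational_space[OF x(1)]
  define e where "e = x - fscale (om m (x, z) / om m (v, z)) v - fscale (om m (v, x) / om m (v, z)) z"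
  have eR: "e \<in> rational"
    unfolding e_def by (intro rational_diff rational_scale x v z rational_om)
  have ev: "om m (e, v) = 0" "om m (e, z) = 0"
    using vs zs xs z(2) om_anti[of m z v] om_anti[of m x v] by (simp_all add: e_def om_simps)
  have "e \<noteq> 0"
  proof
    assume "e = 0"
    then have "x = fscale (om m (x, z) / om m (v, z)) v + fscale (om m (v, x) / om m (v, z)) z"
      by (simp add: e_def diff_diff_eq right_minus_eq)
    then have "x \<in> fv.span {v, z}" by (metis fv.span_add fv.span_scale fv.span_base insertI1 insertI2)
    then show False using x(2) by blast
  qed
  then obtain h where h: "h \<in> rational" "om m (e, h) \<noteq> 0" by (rule rational_nondeg[OF rational_space[OF eR]])
  note hs = rational_space[OF h(1)] and es = rational_space[OF eR]
  define g where "g = h - fscale (om m (v, h) / om m (v, z)) z"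
  have "g \<in> rational" unfolding g_def by (intro rational_diff rational_scale h v z rational_om)
  moreover have "om m (v, g) = 0" "om m (e, g) \<noteq> 0" using vs zs hs es h(2) z(2) ev by (simp_all add: g_def om_simps)
  ultimately show thesis using that eR ev(1) by blast
qed

text \<open>With this parameter the root elements of rational vectors are fixed by \<open>F\<close>, by \<open>F_RV\<close>.\<close>

lemma fixed_scalar: obtains s where "s \<noteq> 0" "s ^ k / \<kappa> = s"
proof -
  let ?P = "Polynomial.monom 1 (k - 1) - [:\<kappa>:]"
  have "degree ?P = k - 1"
    using k_ge_2[OF fin] by (subst diff_conv_add_uminus, subst degree_add_eq_left) (simp_all add: degree_monom_eq)
  then have "degree ?P > 0" using k_ge_2[OF fin] by simp
  then obtain s where "poly ?P s = 0" using alg_closed_imp_poly_has_root by blast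
  then have s: "s ^ (k - 1) = \<kappa>" by (simp add: poly_monom)
  have "s \<noteq> 0" using s kappa_nonzero k_ge_2[OF fin] by (auto simp: zero_power)
  moreover have "s ^ k = s * s ^ (k - 1)" using k0 by (cases k) simp_all
  ultimately show thesis using that s kappa_nonzero by simp
qed

abbreviation \<Gamma> :: "'k mat monoid" where "\<Gamma> \<equiv> fixed_point_group (symplectic_group m) F"

lemma Gamma_simps: "carrier \<Gamma> = {A \<in> Sp m. F A = A}" "A \<otimes>\<^bsub>\<Gamma>\<^esub> B = A * B" "\<one>\<^bsub>\<Gamma>\<^esub> = 1\<^sub>m (2 * m)"
  by (simp_all add: fixed_point_group_def symplectic_group_def matrix_group_def)

lemma group_Gamma: "group \<Gamma>"
proof (rule groupI)
  fix A assume "A \<in> carrier \<Gamma>"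
  then have A: "A \<in> Sp m" "F A = A" by (auto simp: Gamma_simps)
  obtain B where B: "B \<in> Sp m" "B * A = 1\<^sub>m (2 * m)" "A * B = 1\<^sub>m (2 * m)" by (rule Sp_inverse[OF A(1)])
  note c = Sp_carrier[OF A(1)] Sp_carrier[OF B(1)] Sp_carrier[OF F_Sp[OF B(1)]]
  have "F B * A = 1\<^sub>m (2 * m)" using F_mult[OF B(1) A(1)] A(2) B(2) F_one by simp
  then have "F B = B" using assoc_mult_mat[OF c(3,1,2)] B(3) c by simp
  then show "\<exists>B\<in>carrier \<Gamma>. B \<otimes>\<^bsub>\<Gamma>\<^esub> A = \<one>\<^bsub>\<Gamma>\<^esub>" using B by (auto simp: Gamma_simps)
next
  fix A B C assume "A \<in> carrier \<Gamma>" "B \<in> carrier \<Gamma>" "C \<in> carrier \<Gamma>"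
  then show "A \<otimes>\<^bsub>\<Gamma>\<^esub> B \<otimes>\<^bsub>\<Gamma>\<^esub> C = A \<otimes>\<^bsub>\<Gamma>\<^esub> (B \<otimes>\<^bsub>\<Gamma>\<^esub> C)"
    unfolding Gamma_simps by (intro assoc_mult_mat[where n\<^sub>1 = "2 * m" and n\<^sub>2 = "2 * m" and n\<^sub>3 = "2 * m" and n\<^sub>4 = "2 * m"]) (auto simp: Sp_carrier)
qed (auto simp: Gamma_simps Sp_mult F_mult Sp_one F_one left_mult_one_mat[OF Sp_carrier])

lemma commutator_derived:
  assumes R: "R1 \<in> carrier \<Gamma>" "R2 \<in> carrier \<Gamma>" and T: "T \<in> Sp m" and e: "R1 * R2 = T * R2 * R1"
  shows "T \<in> derived \<Gamma> (carrier \<Gamma>)"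
proof -
  interpret \<Gamma>: group \<Gamma> by (rule group_Gamma)
  let ?X = "R1 \<otimes>\<^bsub>\<Gamma>\<^esub> R2 \<otimes>\<^bsub>\<Gamma>\<^esub> inv\<^bsub>\<Gamma>\<^esub> R1 \<otimes>\<^bsub>\<Gamma>\<^esub> inv\<^bsub>\<Gamma>\<^esub> R2"
  have X: "?X \<in> carrier \<Gamma>" using R by simp
  have "?X \<otimes>\<^bsub>\<Gamma>\<^esub> (R2 \<otimes>\<^bsub>\<Gamma>\<^esub> R1) = R1 \<otimes>\<^bsub>\<Gamma>\<^esub> R2"
  proof -
    have "inv\<^bsub>\<Gamma>\<^esub> R1 \<otimes>\<^bsub>\<Gamma>\<^esub> inv\<^bsub>\<Gamma>\<^esub> R2 = inv\<^bsub>\<Gamma>\<^esub> (R2 \<otimes>\<^bsub>\<Gamma>\<^esub> R1)" using \<Gamma>.inv_mult_group[OF R(2,1)] by simp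
    then have "?X = R1 \<otimes>\<^bsub>\<Gamma>\<^esub> R2 \<otimes>\<^bsub>\<Gamma>\<^esub> inv\<^bsub>\<Gamma>\<^esub> (R2 \<otimes>\<^bsub>\<Gamma>\<^esub> R1)" using R by (simp add: \<Gamma>.m_assoc)
    then show ?thesis using R by (simp add: \<Gamma>.m_assoc)
  qed
  then have XR: "?X * (R2 * R1) = T * (R2 * R1)"
    using e R assoc_mult_mat[OF Sp_carrier[OF T], of R2 "2 * m" R1 "2 * m"] by (auto simp: Gamma_simps Sp_carrier)
  have RR: "R2 * R1 \<in> Sp m" using R by (auto simp: Gamma_simps Sp_mult)
  obtain C where C: "C \<in> Sp m" "(R2 * R1) * C = 1\<^sub>m (2 * m)" by (rule Sp_inverse[OF RR])
  have XS: "?X \<in> Sp m" using X unfolding Gamma_simps(1) by simp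
  have "?X * (R2 * R1) * C = T * (R2 * R1) * C" unfolding XR ..
  then have "?X = T"
    using assoc_mult_mat[OF Sp_carrier[OF XS] Sp_carrier[OF RR] Sp_carrier[OF C(1)]]
      assoc_mult_mat[OF Sp_carrier[OF T] Sp_carrier[OF RR] Sp_carrier[OF C(1)]] C(2)
      right_mult_one_mat[OF Sp_carrier[OF XS]] right_mult_one_mat[OF Sp_carrier[OF T]] by simp
  moreover have "?X \<in> derived \<Gamma> (carrier \<Gamma>)"
    unfolding derived_def by (rule generate.incl) (use R in blast)
  ultimately show ?thesis by simp
qed

lemma derived_transvection:
  assumes v: "v \<in> rational"
  obtains s where "s \<noteq> 0" "TV m v s \<in> derived \<Gamma> (carrier \<Gamma>)"
proof (cases "v = 0")
  case True
  have "tv m 0 1 = (\<lambda>x :: nat \<Rightarrow> 'k. x)" by (auto simp: tv_def)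
  then have "TV m v 1 = mof m (\<lambda>x :: nat \<Rightarrow> 'k. x)" using True by simp
  also have "\<dots> = TV m (delta 0) 0" by (auto simp: tv_def intro!: arg_cong[where f = "mof m"])
  also have "\<dots> = 1\<^sub>m (2 * m)" by (rule TV_0[OF e_space(1)])
  finally have "TV m v 1 \<in> derived \<Gamma> (carrier \<Gamma>)"
    unfolding derived_def using generate.one[of \<Gamma>] by (simp add: Gamma_simps)
  then show thesis using that[of 1] by simp
next
  case False
  obtain e g where eg: "e \<in> rational" "g \<in> rational" "om m (e, v) = 0" "om m (v, g) = 0" "om m (e, g) \<noteq> 0"
    by (rule rational_commutator_data[OF v False])
  obtain s where s: "s \<noteq> 0" "s ^ k / \<kappa> = s" by (rule fixed_scalar)
  note S = rational_space[OF v] rational_space[OF eg(1)] rational_space[OF eg(2)]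
  have R1: "RV m v g s \<in> carrier \<Gamma>"
    using RV_Sp[OF S(1,3) eg(4), of s] F_RV[OF S(1,3) eg(4), of s] s(2) rational_phi[OF v] rational_phi[OF eg(2)] by (simp add: Gamma_simps)
  have R2: "RV m e v s \<in> carrier \<Gamma>"
    using RV_Sp[OF S(2,1) eg(3), of s] F_RV[OF S(2,1) eg(3), of s] s(2) rational_phi[OF v] rational_phi[OF eg(1)] by (simp add: Gamma_simps)
  show thesis
  proof (rule that)
    show "2 * s * s * om m (e, g) \<noteq> 0" using two s(1) eg(5) by simp
    show "TV m v (2 * s * s * om m (e, g)) \<in> derived \<Gamma> (carrier \<Gamma>)"
      by (rule commutator_derived[OF R1 R2 TV_Sp[OF S(1)] RV_commutator[OF S(2) eg(3) S(1,3) eg(4)]])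
  qed
qed

theorem no_invariant_form:
  assumes B: "B \<in> sym_forms m"
    and inv: "\<And>A x y. A \<in> derived \<Gamma> (carrier \<Gamma>) \<Longrightarrow> x \<in> space m \<Longrightarrow> y \<in> space m \<Longrightarrow> B (act m A x, act m A y) = B (x, y)"
  shows "B = 0"
proof (rule transvections_no_invariant_form[OF B two _ rational_span rational_add])
  show "rational \<subseteq> space m" using rational_space by blast
  fix v assume v: "v \<in> rational"
  obtain s where s: "s \<noteq> 0" "TV m v s \<in> derived \<Gamma> (carrier \<Gamma>)" by (rule derived_transvection[OF v])
  have "B (tv m v s x, tv m v s y) = B (x, y)" if "x \<in> space m" "y \<in> space m" for x y
    using inv[OF s(2) that] TV_act[OF rational_space[OF v]] that by simp
  then show "\<exists>s. s \<noteq> 0 \<and> (\<forall>x\<in>space m. \<forall>y\<in>space m. B (tv m v s x, tv m v s y) = B (x, y))" using s(1) by blast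
qed

end

section \<open>Generators as symplectic operators\<close>

lemma symplectic_group_simps:
  "A \<otimes>\<^bsub>symplectic_group m\<^esub> B = A * B" "\<one>\<^bsub>symplectic_group m\<^esub> = 1\<^sub>m (2 * m)"
  by (simp_all add: symplectic_group_def matrix_group_def)

lemma steinberg_symplectic_endomorphism:
  fixes F :: "'k::alg_closed_field mat \<Rightarrow> 'k mat"
  assumes S: "steinberg_endomorphism (symplectic_group m) F" and m: "m \<ge> 2" and two: "(2::'k) \<noteq> 0"
  shows "symplectic_endomorphism m F"
proof
  note alg = S[unfolded steinberg_endomorphism_def algebraic_endomorphism_def]
  have hom: "F \<in> hom (symplectic_group m) (symplectic_group m)" using alg by blast
  show "F A \<in> Sp m" if "A \<in> Sp m" for A using hom that by (auto simp: hom_def)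
  show "F (A * B) = F A * F B" if "A \<in> Sp m" "B \<in> Sp m" for A B
    using hom that by (auto simp: hom_def symplectic_group_simps)
  show "F ` Sp m = Sp m" using alg by blast
  show "\<exists>f\<in>entry_polynomials (2 * m). \<forall>A\<in>Sp m. F A $$ (i, j) = f A" if "i < 2 * m" "j < 2 * m" for i j
    using alg that by (simp add: symplectic_group_simps Let_def)
qed (rule m, rule two)

lemma act_nat_pow:
  fixes H (structure)
  assumes H: "monoid H" "carrier H \<subseteq> Sp m" "\<And>A B. A \<otimes> B = A * B" "\<one> = 1\<^sub>m (2 * m)"
    and A: "A \<in> carrier H" and x: "x \<in> space m"
  shows "act m (A [^] (n::nat)) x = (act m A ^^ n) x"
  using x
proof (induction n arbitrary: x)
  case 0
  then show ?case using H(4) act_one[OF 0] by simp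
next
  case (Suc n)
  have "A [^] n \<in> Sp m" using monoid.nat_pow_closed[OF H(1) A] H(2) by blast
  moreover have "A \<in> Sp m" using A H(2) by blast
  ultimately have "act m (A [^] Suc n) x = act m (A [^] n) (act m A x)" using H(3) Sp_act_mult[OF _ _ Suc(2)] by simp
  also have "\<dots> = (act m A ^^ n) (act m A x)" by (rule Suc(1)) simp
  finally show ?case by (simp add: funpow_swap1)
qed

text \<open>All lower bounds for the dimension \<open>d\<close> of the invariant symmetric forms of an isometry of order dividing \<open>a\<close>, in one predicate.\<close>

definition dim_bound :: "nat \<Rightarrow> nat \<Rightarrow> nat \<Rightarrow> bool" where
  "dim_bound m a d \<longleftrightarrow> m \<le> d
     \<and> (\<forall>k. (2 * k + 1) * (2 * m) \<le> 2 * d + (a - (if even a then 2 else 1)) * (k * (k + 1)) + (if even a then 2 else 1) * (k * k))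
     \<and> (\<forall>k. (2 * k + 2) * (2 * m) \<le> 2 * d + (a - (if even a then 2 else 1)) * ((k + 1) * (k + 1)) + (if even a then 2 else 1) * ((k + 1) * k))
     \<and> (a = 2 \<longrightarrow> odd m \<longrightarrow> m * m + m + 1 \<le> d) \<and> (a = 4 \<longrightarrow> m = 2 \<longrightarrow> 4 \<le> d) \<and> (a = 6 \<longrightarrow> m = 3 \<longrightarrow> 5 \<le> d)"

lemma dim_bound_rank: "dim_bound m a d \<Longrightarrow> m \<le> d"
  and dim_bound_odd: "dim_bound m a d \<Longrightarrow> (2 * k + 1) * (2 * m) \<le> 2 * d + (a - (if even a then 2 else 1)) * (k * (k + 1)) + (if even a then 2 else 1) * (k * k)"
  and dim_bound_even: "dim_bound m a d \<Longrightarrow> (2 * k + 2) * (2 * m) \<le> 2 * d + (a - (if even a then 2 else 1)) * ((k + 1) * (k + 1)) + (if even a then 2 else 1) * ((k + 1) * k)"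
  and dim_bound_involution: "dim_bound m 2 d \<Longrightarrow> odd m \<Longrightarrow> m * m + m + 1 \<le> d"
  and dim_bound_4_2: "dim_bound 2 4 d \<Longrightarrow> 4 \<le> d"
  and dim_bound_6_3: "dim_bound 3 6 d \<Longrightarrow> 5 \<le> d"
  unfolding dim_bound_def by blast+

lemma fixed_dim_dim_bound:
  fixes T :: "(nat \<Rightarrow> 'k::alg_closed_field) \<Rightarrow> nat \<Rightarrow> 'k"
  assumes "sp_op m T" "a > 0" "\<forall>x\<in>space m. (T ^^ a) x = x" "prime CHAR('k)" "CHAR('k) \<noteq> 2" "(2::'k) \<noteq> 0"
  shows "dim_bound m a (fixed_dim m T)"
  unfolding dim_bound_def
  by (intro conjI allI impI fixed_dim_ge_rank[OF assms] fixed_dim_odd_slope[OF assms refl] fixed_dim_even_slope[OF assms refl]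
      fixed_dim_involution[OF assms] fixed_dim_4_rank_2[OF assms] fixed_dim_6_rank_3[OF assms])

text \<open>A form invariant under both generators is invariant under the whole group, hence zero, so Scott's inequality applies.\<close>

theorem symplectic_dim_bounds:
  fixes F :: "'k::alg_closed_field mat \<Rightarrow> 'k mat"
  assumes S: "steinberg_endomorphism (symplectic_group m) F" and m: "m \<ge> 2" and p: "prime CHAR('k)" "CHAR('k) \<noteq> 2" and two: "(2::'k) \<noteq> 0"
    and abc: "abc_group a b c (derived_group (fixed_point_group (symplectic_group m) F))" and pos: "a > 0" "b > 0" "c > 0"
  shows "\<exists>d1 d2 d3. dim_bound m a d1 \<and> dim_bound m b d2 \<and> dim_bound m c d3 \<and> d1 + d2 + d3 \<le> m * (2 * m + 1)"
proof -
  define H where "H = derived_group (fixed_point_group (symplectic_group m) F)"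
  interpret E: symplectic_endomorphism m F by (rule steinberg_symplectic_endomorphism[OF S m two])
  obtain f k where fk: "k > 0" "f \<noteq> 0" "E.wt 0 (int k) f" "E.hw 0 f" by (rule E.highest_weight_exists)
  have "finite {A \<in> Sp m. F A = A}" using S by (simp add: steinberg_endomorphism_def fixed_point_group_def)
  then interpret L: finite_highest_weight m F f k by unfold_locales (use fk in auto)
  have mult: "A \<otimes>\<^bsub>H\<^esub> B = A * B" and one: "\<one>\<^bsub>H\<^esub> = 1\<^sub>m (2 * m)" for A B
    by (simp_all add: H_def derived_group_def L.Gamma_simps)
  have "carrier H \<subseteq> carrier (fixed_point_group (symplectic_group m) F)"
    unfolding H_def derived_group_def using group.derived_in_carrier[OF L.group_Gamma order_refl] by simp
  then have HS: "carrier H \<subseteq> Sp m" unfolding L.Gamma_simps by blast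
  obtain x y where gr: "group H" and x: "x \<in> carrier H" and y: "y \<in> carrier H" and gen: "generate H {x, y} = carrier H"
    and ord: "group.ord H x dvd a" "group.ord H y dvd b" "group.ord H (x \<otimes>\<^bsub>H\<^esub> y) dvd c"
    using abc unfolding abc_group_def H_def by blast
  interpret H: group H by (rule gr)
  have xy: "x \<otimes>\<^bsub>H\<^esub> y \<in> carrier H" using x y by simp
  have pow: "(act m g ^^ n) v = v" if "g \<in> carrier H" "H.ord g dvd n" "v \<in> space m" for g n v
  proof -
    have "g [^]\<^bsub>H\<^esub> n = \<one>\<^bsub>H\<^esub>" using that H.pow_eq_id by blast
    then show ?thesis
      using act_nat_pow[OF H.monoid_axioms HS mult one that(1,3), of n] act_one[OF that(3)] one by simp
  qed
  note Sx = subsetD[OF HS x] and Sy = subsetD[OF HS y] and Sxy = subsetD[OF HS xy]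
  let ?X = "act m x" and ?Y = "act m y"
  have XY: "?X (?Y v) = act m (x \<otimes>\<^bsub>H\<^esub> y) v" if "v \<in> space m" for v using Sp_act_mult[OF Sx Sy that] mult by simp
  have powXY: "((\<lambda>v. ?X (?Y v)) ^^ n) v = (act m (x \<otimes>\<^bsub>H\<^esub> y) ^^ n) v" if "v \<in> space m" for n v
  proof (induction n)
    case (Suc n)
    have "(act m (x \<otimes>\<^bsub>H\<^esub> y) ^^ n) v \<in> space m" by (rule funpow_space[OF Sp_op[OF Sxy] that])
    then show ?case using Suc XY by simp
  qed simp
  have spXY: "sp_op m (\<lambda>v. ?X (?Y v))"
    unfolding sp_op_def using Sp_om[OF Sx] Sp_om[OF Sy] by (auto intro!: flinI simp: flin_add[OF flin_act] flin_scale[OF flin_act])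
  have irr: "B = 0" if B: "B \<in> sym_forms m" "pullback m ?X B = B" "pullback m ?Y B = B" for B
  proof (rule L.no_invariant_form[OF B(1)])
    fix A :: "'k mat" and u v :: "nat \<Rightarrow> 'k"
    assume A: "A \<in> derived L.\<Gamma> (carrier L.\<Gamma>)" and uv: "u \<in> space m" "v \<in> space m"
    have gx: "B (act m g u, act m g v) = B (u, v)" if "g \<in> {x, y}" "u \<in> space m" "v \<in> space m" for g u v
    proof -
      have "pullback m (act m g) B (u, v) = B (u, v)" using that(1) B(2,3) by auto
      then show ?thesis using that(2,3) by (simp add: pullback_def)
    qed
    have "A \<in> generate H {x, y}" using A unfolding gen by (simp add: H_def derived_group_def)
    then show "B (act m A u, act m A v) = B (u, v)" using uv
    proof (induction arbitrary: u v rule: generate.induct)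
      case one
      then show ?case by (simp add: \<open>\<one>\<^bsub>H\<^esub> = 1\<^sub>m (2 * m)\<close> act_one)
    next
      case (incl h)
      then show ?case by (rule gx)
    next
      case (inv h)
      have h: "h \<in> carrier H" using inv(1) x y by blast
      have "act m h (act m (inv\<^bsub>H\<^esub> h) w) = w" if "w \<in> space m" for w
        using Sp_act_mult[OF subsetD[OF HS h] subsetD[OF HS H.inv_closed[OF h]] that] H.r_inv[OF h] act_one[OF that] mult one by simp
      then show ?case using gx[OF inv(1) act_space act_space, of "inv\<^bsub>H\<^esub> h" u "inv\<^bsub>H\<^esub> h" v] inv(2,3) by simp
    next
      case (eng g h)
      have "g \<in> Sp m" "h \<in> Sp m" using eng(1,2) HS unfolding gen by auto
      then show ?case using eng(3)[OF act_space act_space] eng(4)[OF eng(5,6)] eng(5,6) by (simp add: mult Sp_act_mult)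
    qed
  qed
  have "fixed_dim m ?X + fixed_dim m ?Y + fixed_dim m (\<lambda>v. ?X (?Y v)) \<le> m * (2 * m + 1)"
    by (rule scott_symmetric_forms[OF Sp_op[OF Sx] Sp_op[OF Sy] Sp_act_surj[OF Sy] two irr])
  moreover have "dim_bound m a (fixed_dim m ?X)"
    by (rule fixed_dim_dim_bound[OF Sp_op[OF Sx] pos(1) _ p two]) (use pow[OF x ord(1)] in blast)
  moreover have "dim_bound m b (fixed_dim m ?Y)"
    by (rule fixed_dim_dim_bound[OF Sp_op[OF Sy] pos(2) _ p two]) (use pow[OF y ord(2)] in blast)
  moreover have "dim_bound m c (fixed_dim m (\<lambda>v. ?X (?Y v)))"
    by (rule fixed_dim_dim_bound[OF spXY pos(3) _ p two]) (use pow[OF xy ord(3)] powXY in simp)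
  ultimately show ?thesis by blast
qed

section \<open>Numerical contradictions\<close>

text \<open>In each case the slope is the one that gives the best bound: \<open>k\<close> is close to \<open>2 m / a\<close>, the average rank drop.\<close>

lemma dim_bounds_2:
  shows "dim_bound 2 2 d \<Longrightarrow> 6 \<le> d"
  and "dim_bound 2 3 d \<Longrightarrow> 4 \<le> d"
  and "dim_bound 2 4 d \<Longrightarrow> 4 \<le> d"
proof -
  show "6 \<le> d" if "dim_bound 2 2 d" using dim_bound_even[OF that, of 1] by simp
  show "4 \<le> d" if "dim_bound 2 3 d" using dim_bound_odd[OF that, of 1] by simp
  show "4 \<le> d" if "dim_bound 2 4 d" using dim_bound_4_2[OF that] by simp
qed

lemma dim_bounds_3:
  shows "dim_bound 3 2 d \<Longrightarrow> 13 \<le> d"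
  and "dim_bound 3 3 d \<Longrightarrow> 7 \<le> d"
  and "dim_bound 3 4 d \<Longrightarrow> 6 \<le> d"
  and "dim_bound 3 5 d \<Longrightarrow> 5 \<le> d"
  and "dim_bound 3 6 d \<Longrightarrow> 5 \<le> d"
proof -
  show "13 \<le> d" if "dim_bound 3 2 d" using dim_bound_involution[OF that] by simp
  show "7 \<le> d" if "dim_bound 3 3 d" using dim_bound_odd[OF that, of 1] by simp
  show "6 \<le> d" if "dim_bound 3 4 d" using dim_bound_odd[OF that, of 1] by simp
  show "5 \<le> d" if "dim_bound 3 5 d" using dim_bound_odd[OF that, of 1] by simp
  show "5 \<le> d" if "dim_bound 3 6 d" using dim_bound_6_3[OF that] by simp
qed

lemma dim_bounds_4:
  shows "dim_bound 4 2 d \<Longrightarrow> 20 \<le> d"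
  and "dim_bound 4 3 d \<Longrightarrow> 12 \<le> d"
  and "dim_bound 4 4 d \<Longrightarrow> 10 \<le> d"
  and "dim_bound 4 5 d \<Longrightarrow> 8 \<le> d"
  and "dim_bound 4 6 d \<Longrightarrow> 7 \<le> d"
  and "dim_bound 4 7 d \<Longrightarrow> 6 \<le> d"
  and "dim_bound 4 8 d \<Longrightarrow> 5 \<le> d"
proof -
  show "20 \<le> d" if "dim_bound 4 2 d" using dim_bound_even[OF that, of 3] by simp
  show "12 \<le> d" if "dim_bound 4 3 d" using dim_bound_odd[OF that, of 2] by simp
  show "10 \<le> d" if "dim_bound 4 4 d" using dim_bound_even[OF that, of 1] by simp
  show "8 \<le> d" if "dim_bound 4 5 d" using dim_bound_odd[OF that, of 1] by simp
  show "7 \<le> d" if "dim_bound 4 6 d" using dim_bound_odd[OF that, of 1] by simp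
  show "6 \<le> d" if "dim_bound 4 7 d" using dim_bound_odd[OF that, of 1] by simp
  show "5 \<le> d" if "dim_bound 4 8 d" using dim_bound_even[OF that, of 0] by simp
qed

lemma dim_bounds_5:
  shows "dim_bound 5 2 d \<Longrightarrow> 31 \<le> d"
  and "dim_bound 5 3 d \<Longrightarrow> 19 \<le> d"
  and "dim_bound 5 4 d \<Longrightarrow> 15 \<le> d"
  and "dim_bound 5 5 d \<Longrightarrow> 11 \<le> d"
  and "dim_bound 5 6 d \<Longrightarrow> 10 \<le> d"
  and "dim_bound 5 7 d \<Longrightarrow> 9 \<le> d"
  and "dim_bound 5 8 d \<Longrightarrow> 8 \<le> d"
  and "dim_bound 5 9 d \<Longrightarrow> 7 \<le> d"
  and "dim_bound 5 10 d \<Longrightarrow> 6 \<le> d"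
proof -
  show "31 \<le> d" if "dim_bound 5 2 d" using dim_bound_involution[OF that] by simp
  show "19 \<le> d" if "dim_bound 5 3 d" using dim_bound_odd[OF that, of 3] by simp
  show "15 \<le> d" if "dim_bound 5 4 d" using dim_bound_odd[OF that, of 2] by simp
  show "11 \<le> d" if "dim_bound 5 5 d" using dim_bound_odd[OF that, of 1] by simp
  show "10 \<le> d" if "dim_bound 5 6 d" using dim_bound_odd[OF that, of 1] by simp
  show "9 \<le> d" if "dim_bound 5 7 d" using dim_bound_odd[OF that, of 1] by simp
  show "8 \<le> d" if "dim_bound 5 8 d" using dim_bound_odd[OF that, of 1] by simp
  show "7 \<le> d" if "dim_bound 5 9 d" using dim_bound_odd[OF that, of 1] by simp
  show "6 \<le> d" if "dim_bound 5 10 d" using dim_bound_even[OF that, of 0] by simp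
qed

lemma dim_bounds_6:
  shows "dim_bound 6 2 d \<Longrightarrow> 42 \<le> d"
  and "dim_bound 6 3 d \<Longrightarrow> 26 \<le> d"
  and "dim_bound 6 4 d \<Longrightarrow> 21 \<le> d"
  and "dim_bound 6 5 d \<Longrightarrow> 16 \<le> d"
  and "dim_bound 6 7 d \<Longrightarrow> 12 \<le> d"
  and "dim_bound 6 8 d \<Longrightarrow> 11 \<le> d"
proof -
  show "42 \<le> d" if "dim_bound 6 2 d" using dim_bound_even[OF that, of 5] by simp
  show "26 \<le> d" if "dim_bound 6 3 d" using dim_bound_odd[OF that, of 3] by simp
  show "21 \<le> d" if "dim_bound 6 4 d" using dim_bound_even[OF that, of 2] by simp
  show "16 \<le> d" if "dim_bound 6 5 d" using dim_bound_odd[OF that, of 2] by simp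
  show "12 \<le> d" if "dim_bound 6 7 d" using dim_bound_odd[OF that, of 1] by simp
  show "11 \<le> d" if "dim_bound 6 8 d" using dim_bound_odd[OF that, of 1] by simp
qed

lemma dim_bounds_7:
  shows "dim_bound 7 2 d \<Longrightarrow> 57 \<le> d"
  and "dim_bound 7 3 d \<Longrightarrow> 35 \<le> d"
  and "dim_bound 7 4 d \<Longrightarrow> 28 \<le> d"
  and "dim_bound 7 5 d \<Longrightarrow> 21 \<le> d"
  and "dim_bound 7 7 d \<Longrightarrow> 15 \<le> d"
  and "dim_bound 7 8 d \<Longrightarrow> 14 \<le> d"
proof -
  show "57 \<le> d" if "dim_bound 7 2 d" using dim_bound_involution[OF that] by simp
  show "35 \<le> d" if "dim_bound 7 3 d" using dim_bound_odd[OF that, of 4] by simp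
  show "28 \<le> d" if "dim_bound 7 4 d" using dim_bound_odd[OF that, of 3] by simp
  show "21 \<le> d" if "dim_bound 7 5 d" using dim_bound_odd[OF that, of 2] by simp
  show "15 \<le> d" if "dim_bound 7 7 d" using dim_bound_odd[OF that, of 1] by simp
  show "14 \<le> d" if "dim_bound 7 8 d" using dim_bound_odd[OF that, of 1] by simp
qed

lemma dim_bounds_8:
  shows "dim_bound 8 2 d \<Longrightarrow> 72 \<le> d"
  and "dim_bound 8 3 d \<Longrightarrow> 46 \<le> d"
  and "dim_bound 8 7 d \<Longrightarrow> 20 \<le> d"
proof -
  show "72 \<le> d" if "dim_bound 8 2 d" using dim_bound_even[OF that, of 7] by simp
  show "46 \<le> d" if "dim_bound 8 3 d" using dim_bound_odd[OF that, of 5] by simp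
  show "20 \<le> d" if "dim_bound 8 7 d" using dim_bound_odd[OF that, of 2] by simp
qed

lemma dim_bounds_9:
  shows "dim_bound 9 2 d \<Longrightarrow> 91 \<le> d"
  and "dim_bound 9 3 d \<Longrightarrow> 57 \<le> d"
  and "dim_bound 9 7 d \<Longrightarrow> 25 \<le> d"
proof -
  show "91 \<le> d" if "dim_bound 9 2 d" using dim_bound_involution[OF that] by simp
  show "57 \<le> d" if "dim_bound 9 3 d" using dim_bound_odd[OF that, of 5] by simp
  show "25 \<le> d" if "dim_bound 9 7 d" using dim_bound_odd[OF that, of 2] by simp
qed

lemma dim_bounds_11:
  shows "dim_bound 11 2 d \<Longrightarrow> 133 \<le> d"
  and "dim_bound 11 3 d \<Longrightarrow> 85 \<le> d"
  and "dim_bound 11 7 d \<Longrightarrow> 37 \<le> d"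
proof -
  show "133 \<le> d" if "dim_bound 11 2 d" using dim_bound_involution[OF that] by simp
  show "85 \<le> d" if "dim_bound 11 3 d" using dim_bound_odd[OF that, of 7] by simp
  show "37 \<le> d" if "dim_bound 11 7 d" using dim_bound_odd[OF that, of 3] by simp
qed
section \<open>The special linear group of rank one\<close>

lemma (in group) commutes_with_generate:
  assumes S: "S \<subseteq> carrier G" and z: "z \<in> carrier G" and c: "\<And>s. s \<in> S \<Longrightarrow> z \<otimes> s = s \<otimes> z" and g: "g \<in> generate G S"
  shows "z \<otimes> g = g \<otimes> z"
  using g
proof (induction rule: generate.induct)
  case (inv h)
  have h: "h \<in> carrier G" using inv S by blast
  have "z \<otimes> inv h = (inv h \<otimes> h) \<otimes> (z \<otimes> inv h)" using h z by simp
  also have "\<dots> = inv h \<otimes> (h \<otimes> z) \<otimes> inv h" using h z by (simp only: m_assoc m_closed inv_closed)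
  also have "\<dots> = inv h \<otimes> (z \<otimes> h) \<otimes> inv h" using c[OF inv] by simp
  also have "\<dots> = (inv h \<otimes> z) \<otimes> (h \<otimes> inv h)" using h z by (simp only: m_assoc m_closed inv_closed)
  also have "\<dots> = inv h \<otimes> z" using h z by simp
  finally show ?case .
next
  case (eng g h)
  have gh: "g \<in> carrier G" "h \<in> carrier G" using eng(1,2) generate_in_carrier[OF S] by auto
  have "z \<otimes> (g \<otimes> h) = (z \<otimes> g) \<otimes> h" using gh z by (simp only: m_assoc)
  also have "\<dots> = g \<otimes> (z \<otimes> h)" unfolding eng(3) using gh z by (simp only: m_assoc)
  also have "\<dots> = (g \<otimes> h) \<otimes> z" unfolding eng(4) using gh z by (simp only: m_assoc)
  finally show ?case .
qed (use c z in auto)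

lemma quasisimple_not_abelian:
  assumes Q: "quasisimple_group H" and c: "\<And>g h. g \<in> carrier H \<Longrightarrow> h \<in> carrier H \<Longrightarrow> g \<otimes>\<^bsub>H\<^esub> h = h \<otimes>\<^bsub>H\<^esub> g"
  shows False
proof -
  interpret H: group H using Q by (simp add: quasisimple_group_def)
  have "derived_set H (carrier H) \<subseteq> {\<one>\<^bsub>H\<^esub>}"
  proof clarify
    fix g h assume a: "g \<in> carrier H" "h \<in> carrier H"
    have "g \<otimes>\<^bsub>H\<^esub> h \<otimes>\<^bsub>H\<^esub> inv\<^bsub>H\<^esub> g \<otimes>\<^bsub>H\<^esub> inv\<^bsub>H\<^esub> h = h \<otimes>\<^bsub>H\<^esub> g \<otimes>\<^bsub>H\<^esub> inv\<^bsub>H\<^esub> g \<otimes>\<^bsub>H\<^esub> inv\<^bsub>H\<^esub> h" using c[OF a] by simp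
    also have "\<dots> = \<one>\<^bsub>H\<^esub>" using a by (simp add: H.m_assoc)
    finally show "g \<otimes>\<^bsub>H\<^esub> h \<otimes>\<^bsub>H\<^esub> inv\<^bsub>H\<^esub> g \<otimes>\<^bsub>H\<^esub> inv\<^bsub>H\<^esub> h = \<one>\<^bsub>H\<^esub>" .
  qed
  then have "derived H (carrier H) \<subseteq> {\<one>\<^bsub>H\<^esub>}"
    unfolding derived_def using H.mono_generate H.generate_one by blast
  then have triv: "carrier H = {\<one>\<^bsub>H\<^esub>}" using Q H.one_closed unfolding quasisimple_group_def by auto
  have "simple_group (H Mod group_centre H)" using Q by (simp add: quasisimple_group_def)
  then have "order (H Mod group_centre H) > 1" by (rule simple_group.order_gt_one)
  moreover have "carrier (H Mod group_centre H) = {group_centre H #>\<^bsub>H\<^esub> \<one>\<^bsub>H\<^esub>}"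
    unfolding FactGroup_def RCOSETS_def by (simp add: triv)
  ultimately show False by (simp add: order_def)
qed

lemma group_fixed_points:
  assumes G: "group G" and F: "F \<in> hom G G"
  shows "group (fixed_point_group G F)"
proof -
  interpret G: group G by (rule G)
  interpret h: group_hom G G F by unfold_locales (rule F)
  have "subgroup {g \<in> carrier G. F g = g} G"
  proof (rule G.subgroupI)
    show "{g \<in> carrier G. F g = g} \<noteq> {}" using G.one_closed h.hom_one by blast
  qed (auto simp: h.hom_mult)
  then show ?thesis unfolding fixed_point_group_def by (rule G.subgroup_imp_group)
qed

lemma group_special_linear: "group (special_linear_group n :: 'k::field mat monoid)"
proof (rule groupI)
  fix A assume "A \<in> carrier (special_linear_group n :: 'k mat monoid)"
  then have A: "A \<in> carrier_mat n n" "det A = 1" by (simp_all add: special_linear_group_def matrix_group_def)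
  then have "A \<in> Units (ring_mat TYPE('k) n ())" by (intro det_non_zero_imp_unit) simp_all
  then obtain B where B: "B \<in> carrier_mat n n" "B * A = 1\<^sub>m n" unfolding Units_def by (auto simp: ring_mat_simps)
  have "det B = 1" using det_mult[OF B(1) A(1)] B(2) A(2) by simp
  then show "\<exists>B\<in>carrier (special_linear_group n). B \<otimes>\<^bsub>special_linear_group n\<^esub> A = \<one>\<^bsub>special_linear_group n\<^esub>"
    using B by (auto simp: special_linear_group_def matrix_group_def)
qed (auto simp: special_linear_group_def matrix_group_def det_mult assoc_mult_mat)

lemma det_2_by_2:
  assumes A: "A \<in> carrier_mat 2 2"
  shows "det A = A $$ (0, 0) * A $$ (1, 1) - A $$ (0, 1) * A $$ (1, 0)"
proof -
  have D: "det (mat_delete A i 0) = A $$ (if 0 < i then 0 else 1, 1)" for i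
  proof -
    have "det (mat_delete A i 0) = mat_delete A i 0 $$ (0, 0)"
      by (rule det_single) (use mat_delete_carrier[OF A] in simp)
    also have "\<dots> = A $$ (if 0 < i then 0 else 1, 1)" using A by (simp add: mat_delete_def)
    finally show ?thesis .
  qed
  have "det A = (\<Sum>i<2. A $$ (i, 0) * cofactor A i 0)" by (rule laplace_expansion_column[OF A]) simp
  also have "\<dots> = A $$ (0, 0) * cofactor A 0 0 + A $$ (1, 0) * cofactor A 1 0" by (simp add: numeral_2_eq_2)
  finally show ?thesis unfolding cofactor_def D by (simp add: mult.commute)
qed

text \<open>If the trace is nonzero, the off-diagonal entries vanish. Trace zero would give \<open>A\<^sup>2 = - det A\<close>, that is \<open>1 = - 1\<close>.\<close>

lemma sl2_involution_scalar:
  fixes A :: "'k::field mat"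
  assumes A: "A \<in> carrier_mat 2 2" "det A = 1" "A * A = 1\<^sub>m 2" and two: "(2::'k) \<noteq> 0"
  shows "A = 1\<^sub>m 2 \<or> A = - 1\<^sub>m 2"
proof -
  define p q r s where d: "p = A $$ (0, 0)" "q = A $$ (0, 1)" "r = A $$ (1, 0)" "s = A $$ (1, 1)"
  have e: "(A * A) $$ (i, j) = A $$ (i, 0) * A $$ (0, j) + A $$ (i, 1) * A $$ (1, j)" if "i < 2" "j < 2" for i j
    using A(1) that by (simp add: scalar_prod_def numeral_2_eq_2)
  have 1: "p * p + q * r = 1" and 2: "p * q + q * s = 0" and 3: "r * p + s * r = 0" and 4: "r * q + s * s = 1"
    using e[of 0 0] e[of 0 1] e[of 1 0] e[of 1 1] unfolding A(3) by (simp_all add: d)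
  have 5: "p * s - q * r = 1" using A(2) unfolding det_2_by_2[OF A(1)] d .
  have ps: "p + s \<noteq> 0"
  proof
    assume "p + s = 0"
    then have "s = - p" by (simp add: add_eq_0_iff)
    then have "- (p * p + q * r) = 1" using 5 by (simp add: algebra_simps)
    then have n: "- (1::'k) = 1" unfolding 1 .
    have "(2::'k) = 1 + 1" by simp
    also have "\<dots> = - 1 + 1" unfolding n ..
    also have "\<dots> = 0" by (rule left_minus)
    finally show False using two by blast
  qed
  have "q * (p + s) = 0" "r * (p + s) = 0" using 2 3 by (simp_all add: algebra_simps)
  then have q: "q = 0" "r = 0" using ps by auto
  have "p * p = 1" "p * s = 1" using 1 5 q by simp_all
  then have "p = s" by (metis mult_cancel_left mult_zero_left zero_neq_one)
  moreover have "p = 1 \<or> p = - 1" using \<open>p * p = 1\<close> by (simp add: square_eq_1_iff)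
  ultimately show ?thesis
    using A(1) q by (elim disjE) (auto intro!: eq_matI simp: d less_2_cases_iff)
qed

lemma special_linear_not_abc:
  fixes F :: "'k::field mat \<Rightarrow> 'k mat"
  assumes two: "(2::'k) \<noteq> 0"
    and Q: "quasisimple_group (derived_group (fixed_point_group (special_linear_group 2) F))"
    and grp: "group (fixed_point_group (special_linear_group 2) F)"
  shows "\<not> abc_group 2 b c (derived_group (fixed_point_group (special_linear_group 2) F))"
proof
  define H where "H = derived_group (fixed_point_group (special_linear_group 2) F)"
  assume "abc_group 2 b c (derived_group (fixed_point_group (special_linear_group 2) F))"
  then obtain x y where gr: "group H" and x: "x \<in> carrier H" and y: "y \<in> carrier H" and gen: "generate H {x, y} = carrier H"
    and ord: "group.ord H x dvd 2"
    unfolding abc_group_def H_def by blast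
  interpret H: group H by (rule gr)
  have mult: "A \<otimes>\<^bsub>H\<^esub> B = A * B" and one: "\<one>\<^bsub>H\<^esub> = 1\<^sub>m 2" for A B
    by (simp_all add: H_def derived_group_def fixed_point_group_def special_linear_group_def matrix_group_def)
  have HS: "carrier H \<subseteq> {A \<in> carrier_mat 2 2. det A = 1}"
    using group.derived_in_carrier[OF grp order_refl]
    by (auto simp: H_def derived_group_def fixed_point_group_def special_linear_group_def matrix_group_def)
  have "x [^]\<^bsub>H\<^esub> (2::nat) = \<one>\<^bsub>H\<^esub>" using ord H.pow_eq_id[OF x] by blast
  moreover have "x [^]\<^bsub>H\<^esub> (2::nat) = x \<otimes>\<^bsub>H\<^esub> x" using x by (simp add: numeral_2_eq_2)
  ultimately have "x * x = 1\<^sub>m 2" unfolding mult one by simp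
  then have "x = 1\<^sub>m 2 \<or> x = - 1\<^sub>m 2" using sl2_involution_scalar[of x] HS x two by blast
  then have xc: "x \<otimes>\<^bsub>H\<^esub> g = g \<otimes>\<^bsub>H\<^esub> x" if "g \<in> carrier H" for g
    using HS that by (auto simp: mult)
  have yc: "y \<otimes>\<^bsub>H\<^esub> g = g \<otimes>\<^bsub>H\<^esub> y" if "g \<in> carrier H" for g
    by (rule H.commutes_with_generate[of "{x, y}"]) (use x y that gen xc in auto)
  have "g \<otimes>\<^bsub>H\<^esub> h = h \<otimes>\<^bsub>H\<^esub> g" if "g \<in> carrier H" "h \<in> carrier H" for g h
    by (rule H.commutes_with_generate[of "{x, y}"]) (use x y that gen xc yc in auto)
  then show False using quasisimple_not_abelian[OF Q[folded H_def]] by blast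
qed

section \<open>Generators of prescribed orders\<close>

theorem corollary11:
  fixes G :: "'k::alg_closed_field mat monoid"
    and F :: "'k mat \<Rightarrow> 'k mat"
    and p a b c :: nat
  assumes "prime p" and "p \<noteq> 2" and "CHAR('k) = p"
    and "hyperbolic_triple a b c"
    and "(G, (a, b, c)) \<in> listed_pairs"
    and "steinberg_endomorphism G F"
    and "quasisimple_group (derived_group (fixed_point_group G F))"
  shows "\<not> abc_group a b c (derived_group (fixed_point_group G F))"
proof
  assume abc: "abc_group a b c (derived_group (fixed_point_group G F))"
  have two: "(2::'k) \<noteq> 0"
  proof
    assume "(2::'k) = 0"
    then have "of_nat 2 = (0::'k)" by simp
    then have "p dvd 2" unfolding of_nat_eq_0_iff_char_dvd assms(3) .
    then show False using assms(1,2) primes_dvd_imp_eq two_is_prime_nat by blast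
  qed
  have ch: "prime CHAR('k)" "CHAR('k) \<noteq> 2" using assms(1-3) by simp_all
  have pos: "a > 0" "b > 0" "c > 0" using assms(4) by (auto simp: hyperbolic_triple_def)
  have sp: "\<exists>d1 d2 d3. dim_bound m a d1 \<and> dim_bound m b d2 \<and> dim_bound m c d3 \<and> d1 + d2 + d3 \<le> m * (2 * m + 1)"
    if "G = symplectic_group m" "m \<ge> 2" for m
    by (rule symplectic_dim_bounds[OF _ that(2) ch two _ pos]) (use assms(6) abc that(1) in simp_all)
  from assms(5) consider
    "G = special_linear_group 2" "a = 2"
  | "G = symplectic_group 2" "a = 2 \<and> b = 3 \<or> a = 2 \<and> b = 4 \<or> a = 3 \<and> b = 3 \<and> c = 4 \<or> a = 3 \<and> b = 4 \<and> c = 4 \<or> a = 4 \<and> b = 4 \<and> c = 4"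
  | "G = symplectic_group 3" "a = 2 \<and> b = 3 \<or> a = 2 \<and> b = 4 \<or> a = 2 \<and> b = 5 \<and> c = 5 \<or> a = 2 \<and> b = 5 \<and> c = 6 \<or> a = 2 \<and> b = 6 \<and> c = 6"
  | "G = symplectic_group 4" "a = 2 \<and> b = 3 \<and> c = 7 \<or> a = 2 \<and> b = 3 \<and> c = 8 \<or> a = 2 \<and> b = 4 \<and> c = 5 \<or> a = 2 \<and> b = 4 \<and> c = 6"
  | "G = symplectic_group 5" "a = 2 \<and> b = 3 \<and> c = 7 \<or> a = 2 \<and> b = 3 \<and> c = 8 \<or> a = 2 \<and> b = 3 \<and> c = 9 \<or> a = 2 \<and> b = 3 \<and> c = 10 \<or> a = 2 \<and> b = 4 \<and> c = 5 \<or> a = 2 \<and> b = 4 \<and> c = 6"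
  | "G = symplectic_group 6" "a = 2 \<and> b = 3 \<and> c = 7 \<or> a = 2 \<and> b = 3 \<and> c = 8 \<or> a = 2 \<and> b = 4 \<and> c = 5"
  | "G = symplectic_group 7" "a = 2 \<and> b = 3 \<and> c = 7 \<or> a = 2 \<and> b = 3 \<and> c = 8 \<or> a = 2 \<and> b = 4 \<and> c = 5"
  | "G = symplectic_group 8" "a = 2 \<and> b = 3 \<and> c = 7"
  | "G = symplectic_group 9" "a = 2 \<and> b = 3 \<and> c = 7"
  | "G = symplectic_group 11" "a = 2 \<and> b = 3 \<and> c = 7"
    unfolding listed_pairs_def by auto
  then show False
  proof cases
    case 1
    have "group (special_linear_group 2 :: 'k mat monoid)" by (rule group_special_linear)
    then have "group (fixed_point_group G F)"
      unfolding 1(1) by (rule group_fixed_points) (use assms(6) 1(1) in \<open>simp add: steinberg_endomorphism_def algebraic_endomorphism_def\<close>)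
    then show False using special_linear_not_abc[OF two] assms(7) abc unfolding 1 by blast
  next
    case 2
    have m: "(2::nat) \<le> 2" by simp
    obtain d1 d2 d3 where d: "dim_bound 2 a d1" "dim_bound 2 b d2" "dim_bound 2 c d3" "d1 + d2 + d3 \<le> 2 * (2 * 2 + 1)"
      using sp[OF 2(1) m] by blast
    from 2(2) show False
    proof (elim disjE conjE)
      assume "a = 2" "b = 3"
      then show False using dim_bounds_2(1)[of d1] dim_bounds_2(2)[of d2] dim_bound_rank[OF d(3)] d by simp
    next
      assume "a = 2" "b = 4"
      then show False using dim_bounds_2(1)[of d1] dim_bounds_2(3)[of d2] dim_bound_rank[OF d(3)] d by simp
    next
      assume "a = 3" "b = 3" "c = 4"
      then show False using dim_bounds_2(2)[of d1] dim_bounds_2(2)[of d2] dim_bounds_2(3)[of d3] d by simp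
    next
      assume "a = 3" "b = 4" "c = 4"
      then show False using dim_bounds_2(2)[of d1] dim_bounds_2(3)[of d2] dim_bounds_2(3)[of d3] d by simp
    next
      assume "a = 4" "b = 4" "c = 4"
      then show False using dim_bounds_2(3)[of d1] dim_bounds_2(3)[of d2] dim_bounds_2(3)[of d3] d by simp
    qed
  next
    case 3
    have m: "(2::nat) \<le> 3" by simp
    obtain d1 d2 d3 where d: "dim_bound 3 a d1" "dim_bound 3 b d2" "dim_bound 3 c d3" "d1 + d2 + d3 \<le> 3 * (2 * 3 + 1)"
      using sp[OF 3(1) m] by blast
    from 3(2) show False
    proof (elim disjE conjE)
      assume "a = 2" "b = 3"
      then show False using dim_bounds_3(1)[of d1] dim_bounds_3(2)[of d2] dim_bound_rank[OF d(3)] d by simp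
    next
      assume "a = 2" "b = 4"
      then show False using dim_bounds_3(1)[of d1] dim_bounds_3(3)[of d2] dim_bound_rank[OF d(3)] d by simp
    next
      assume "a = 2" "b = 5" "c = 5"
      then show False using dim_bounds_3(1)[of d1] dim_bounds_3(4)[of d2] dim_bounds_3(4)[of d3] d by simp
    next
      assume "a = 2" "b = 5" "c = 6"
      then show False using dim_bounds_3(1)[of d1] dim_bounds_3(4)[of d2] dim_bounds_3(5)[of d3] d by simp
    next
      assume "a = 2" "b = 6" "c = 6"
      then show False using dim_bounds_3(1)[of d1] dim_bounds_3(5)[of d2] dim_bounds_3(5)[of d3] d by simp
    qed
  next
    case 4
    have m: "(2::nat) \<le> 4" by simp
    obtain d1 d2 d3 where d: "dim_bound 4 a d1" "dim_bound 4 b d2" "dim_bound 4 c d3" "d1 + d2 + d3 \<le> 4 * (2 * 4 + 1)"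
      using sp[OF 4(1) m] by blast
    from 4(2) show False
    proof (elim disjE conjE)
      assume "a = 2" "b = 3" "c = 7"
      then show False using dim_bounds_4(1)[of d1] dim_bounds_4(2)[of d2] dim_bounds_4(6)[of d3] d by simp
    next
      assume "a = 2" "b = 3" "c = 8"
      then show False using dim_bounds_4(1)[of d1] dim_bounds_4(2)[of d2] dim_bounds_4(7)[of d3] d by simp
    next
      assume "a = 2" "b = 4" "c = 5"
      then show False using dim_bounds_4(1)[of d1] dim_bounds_4(3)[of d2] dim_bounds_4(4)[of d3] d by simp
    next
      assume "a = 2" "b = 4" "c = 6"
      then show False using dim_bounds_4(1)[of d1] dim_bounds_4(3)[of d2] dim_bounds_4(5)[of d3] d by simp
    qed
  next
    case 5
    have m: "(2::nat) \<le> 5" by simp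
    obtain d1 d2 d3 where d: "dim_bound 5 a d1" "dim_bound 5 b d2" "dim_bound 5 c d3" "d1 + d2 + d3 \<le> 5 * (2 * 5 + 1)"
      using sp[OF 5(1) m] by blast
    from 5(2) show False
    proof (elim disjE conjE)
      assume "a = 2" "b = 3" "c = 7"
      then show False using dim_bounds_5(1)[of d1] dim_bounds_5(2)[of d2] dim_bounds_5(6)[of d3] d by simp
    next
      assume "a = 2" "b = 3" "c = 8"
      then show False using dim_bounds_5(1)[of d1] dim_bounds_5(2)[of d2] dim_bounds_5(7)[of d3] d by simp
    next
      assume "a = 2" "b = 3" "c = 9"
      then show False using dim_bounds_5(1)[of d1] dim_bounds_5(2)[of d2] dim_bounds_5(8)[of d3] d by simp
    next
      assume "a = 2" "b = 3" "c = 10"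
      then show False using dim_bounds_5(1)[of d1] dim_bounds_5(2)[of d2] dim_bounds_5(9)[of d3] d by simp
    next
      assume "a = 2" "b = 4" "c = 5"
      then show False using dim_bounds_5(1)[of d1] dim_bounds_5(3)[of d2] dim_bounds_5(4)[of d3] d by simp
    next
      assume "a = 2" "b = 4" "c = 6"
      then show False using dim_bounds_5(1)[of d1] dim_bounds_5(3)[of d2] dim_bounds_5(5)[of d3] d by simp
    qed
  next
    case 6
    have m: "(2::nat) \<le> 6" by simp
    obtain d1 d2 d3 where d: "dim_bound 6 a d1" "dim_bound 6 b d2" "dim_bound 6 c d3" "d1 + d2 + d3 \<le> 6 * (2 * 6 + 1)"
      using sp[OF 6(1) m] by blast
    from 6(2) show False
    proof (elim disjE conjE)
      assume "a = 2" "b = 3" "c = 7"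
      then show False using dim_bounds_6(1)[of d1] dim_bounds_6(2)[of d2] dim_bounds_6(5)[of d3] d by simp
    next
      assume "a = 2" "b = 3" "c = 8"
      then show False using dim_bounds_6(1)[of d1] dim_bounds_6(2)[of d2] dim_bounds_6(6)[of d3] d by simp
    next
      assume "a = 2" "b = 4" "c = 5"
      then show False using dim_bounds_6(1)[of d1] dim_bounds_6(3)[of d2] dim_bounds_6(4)[of d3] d by simp
    qed
  next
    case 7
    have m: "(2::nat) \<le> 7" by simp
    obtain d1 d2 d3 where d: "dim_bound 7 a d1" "dim_bound 7 b d2" "dim_bound 7 c d3" "d1 + d2 + d3 \<le> 7 * (2 * 7 + 1)"
      using sp[OF 7(1) m] by blast
    from 7(2) show False
    proof (elim disjE conjE)
      assume "a = 2" "b = 3" "c = 7"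
      then show False using dim_bounds_7(1)[of d1] dim_bounds_7(2)[of d2] dim_bounds_7(5)[of d3] d by simp
    next
      assume "a = 2" "b = 3" "c = 8"
      then show False using dim_bounds_7(1)[of d1] dim_bounds_7(2)[of d2] dim_bounds_7(6)[of d3] d by simp
    next
      assume "a = 2" "b = 4" "c = 5"
      then show False using dim_bounds_7(1)[of d1] dim_bounds_7(3)[of d2] dim_bounds_7(4)[of d3] d by simp
    qed
  next
    case 8
    have m: "(2::nat) \<le> 8" by simp
    obtain d1 d2 d3 where d: "dim_bound 8 a d1" "dim_bound 8 b d2" "dim_bound 8 c d3" "d1 + d2 + d3 \<le> 8 * (2 * 8 + 1)"
      using sp[OF 8(1) m] by blast
    from 8(2) show False
    proof (elim disjE conjE)
      assume "a = 2" "b = 3" "c = 7"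
      then show False using dim_bounds_8(1)[of d1] dim_bounds_8(2)[of d2] dim_bounds_8(3)[of d3] d by simp
    qed
  next
    case 9
    have m: "(2::nat) \<le> 9" by simp
    obtain d1 d2 d3 where d: "dim_bound 9 a d1" "dim_bound 9 b d2" "dim_bound 9 c d3" "d1 + d2 + d3 \<le> 9 * (2 * 9 + 1)"
      using sp[OF 9(1) m] by blast
    from 9(2) show False
    proof (elim disjE conjE)
      assume "a = 2" "b = 3" "c = 7"
      then show False using dim_bounds_9(1)[of d1] dim_bounds_9(2)[of d2] dim_bounds_9(3)[of d3] d by simp
    qed
  next
    case 10
    have m: "(2::nat) \<le> 11" by simp
    obtain d1 d2 d3 where d: "dim_bound 11 a d1" "dim_bound 11 b d2" "dim_bound 11 c d3" "d1 + d2 + d3 \<le> 11 * (2 * 11 + 1)"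
      using sp[OF 10(1) m] by blast
    from 10(2) show False
    proof (elim disjE conjE)
      assume "a = 2" "b = 3" "c = 7"
      then show False using dim_bounds_11(1)[of d1] dim_bounds_11(2)[of d2] dim_bounds_11(3)[of d3] d by simp
    qed
  qed
qed

end
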